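(* Let $d\ge 1$ be an integer, let $0<T<\infty$, and let $Q=[0,T]\times\mathbb{R}^d$. Let $0<\alpha\le 2$, $2\le q\le p<\infty$, and $s\in\mathbb{R}$. Let $T^{\alpha}$ be the operator \[ T^{\alpha}f(t,x)=\int_0^t\int_{\mathbb{R}^d}P^{\alpha}(t-r,x-y)\,f(r,y)\,dy\,dr, \] where \[ P^{\alpha}(t,x)=\int_{\mathbb{R}^d}e^{2\pi i x\cdot\xi}e^{-t|\xi|^{\alpha}}\,d\xi . \] Then $T^{\alpha}$ maps $L^{p}F_{s}^{p,q}(Q)$ to $L^{p}F_{s+\alpha/p}^{p,q}(Q)$, and there is a constant $c>0$, independent of $f$, such that for all $f\in L^{p}F_{s}^{p,q}(Q)$, \[ \|T^{\alpha}f\|_{L^{p}F_{s+\alpha/p}^{p,q}(Q)}\le c\,\|f\|_{L^{p}F_{s}^{p,q}(Q)}. \]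
   Context: Fourier transform: $\widehat{f}(\xi)=\int_{\mathbb{R}^d}e^{-2\pi i\xi\cdot x}f(x)\,dx$ for Schwartz functions $f$, extended to tempered distributions in the usual way. Littlewood--Paley operators: fix a radial Schwartz function $\Phi$ on $\mathbb{R}^d$ whose Fourier transform $\widehat{\Phi}$ is nonnegative, supported in $\{|\xi|\le 2\}$, and equal to $1$ on $\{|\xi|\le 1\}$. Put $\widehat{\Psi}(\xi)=\widehat{\Phi}(\xi)-\widehat{\Phi}(2\xi)$, so that $\widehat{\Phi}(\xi)+\sum_{j=1}^{\infty}\widehat{\Psi}(2^{-j}\xi)=1$. Define $S_0$ and $\Delta_j$ ($j\in\mathbb{Z}$) by \[ S_0f(x)=\int_{\mathbb{R}^d}e^{2\pi i x\cdot\xi}\widehat{\Phi}(\xi)\widehat{f}(\xi)\,d\xi,\qquad \Delta_jf(x)=\int_{\mathbb{R}^d}e^{2\pi i x\cdot\xi}\widehat{\Psi}(2^{-j}\xi)\widehat{f}(\xi)\,d\xi . \] Triebel--Lizorkin space: for $\sigma\in\mathbb{R}$ and $0<p,q\le\infty$, $F_{\sigma}^{p,q}(\mathbb{R}^d)$ is the space of tempered distributions $f$ with \[ \|f\|_{F_{\sigma}^{p,q}}=\|S_0f\|_{L^p(\mathbb{R}^d)}+\Big\|\Big(\sum_{j=1}^{\infty}(2^{j\sigma}|\Delta_jf|)^q\Big)^{1/q}\Big\|_{L^p(\mathbb{R}^d)}<\infty . \] Parabolic space: $L^{p}F_{\sigma}^{p,q}(Q)$ is the set of measurable functions $u:Q\to\mathbb{R}$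 such that \[ \|u\|_{L^{p}F_{\sigma}^{p,q}(Q)}=\Big(\int_0^T\|u(t,\cdot)\|_{F_{\sigma}^{p,q}(\mathbb{R}^d)}^p\,dt\Big)^{1/p}<\infty , \] where the Littlewood--Paley operators act in the space variable $x$ only.
   Formalization: Since for negative s the double integral can diverge for f in the space, "measurable functions on Q" is read as weakly measurable families of real tempered distributions in x, and T^α f is defined distributionally (agreeing with the double integral when that converges absolutely). *)

theory Defs
  imports "HOL-Analysis.Analysis"
begin

section \<open>Schwartz functions and tempered distributions\<close>

primrec iter_deriv :: "'a list \<Rightarrow> ('a::euclidean_space \<Rightarrow> complex) \<Rightarrow> 'a \<Rightarrow> complex" where
  "iter_deriv [] \<phi> = \<phi>"
| "iter_deriv (b # bs) \<phi> = (\<lambda>x. frechet_derivative (iter_deriv bs \<phi>) (at x) b)"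

text \<open>Multi-indices are encoded as lists of basis vectors. A function is smooth iff all its
  iterated partial derivatives exist and are (totally) differentiable.\<close>

definition schwartz :: "('a::euclidean_space \<Rightarrow> complex) set" where
  "schwartz = {\<phi>. \<forall>bs. set bs \<subseteq> Basis \<longrightarrow>
     iter_deriv bs \<phi> differentiable_on UNIV \<and>
     (\<forall>k::nat. bounded (range (\<lambda>x. norm x ^ k * norm (iter_deriv bs \<phi> x))))}"

definition schwartz_seminorm :: "nat \<Rightarrow> 'a list \<Rightarrow> ('a::euclidean_space \<Rightarrow> complex) \<Rightarrow> real" where
  "schwartz_seminorm k bs \<phi> = (SUP x. norm x ^ k * norm (iter_deriv bs \<phi> x))"

text \<open>A distribution is a functional on all functions of which only the values on
  \<^const>\<open>schwartz\<close> matter.\<close>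

type_synonym 'a dist = "('a \<Rightarrow> complex) \<Rightarrow> complex"

definition tempered :: "'a::euclidean_space dist \<Rightarrow> bool" where
  "tempered u \<longleftrightarrow>
     (\<forall>\<phi>\<in>schwartz. \<forall>\<psi>\<in>schwartz. \<forall>a b. u (\<lambda>x. a * \<phi> x + b * \<psi> x) = a * u \<phi> + b * u \<psi>) \<and>
     (\<exists>C N. \<forall>\<phi>\<in>schwartz. norm (u \<phi>) \<le>
        C * (\<Sum>k\<le>N. \<Sum>bs\<in>{bs. set bs \<subseteq> Basis \<and> length bs \<le> N}. schwartz_seminorm k bs \<phi>))"

definition real_dist :: "'a::euclidean_space dist \<Rightarrow> bool" where
  "real_dist u \<longleftrightarrow> (\<forall>\<phi>\<in>schwartz. range \<phi> \<subseteq> \<real> \<longrightarrow> u \<phi> \<in> \<real>)"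

definition dist_of :: "('a::euclidean_space \<Rightarrow> complex) \<Rightarrow> 'a dist" where
  "dist_of g \<phi> = (\<integral>x. g x * \<phi> x \<partial>lebesgue)"

definition fourier :: "('a::euclidean_space \<Rightarrow> complex) \<Rightarrow> 'a \<Rightarrow> complex" where
  "fourier f \<xi> = (\<integral>x. cis (- 2 * pi * (\<xi> \<bullet> x)) * f x \<partial>lborel)"

definition dist_fourier :: "'a::euclidean_space dist \<Rightarrow> 'a dist" where
  "dist_fourier u \<phi> = u (fourier \<phi>)"


section \<open>Littlewood--Paley operators\<close>

definition lp_function :: "('a::euclidean_space \<Rightarrow> complex) \<Rightarrow> bool" where
  "lp_function \<Phi> \<longleftrightarrow> \<Phi> \<in> schwartz \<and>
     (\<forall>x y. norm x = norm y \<longrightarrow> \<Phi> x = \<Phi> y) \<and>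
     (\<forall>\<xi>. fourier \<Phi> \<xi> \<in> \<real>\<^sub>\<ge>\<^sub>0) \<and>
     (\<forall>\<xi>. norm \<xi> > 2 \<longrightarrow> fourier \<Phi> \<xi> = 0) \<and>
     (\<forall>\<xi>. norm \<xi> \<le> 1 \<longrightarrow> fourier \<Phi> \<xi> = 1)"

definition psi_hat :: "('a::euclidean_space \<Rightarrow> complex) \<Rightarrow> 'a \<Rightarrow> complex" where
  "psi_hat \<Phi> \<xi> = fourier \<Phi> \<xi> - fourier \<Phi> (2 *\<^sub>R \<xi>)"

text \<open>For a tempered distribution, the integrals defining \<open>S_0\<close> and \<open>\<Delta>_j\<close> are
  pairings of its Fourier transform with a test function of the frequency variable; they yield
  functions of \<open>x\<close>.\<close>

definition lp_S0 :: "('a::euclidean_space \<Rightarrow> complex) \<Rightarrow> 'a dist \<Rightarrow> 'a \<Rightarrow> complex" where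
  "lp_S0 \<Phi> u x = dist_fourier u (\<lambda>\<xi>. cis (2 * pi * (x \<bullet> \<xi>)) * fourier \<Phi> \<xi>)"

definition lp_Delta ::
    "('a::euclidean_space \<Rightarrow> complex) \<Rightarrow> int \<Rightarrow> 'a dist \<Rightarrow> 'a \<Rightarrow> complex" where
  "lp_Delta \<Phi> j u x =
     dist_fourier u (\<lambda>\<xi>. cis (2 * pi * (x \<bullet> \<xi>)) * psi_hat \<Phi> ((2 powi (- j)) *\<^sub>R \<xi>))"


section \<open>Triebel--Lizorkin norms\<close>

text \<open>Real powers on the extended half-line, for exponents \<open>a > 0\<close>.\<close>

definition ennpow :: "ennreal \<Rightarrow> real \<Rightarrow> ennreal" where
  "ennpow x a = (if x = top then top else ennreal (enn2real x powr a))"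

definition Lp_norm :: "real \<Rightarrow> ('a \<Rightarrow> ennreal) \<Rightarrow> 'a measure \<Rightarrow> ennreal" where
  "Lp_norm p f M = ennpow (\<integral>\<^sup>+x. ennpow (f x) p \<partial>M) (1 / p)"

text \<open>Only finite exponents \<open>p\<close> and \<open>q\<close> are covered. The summation index \<open>n\<close> corresponds to
  \<open>j = n + 1\<close>.\<close>

definition TL_norm ::
    "('a::euclidean_space \<Rightarrow> complex) \<Rightarrow> real \<Rightarrow> real \<Rightarrow> real \<Rightarrow> 'a dist \<Rightarrow> ennreal" where
  "TL_norm \<Phi> p q \<sigma> u =
     Lp_norm p (\<lambda>x. ennreal (norm (lp_S0 \<Phi> u x))) lborel +
     Lp_norm p (\<lambda>x. ennpow (\<Sum>n::nat.
         ennreal ((2 powr (real (Suc n) * \<sigma>) * norm (lp_Delta \<Phi> (int (Suc n)) u x)) powr q))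
         (1 / q)) lborel"

definition parabolic_norm ::
    "('a::euclidean_space \<Rightarrow> complex) \<Rightarrow> real \<Rightarrow> real \<Rightarrow> real \<Rightarrow> real \<Rightarrow> (real \<Rightarrow> 'a dist) \<Rightarrow> ennreal" where
  "parabolic_norm \<Phi> T p q \<sigma> u = Lp_norm p (\<lambda>t. TL_norm \<Phi> p q \<sigma> (u t)) (lebesgue_on {0..T})"

text \<open>Since elements of the Triebel--Lizorkin spaces are tempered distributions, which for
  negative \<open>\<sigma>\<close> need not be functions, a real-valued measurable \<open>u\<close> on \<open>[0,T] \<times> R^d\<close> is
  understood as a weakly measurable family of real tempered distributions \<open>u(t,\<cdot>)\<close>.
  A function \<open>v\<close> is included as \<open>\<lambda>t. dist_of (v t)\<close>.\<close>

definition parabolic_TL ::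
    "('a::euclidean_space \<Rightarrow> complex) \<Rightarrow> real \<Rightarrow> real \<Rightarrow> real \<Rightarrow> real \<Rightarrow> (real \<Rightarrow> 'a dist) set" where
  "parabolic_TL \<Phi> T p q \<sigma> = {u.
     (AE t in lebesgue_on {0..T}. tempered (u t) \<and> real_dist (u t)) \<and>
     (\<forall>\<phi>\<in>schwartz. (\<lambda>t. u t \<phi>) \<in> borel_measurable (lebesgue_on {0..T})) \<and>
     parabolic_norm \<Phi> T p q \<sigma> u < top}"


section \<open>The operator\<close>

definition heat_kernel :: "real \<Rightarrow> real \<Rightarrow> 'a::euclidean_space \<Rightarrow> complex" where
  "heat_kernel \<alpha> t x =
     (\<integral>\<xi>. cis (2 * pi * (x \<bullet> \<xi>)) * of_real (exp (- t * norm \<xi> powr \<alpha>)) \<partial>lborel)"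

text \<open>\<open>\<integral> K(x - y) u(y) dy\<close> for a tempered distribution \<open>u\<close> and a smooth kernel \<open>K\<close>.
  For \<open>\<alpha> < 2\<close> the heat kernel decays only polynomially, so that \<open>K(x - \<cdot>)\<close> is not a
  Schwartz function and the integral has to be read as an improper one: the pairing is taken with
  \<open>K(x - \<cdot>)\<close> times a smooth compactly supported function equal to \<open>1\<close> on the ball of
  radius \<open>R\<close>, and \<open>R\<close> tends to infinity. For a function \<open>u\<close> for which the integral
  converges this is the integral itself, see \<open>conv_dist_dist_of\<close> below.\<close>

definition trunc_conv ::
    "('a::euclidean_space \<Rightarrow> complex) \<Rightarrow> ('a \<Rightarrow> complex) \<Rightarrow> 'a dist \<Rightarrow> 'a \<Rightarrow> real \<Rightarrow> complex" where
  "trunc_conv \<Phi> K u x R = u (\<lambda>y. K (x - y) * fourier \<Phi> (y /\<^sub>R R))"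

definition conv_dist ::
    "('a::euclidean_space \<Rightarrow> complex) \<Rightarrow> ('a \<Rightarrow> complex) \<Rightarrow> 'a dist \<Rightarrow> 'a \<Rightarrow> complex" where
  "conv_dist \<Phi> K u x = Lim at_top (trunc_conv \<Phi> K u x)"

text \<open>The integral over \<open>r\<close> is a weak one, i.e. it is tested against Schwartz functions
  of \<open>x\<close>.\<close>

definition T_op ::
    "('a::euclidean_space \<Rightarrow> complex) \<Rightarrow> real \<Rightarrow> (real \<Rightarrow> 'a dist) \<Rightarrow> real \<Rightarrow> 'a dist" where
  "T_op \<Phi> \<alpha> f t \<phi> =
     (\<integral>r. (\<integral>x. conv_dist \<Phi> (heat_kernel \<alpha> (t - r)) (f r) x * \<phi> x \<partial>lborel) \<partial>lebesgue_on {0..t})"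

text \<open>Existence of all limits and integrals in the definition of \<^const>\<open>T_op\<close>.\<close>

definition T_op_defined ::
    "('a::euclidean_space \<Rightarrow> complex) \<Rightarrow> real \<Rightarrow> real \<Rightarrow> (real \<Rightarrow> 'a dist) \<Rightarrow> bool" where
  "T_op_defined \<Phi> \<alpha> T f \<longleftrightarrow> (\<forall>t\<in>{0..T}.
     (AE r in lebesgue_on {0..t}.
        (\<forall>x. \<exists>l. (trunc_conv \<Phi> (heat_kernel \<alpha> (t - r)) (f r) x \<longlongrightarrow> l) at_top) \<and>
        (\<forall>\<phi>\<in>schwartz. integrable lborel
           (\<lambda>x. conv_dist \<Phi> (heat_kernel \<alpha> (t - r)) (f r) x * \<phi> x))) \<and>
     (\<forall>\<phi>\<in>schwartz. integrable (lebesgue_on {0..t})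
        (\<lambda>r. \<integral>x. conv_dist \<Phi> (heat_kernel \<alpha> (t - r)) (f r) x * \<phi> x \<partial>lborel)))"


section \<open>Consistency with the pointwise formula for functions\<close>

lemma schwartz_borel_measurable:
  assumes "\<phi> \<in> schwartz"
  shows "\<phi> \<in> borel_measurable borel"
proof -
  have "iter_deriv [] \<phi> differentiable_on UNIV"
    using assms unfolding schwartz_def mem_Collect_eq by (metis empty_iff empty_set subsetI)
  then have "continuous_on UNIV \<phi>"
    by (simp add: differentiable_imp_continuous_on)
  then show ?thesis
    by (rule borel_measurable_continuous_onI)
qed

lemma fourier_borel_measurable:
  assumes "\<phi> \<in> schwartz"
  shows "fourier \<phi> \<in> borel_measurable borel"
proof -
  have 1: "(\<lambda>z::'a \<times> 'a. cis (- 2 * pi * (fst z \<bullet> snd z))) \<in> borel_measurable (borel \<Otimes>\<^sub>M lborel)"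
    unfolding cis_conv_exp measurable_cong_sets[OF sets_pair_measure_cong[OF refl sets_lborel] refl] borel_prod
    by (intro borel_measurable_continuous_onI continuous_intros)
  have 2: "(\<lambda>z::'a \<times> 'a. \<phi> (snd z)) \<in> borel_measurable (borel \<Otimes>\<^sub>M lborel)"
    by (rule measurable_compose[OF measurable_snd]) (use schwartz_borel_measurable[OF assms] in simp)
  have "(\<lambda>(\<xi>, x). cis (- 2 * pi * (\<xi> \<bullet> x)) * \<phi> x) \<in> borel_measurable (borel \<Otimes>\<^sub>M lborel)"
    unfolding case_prod_beta using 1 2 by (rule borel_measurable_times)
  then have "(\<lambda>\<xi>. \<integral>x. cis (- 2 * pi * (\<xi> \<bullet> x)) * \<phi> x \<partial>lborel) \<in> borel_measurable borel"
    by (rule lborel.borel_measurable_lebesgue_integral)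
  then show ?thesis
    unfolding fourier_def[abs_def] .
qed

lemma norm_fourier_le: "norm (fourier \<phi> \<xi>) \<le> (\<integral>x. norm (\<phi> x) \<partial>lborel)"
  unfolding fourier_def by (rule order_trans[OF integral_norm_bound]) (simp add: norm_mult)

lemma conv_dist_dist_of:
  assumes \<Phi>: "lp_function \<Phi>"
    and int: "integrable lebesgue (\<lambda>y. K (x - y) * g y)"
  shows "(trunc_conv \<Phi> K (dist_of g) x \<longlongrightarrow> (\<integral>y. K (x - y) * g y \<partial>lebesgue)) at_top"
    and "conv_dist \<Phi> K (dist_of g) x = (\<integral>y. K (x - y) * g y \<partial>lebesgue)"
proof -
  have S: "\<Phi> \<in> schwartz" and one: "\<And>\<xi>. norm \<xi> \<le> 1 \<Longrightarrow> fourier \<Phi> \<xi> = 1"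
    using \<Phi> unfolding lp_function_def by auto
  define h where "h = (\<lambda>y. K (x - y) * g y)"
  define B where "B = (\<integral>x. norm (\<Phi> x) \<partial>lborel)"
  have hm: "h \<in> borel_measurable lebesgue"
    using int unfolding h_def by (rule borel_measurable_integrable)
  have fm: "(\<lambda>y. fourier \<Phi> (y /\<^sub>R R)) \<in> borel_measurable lebesgue" for R
  proof -
    have "(\<lambda>y. fourier \<Phi> (y /\<^sub>R R)) \<in> borel_measurable lborel"
      using fourier_borel_measurable[OF S] by measurable
    then show ?thesis
      by (rule measurable_completion)
  qed
  have "((\<lambda>R. \<integral>y. h y * fourier \<Phi> (y /\<^sub>R R) \<partial>lebesgue) \<longlongrightarrow> (\<integral>y. h y \<partial>lebesgue)) at_top"
  proof (rule integral_dominated_convergence_at_top[where w = "\<lambda>y. norm (h y) * B"])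
    show "h \<in> borel_measurable lebesgue" by (rule hm)
    show "(\<lambda>y. h y * fourier \<Phi> (y /\<^sub>R R)) \<in> borel_measurable lebesgue" for R
      using hm fm by (rule borel_measurable_times)
    show "integrable lebesgue (\<lambda>y. norm (h y) * B)"
      using int unfolding h_def by simp
    show "\<forall>\<^sub>F R in at_top. AE y in lebesgue. norm (h y * fourier \<Phi> (y /\<^sub>R R)) \<le> norm (h y) * B"
      unfolding B_def
      by (intro always_eventually allI AE_I2) (simp add: norm_mult mult_left_mono norm_fourier_le)
    show "AE y in lebesgue. ((\<lambda>R. h y * fourier \<Phi> (y /\<^sub>R R)) \<longlongrightarrow> h y) at_top"
    proof (rule AE_I2)
      fix y
      have "\<forall>\<^sub>F R in at_top. h y * fourier \<Phi> (y /\<^sub>R R) = h y"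
        using eventually_ge_at_top[of "norm y + 1"]
      proof eventually_elim
        case (elim R)
        then have "R > 0" "norm y \<le> R"
          using norm_ge_zero[of y] by linarith+
        then have "norm (y /\<^sub>R R) \<le> 1"
          by (simp add: field_simps)
        then show ?case by (simp add: one)
      qed
      then show "((\<lambda>R. h y * fourier \<Phi> (y /\<^sub>R R)) \<longlongrightarrow> h y) at_top"
        by (rule tendsto_eventually)
    qed
  qed
  moreover have "trunc_conv \<Phi> K (dist_of g) x = (\<lambda>R. \<integral>y. h y * fourier \<Phi> (y /\<^sub>R R) \<partial>lebesgue)"
    unfolding trunc_conv_def dist_of_def h_def by (simp add: ac_simps fun_eq_iff)
  ultimately show *: "(trunc_conv \<Phi> K (dist_of g) x \<longlongrightarrow> (\<integral>y. K (x - y) * g y \<partial>lebesgue)) at_top"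
    unfolding h_def by simp
  show "conv_dist \<Phi> K (dist_of g) x = (\<integral>y. K (x - y) * g y \<partial>lebesgue)"
    unfolding conv_dist_def by (rule tendsto_Lim[OF _ *]) simp
qed

text \<open>For a function \<open>v\<close> with absolutely convergent integrals, \<^const>\<open>T_op\<close> is given
  by the double integral.\<close>

lemma T_op_dist_of:
  assumes \<Phi>: "lp_function \<Phi>"
    and int: "\<And>r x. r \<in> {0..<t} \<Longrightarrow> integrable lebesgue (\<lambda>y. heat_kernel \<alpha> (t - r) (x - y) * v r y)"
    and int2: "integrable (lebesgue_on {0..t} \<Otimes>\<^sub>M lborel)
      (\<lambda>(r, x). (\<integral>y. heat_kernel \<alpha> (t - r) (x - y) * v r y \<partial>lebesgue) * \<phi> x)"
  shows "T_op \<Phi> \<alpha> (\<lambda>r. dist_of (v r)) t \<phi> =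
    dist_of (\<lambda>x. \<integral>r. (\<integral>y. heat_kernel \<alpha> (t - r) (x - y) * v r y \<partial>lebesgue) \<partial>lebesgue_on {0..t}) \<phi>"
proof -
  define F where "F = (\<lambda>r x. \<integral>y. heat_kernel \<alpha> (t - r) (x - y) * v r y \<partial>lebesgue)"
  let ?I = "lebesgue_on {0..t}"
  interpret I: finite_measure ?I
    by (rule finite_measure_lebesgue_on) simp
  interpret pair_sigma_finite ?I "lborel :: 'a measure" ..
  have neq: "AE r in ?I. r \<noteq> t"
  proof -
    have "AE r in lebesgue. r \<noteq> t"
      by (rule AE_I[where N = "{t}"]) auto
    then show ?thesis
      by (subst AE_restrict_space_iff) (auto elim: eventually_mono)
  qed
  have int3: "integrable (?I \<Otimes>\<^sub>M lborel) (case_prod (\<lambda>r x. F r x * \<phi> x))"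
    using int2 by (simp add: F_def)
  have conv: "conv_dist \<Phi> (heat_kernel \<alpha> (t - r)) (dist_of (v r)) x = F r x"
    if "r \<in> {0..<t}" for r x
    unfolding F_def by (rule conv_dist_dist_of(2)[OF \<Phi> int[OF that]])
  have "T_op \<Phi> \<alpha> (\<lambda>r. dist_of (v r)) t \<phi> = (\<integral>r. (\<integral>x. F r x * \<phi> x \<partial>lborel) \<partial>?I)"
  proof -
    define G where "G = (\<lambda>r. \<integral>x. conv_dist \<Phi> (heat_kernel \<alpha> (t - r)) (dist_of (v r)) x * \<phi> x \<partial>lborel)"
    have eq: "AE r in ?I. (\<integral>x. F r x * \<phi> x \<partial>lborel) = G r"
      using neq AE_space
    proof eventually_elim
      case (elim r)
      then have "r \<in> {0..<t}" by (auto simp: space_restrict_space)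
      then show ?case by (simp add: G_def conv)
    qed
    have mF: "(\<lambda>r. \<integral>x. F r x * \<phi> x \<partial>lborel) \<in> borel_measurable ?I"
      by (rule borel_measurable_integrable[OF integrable_fst[OF int3]])
    have "G \<in> borel_measurable ?I"
    proof -
      have "(\<lambda>r. if r = t then G t else (\<integral>x. F r x * \<phi> x \<partial>lborel)) \<in> borel_measurable ?I"
        by (intro measurable_If mF measurable_const)
          (auto simp: space_restrict_space sets_restrict_space intro!: image_eqI[of _ _ "{t} \<inter> {0..t}"])
      moreover have "G r = (if r = t then G t else (\<integral>x. F r x * \<phi> x \<partial>lborel))" if "r \<in> space ?I" for r
        using that by (auto simp: G_def conv space_restrict_space)
      ultimately show ?thesis
        by (subst measurable_cong[where g = "\<lambda>r. if r = t then G t else (\<integral>x. F r x * \<phi> x \<partial>lborel)"])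
    qed
    then have "(\<integral>r. (\<integral>x. F r x * \<phi> x \<partial>lborel) \<partial>?I) = (\<integral>r. G r \<partial>?I)"
      by (intro integral_cong_AE mF eq)
    then show ?thesis unfolding T_op_def G_def ..
  qed
  also have "\<dots> = (\<integral>x. (\<integral>r. F r x * \<phi> x \<partial>?I) \<partial>lborel)"
    by (rule Fubini_integral[OF int3, symmetric])
  also have "\<dots> = (\<integral>x. (\<integral>r. F r x * \<phi> x \<partial>?I) \<partial>lebesgue)"
    by (rule integral_completion[symmetric], rule borel_measurable_integrable[OF integrable_snd[OF int3]])
  also have "\<dots> = (\<integral>x. (\<integral>r. F r x \<partial>?I) * \<phi> x \<partial>lebesgue)"
    by simp
  finally show ?thesis unfolding dist_of_def F_def .
qed

end

theory Submission
  imports Defs "HOL-Probability.Characteristic_Functions"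
begin

text \<open>
  Write \<open>D\<^sub>j\<close> for the convolution kernels of \<open>S\<^sub>0\<close> and \<open>\<Delta>\<^sub>j\<close>, and \<open>E\<^sub>j\<close> for slightly fatter ones, so that
  \<open>D\<^sub>j * E\<^sub>j = D\<^sub>j\<close> and \<open>D\<^sub>i * E\<^sub>j = 0\<close> for \<open>\<bar>i - j\<bar> > 3\<close>. A tempered \<open>u\<close> is the sum of
  \<open>E\<^sub>j * a\<^sub>j\<close> with \<open>a\<^sub>j = D\<^sub>j * u\<close>, and the Triebel--Lizorkin norm bounds each \<open>a\<^sub>j\<close> in \<open>L\<^sup>p\<close>. The heat kernel
  decays like \<open>\<bar>x\<bar>\<close> to the power \<open>- d - \<alpha>\<close>, and \<open>E\<^sub>j\<close> has vanishing moments, whence \<open>K\<^sub>\<tau> * u\<close> is the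
  convergent sum of \<open>k\<^sub>j\<^sub>,\<^sub>\<tau> * a\<^sub>j\<close> with \<open>k\<^sub>j\<^sub>,\<^sub>\<tau> = E\<^sub>j * K\<^sub>\<tau>\<close>.

  Only \<open>\<alpha> / p \<le> \<alpha> / 2\<close> derivatives have to be gained, whereas the full gain is \<open>\<alpha>\<close>. So no maximal
  functions are needed: the \<open>L\<^sup>1\<close> norm of \<open>k\<^sub>j\<^sub>,\<^sub>\<tau>\<close> is at most a constant times
  \<open>2 powr (- 3 j \<alpha> / 4)\<close> times \<open>\<tau> powr (- 3 / 4)\<close>, which is integrable in \<open>\<tau>\<close>, and Schur's test on
  \<open>[0, T]\<close> times the space bounds every \<open>\<Delta>\<^sub>i (T\<^sup>\<alpha> f)\<close> in \<open>L\<^sup>p\<close> with a gain of \<open>3 \<alpha> / 4\<close> derivatives. The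
  surplus of at least \<open>\<alpha> / 4\<close> makes the sum over \<open>i\<close> harmless.
\<close>

section \<open>Uniformly bounded families of smooth functions\<close>

text \<open>The exponent 3 / 4 stands for any \<theta> with 1/2 < \<theta> < 1:
  \<open>\<tau> powr (- \<theta>)\<close> has to be integrable at 0, and \<theta> \<alpha> has to
  exceed \<alpha> / 2, the largest gain demanded since p \<ge> 2; two derivatives of the kernel
  suffice because \<theta> \<alpha> < 2. The obstacle is that u is merely tempered while the heat
  kernel, for \<alpha> < 2, is not a Schwartz function, so \<open>K\<^sub>\<tau> * u\<close> is a
  limit of truncated pairings rather than a pairing. The limit is taken term by term in the dyadic
  sum, and for negative s the pieces \<open>a\<^sub>j\<close> may grow with j; so bounds are needed
  that are uniform in the truncation radius and decay in j at any prescribed rate. Hence smoothness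
  and decay are stated for families: the index may be a radius, a time, a dyadic scale or a
  translation, and uniform constants come with it. A second obstacle is that f t is tempered with
  finite norm only for almost every t; exceptional times are replaced by the zero distribution, and
  all constants are functions of parameters other than f.\<close>

definition pd :: "'a \<Rightarrow> ('a::euclidean_space \<Rightarrow> complex) \<Rightarrow> 'a \<Rightarrow> complex" where
  "pd b \<phi> = (\<lambda>x. frechet_derivative \<phi> (at x) b)"

text \<open>The Henstock--Kurzweil facts of the same names shadow those for the Bochner integral.\<close>

lemmas integral_cong = Bochner_Integration.integral_cong
lemmas integrable_bound = Bochner_Integration.integrable_bound

section \<open>Partial derivatives, mean value and Taylor estimates\<close>

lemma iter_deriv_append: "iter_deriv (bs @ cs) \<phi> = iter_deriv bs (iter_deriv cs \<phi>)"
  by (induction bs) auto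

lemma iter_deriv_snoc: "iter_deriv (bs @ [b]) \<phi> = iter_deriv bs (pd b \<phi>)"
  by (simp add: iter_deriv_append pd_def)

lemma pd_eqI: "(f has_derivative f') (at x) \<Longrightarrow> pd b f x = f' b"
  using frechet_derivative_at by (metis pd_def)

lemma has_derivative_pd:
  assumes "f differentiable (at x)"
  shows "(f has_derivative (\<lambda>h. \<Sum>b\<in>Basis. (h \<bullet> b) *\<^sub>R pd b f x)) (at x)"
proof -
  let ?D = "frechet_derivative f (at x)"
  have *: "(f has_derivative ?D) (at x)"
    using assms frechet_derivative_works by blast
  then have l: "linear ?D"
    using has_derivative_linear by blast
  have "?D h = (\<Sum>b\<in>Basis. (h \<bullet> b) *\<^sub>R pd b f x)" for h
  proof -
    have "?D h = ?D (\<Sum>b\<in>Basis. (h \<bullet> b) *\<^sub>R b)"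
      by (simp add: euclidean_representation)
    also have "\<dots> = (\<Sum>b\<in>Basis. (h \<bullet> b) *\<^sub>R ?D b)"
      using l by (simp add: linear_sum linear_cmul)
    finally show ?thesis by (simp add: pd_def)
  qed
  then have "?D = (\<lambda>h. \<Sum>b\<in>Basis. (h \<bullet> b) *\<^sub>R pd b f x)" by (rule ext)
  with * show ?thesis by simp
qed

lemma onorm_coord_sum_le:
  fixes c :: "'a::euclidean_space \<Rightarrow> complex"
  shows "onorm (\<lambda>h. \<Sum>b\<in>Basis. (h \<bullet> b) *\<^sub>R c b) \<le> (\<Sum>b\<in>Basis. norm (c b))"
proof (rule onorm_bound)
  show "0 \<le> (\<Sum>b\<in>Basis. norm (c b))" by (intro sum_nonneg) auto
  fix h :: 'a
  have "norm (\<Sum>b\<in>Basis. (h \<bullet> b) *\<^sub>R c b) \<le> (\<Sum>b\<in>Basis. norm h * norm (c b))"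
    by (rule sum_norm_le) (auto simp: Basis_le_norm intro!: mult_right_mono)
  then show "norm (\<Sum>b\<in>Basis. (h \<bullet> b) *\<^sub>R c b) \<le> (\<Sum>b\<in>Basis. norm (c b)) * norm h"
    by (simp add: sum_distrib_left mult.commute)
qed

text \<open>Mean value inequality along the segment from x to x + h. The bound C refers to that
  segment only, because \<open>sch_lipschitz\<close> uses it with a value depending on x.\<close>

lemma norm_diff_le_pd:
  fixes f :: "'a::euclidean_space \<Rightarrow> complex" and C :: real
  assumes d: "\<And>z. f differentiable (at z)"
    and C: "\<And>b t. b \<in> Basis \<Longrightarrow> t \<in> {0..1} \<Longrightarrow> norm (pd b f (x + t *\<^sub>R h)) \<le> C"
  shows "norm (f (x + h) - f x) \<le> real DIM('a) * C * norm h"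
proof -
  have "norm (f (x + h) - f x) \<le> (DIM('a) * C) * norm ((x + h) - x)"
  proof (rule differentiable_bound[where S = "closed_segment x (x + h)"])
    fix z assume "z \<in> closed_segment x (x + h)"
    then obtain t where t: "t \<in> {0..1}" "z = x + t *\<^sub>R h"
      by (auto simp: in_segment algebra_simps)
    show "(f has_derivative (\<lambda>h. \<Sum>b\<in>Basis. (h \<bullet> b) *\<^sub>R pd b f z)) (at z within closed_segment x (x + h))"
      by (rule has_derivative_at_withinI[OF has_derivative_pd[OF d]])
    have "(\<Sum>b\<in>Basis. norm (pd b f z)) \<le> real DIM('a) * C"
      using C[OF _ t(1)] unfolding t(2) by (intro sum_bounded_above) auto
    then show "onorm (\<lambda>h. \<Sum>b\<in>Basis. (h \<bullet> b) *\<^sub>R pd b f z) \<le> DIM('a) * C"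
      by (rule order_trans[OF onorm_coord_sum_le])
  qed auto
  then show ?thesis by simp
qed

text \<open>Linearization with the Lipschitz constant of the first derivatives, which
  \<open>norm_diff_le_pd\<close> supplies from the second ones. The remainder is quadratic for every
  h with an explicit constant, so it can be integrated over a parameter; differentiation under the
  integral relies on that.\<close>

lemma taylor2_pd:
  fixes f :: "'a::euclidean_space \<Rightarrow> complex"
  assumes d: "\<And>z. f differentiable (at z)" and d2: "\<And>b z. b \<in> Basis \<Longrightarrow> pd b f differentiable (at z)"
    and C: "\<And>b c z. b \<in> Basis \<Longrightarrow> c \<in> Basis \<Longrightarrow> norm (pd c (pd b f) z) \<le> C"
  shows "norm (f (x + h) - f x - (\<Sum>b\<in>Basis. (h \<bullet> b) *\<^sub>R pd b f x)) \<le> real DIM('a) ^ 2 * C * norm h ^ 2"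
proof -
  have "C \<ge> 0" using C[OF SOME_Basis SOME_Basis] norm_ge_zero order_trans by blast
  let ?f' = "\<lambda>z h. \<Sum>b\<in>Basis. (h \<bullet> b) *\<^sub>R pd b f z"
  have "norm (f (x + h) - f x - ?f' x ((x + h) - x)) \<le> norm ((x + h) - x) * (real DIM('a) * (real DIM('a) * C * norm h))"
  proof (rule differentiable_bound_linearization[where S = "closed_segment x (x + h)"])
    show "x + t *\<^sub>R (x + h - x) \<in> closed_segment x (x + h)" if "t \<in> {0..1}" for t
      using that by (auto simp: in_segment algebra_simps intro!: exI[of _ t])
    fix z assume "z \<in> closed_segment x (x + h)"
    then obtain t where t: "t \<in> {0..1}" "z = x + t *\<^sub>R h"
      by (auto simp: in_segment algebra_simps)
    show "(f has_derivative ?f' z) (at z within closed_segment x (x + h))"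
      by (rule has_derivative_at_withinI[OF has_derivative_pd[OF d]])
    have "norm (pd b f z - pd b f x) \<le> DIM('a) * C * norm h" if "b \<in> Basis" for b
    proof -
      have "norm (pd b f z - pd b f x) \<le> DIM('a) * C * norm (t *\<^sub>R h)"
        unfolding t(2) using that by (intro norm_diff_le_pd d2 C)
      also have "\<dots> \<le> DIM('a) * C * norm h"
        using t(1) \<open>C \<ge> 0\<close> by (intro mult_left_mono) (auto simp: mult_left_le_one_le)
      finally show ?thesis .
    qed
    then have "(\<Sum>b\<in>Basis. norm (pd b f z - pd b f x)) \<le> real DIM('a) * (real DIM('a) * C * norm h)"
      by (intro sum_bounded_above) auto
    moreover have "?f' z - ?f' x = (\<lambda>h. \<Sum>b\<in>Basis. (h \<bullet> b) *\<^sub>R (pd b f z - pd b f x))"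
      by (auto simp: fun_eq_iff sum_subtractf scaleR_diff_right)
    ultimately show "onorm (?f' z - ?f' x) \<le> real DIM('a) * (real DIM('a) * C * norm h)"
      using onorm_coord_sum_le[of "\<lambda>b. pd b f z - pd b f x"] by simp
  qed auto
  then show ?thesis by (simp add: power2_eq_square mult_ac)
qed

text \<open>Turns an integrated Taylor remainder into a derivative of the integral;
  \<open>fam_integral\<close> applies it with C containing the integral of the dominating
  function.\<close>

lemma has_derivative_quadratic:
  fixes f :: "'a::euclidean_space \<Rightarrow> 'b::real_normed_vector"
  assumes L: "bounded_linear L" and C: "\<And>h. norm (f (y + h) - f y - L h) \<le> C * norm h ^ 2"
  shows "(f has_derivative L) (at y)"
  unfolding has_derivative_at
proof (intro conjI L)
  have "((\<lambda>h::'a. C * norm h) \<longlongrightarrow> C * 0) (at 0)"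
    by (intro tendsto_mult tendsto_const tendsto_norm_zero tendsto_ident_at)
  then have *: "((\<lambda>h::'a. C * norm h) \<longlongrightarrow> 0) (at 0)" by simp
  have "norm (norm (f (y + h) - f y - L h) / norm h) \<le> C * norm h" if "h \<noteq> 0" for h
  proof -
    have "norm (f (y + h) - f y - L h) / norm h \<le> C * norm h"
      using C[of h] that by (subst pos_divide_le_eq) (simp_all add: power2_eq_square mult.assoc)
    then show ?thesis by simp
  qed
  then have "\<forall>\<^sub>F h in at 0. norm (norm (f (y + h) - f y - L h) / norm h) \<le> C * norm h"
    unfolding eventually_at_filter by (intro always_eventually allI impI)
  then show "(\<lambda>h. norm (f (y + h) - f y - L h) / norm h) \<midarrow>0\<rightarrow> 0"
    by (rule Lim_null_comparison[OF _ *])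
qed

text \<open>Steps \<open>1 / (n + 1)\<close> make the partial derivative the limit of a sequence,
  hence measurable in a parameter and accessible to dominated convergence.\<close>

lemma pd_LIMSEQ:
  assumes "f differentiable (at y)"
  shows "(\<lambda>n. of_nat (Suc n) * (f (y + b /\<^sub>R real (Suc n)) - f y)) \<longlonglongrightarrow> pd b f y"
proof -
  let ?D = "frechet_derivative f (at y)"
  have *: "(f has_derivative ?D) (at y)"
    using assms frechet_derivative_works by blast
  have "((\<lambda>t. f (y + t *\<^sub>R b)) has_derivative (\<lambda>t. ?D (t *\<^sub>R b))) (at 0)"
    by (rule has_derivative_compose[of "\<lambda>t. y + t *\<^sub>R b" "\<lambda>t. t *\<^sub>R b" 0 UNIV f ?D])
       (use * in \<open>auto intro!: derivative_eq_intros\<close>)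
  moreover have "linear ?D" using * has_derivative_linear by blast
  ultimately have "((\<lambda>t. f (y + t *\<^sub>R b)) has_vector_derivative pd b f y) (at 0)"
    by (simp add: has_vector_derivative_def pd_def linear_cmul)
  then have "(\<lambda>h. norm (f (y + h *\<^sub>R b) - f y - h *\<^sub>R pd b f y) / norm h) \<midarrow>0\<rightarrow> 0"
    by (simp add: has_vector_derivative_def has_derivative_at)
  then have "(\<lambda>h. norm ((f (y + h *\<^sub>R b) - f y) /\<^sub>R h - pd b f y)) \<midarrow>0\<rightarrow> 0"
  proof (rule Lim_transform_eventually)
    have "norm (f (y + h *\<^sub>R b) - f y - h *\<^sub>R pd b f y) / norm h
        = norm ((f (y + h *\<^sub>R b) - f y) /\<^sub>R h - pd b f y)" if "h \<noteq> 0" for h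
    proof -
      have "(f (y + h *\<^sub>R b) - f y) /\<^sub>R h - pd b f y = (f (y + h *\<^sub>R b) - f y - h *\<^sub>R pd b f y) /\<^sub>R h"
        using that by (simp add: scaleR_diff_right)
      then show ?thesis by (simp add: divide_inverse mult.commute)
    qed
    then show "\<forall>\<^sub>F h in at 0. norm (f (y + h *\<^sub>R b) - f y - h *\<^sub>R pd b f y) / norm h
        = norm ((f (y + h *\<^sub>R b) - f y) /\<^sub>R h - pd b f y)"
      unfolding eventually_at_filter by (intro always_eventually allI impI)
  qed
  then have "((\<lambda>t. (f (y + t *\<^sub>R b) - f y) /\<^sub>R t) \<longlongrightarrow> pd b f y) (at 0)"
    by (rule LIM_zero_cancel[OF tendsto_norm_zero_cancel])
  moreover have "filterlim (\<lambda>n. 1 / real (Suc n)) (at 0) sequentially"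
    unfolding filterlim_at using LIMSEQ_Suc[OF lim_inverse_n'] by (auto simp: inverse_eq_divide)
  ultimately have "(\<lambda>n. (f (y + (1 / real (Suc n)) *\<^sub>R b) - f y) /\<^sub>R (1 / real (Suc n))) \<longlonglongrightarrow> pd b f y"
    by (rule filterlim_compose)
  then show ?thesis
    by (simp add: scaleR_conv_of_real inverse_eq_divide del: of_nat_Suc)
qed

text \<open>If f is not integrable its Bochner integral is 0 and g is nonnegative; so a pointwise
  majorant alone bounds the integral.\<close>

lemma norm_integral_le:
  fixes f :: "'x \<Rightarrow> 'b::{banach,second_countable_topology}"
  assumes "integrable M g" "\<And>x. x \<in> space M \<Longrightarrow> norm (f x) \<le> g x"
  shows "norm (\<integral>x. f x \<partial>M) \<le> (\<integral>x. g x \<partial>M)"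
proof (cases "integrable M f")
  case True
  have "norm (\<integral>x. f x \<partial>M) \<le> (\<integral>x. norm (f x) \<partial>M)" by (rule integral_norm_bound)
  also have "\<dots> \<le> (\<integral>x. g x \<partial>M)" using True assms by (intro integral_mono) auto
  finally show ?thesis .
next
  case False
  have "0 \<le> (\<integral>x. g x \<partial>M)" using assms(2) norm_ge_zero order_trans by (intro Bochner_Integration.integral_nonneg) blast
  then show ?thesis using False by (simp add: not_integrable_integral_eq)
qed

text \<open>Each weight together with a list of basis vectors is a seminorm, and
  \<open>fam W H\<close> says that the functions H i form a bounded set for all of them. The order
  of quantifiers is the point: C is chosen before i, so that any parameter placed in the index is
  treated uniformly. Weights may depend on the index too, which is how integrable majorants in a
  parameter are expressed.\<close>

definition fam :: "('i \<Rightarrow> 'a \<Rightarrow> real) set \<Rightarrow> ('i \<Rightarrow> 'a::euclidean_space \<Rightarrow> complex) \<Rightarrow> bool" where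
  "fam W H \<longleftrightarrow> (\<forall>bs. set bs \<subseteq> Basis \<longrightarrow> (\<forall>i x. iter_deriv bs (H i) differentiable (at x)) \<and>
     (\<forall>w\<in>W. \<exists>C. \<forall>i x. w i x * norm (iter_deriv bs (H i) x) \<le> C))"

lemma fam_differentiable: "fam W H \<Longrightarrow> H i differentiable (at x)"
  unfolding fam_def by (metis iter_deriv.simps(1) empty_set empty_subsetI)

lemma fam_bound_deriv:
  assumes "fam W H" "set bs \<subseteq> Basis" "w \<in> W"
  obtains C where "C \<ge> 0" "\<And>i x. w i x * norm (iter_deriv bs (H i) x) \<le> C"
proof -
  obtain C where "\<forall>i x. w i x * norm (iter_deriv bs (H i) x) \<le> C"
    using assms unfolding fam_def by blast
  then show thesis by (intro that[of "max C 0"]) (auto simp: le_max_iff_disj)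
qed

lemma fam_bound:
  assumes "fam W H" "w \<in> W"
  obtains C where "C \<ge> 0" "\<And>i x. w i x * norm (H i x) \<le> C"
  using fam_bound_deriv[OF assms(1), of "[]"] assms(2) by auto

lemma fam_iter_deriv:
  assumes "fam W H" "set cs \<subseteq> Basis"
  shows "fam W (\<lambda>i. iter_deriv cs (H i))"
  unfolding fam_def
proof (intro allI impI)
  fix bs :: "'b list" assume "set bs \<subseteq> Basis"
  then have "set (bs @ cs) \<subseteq> Basis" using assms by simp
  then show "(\<forall>i x. iter_deriv bs (iter_deriv cs (H i)) differentiable at x) \<and>
     (\<forall>w\<in>W. \<exists>C. \<forall>i x. w i x * cmod (iter_deriv bs (iter_deriv cs (H i)) x) \<le> C)"
    using assms(1) unfolding fam_def iter_deriv_append[symmetric] by blast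
qed

lemma fam_pd:
  assumes "fam W H" "b \<in> Basis"
  shows "fam W (\<lambda>i. pd b (H i))"
  using fam_iter_deriv[OF assms(1), of "[b]"] assms(2) by (simp add: pd_def)

text \<open>Higher derivatives need not be computed: it is enough to exhibit a class X containing H
  that has the bounds of order 0 and is closed under every partial derivative. Below, X consists of
  sums of products, and closure is the product rule.\<close>

lemma fam_coinduct:
  assumes X: "H \<in> X"
    and d: "\<And>H i x. H \<in> X \<Longrightarrow> H i differentiable (at x)"
    and b: "\<And>H w. H \<in> X \<Longrightarrow> w \<in> W \<Longrightarrow> \<exists>C. \<forall>i x. w i x * norm (H i x) \<le> C"
    and c: "\<And>H b. H \<in> X \<Longrightarrow> b \<in> Basis \<Longrightarrow> (\<lambda>i. pd b (H i)) \<in> X"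
  shows "fam W H"
proof -
  have *: "(\<lambda>i. iter_deriv bs (H i)) \<in> X" if "set bs \<subseteq> Basis" for bs
    using that
  proof (induction bs)
    case (Cons b bs)
    then show ?case using c[of "\<lambda>i. iter_deriv bs (H i)" b] by (simp add: pd_def)
  qed (use X in simp)
  then show ?thesis
    unfolding fam_def using d[OF *] b[OF *] by blast
qed

lemma fam_weaken:
  assumes "fam W H" "\<And>w. w \<in> W' \<Longrightarrow> \<exists>w'\<in>W. \<exists>C\<ge>0. \<forall>i x. w i x \<le> C * w' i x"
  shows "fam W' H"
  unfolding fam_def
proof (intro allI impI conjI ballI)
  fix bs i x assume bs: "set (bs::'b list) \<subseteq> Basis"
  show "iter_deriv bs (H i) differentiable at x" using assms bs unfolding fam_def by blast
next
  fix bs w assume bs: "set (bs::'b list) \<subseteq> Basis" and "w \<in> W'"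
  then obtain w' C where w': "w' \<in> W" "C \<ge> 0" "\<And>i x. w i x \<le> C * w' i x" using assms(2) by metis
  obtain D where D: "\<And>i x. w' i x * norm (iter_deriv bs (H i) x) \<le> D"
    using fam_bound_deriv[OF assms(1) bs w'(1)] by metis
  have "w i x * norm (iter_deriv bs (H i) x) \<le> C * D" for i x
  proof -
    have "w i x * norm (iter_deriv bs (H i) x) \<le> (C * w' i x) * norm (iter_deriv bs (H i) x)"
      by (intro mult_right_mono w') auto
    also have "\<dots> \<le> C * D" using D[of i x] w'(2) by (simp add: mult.assoc mult_left_mono)
    finally show ?thesis .
  qed
  then show "\<exists>C. \<forall>i x. w i x * cmod (iter_deriv bs (H i) x) \<le> C" by blast
qed

lemma fam_reindex:
  assumes "fam W H"
  shows "fam ((\<lambda>w j. w (f j)) ` W) (\<lambda>j. H (f j))"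
  unfolding fam_def
proof (intro allI impI conjI ballI)
  fix bs w assume "set (bs::'b list) \<subseteq> Basis" "w \<in> (\<lambda>w j. w (f j)) ` W"
  then obtain w' where "w' \<in> W" "w = (\<lambda>j. w' (f j))" "set bs \<subseteq> Basis" by blast
  then show "\<exists>C. \<forall>i x. w i x * cmod (iter_deriv bs (H (f i)) x) \<le> C"
    using fam_bound_deriv[OF assms, of bs w'] by metis
qed (use assms in \<open>auto simp: fam_def\<close>)

lemma pd_add: "f differentiable (at x) \<Longrightarrow> g differentiable (at x) \<Longrightarrow> pd b (\<lambda>x. f x + g x) x = pd b f x + pd b g x"
  by (rule pd_eqI) (auto simp: pd_def frechet_derivative_works intro!: derivative_eq_intros)

lemma pd_mult: "f differentiable (at x) \<Longrightarrow> g differentiable (at x) \<Longrightarrow>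
    pd b (\<lambda>x. f x * g x) x = pd b f x * g x + f x * pd b g x"
  by (rule pd_eqI) (auto simp: pd_def frechet_derivative_works intro!: derivative_eq_intros)

lemma pd_cmult: "f differentiable (at x) \<Longrightarrow> pd b (\<lambda>x. c * f x) x = c * pd b f x"
  by (rule pd_eqI) (auto simp: pd_def frechet_derivative_works intro!: derivative_eq_intros)

lemma pd_coord: "pd b (\<lambda>x. of_real (x \<bullet> c)) x = of_real (b \<bullet> c)"
  by (rule pd_eqI) (auto intro!: derivative_eq_intros)

lemma has_derivative_affine_comp:
  assumes "f differentiable (at (c *\<^sub>R y + v))"
  shows "((\<lambda>y. f (c *\<^sub>R y + v)) has_derivative (\<lambda>h. frechet_derivative f (at (c *\<^sub>R y + v)) (c *\<^sub>R h))) (at y)"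
  by (rule has_derivative_compose[of "\<lambda>y. c *\<^sub>R y + v" "\<lambda>h. c *\<^sub>R h" y UNIV f])
     (use assms frechet_derivative_works in \<open>auto intro!: derivative_eq_intros\<close>)

lemma differentiable_affine_comp:
  "f differentiable (at (c *\<^sub>R y + v)) \<Longrightarrow> (\<lambda>y. f (c *\<^sub>R y + v)) differentiable (at y)"
  using has_derivative_affine_comp differentiableI by blast

lemma pd_affine:
  assumes "f differentiable (at (c *\<^sub>R y + v))"
  shows "pd b (\<lambda>y. f (c *\<^sub>R y + v)) y = of_real c * pd b f (c *\<^sub>R y + v)"
proof -
  have "linear (frechet_derivative f (at (c *\<^sub>R y + v)))"
    using assms linear_frechet_derivative by blast
  then show ?thesis
    using pd_eqI[OF has_derivative_affine_comp[OF assms], of b]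
    by (simp add: pd_def linear_cmul scaleR_conv_of_real)
qed

lemma pd_zero: "pd b (\<lambda>x. 0) = (\<lambda>x. 0)"
  by (simp add: pd_def)

lemma fam_0: "fam W (\<lambda>i x. 0)"
  by (rule fam_coinduct[where X = "{\<lambda>i x. 0}"]) (auto simp: pd_zero)

lemma fam_add:
  assumes "fam W H" "fam W G"
  shows "fam W (\<lambda>i x. H i x + G i x)"
proof (rule fam_coinduct[where X = "{\<lambda>i x. H i x + G i x |H G. fam W H \<and> fam W G}"])
  fix K i x assume "K \<in> {\<lambda>i x. H i x + G i x |H G. fam W H \<and> fam W G}"
  then show "K i differentiable (at x)" by (elim CollectE exE conjE) (simp add: differentiable_add fam_differentiable)
next
  fix K w assume "K \<in> {\<lambda>i x. H i x + G i x |H G. fam W H \<and> fam W G}" and w: "w \<in> W"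
  then obtain H G where K: "K = (\<lambda>i x. H i x + G i x)" and *: "fam W H" "fam W G" by blast
  obtain C where C: "\<And>i x. w i x * norm (H i x) \<le> C" using fam_bound[OF *(1) w] by metis
  obtain D where D: "\<And>i x. w i x * norm (G i x) \<le> D" using fam_bound[OF *(2) w] by metis
  \<comment> \<open>Weights carry no sign condition at this point; where w is negative the left side
    is at most 0.\<close>
  have "w i x * norm (K i x) \<le> max 0 (C + D)" for i x
  proof (cases "w i x \<ge> 0")
    case True
    have "w i x * norm (K i x) \<le> w i x * (norm (H i x) + norm (G i x))"
      unfolding K using True by (intro mult_left_mono norm_triangle_ineq)
    also have "\<dots> \<le> C + D" using C[of i x] D[of i x] by (simp add: distrib_left)
    finally show ?thesis by simp
  next
    case False
    then have "w i x * norm (K i x) \<le> 0" by (simp add: mult_nonpos_nonneg)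
    then show ?thesis by simp
  qed
  then show "\<exists>C. \<forall>i x. w i x * norm (K i x) \<le> C" by blast
next
  fix K b assume "K \<in> {\<lambda>i x. H i x + G i x |H G. fam W H \<and> fam W G}" and b: "b \<in> (Basis::'b set)"
  then obtain H G where K: "K = (\<lambda>i x. H i x + G i x)" and *: "fam W H" "fam W G" by blast
  show "(\<lambda>i. pd b (K i)) \<in> {\<lambda>i x. H i x + G i x |H G. fam W H \<and> fam W G}"
    by (intro CollectI exI[of _ "\<lambda>i. pd b (H i)"] exI[of _ "\<lambda>i. pd b (G i)"] conjI fam_pd * b)
       (simp add: fun_eq_iff K pd_add fam_differentiable[OF *(1)] fam_differentiable[OF *(2)])
qed (use assms in blast)

lemma fam_sum:
  assumes "finite J" "\<And>j. j \<in> J \<Longrightarrow> fam W (H j)"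
  shows "fam W (\<lambda>i x. \<Sum>j\<in>J. H j i x)"
  using assms by (induction J rule: finite_induct) (auto intro: fam_0 fam_add)

text \<open>Here \<open>n\<close> counts derivatives, each of which produces a factor \<open>c i\<close>.\<close>

lemma fam_affine:
  assumes H: "fam W' H"
    and W: "\<And>w n. w \<in> W \<Longrightarrow> \<exists>w'\<in>W'. \<exists>C\<ge>0. \<forall>i y. norm (F i) * \<bar>c i\<bar> ^ n * w i y \<le> C * w' i (c i *\<^sub>R y + v i)"
  shows "fam W (\<lambda>i y. F i * H i (c i *\<^sub>R y + v i))"
proof -
  define X where "X = {\<lambda>i y. (F i * of_real (c i) ^ n) * G i (c i *\<^sub>R y + v i) |n G. fam W' G}"
  show ?thesis
  proof (rule fam_coinduct[where X = X])
    show "(\<lambda>i y. F i * H i (c i *\<^sub>R y + v i)) \<in> X"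
      unfolding X_def using H by (intro CollectI exI[of _ 0] exI[of _ H]) simp
  next
    fix K i x assume "K \<in> X"
    then show "K i differentiable (at x)"
      unfolding X_def by (elim CollectE exE conjE)
        (simp add: differentiable_mult differentiable_affine_comp fam_differentiable)
  next
    fix K w assume "K \<in> X" and w: "w \<in> W"
    then obtain n G where K: "K = (\<lambda>i y. (F i * of_real (c i) ^ n) * G i (c i *\<^sub>R y + v i))" and G: "fam W' G"
      unfolding X_def by blast
    obtain w' C where w': "w' \<in> W'" "C \<ge> 0"
        "\<And>i y. norm (F i) * \<bar>c i\<bar> ^ n * w i y \<le> C * w' i (c i *\<^sub>R y + v i)"
      using W[OF w, of n] by metis
    obtain D where D: "\<And>i x. w' i x * norm (G i x) \<le> D" using fam_bound[OF G w'(1)] by metis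
    have "w i x * norm (K i x) \<le> C * D" for i x
    proof -
      have "w i x * norm (K i x) = (norm (F i) * \<bar>c i\<bar> ^ n * w i x) * norm (G i (c i *\<^sub>R x + v i))"
        by (simp add: K norm_mult norm_power)
      also have "\<dots> \<le> (C * w' i (c i *\<^sub>R x + v i)) * norm (G i (c i *\<^sub>R x + v i))"
        by (intro mult_right_mono w') auto
      also have "\<dots> \<le> C * D" using D[of i "c i *\<^sub>R x + v i"] w'(2) by (simp add: mult.assoc mult_left_mono)
      finally show ?thesis .
    qed
    then show "\<exists>C. \<forall>i x. w i x * norm (K i x) \<le> C" by blast
  next
    fix K b assume "K \<in> X" and b: "b \<in> (Basis::'b set)"
    then obtain n G where K: "K = (\<lambda>i y. (F i * of_real (c i) ^ n) * G i (c i *\<^sub>R y + v i))" and G: "fam W' G"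
      unfolding X_def by blast
    show "(\<lambda>i. pd b (K i)) \<in> X"
      unfolding X_def
      by (intro CollectI exI[of _ "Suc n"] exI[of _ "\<lambda>i. pd b (G i)"] conjI fam_pd G b)
         (simp add: fun_eq_iff K pd_cmult pd_affine differentiable_affine_comp fam_differentiable[OF G])
  qed
qed

lemma fam_cmult:
  assumes "fam W H" "\<And>i. norm (c i) \<le> B" "\<And>w i x. w \<in> W \<Longrightarrow> 0 \<le> w i x"
  shows "fam W (\<lambda>i x. c i * H i x)"
proof -
  have "B \<ge> 0" using assms(2) norm_ge_zero order_trans by blast
  have "fam W (\<lambda>i x. c i * H i (1 *\<^sub>R x + 0))"
    using \<open>B \<ge> 0\<close> assms by (intro fam_affine[OF assms(1)] bexI exI[of _ B]) (auto intro!: mult_right_mono)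
  then show ?thesis by simp
qed

text \<open>Differentiating one product gives a sum of two, so the class that is closed under
  \<open>pd\<close> must contain sums. As an inductive set it records them without counting
  terms.\<close>

inductive_set fam_products :: "('i \<Rightarrow> 'a \<Rightarrow> real) set \<Rightarrow> ('i \<Rightarrow> 'a::euclidean_space \<Rightarrow> complex) set"
  for W :: "('i \<Rightarrow> 'a \<Rightarrow> real) set" where
  prod: "fam W H \<Longrightarrow> fam {\<lambda>_ _. 1} G \<Longrightarrow> (\<lambda>i x. H i x * G i x) \<in> fam_products W"
| add: "H \<in> fam_products W \<Longrightarrow> G \<in> fam_products W \<Longrightarrow> (\<lambda>i x. H i x + G i x) \<in> fam_products W"

lemma fam_mult:
  assumes "fam W H" "fam {\<lambda>_ _. 1} G" and pos: "\<And>w i x. w \<in> W \<Longrightarrow> 0 \<le> w i x"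
  shows "fam W (\<lambda>i x. H i x * G i x)"
proof (rule fam_coinduct[where X = "fam_products W"])
  show "(\<lambda>i x. H i x * G i x) \<in> fam_products W" by (rule fam_products.prod[OF assms(1,2)])
next
  fix K :: "'a \<Rightarrow> 'b \<Rightarrow> complex" and i x assume "K \<in> fam_products W"
  then show "K i differentiable (at x)"
    by induction (simp_all add: differentiable_add differentiable_mult fam_differentiable)
next
  fix K :: "'a \<Rightarrow> 'b \<Rightarrow> complex" and w assume "K \<in> fam_products W" and w: "w \<in> W"
  then show "\<exists>C. \<forall>i x. w i x * norm (K i x) \<le> C"
  proof induction
    case (prod H G)
    obtain C where C: "C \<ge> 0" "\<And>i x. w i x * norm (H i x) \<le> C" using fam_bound[OF prod(1) w] by metis
    obtain D where D: "\<And>i x. norm (G i x) \<le> D" using fam_bound[OF prod(2), of "\<lambda>_ _. 1"] by (metis insertI1 mult_1)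
    have "w i x * norm (H i x * G i x) \<le> C * D" for i x
      using mult_mono[OF C(2)[of i x] D[of i x] C(1)] by (simp add: norm_mult mult.assoc)
    then show ?case by blast
  next
    case (add H G)
    obtain C where C: "\<And>i x. w i x * norm (H i x) \<le> C" using add by blast
    obtain D where D: "\<And>i x. w i x * norm (G i x) \<le> D" using add by blast
    have "w i x * norm (H i x + G i x) \<le> C + D" for i x
    proof -
      have "w i x * norm (H i x + G i x) \<le> w i x * (norm (H i x) + norm (G i x))"
        using pos[OF w] by (intro mult_left_mono norm_triangle_ineq)
      also have "\<dots> \<le> C + D" using C[of i x] D[of i x] by (simp add: distrib_left)
      finally show ?thesis .
    qed
    then show ?case by blast
  qed
next
  fix K :: "'a \<Rightarrow> 'b \<Rightarrow> complex" and b :: 'b assume K: "K \<in> fam_products W" and b: "b \<in> Basis"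
  have diff: "L i differentiable (at x)" if "L \<in> fam_products W" for L :: "'a \<Rightarrow> 'b \<Rightarrow> complex" and i x
    using that by induction (simp_all add: differentiable_add differentiable_mult fam_differentiable)
  from K show "(\<lambda>i. pd b (K i)) \<in> fam_products W"
  proof induction
    case (prod H G)
    have "(\<lambda>i. pd b (\<lambda>x. H i x * G i x)) = (\<lambda>i x. pd b (H i) x * G i x + H i x * pd b (G i) x)"
      by (simp add: fun_eq_iff pd_mult fam_differentiable[OF prod(1)] fam_differentiable[OF prod(2)])
    then show ?case
      using fam_products.add[OF fam_products.prod[OF fam_pd[OF prod(1) b] prod(2)] fam_products.prod[OF prod(1) fam_pd[OF prod(2) b]]]
      by simp
  next
    case (add H G)
    have "(\<lambda>i. pd b (\<lambda>x. H i x + G i x)) = (\<lambda>i x. pd b (H i) x + pd b (G i) x)"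
      by (simp add: fun_eq_iff pd_add diff add)
    then show ?case using fam_products.add[OF add(3,4)] by simp
  qed
qed

text \<open>The class of functions "coordinate times A plus B" is closed under derivatives because
  the coordinate has constant derivatives. The growth of the coordinate is paid for by a stronger
  weight of W.\<close>

lemma fam_coord:
  assumes H: "fam W H" and pos: "\<And>w i x. w \<in> W \<Longrightarrow> 0 \<le> w i x"
    and W: "\<And>w. w \<in> W \<Longrightarrow> \<exists>w'\<in>W. \<exists>C\<ge>0. \<forall>i x. norm x * w i x \<le> C * w' i x"
  shows "fam W (\<lambda>i x. of_real (x \<bullet> e) * H i x)"
proof -
  define X where "X = {\<lambda>i x. of_real (x \<bullet> e) * A i x + B i x |A B. fam W A \<and> fam W B}"
  have lin: "(\<lambda>x. complex_of_real (x \<bullet> e)) differentiable (at x)" for x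
    by (rule differentiableI[of _ "\<lambda>h. of_real (h \<bullet> e)"]) (auto intro!: derivative_eq_intros)
  show ?thesis
  proof (rule fam_coinduct[where X = X])
    show "(\<lambda>i x. of_real (x \<bullet> e) * H i x) \<in> X"
      unfolding X_def using H by (intro CollectI exI[of _ H] exI[of _ "\<lambda>i x. 0"]) (simp add: fam_0)
  next
    fix K i x assume "K \<in> X"
    then show "K i differentiable (at x)"
      unfolding X_def by (elim CollectE exE conjE)
        (simp add: differentiable_add differentiable_mult lin fam_differentiable)
  next
    fix K w assume "K \<in> X" and w: "w \<in> W"
    then obtain A B where K: "K = (\<lambda>i x. of_real (x \<bullet> e) * A i x + B i x)" and AB: "fam W A" "fam W B"
      unfolding X_def by blast
    obtain w' C where w': "w' \<in> W" "C \<ge> 0" "\<And>i x. norm x * w i x \<le> C * w' i x"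
      using W[OF w] by metis
    obtain D where D: "\<And>i x. w' i x * norm (A i x) \<le> D" using fam_bound[OF AB(1) w'(1)] by metis
    obtain D' where D': "\<And>i x. w i x * norm (B i x) \<le> D'" using fam_bound[OF AB(2) w] by metis
    have "w i x * norm (K i x) \<le> norm e * (C * D) + D'" for i x
    proof -
      have "w i x * norm (K i x) \<le> w i x * (norm e * norm x * norm (A i x) + norm (B i x))"
        unfolding K using pos[OF w] Cauchy_Schwarz_ineq2[of x e]
        by (intro mult_left_mono order_trans[OF norm_triangle_ineq] add_right_mono)
          (auto simp: norm_mult mult.commute[of "norm e"] intro!: mult_right_mono)
      also have "\<dots> = norm e * ((norm x * w i x) * norm (A i x)) + w i x * norm (B i x)"
        by (simp add: algebra_simps)
      also have "\<dots> \<le> norm e * ((C * w' i x) * norm (A i x)) + D'"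
        by (intro add_mono mult_left_mono mult_right_mono w' D') auto
      also have "\<dots> \<le> norm e * (C * D) + D'"
        using D[of i x] w'(2) by (intro add_right_mono mult_left_mono) (auto simp: mult.assoc intro!: mult_left_mono)
      finally show ?thesis .
    qed
    then show "\<exists>C. \<forall>i x. w i x * norm (K i x) \<le> C" by blast
  next
    fix K b assume "K \<in> X" and b: "b \<in> (Basis::'b set)"
    then obtain A B where K: "K = (\<lambda>i x. of_real (x \<bullet> e) * A i x + B i x)" and AB: "fam W A" "fam W B"
      unfolding X_def by blast
    have "fam W (\<lambda>i x. of_real (b \<bullet> e) * A i x)"
      by (rule fam_cmult[OF AB(1), where B = "norm (of_real (b \<bullet> e) :: complex)"]) (auto intro: pos)
    then show "(\<lambda>i. pd b (K i)) \<in> X"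
      unfolding X_def
      by (intro CollectI exI[of _ "\<lambda>i. pd b (A i)"] exI[of _ "\<lambda>i x. of_real (b \<bullet> e) * A i x + pd b (B i) x"]
            conjI fam_pd AB b fam_add)
         (simp_all add: fun_eq_iff K pd_add pd_mult pd_coord lin fam_differentiable[OF AB(1)] fam_differentiable[OF AB(2)])
  qed
qed

section \<open>Families bounded in the Schwartz seminorms\<close>

definition sch :: "('i \<Rightarrow> 'a::euclidean_space \<Rightarrow> complex) \<Rightarrow> bool" where
  "sch H \<longleftrightarrow> fam (range (\<lambda>k i x. (1 + norm x) ^ k)) H"

text \<open>The index type \<open>unit\<close> makes single functions a special case of families, so
  that every closure property is proved once.\<close>

abbreviation sch1 :: "('a::euclidean_space \<Rightarrow> complex) \<Rightarrow> bool" where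
  "sch1 \<phi> \<equiv> sch (\<lambda>_::unit. \<phi>)"

lemma sch_differentiable: "sch H \<Longrightarrow> H i differentiable (at x)"
  unfolding sch_def by (rule fam_differentiable)

lemma sch_bound_deriv:
  assumes "sch H" "set bs \<subseteq> Basis"
  obtains C where "C \<ge> 0" "\<And>i x. (1 + norm x) ^ k * norm (iter_deriv bs (H i) x) \<le> C"
  using fam_bound_deriv[OF assms[unfolded sch_def], of "\<lambda>i x. (1 + norm x) ^ k"] by auto

lemma sch_bound:
  assumes "sch H"
  obtains C where "C \<ge> 0" "\<And>i x. (1 + norm x) ^ k * norm (H i x) \<le> C"
  using sch_bound_deriv[OF assms, of "[]"] by auto

lemma sch_reindex: "sch H \<Longrightarrow> sch (\<lambda>j. H (f j))"
  unfolding sch_def by (drule fam_reindex[of _ H f]) (simp add: image_image)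

lemma sch_add: "sch H \<Longrightarrow> sch G \<Longrightarrow> sch (\<lambda>i x. H i x + G i x)"
  unfolding sch_def by (rule fam_add)

lemma sch_sum: "finite J \<Longrightarrow> (\<And>j. j \<in> J \<Longrightarrow> sch (H j)) \<Longrightarrow> sch (\<lambda>i x. \<Sum>j\<in>J. H j i x)"
  unfolding sch_def by (rule fam_sum)

lemma sch_cmult: "sch H \<Longrightarrow> (\<And>i. norm (c i) \<le> B) \<Longrightarrow> sch (\<lambda>i x. c i * H i x)"
  unfolding sch_def by (rule fam_cmult) auto

lemma sch_cmult_const: "sch H \<Longrightarrow> sch (\<lambda>i x. c * H i x)"
  by (rule sch_cmult[where B = "norm c"]) auto

lemma sch_diff: "sch H \<Longrightarrow> sch G \<Longrightarrow> sch (\<lambda>i x. H i x - G i x)"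
  using sch_add[of H "\<lambda>i x. -1 * G i x"] sch_cmult_const[of G "-1"] by simp

lemma sch_pd: "sch H \<Longrightarrow> b \<in> Basis \<Longrightarrow> sch (\<lambda>i. pd b (H i))"
  unfolding sch_def by (rule fam_pd)

lemma sch_iter_deriv: "sch H \<Longrightarrow> set bs \<subseteq> Basis \<Longrightarrow> sch (\<lambda>i. iter_deriv bs (H i))"
  unfolding sch_def by (rule fam_iter_deriv)

lemma sch_mult: "sch H \<Longrightarrow> fam {\<lambda>_ _. 1} G \<Longrightarrow> sch (\<lambda>i x. H i x * G i x)"
  unfolding sch_def by (rule fam_mult) auto

lemma sch_imp_fam1: "sch H \<Longrightarrow> fam {\<lambda>_ _. 1} H"
  unfolding sch_def by (rule fam_weaken) (auto intro!: exI[of _ 0] exI[of _ 1])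

lemma sch_coord: "sch H \<Longrightarrow> sch (\<lambda>i x. of_real (x \<bullet> e) * H i x)"
  unfolding sch_def
proof (rule fam_coord, assumption)
  fix w :: "'a \<Rightarrow> 'b \<Rightarrow> real" assume "w \<in> range (\<lambda>k i x. (1 + norm x) ^ k)"
  then obtain k where k: "w = (\<lambda>i x. (1 + norm x) ^ k)" by blast
  have "norm x * w i x \<le> 1 * (1 + norm x) ^ Suc k" for i x
    unfolding k by (simp add: mult_right_mono)
  then show "\<exists>w'\<in>range (\<lambda>k i x. (1 + norm x) ^ k). \<exists>C\<ge>0. \<forall>i x. norm x * w i x \<le> C * w' i x"
    by (intro bexI[of _ "\<lambda>i x. (1 + norm x) ^ Suc k"] exI[of _ 1] conjI rangeI) auto
qed auto

text \<open>The powers of \<open>norm x\<close> in \<open>schwartz\<close> and the weights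
  \<open>(1 + norm x) ^ k\<close> are equivalent by the binomial theorem; the latter are never 0 and
  behave well under translations.\<close>

lemma schwartz_sch1: "\<phi> \<in> schwartz \<longleftrightarrow> sch1 \<phi>"
proof
  assume \<phi>: "\<phi> \<in> schwartz"
  show "sch1 \<phi>"
    unfolding sch_def fam_def
  proof (intro allI impI conjI ballI)
    fix bs :: "'a list" and x assume "set bs \<subseteq> Basis"
    then have "iter_deriv bs \<phi> differentiable_on UNIV" using \<phi> unfolding schwartz_def by blast
    then show "iter_deriv bs \<phi> differentiable at x" by (simp add: differentiable_on_def)
  next
    fix bs :: "'a list" and w :: "unit \<Rightarrow> 'a \<Rightarrow> real"
    assume bs: "set bs \<subseteq> Basis" and "w \<in> range (\<lambda>k i x. (1 + norm x) ^ k)"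
    then obtain k where w: "w = (\<lambda>i x. (1 + norm x) ^ k)" by blast
    have bd: "bounded (range (\<lambda>x. norm x ^ n * norm (iter_deriv bs \<phi> x)))" for n
      using \<phi> bs unfolding schwartz_def by blast
    have "\<exists>C. \<forall>x. norm x ^ n * norm (iter_deriv bs \<phi> x) \<le> C" for n
      using bd[of n] by (auto simp: bounded_iff)
    then obtain C where C: "\<And>n x. norm x ^ n * norm (iter_deriv bs \<phi> x) \<le> C n" by metis
    have "(1 + norm x) ^ k * norm (iter_deriv bs \<phi> x) \<le> (\<Sum>n\<le>k. of_nat (k choose n) * C n)" for x
    proof -
      have "(1 + norm x) ^ k * norm (iter_deriv bs \<phi> x) = (\<Sum>n\<le>k. of_nat (k choose n) * (norm x ^ n * norm (iter_deriv bs \<phi> x)))"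
        by (subst add.commute) (simp add: binomial_ring sum_distrib_right mult.assoc)
      also have "\<dots> \<le> (\<Sum>n\<le>k. of_nat (k choose n) * C n)"
        by (intro sum_mono mult_left_mono C) auto
      finally show ?thesis .
    qed
    then show "\<exists>C. \<forall>i x. w i x * norm (iter_deriv bs \<phi> x) \<le> C" unfolding w by blast
  qed
next
  assume \<phi>: "sch1 \<phi>"
  show "\<phi> \<in> schwartz"
    unfolding schwartz_def
  proof (intro CollectI allI impI conjI)
    fix bs :: "'a list" assume bs: "set bs \<subseteq> Basis"
    show "iter_deriv bs \<phi> differentiable_on UNIV"
      using sch_differentiable[OF sch_iter_deriv[OF \<phi> bs]] by (simp add: differentiable_on_def)
    fix k
    obtain C where C: "\<And>x. (1 + norm x) ^ k * norm (iter_deriv bs \<phi> x) \<le> C"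
      using sch_bound_deriv[OF \<phi> bs] by metis
    have "norm x ^ k * norm (iter_deriv bs \<phi> x) \<le> C" for x
      by (rule order_trans[OF _ C[of x]]) (intro mult_right_mono power_mono, auto)
    then show "bounded (range (\<lambda>x. norm x ^ k * norm (iter_deriv bs \<phi> x)))"
      unfolding bounded_iff by (intro exI[of _ C]) (auto simp: abs_mult)
  qed
qed

lemma sch_const: "sch1 \<phi> \<Longrightarrow> sch (\<lambda>_. \<phi>)"
  by (rule sch_reindex[of _ "\<lambda>_. ()"])

text \<open>Peetre's inequality: a translation changes the polynomial weight at most by the weight
  of the shift. The weighted convolution bounds rest on it.\<close>

lemma jp_triangle: "1 + norm x \<le> (1 + norm (x + y)) * (1 + norm (y::'a::real_normed_vector))"
proof -
  have 1: "norm x \<le> norm (x + y) + norm y" using norm_triangle_ineq4[of "x + y" y] by simp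
  have 2: "0 \<le> norm (x + y) * norm y" by simp
  have "(1 + norm (x + y)) * (1 + norm y) = 1 + norm (x + y) + norm y + norm (x + y) * norm y"
    by (simp add: algebra_simps)
  with 1 2 show ?thesis by linarith
qed

text \<open>For shifts of length at most 1 the weights at x and on the segment differ by a factor of
  at most \<open>2 ^ k\<close>, so the mean value inequality preserves the decay.\<close>

lemma sch_lipschitz:
  fixes H :: "'i \<Rightarrow> 'a::euclidean_space \<Rightarrow> complex"
  assumes "sch H"
  obtains C where "C \<ge> 0" "\<And>i x h. norm h \<le> 1 \<Longrightarrow> (1 + norm x) ^ k * norm (H i (x + h) - H i x) \<le> C * norm h"
proof -
  have "\<exists>C. \<forall>i x. (1 + norm x) ^ k * norm (pd b (H i) x) \<le> C" if "b \<in> Basis" for b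
    using sch_bound[OF sch_pd[OF assms that], of k] by metis
  then obtain C where C: "\<And>b i x. b \<in> Basis \<Longrightarrow> (1 + norm x) ^ k * norm (pd b (H i) x) \<le> C b" by metis
  define D where "D = (\<Sum>b\<in>Basis. \<bar>C b\<bar>)"
  have D: "(1 + norm x) ^ k * norm (pd b (H i) x) \<le> D" if "b \<in> Basis" for b i x
    using C[OF that, of x i] member_le_sum[of b Basis "\<lambda>b. \<bar>C b\<bar>"] that unfolding D_def by force
  show thesis
  proof (rule that[of "DIM('a) * (2 ^ k * D)"])
    show "0 \<le> DIM('a) * (2 ^ k * D)" unfolding D_def by (simp add: sum_nonneg)
    fix i x h assume h: "norm (h::'a) \<le> 1"
    have "norm (pd b (H i) (x + t *\<^sub>R h)) \<le> 2 ^ k * D / (1 + norm x) ^ k" if b: "b \<in> Basis" and t: "t \<in> {0..1}" for b t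
    proof -
      have "norm (t *\<^sub>R h) \<le> 1" using t h by (simp add: mult_le_one)
      then have "1 + norm x \<le> (1 + norm (x + t *\<^sub>R h)) * 2"
        by (intro order_trans[OF jp_triangle[of x "t *\<^sub>R h"]] mult_left_mono) auto
      then have "(1 + norm x) ^ k \<le> ((1 + norm (x + t *\<^sub>R h)) * 2) ^ k" by (intro power_mono) auto
      then have "(1 + norm x) ^ k * norm (pd b (H i) (x + t *\<^sub>R h)) \<le> ((1 + norm (x + t *\<^sub>R h)) * 2) ^ k * norm (pd b (H i) (x + t *\<^sub>R h))"
        by (intro mult_right_mono) auto
      also have "\<dots> = 2 ^ k * ((1 + norm (x + t *\<^sub>R h)) ^ k * norm (pd b (H i) (x + t *\<^sub>R h)))"
        unfolding power_mult_distrib by (simp only: mult_ac)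
      also have "\<dots> \<le> 2 ^ k * D" using D[OF b] by (intro mult_left_mono) auto
      finally show ?thesis by (simp add: pos_le_divide_eq add_pos_nonneg mult.commute)
    qed
    then have "norm (H i (x + h) - H i x) \<le> DIM('a) * (2 ^ k * D / (1 + norm x) ^ k) * norm h"
      by (intro norm_diff_le_pd sch_differentiable[OF assms]) auto
    then have "(1 + norm x) ^ k * norm (H i (x + h) - H i x) \<le> (1 + norm x) ^ k * (DIM('a) * (2 ^ k * D / (1 + norm x) ^ k) * norm h)"
      by (intro mult_left_mono) auto
    also have "\<dots> = DIM('a) * (2 ^ k * D) * norm h"
    proof -
      have "(1 + norm x) ^ k \<noteq> 0" using norm_ge_zero[of x] by (simp add: add_nonneg_eq_0_iff)
      then show ?thesis by simp
    qed
    finally show "(1 + norm x) ^ k * norm (H i (x + h) - H i x) \<le> DIM('a) * (2 ^ k * D) * norm h" .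
  qed
qed

lemma sch_continuous: "sch H \<Longrightarrow> continuous_on UNIV (H i)"
  by (intro differentiable_imp_continuous_on) (auto simp: differentiable_on_def dest: sch_differentiable)

lemma sch_measurable: "sch H \<Longrightarrow> H i \<in> borel_measurable borel"
  by (intro borel_measurable_continuous_onI sch_continuous)

section \<open>Affine substitutions, integrable weights and parameter integrals\<close>

lemma nn_integral_lborel_affine:
  fixes f :: "'a::euclidean_space \<Rightarrow> ennreal"
  assumes [measurable]: "f \<in> borel_measurable borel" and c: "c \<noteq> 0"
  shows "(\<integral>\<^sup>+x. f x \<partial>lborel) = ennreal (\<bar>c\<bar> ^ DIM('a)) * (\<integral>\<^sup>+x. f (t + c *\<^sub>R x) \<partial>lborel)"
  by (subst lborel_affine[OF c, of t]) (simp add: nn_integral_density nn_integral_distr nn_integral_cmult)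

lemma integrable_lborel_affine:
  fixes f :: "'a::euclidean_space \<Rightarrow> complex"
  assumes f: "integrable lborel f" and c: "c \<noteq> 0"
  shows "integrable lborel (\<lambda>x. f (t + c *\<^sub>R x))"
  using c f f[THEN borel_measurable_integrable] unfolding integrable_iff_bounded
  by (subst (asm) nn_integral_lborel_affine[where c=c and t=t]) (auto simp: ennreal_mult_less_top)

lemma integrable_lborel_affine_iff:
  fixes f :: "'a::euclidean_space \<Rightarrow> complex"
  assumes c: "c \<noteq> 0"
  shows "integrable lborel (\<lambda>x. f (t + c *\<^sub>R x)) \<longleftrightarrow> integrable lborel f"
  using integrable_lborel_affine[of f c t] c
    integrable_lborel_affine[of "\<lambda>x. f (t + c *\<^sub>R x)" "1/c" "-t /\<^sub>R c"]
  by (auto simp: algebra_simps)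

lemma integral_lborel_affine:
  fixes f :: "'a::euclidean_space \<Rightarrow> complex"
  assumes c: "c \<noteq> 0"
  shows "(LBINT x. f x) = \<bar>c\<bar> ^ DIM('a) *\<^sub>R (LBINT x. f (t + c *\<^sub>R x))"
proof cases
  assume f[measurable]: "integrable lborel f" then show ?thesis
    using c f f[THEN borel_measurable_integrable] integrable_lborel_affine[OF f c, of t]
    by (subst lborel_affine[OF c, of t]) (simp add: integral_density integral_distr)
next
  assume "\<not> integrable lborel f" with c show ?thesis
    by (simp add: integrable_lborel_affine_iff not_integrable_integral_eq)
qed

text \<open>Dyadic shells, enlarged to balls: on the k-th one the integrand is at most
  \<open>2 powr (- a * k)\<close> and the volume is of order \<open>2 ^ (k * d)\<close>, d being the
  dimension, so the series is geometric with ratio \<open>2 powr (d - a)\<close>.\<close>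

lemma nn_integral_jp:
  fixes a :: real
  assumes a: "a > real DIM('a::euclidean_space)"
  shows "(\<integral>\<^sup>+x. ennreal ((1 + norm (x::'a)) powr (-a)) \<partial>lborel) < \<infinity>"
proof -
  define V where "V = unit_ball_vol (real DIM('a))"
  have V0: "V \<ge> 0" unfolding V_def by simp
  define F where "F = (\<lambda>(k::nat) (x::'a). ennreal (2 powr (- a * k)) * indicator (ball 0 (2 ^ Suc k)) x)"
  have le: "ennreal ((1 + norm x) powr (-a)) \<le> (\<Sum>k. F k x)" for x :: 'a
  proof -
    define l where "l = log 2 (1 + norm x)"
    have l0: "l \<ge> 0" unfolding l_def by (subst zero_le_log_cancel_iff) (auto simp: add_pos_nonneg)
    have x: "1 + norm x = 2 powr l" unfolding l_def by (simp add: add_pos_nonneg)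
    define k where "k = nat \<lfloor>l\<rfloor>"
    have k: "real k \<le> l" "l < real k + 1" using l0 unfolding k_def by linarith+
    have "2 powr l < 2 powr (real (Suc k))" using k by simp
    also have "2 powr (real (Suc k)) = 2 ^ Suc k" by (rule powr_realpow) simp
    finally have "norm x < 2 ^ Suc k" using x by linarith
    then have "F k x = ennreal (2 powr (- a * k))" unfolding F_def by (simp add: indicator_def)
    moreover have "(1 + norm x) powr (-a) \<le> 2 powr (- a * k)"
      unfolding x powr_powr using k(1) a by (intro powr_mono) (auto simp: mult.commute)
    ultimately have "ennreal ((1 + norm x) powr (-a)) \<le> F k x" by (simp add: ennreal_leI)
    also have "\<dots> \<le> (\<Sum>k. F k x)" using sum_le_suminf[of "\<lambda>k. F k x" "{k}"] by simp
    finally show ?thesis .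
  qed
  have "(\<integral>\<^sup>+x. ennreal ((1 + norm (x::'a)) powr (-a)) \<partial>lborel) \<le> (\<integral>\<^sup>+x. (\<Sum>k. F k x) \<partial>lborel)"
    by (intro nn_integral_mono le)
  also have "\<dots> = (\<Sum>k. \<integral>\<^sup>+x. F k x \<partial>lborel)"
    unfolding F_def by (intro nn_integral_suminf borel_measurable_times_ennreal borel_measurable_const borel_measurable_indicator) auto
  also have "\<dots> = (\<Sum>k. ennreal (V * 2 ^ DIM('a) * (2 powr (DIM('a) - a)) ^ k))"
  proof (intro suminf_cong)
    fix k
    have "(\<integral>\<^sup>+x. F k x \<partial>lborel) = ennreal (2 powr (- a * k)) * ennreal (V * (2 ^ Suc k) ^ DIM('a))"
      unfolding F_def V_def by (subst nn_integral_cmult_indicator) (simp_all only: emeasure_ball zero_le_power zero_le_numeral, auto)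
    also have "\<dots> = ennreal (2 powr (- a * k) * (V * (2 ^ Suc k) ^ DIM('a)))"
      using V0 by (simp add: ennreal_mult'[symmetric])
    also have "2 powr (- a * k) * (V * (2 ^ Suc k) ^ DIM('a)) = V * 2 ^ DIM('a) * (2 powr (DIM('a) - a)) ^ k"
    proof -
      have "(2 powr (DIM('a) - a)) ^ k = 2 powr (real k * (DIM('a) - a))" by (simp add: powr_power)
      also have "\<dots> = 2 powr (- a * k) * 2 powr (real (k * DIM('a)))" by (simp add: powr_add[symmetric] algebra_simps)
      also have "2 powr (real (k * DIM('a))) = (2 ^ k) ^ DIM('a)"
        by (simp add: powr_realpow power_mult del: of_nat_mult)
      finally show ?thesis by (simp add: power_mult_distrib)
    qed
    finally show "(\<integral>\<^sup>+x. F k x \<partial>lborel) = ennreal (V * 2 ^ DIM('a) * (2 powr (DIM('a) - a)) ^ k)" .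
  qed
  also have "\<dots> < \<infinity>"
  proof -
    have "2 powr (DIM('a) - a) < 1" using a powr_less_mono[of "DIM('a) - a" 0 2] by simp
    then have "summable (\<lambda>k. V * 2 ^ DIM('a) * (2 powr (DIM('a) - a)) ^ k)"
      by (intro summable_mult summable_geometric) simp
    moreover have "V * 2 ^ DIM('a) * (2 powr (DIM('a) - a)) ^ k \<ge> 0" for k :: nat using V0 by simp
    ultimately have "(\<Sum>k. ennreal (V * 2 ^ DIM('a) * (2 powr (DIM('a) - a)) ^ k)) \<noteq> top"
      by (rule ennreal_suminf_neq_top)
    then show ?thesis unfolding infinity_ennreal_def less_top .
  qed
  finally show ?thesis .
qed

lemma integrable_jp:
  fixes a :: real
  assumes a: "a > real DIM('a::euclidean_space)"
  shows "integrable lborel (\<lambda>x::'a. (1 + norm x) powr (-a))"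
  using nn_integral_jp[OF a] by (intro integrableI_nonneg) auto

text \<open>The usual dominating function. The exponent is a natural number, one above the
  dimension, so that the bounds of \<open>sch\<close> compare with it directly.\<close>

definition jw :: "'a::euclidean_space \<Rightarrow> real" where "jw x = 1 / (1 + norm x) ^ Suc DIM('a)"

lemma jw_pos: "jw x > 0" unfolding jw_def by (simp add: add_pos_nonneg)

lemma jw_measurable[measurable]: "jw \<in> borel_measurable borel" unfolding jw_def by measurable

lemma integrable_jw: "integrable lborel (jw :: 'a::euclidean_space \<Rightarrow> real)"
proof -
  have "(1 + norm x) powr (- real (Suc (DIM('a)))) = jw x" for x :: 'a
    unfolding jw_def using powr_minus_divide[of "1 + norm x" "real (Suc (DIM('a)))"]
    by (subst (asm) powr_realpow) (auto simp: add_pos_nonneg simp del: power_Suc)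
  then show ?thesis using integrable_jp[of "real (Suc (DIM('a)))", where 'a='a] by simp
qed

lemma bounded_by_jw:
  "(1 + norm (x::'a::euclidean_space)) ^ Suc DIM('a) * y \<le> C \<Longrightarrow> y \<le> C * jw x"
  unfolding jw_def by (simp add: pos_le_divide_eq add_pos_nonneg mult.commute del: power_Suc)

lemma sch_integrable:
  fixes H :: "'i \<Rightarrow> 'a::euclidean_space \<Rightarrow> complex"
  assumes "sch H"
  shows "integrable lborel (H i)"
proof -
  obtain C where C: "\<And>i x. (1 + norm x) ^ Suc DIM('a) * norm (H i x) \<le> C" using sch_bound[OF assms] by metis
  show ?thesis
  proof (rule integrable_bound[where f = "\<lambda>x. C * jw x"])
    show "integrable lborel (\<lambda>x::'a. C * jw x)" by (intro integrable_mult_right integrable_jw)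
    show "AE x in lborel. norm (H i x) \<le> norm (C * jw x)"
      using bounded_by_jw[OF C] by (intro AE_I2) (metis abs_ge_self order_trans real_norm_def)
  qed (use sch_measurable[OF assms] in simp)
qed

text \<open>Differentiation under the integral sign for a whole family. Dividing the weights by v x
  expresses that all derivatives of the integrand are dominated by the integrable v. The bounds on
  second derivatives give Taylor remainders that remain quadratic in h after integration. The weight
  w1 \<ge> 1 ensures that plain bounds are among the weighted ones.\<close>

lemma fam_integral:
  fixes H :: "'i \<times> 'x \<Rightarrow> 'a::euclidean_space \<Rightarrow> complex"
  assumes v: "integrable M v" "\<And>x. v x > 0"
    and F: "fam ((\<lambda>w (i, x) y. w i y / v x) ` W) H"
    and one: "w1 \<in> W" "\<And>i y. 1 \<le> w1 i y"
    and pos: "\<And>w i x. w \<in> W \<Longrightarrow> 0 \<le> w i x"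
    and meas: "\<And>i y. (\<lambda>x. H (i, x) y) \<in> borel_measurable M"
  shows "fam W (\<lambda>i y. \<integral>x. H (i, x) y \<partial>M)"
    and "\<And>i y. integrable M (\<lambda>x. H (i, x) y)"
    and "\<And>b i. b \<in> Basis \<Longrightarrow> pd b (\<lambda>y. \<integral>x. H (i, x) y \<partial>M) = (\<lambda>y. \<integral>x. pd b (H (i, x)) y \<partial>M)"
proof -
  let ?W = "(\<lambda>w (i, x) y. w i y / v x) ` W"
  define Q where "Q = {H :: 'i \<times> 'x \<Rightarrow> 'a \<Rightarrow> complex. fam ?W H \<and> (\<forall>i y. (\<lambda>x. H (i, x) y) \<in> borel_measurable M)}"
  have pdQ: "(\<lambda>k. pd b (H k)) \<in> Q" if "H \<in> Q" "b \<in> Basis" for H b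
    unfolding Q_def
  proof (intro CollectI conjI allI)
    show "fam ?W (\<lambda>k. pd b (H k))" using that by (intro fam_pd) (auto simp: Q_def)
    fix i y
    \<comment> \<open>Measurability in the parameter x survives differentiation in y, as a limit of
      difference quotients.\<close>
    show "(\<lambda>x. pd b (H (i, x)) y) \<in> borel_measurable M"
    proof (rule borel_measurable_LIMSEQ_metric)
      show "(\<lambda>x. of_nat (Suc n) * (H (i, x) (y + b /\<^sub>R real (Suc n)) - H (i, x) y)) \<in> borel_measurable M" for n
        using that(1) unfolding Q_def by (intro borel_measurable_times borel_measurable_diff borel_measurable_const) auto
      show "(\<lambda>n. of_nat (Suc n) * (H (i, x) (y + b /\<^sub>R real (Suc n)) - H (i, x) y)) \<longlonglongrightarrow> pd b (H (i, x)) y" for x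
        using that(1) by (intro pd_LIMSEQ) (auto simp: Q_def intro: fam_differentiable)
    qed
  qed
  have bd: "\<exists>C\<ge>0. \<forall>i x y. w i y * norm (H (i, x) y) \<le> C * v x" if HQ: "H \<in> Q" and w: "w \<in> W" for H w
  proof -
    have "fam ?W H" using HQ by (simp add: Q_def)
    then obtain C where C: "C \<ge> 0" "\<And>k y. (case k of (i, x) \<Rightarrow> \<lambda>y. w i y / v x) y * norm (H k y) \<le> C"
      using fam_bound[of ?W H "\<lambda>(i, x) y. w i y / v x"] w by blast
    have "w i y * norm (H (i, x) y) \<le> C * v x" for i x y
      using C(2)[of "(i, x)" y] v(2)[of x] by (simp add: divide_le_eq)
    then show ?thesis using C(1) by blast
  qed
  have bd1: "\<exists>C\<ge>0. \<forall>i x y. norm (H (i, x) y) \<le> C * v x" if "H \<in> Q" for H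
  proof -
    obtain C where C: "C \<ge> 0" "\<And>i x y. w1 i y * norm (H (i, x) y) \<le> C * v x" using bd[OF \<open>H \<in> Q\<close> one(1)] by blast
    have "norm (H (i, x) y) \<le> C * v x" for i x y
      using mult_right_mono[OF one(2)[of i y] norm_ge_zero[of "H (i, x) y"]] C(2)[of i y x] by simp
    then show ?thesis using C(1) by blast
  qed
  have int: "integrable M (\<lambda>x. H (i, x) y)" if "H \<in> Q" for H i y
  proof -
    obtain C where C: "C \<ge> 0" "\<And>i x y. norm (H (i, x) y) \<le> C * v x" using bd1[OF \<open>H \<in> Q\<close>] by blast
    show ?thesis
    proof (rule integrable_bound[where f = "\<lambda>x. C * v x"])
      show "AE x in M. norm (H (i, x) y) \<le> norm (C * v x)"
        using C(2) by (intro AE_I2) (metis abs_ge_self order_trans real_norm_def)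
    qed (use that v in \<open>auto simp: Q_def\<close>)
  qed
  have der: "((\<lambda>y. \<integral>x. H (i, x) y \<partial>M) has_derivative (\<lambda>h. \<Sum>b\<in>Basis. (h \<bullet> b) *\<^sub>R (\<integral>x. pd b (H (i, x)) y \<partial>M))) (at y)"
    if Q: "H \<in> Q" for H i y
  proof -
    have "\<exists>C\<ge>0. \<forall>i x y. norm (pd c (pd b (H (i, x))) y) \<le> C * v x" if "b \<in> Basis" "c \<in> Basis" for b c
      using bd1[OF pdQ[OF pdQ[OF Q that(1)] that(2)]] .
    then obtain C where C: "\<And>b c i x y. b \<in> Basis \<Longrightarrow> c \<in> Basis \<Longrightarrow> C b c \<ge> 0 \<and> norm (pd c (pd b (H (i, x))) y) \<le> C b c * v x"
      by metis
    define D where "D = (\<Sum>b\<in>Basis. \<Sum>c\<in>Basis. C b c)"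
    have D: "norm (pd c (pd b (H (i, x))) y) \<le> D * v x" if bc: "b \<in> Basis" "c \<in> Basis" for b c i x y
    proof -
      have "C b c \<le> (\<Sum>c\<in>Basis. C b c)" using bc C by (intro member_le_sum) auto
      also have "\<dots> \<le> D" unfolding D_def using bc C by (intro member_le_sum[where f = "\<lambda>b. \<Sum>c\<in>Basis. C b c"]) (auto intro!: sum_nonneg)
      finally show ?thesis using C[OF bc] v(2)[of x] mult_right_mono[of "C b c" D "v x"] by (meson less_imp_le order_trans)
    qed
    have fQ: "fam ?W H" using Q by (simp add: Q_def)
    let ?L = "\<lambda>h. \<Sum>b\<in>Basis. (h \<bullet> b) *\<^sub>R (\<integral>x. pd b (H (i, x)) y \<partial>M)"
    show ?thesis
    proof (rule has_derivative_quadratic[where C = "real DIM('a) ^ 2 * (D * (\<integral>x. v x \<partial>M))"])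
      show "bounded_linear ?L"
        by (intro bounded_linear_sum bounded_linear_scaleR_const bounded_linear_inner_left)
      fix h
      have eq: "(\<integral>x. H (i, x) (y + h) - H (i, x) y - (\<Sum>b\<in>Basis. (h \<bullet> b) *\<^sub>R pd b (H (i, x)) y) \<partial>M)
          = (\<integral>x. H (i, x) (y + h) \<partial>M) - (\<integral>x. H (i, x) y \<partial>M) - ?L h"
        using int[OF Q] int[OF pdQ[OF Q]] by simp
      have "norm (\<integral>x. H (i, x) (y + h) - H (i, x) y - (\<Sum>b\<in>Basis. (h \<bullet> b) *\<^sub>R pd b (H (i, x)) y) \<partial>M)
          \<le> (\<integral>x. real DIM('a) ^ 2 * (D * v x) * norm h ^ 2 \<partial>M)"
      proof (rule norm_integral_le)
        show "norm (H (i, x) (y + h) - H (i, x) y - (\<Sum>b\<in>Basis. (h \<bullet> b) *\<^sub>R pd b (H (i, x)) y)) \<le> real DIM('a) ^ 2 * (D * v x) * norm h ^ 2" for x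
          by (rule taylor2_pd) (use D fam_differentiable[OF fQ] fam_differentiable[OF fam_pd[OF fQ]] in auto)
      qed (intro integrable_mult_left integrable_mult_right v(1))
      also have "\<dots> = real DIM('a) ^ 2 * (D * (\<integral>x. v x \<partial>M)) * norm h ^ 2" by simp
      finally show "norm ((\<integral>x. H (i, x) (y + h) \<partial>M) - (\<integral>x. H (i, x) y \<partial>M) - ?L h) \<le> real DIM('a) ^ 2 * (D * (\<integral>x. v x \<partial>M)) * norm h ^ 2"
        unfolding eq .
    qed
  qed
  have pdI: "pd b (\<lambda>y. \<integral>x. H (i, x) y \<partial>M) = (\<lambda>y. \<integral>x. pd b (H (i, x)) y \<partial>M)" if "H \<in> Q" "b \<in> Basis" for H b i
  proof
    fix y
    have "pd b (\<lambda>y. \<integral>x. H (i, x) y \<partial>M) y = (\<Sum>c\<in>Basis. (b \<bullet> c) *\<^sub>R (\<integral>x. pd c (H (i, x)) y \<partial>M))"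
      by (rule pd_eqI[OF der[OF that(1)]])
    also have "\<dots> = (\<Sum>c\<in>Basis. if c = b then (\<integral>x. pd c (H (i, x)) y \<partial>M) else 0)"
      using that(2) by (intro sum.cong) (auto simp: inner_Basis)
    finally show "pd b (\<lambda>y. \<integral>x. H (i, x) y \<partial>M) y = (\<integral>x. pd b (H (i, x)) y \<partial>M)"
      using that(2) by simp
  qed
  have HQ: "H \<in> Q" unfolding Q_def using F meas by blast
  show "\<And>i y. integrable M (\<lambda>x. H (i, x) y)" using int[OF HQ] .
  show "\<And>b i. b \<in> Basis \<Longrightarrow> pd b (\<lambda>y. \<integral>x. H (i, x) y \<partial>M) = (\<lambda>y. \<integral>x. pd b (H (i, x)) y \<partial>M)"
    using pdI[OF HQ] .
  show "fam W (\<lambda>i y. \<integral>x. H (i, x) y \<partial>M)"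
  \<comment> \<open>The closed class is the image of Q under integration; \<open>pdI\<close> moves
    the derivative inside and \<open>pdQ\<close> keeps it in Q.\<close>
  proof (rule fam_coinduct[where X = "(\<lambda>H i y. \<integral>x. H (i, x) y \<partial>M) ` Q"])
    show "(\<lambda>i y. \<integral>x. H (i, x) y \<partial>M) \<in> (\<lambda>H i y. \<integral>x. H (i, x) y \<partial>M) ` Q" using HQ by blast
  next
    fix K i x assume "K \<in> (\<lambda>H i y. \<integral>x. H (i, x) y \<partial>M) ` Q"
    then show "K i differentiable (at x)" using der differentiableI by fastforce
  next
    fix K w assume "K \<in> (\<lambda>H i y. \<integral>x. H (i, x) y \<partial>M) ` Q" and w: "w \<in> W"
    then obtain H where H: "H \<in> Q" "K = (\<lambda>i y. \<integral>x. H (i, x) y \<partial>M)" by blast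
    obtain C where C: "C \<ge> 0" "\<And>i x y. w i y * norm (H (i, x) y) \<le> C * v x" using bd[OF H(1) w] by blast
    have "w i y * norm (K i y) \<le> C * (\<integral>x. v x \<partial>M)" for i y
    proof -
      have "norm (w i y *\<^sub>R K i y) = norm (\<integral>x. w i y *\<^sub>R H (i, x) y \<partial>M)" unfolding H(2) by simp
      also have "\<dots> \<le> (\<integral>x. C * v x \<partial>M)"
      proof (rule norm_integral_le)
        show "norm (w i y *\<^sub>R H (i, x) y) \<le> C * v x" for x using C(2)[of i y x] pos[OF w] by simp
      qed (use v(1) in simp)
      finally show ?thesis using pos[OF w, of i y] by simp
    qed
    then show "\<exists>C. \<forall>i x. w i x * norm (K i x) \<le> C" by blast
  next
    fix K b assume "K \<in> (\<lambda>H i y. \<integral>x. H (i, x) y \<partial>M) ` Q" and b: "b \<in> (Basis :: 'a set)"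
    then obtain H where H: "H \<in> Q" "K = (\<lambda>i y. \<integral>x. H (i, x) y \<partial>M)" by blast
    show "(\<lambda>i. pd b (K i)) \<in> (\<lambda>H i y. \<integral>x. H (i, x) y \<partial>M) ` Q"
      unfolding H(2) by (rule image_eqI[OF _ pdQ[OF H(1) b]]) (simp add: pdI[OF H(1) b])
  qed
qed

text \<open>The difference quotients have integral 0 by translation invariance and are dominated by
  a multiple of \<open>jw\<close>; so their limit has integral 0. This is the source of every
  integration by parts below.\<close>

lemma integral_pd_zero:
  fixes \<phi> :: "'a::euclidean_space \<Rightarrow> complex"
  assumes \<phi>: "sch1 \<phi>" and b: "b \<in> Basis"
  shows "(LBINT x. pd b \<phi> x) = 0"
proof -
  define G where "G = (\<lambda>n x. of_nat (Suc n) * (\<phi> (x + b /\<^sub>R real (Suc n)) - \<phi> x))"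
  obtain C where C: "C \<ge> 0"
      "\<And>x h. norm h \<le> 1 \<Longrightarrow> (1 + norm x) ^ Suc DIM('a) * norm (\<phi> (x + h) - \<phi> x) \<le> C * norm h"
    using sch_lipschitz[OF \<phi>] by metis
  have int: "integrable lborel \<phi>" "integrable lborel (\<lambda>x. \<phi> (x + v))" for v
    using sch_integrable[OF \<phi>] integrable_lborel_affine[OF sch_integrable[OF \<phi>], of 1 v] by (auto simp: add.commute)
  have "(\<lambda>n. \<integral>x. G n x \<partial>lborel) \<longlonglongrightarrow> (LBINT x. pd b \<phi> x)"
  proof (rule integral_dominated_convergence[where w = "\<lambda>x. C * jw x"])
    show "pd b \<phi> \<in> borel_measurable lborel" using sch_measurable[OF sch_pd[OF \<phi> b]] by simp
    show "G n \<in> borel_measurable lborel" for n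
      unfolding G_def using borel_measurable_integrable[OF int(1)] borel_measurable_integrable[OF int(2)]
      by (intro borel_measurable_times borel_measurable_diff borel_measurable_const) auto
    show "integrable lborel (\<lambda>x::'a. C * jw x)" by (intro integrable_mult_right integrable_jw)
    show "AE x in lborel. (\<lambda>n. G n x) \<longlonglongrightarrow> pd b \<phi> x"
      unfolding G_def by (intro AE_I2 pd_LIMSEQ sch_differentiable[OF \<phi>])
    show "AE x in lborel. norm (G n x) \<le> C * jw x" for n
    proof (intro AE_I2)
      fix x
      have "(1 + norm x) ^ Suc DIM('a) * norm (\<phi> (x + b /\<^sub>R real (Suc n)) - \<phi> x) \<le> C * norm (b /\<^sub>R real (Suc n))"
        by (rule C(2)) (use b in \<open>simp add: inverse_eq_divide del: of_nat_Suc\<close>)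
      then have "norm (\<phi> (x + b /\<^sub>R real (Suc n)) - \<phi> x) \<le> C / real (Suc n) * jw x"
        using b by (intro bounded_by_jw) (simp add: divide_inverse del: of_nat_Suc)
      then have "real (Suc n) * norm (\<phi> (x + b /\<^sub>R real (Suc n)) - \<phi> x) \<le> real (Suc n) * (C / real (Suc n) * jw x)"
        by (intro mult_left_mono) auto
      then show "norm (G n x) \<le> C * jw x" unfolding G_def by (simp add: norm_mult del: of_nat_Suc)
    qed
  qed
  moreover have "(LBINT x. G n x) = 0" for n
  proof -
    have "(LBINT x. \<phi> (x + b /\<^sub>R real (Suc n))) = (LBINT x. \<phi> x)"
      using integral_lborel_affine[of 1 \<phi> "b /\<^sub>R real (Suc n)"] by (simp add: add.commute)
    then show ?thesis unfolding G_def using int by simp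
  qed
  ultimately have "(\<lambda>n::nat. 0) \<longlonglongrightarrow> (LBINT x. pd b \<phi> x)" by simp
  then show ?thesis by (rule LIMSEQ_unique[OF _ tendsto_const])
qed

section \<open>Fourier inversion and convolution\<close>

lemma borel_measurable_cis[measurable (raw)]:
  "f \<in> borel_measurable M \<Longrightarrow> (\<lambda>x. cis (f x)) \<in> borel_measurable M"
  unfolding cis_conv_exp
  by (rule borel_measurable_continuous_on[of "\<lambda>t. exp (\<i> * of_real t)"]) (auto intro!: continuous_intros)

lemma has_derivative_cis_inner:
  "((\<lambda>\<xi>. cis (c * (\<xi> \<bullet> x))) has_derivative (\<lambda>h. of_real (c * (h \<bullet> x)) * (\<i> * cis (c * (\<xi> \<bullet> x))))) (at \<xi>)"
proof -
  have 1: "((\<lambda>\<xi>. \<i> * complex_of_real (c * (\<xi> \<bullet> x))) has_derivative (\<lambda>h. \<i> * complex_of_real (c * (h \<bullet> x)))) (at \<xi>)"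
    by (auto intro!: derivative_eq_intros)
  have "((\<lambda>\<xi>. exp (\<i> * complex_of_real (c * (\<xi> \<bullet> x)))) has_derivative
      (\<lambda>h. exp (\<i> * complex_of_real (c * (\<xi> \<bullet> x))) * (\<i> * complex_of_real (c * (h \<bullet> x))))) (at \<xi>)"
    by (rule has_derivative_compose[OF 1 DERIV_exp[unfolded has_field_derivative_def]])
  then show ?thesis unfolding cis_conv_exp by (simp add: mult_ac)
qed

text \<open>Decay without smoothness: the part of the Schwartz conditions that makes a Fourier
  transform smooth, and that survives division by \<open>jw\<close>.\<close>

definition rapid :: "('i \<Rightarrow> 'a::real_normed_vector \<Rightarrow> complex) \<Rightarrow> bool" where
  "rapid c \<longleftrightarrow> (\<forall>k. \<exists>C. \<forall>i x. (1 + norm x) ^ k * norm (c i x) \<le> C)"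

lemma sch_rapid: "sch H \<Longrightarrow> rapid H"
  unfolding rapid_def by (metis sch_bound)

lemma rapid_coord:
  assumes "rapid c"
  shows "rapid (\<lambda>i x. z * of_real (x \<bullet> e) * c i x)"
  unfolding rapid_def
proof
  fix k
  obtain C where C: "\<And>i x. (1 + norm x) ^ Suc k * norm (c i x) \<le> C" using assms unfolding rapid_def by metis
  have "(1 + norm x) ^ k * norm (z * of_real (x \<bullet> e) * c i x) \<le> norm z * norm e * C" for i x
  proof -
    have "norm (z * of_real (x \<bullet> e) * c i x) \<le> norm z * (norm x * norm e) * norm (c i x)"
      using Cauchy_Schwarz_ineq2[of x e] by (auto simp: norm_mult intro!: mult_right_mono mult_left_mono)
    also have "\<dots> \<le> norm z * ((1 + norm x) * norm e) * norm (c i x)"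
      by (intro mult_right_mono mult_left_mono) auto
    finally have "(1 + norm x) ^ k * norm (z * of_real (x \<bullet> e) * c i x) \<le> (1 + norm x) ^ k * (norm z * ((1 + norm x) * norm e) * norm (c i x))"
      by (intro mult_left_mono) auto
    also have "\<dots> = norm z * norm e * ((1 + norm x) ^ Suc k * norm (c i x))" by simp
    also have "\<dots> \<le> norm z * norm e * C" by (intro mult_left_mono C) auto
    finally show ?thesis .
  qed
  then show "\<exists>C. \<forall>i x. (1 + norm x) ^ k * norm (z * of_real (x \<bullet> e) * c i x) \<le> C" by blast
qed

lemma pd_cis_inner: "pd b (\<lambda>\<xi>. cis (k * (\<xi> \<bullet> x)) * c) \<xi> = cis (k * (\<xi> \<bullet> x)) * (\<i> * of_real k * of_real (b \<bullet> x) * c)"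
proof -
  have "((\<lambda>\<xi>. cis (k * (\<xi> \<bullet> x)) * c) has_derivative (\<lambda>h. of_real (k * (h \<bullet> x)) * (\<i> * cis (k * (\<xi> \<bullet> x))) * c)) (at \<xi>)"
    by (intro has_derivative_mult_left has_derivative_cis_inner)
  then show ?thesis by (subst pd_eqI) (auto simp: algebra_simps)
qed

lemma cis_inner_differentiable: "(\<lambda>\<xi>. cis (k * (\<xi> \<bullet> x)) * c) differentiable (at \<xi>)"
  using has_derivative_mult_left[OF has_derivative_cis_inner] differentiableI by blast

text \<open>A derivative in \<xi> only multiplies the coefficient by a coordinate of x and a
  constant, and \<open>rapid\<close> is stable under that. Dividing by \<open>jw x\<close> prepares
  the integration over x.\<close>

lemma fam_phase:
  fixes c :: "'i \<Rightarrow> 'a::euclidean_space \<Rightarrow> complex"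
  assumes "rapid c"
  shows "fam ((\<lambda>w (i, x) y. w i y / jw x) ` {\<lambda>_ _. 1}) (\<lambda>(i, x) \<xi>. cis (- 2 * pi * (\<xi> \<bullet> x)) * c i x)"
proof (rule fam_coinduct[where X = "{\<lambda>(i, x) \<xi>. cis (- 2 * pi * (\<xi> \<bullet> x)) * c i x | c :: 'i \<Rightarrow> 'a \<Rightarrow> complex. rapid c}"])
  fix H :: "'i \<times> 'a \<Rightarrow> 'a \<Rightarrow> complex" and i x
  assume "H \<in> {\<lambda>(i, x) \<xi>. cis (- 2 * pi * (\<xi> \<bullet> x)) * c i x | c :: 'i \<Rightarrow> 'a \<Rightarrow> complex. rapid c}"
  then obtain c :: "'i \<Rightarrow> 'a \<Rightarrow> complex" where H: "H = (\<lambda>(i, x) \<xi>. cis (- 2 * pi * (\<xi> \<bullet> x)) * c i x)" by blast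
  show "H i differentiable (at x)"
    unfolding H case_prod_beta by (rule cis_inner_differentiable)
next
  fix H :: "'i \<times> 'a \<Rightarrow> 'a \<Rightarrow> complex" and w :: "'i \<times> 'a \<Rightarrow> 'a \<Rightarrow> real"
  assume "H \<in> {\<lambda>(i, x) \<xi>. cis (- 2 * pi * (\<xi> \<bullet> x)) * c i x | c :: 'i \<Rightarrow> 'a \<Rightarrow> complex. rapid c}"
    and "w \<in> (\<lambda>w (i, x) y. w i y / jw x) ` {\<lambda>_ _. 1}"
  then obtain c :: "'i \<Rightarrow> 'a \<Rightarrow> complex" where H: "H = (\<lambda>(i, x) \<xi>. cis (- 2 * pi * (\<xi> \<bullet> x)) * c i x)"
    and c: "rapid c" and w: "w = (\<lambda>(i, x) y. 1 / jw x)" by blast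
  obtain C where C: "\<And>i x. (1 + norm x) ^ Suc DIM('a) * norm (c i x) \<le> C" using c unfolding rapid_def by metis
  have "w k y * norm (H k y) \<le> C" for k :: "'i \<times> 'a" and y
  proof (cases k)
    case (Pair i x)
    have "norm (c i x) \<le> C * jw x" by (rule bounded_by_jw[OF C])
    then show ?thesis unfolding H w Pair using jw_pos[of x] by (simp add: norm_mult divide_le_eq)
  qed
  then show "\<exists>C. \<forall>i x. w i x * norm (H i x) \<le> C" by blast
next
  fix H :: "'i \<times> 'a \<Rightarrow> 'a \<Rightarrow> complex" and b :: 'a
  assume "H \<in> {\<lambda>(i, x) \<xi>. cis (- 2 * pi * (\<xi> \<bullet> x)) * c i x | c :: 'i \<Rightarrow> 'a \<Rightarrow> complex. rapid c}"
  then obtain c :: "'i \<Rightarrow> 'a \<Rightarrow> complex" where H: "H = (\<lambda>(i, x) \<xi>. cis (- 2 * pi * (\<xi> \<bullet> x)) * c i x)" and c: "rapid c" by blast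
  show "(\<lambda>i. pd b (H i)) \<in> {\<lambda>(i, x) \<xi>. cis (- 2 * pi * (\<xi> \<bullet> x)) * c i x | c :: 'i \<Rightarrow> 'a \<Rightarrow> complex. rapid c}"
  proof (intro CollectI exI[of _ "\<lambda>i x. (\<i> * of_real (- 2 * pi)) * of_real (x \<bullet> b) * c i x"] conjI rapid_coord c)
    show "(\<lambda>i. pd b (H i)) = (\<lambda>(i, x) \<xi>. cis (- 2 * pi * (\<xi> \<bullet> x)) * ((\<i> * of_real (- 2 * pi)) * of_real (x \<bullet> b) * c i x))"
      unfolding H using pd_cis_inner[of b "- 2 * pi"] by (auto simp: fun_eq_iff inner_commute[of b])
  qed
qed (use assms in blast)

lemma
  assumes c: "rapid c" and m: "\<And>i. c i \<in> borel_measurable borel"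
  shows fam_fourier: "fam {\<lambda>_ _. 1} (\<lambda>i. fourier (c i))"
    and pd_fourier: "b \<in> Basis \<Longrightarrow> pd b (fourier (c i)) = fourier (\<lambda>x. (\<i> * of_real (- 2 * pi)) * of_real (x \<bullet> b) * c i x)"
proof -
  have [measurable]: "c i \<in> borel_measurable borel" for i by (rule m)
  note * = fam_integral[OF integrable_jw jw_pos fam_phase[OF c], of "\<lambda>_ _. 1"]
  have m1: "(\<lambda>x. (case (i, x) of (i, x) \<Rightarrow> \<lambda>\<xi>. cis (- 2 * pi * (\<xi> \<bullet> x)) * c i x) y) \<in> borel_measurable lborel" for i y
    by simp
  have "fam {\<lambda>_ _. 1} (\<lambda>i y. \<integral>x. (case (i, x) of (i, x) \<Rightarrow> \<lambda>\<xi>. cis (- 2 * pi * (\<xi> \<bullet> x)) * c i x) y \<partial>lborel)"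
    by (rule *(1)) (use m1 in auto)
  then show "fam {\<lambda>_ _. 1} (\<lambda>i. fourier (c i))" by (simp add: fourier_def[abs_def])
  assume b: "b \<in> Basis"
  have "pd b (\<lambda>y. \<integral>x. (case (i, x) of (i, x) \<Rightarrow> \<lambda>\<xi>. cis (- 2 * pi * (\<xi> \<bullet> x)) * c i x) y \<partial>lborel)
    = (\<lambda>y. \<integral>x. pd b (case (i, x) of (i, x) \<Rightarrow> \<lambda>\<xi>. cis (- 2 * pi * (\<xi> \<bullet> x)) * c i x) y \<partial>lborel)"
    by (rule *(3)) (use m1 b in auto)
  then show "pd b (fourier (c i)) = fourier (\<lambda>x. (\<i> * of_real (- 2 * pi)) * of_real (x \<bullet> b) * c i x)"
    using pd_cis_inner[of b "- 2 * pi"] by (simp add: fourier_def[abs_def] inner_commute[of b])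
qed

lemma fam_cis: "fam {\<lambda>_ _. 1} (\<lambda>_::unit. \<lambda>x. cis (k * (x \<bullet> a)))"
proof -
  have "fam {\<lambda>_ _. 1} (\<lambda>_::unit. \<lambda>x. cis (k * (x \<bullet> a)) * 1)"
  proof (rule fam_coinduct[where X = "{\<lambda>_::unit. \<lambda>x. cis (k * (x \<bullet> a)) * c | c. True}"])
    fix K :: "unit \<Rightarrow> 'a \<Rightarrow> complex" and i x assume "K \<in> {\<lambda>_::unit. \<lambda>x. cis (k * (x \<bullet> a)) * c | c. True}"
    then obtain c where K: "K = (\<lambda>_ x. cis (k * (x \<bullet> a)) * c)" by blast
    show "K i differentiable (at x)" unfolding K by (rule cis_inner_differentiable)
  next
    fix K :: "unit \<Rightarrow> 'a \<Rightarrow> complex" and w :: "unit \<Rightarrow> 'a \<Rightarrow> real"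
    assume "K \<in> {\<lambda>_::unit. \<lambda>x. cis (k * (x \<bullet> a)) * c | c. True}" "w \<in> {\<lambda>_ _. 1}"
    then show "\<exists>C. \<forall>i x. w i x * norm (K i x) \<le> C" by (auto simp: norm_mult)
  next
    fix K :: "unit \<Rightarrow> 'a \<Rightarrow> complex" and b :: 'a
    assume "K \<in> {\<lambda>_::unit. \<lambda>x. cis (k * (x \<bullet> a)) * c | c. True}"
    then obtain c where K: "K = (\<lambda>_ x. cis (k * (x \<bullet> a)) * c)" by blast
    show "(\<lambda>i. pd b (K i)) \<in> {\<lambda>_::unit. \<lambda>x. cis (k * (x \<bullet> a)) * c | c. True}"
      by (intro CollectI exI[of _ "\<i> * of_real k * of_real (b \<bullet> a) * c"]) (simp add: K fun_eq_iff pd_cis_inner)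
  qed blast
  then show ?thesis by simp
qed

lemma fourier_pd:
  assumes \<phi>: "sch1 \<phi>" and b: "b \<in> Basis"
  shows "fourier (pd b \<phi>) \<xi> = \<i> * of_real (2 * pi) * of_real (\<xi> \<bullet> b) * fourier \<phi> \<xi>"
proof -
  let ?e = "\<lambda>x. cis (- 2 * pi * (x \<bullet> \<xi>))"
  have s: "sch1 (\<lambda>x. \<phi> x * ?e x)" by (rule sch_mult[OF \<phi> fam_cis])
  have d: "?e differentiable (at x)" for x using fam_differentiable[OF fam_cis] .
  have "pd b ?e x = ?e x * (\<i> * of_real (- 2 * pi) * of_real (b \<bullet> \<xi>))" for x
    using pd_cis_inner[of b "- 2 * pi" \<xi> 1 x] by simp
  then have eq: "pd b (\<lambda>x. \<phi> x * ?e x) x = ?e x * pd b \<phi> x + (\<i> * of_real (- 2 * pi) * of_real (b \<bullet> \<xi>)) * (?e x * \<phi> x)" for x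
    unfolding pd_mult[OF sch_differentiable[OF \<phi>] d] by (simp only: mult_ac)
  have i1: "integrable lborel (\<lambda>x. ?e x * pd b \<phi> x)"
    using sch_integrable[OF sch_mult[OF sch_pd[OF \<phi> b] fam_cis[of "- 2 * pi" \<xi>]]] by (simp only: mult.commute)
  have i2: "integrable lborel (\<lambda>x. ?e x * \<phi> x)"
    using sch_integrable[OF s] by (simp only: mult.commute)
  have "0 = (LBINT x. ?e x * pd b \<phi> x + (\<i> * of_real (- 2 * pi) * of_real (b \<bullet> \<xi>)) * (?e x * \<phi> x))"
    using integral_pd_zero[OF s b] unfolding eq by simp
  also have "\<dots> = fourier (pd b \<phi>) \<xi> + (\<i> * of_real (- 2 * pi) * of_real (b \<bullet> \<xi>)) * fourier \<phi> \<xi>"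
    unfolding fourier_def inner_commute[of \<xi>]
    by (subst Bochner_Integration.integral_add) (use i1 i2 in \<open>auto intro: integrable_mult_right\<close>)
  finally show ?thesis by (simp add: inner_commute add_eq_0_iff algebra_simps)
qed

lemma jp_le_coords: "1 + norm (x::'a::euclidean_space) \<le> 1 + (\<Sum>b\<in>Basis. \<bar>x \<bullet> b\<bar>)"
  using norm_le_l1 by auto

text \<open>Induction on k: one factor of the weight is bounded by the coordinates of \<xi>, and
  each coordinate is traded for a partial derivative of H. These derivatives form a Schwartz family
  again, so the induction hypothesis applies. The factor \<open>2 * pi\<close> is dropped, being at
  least 1.\<close>

lemma fourier_rapid:
  assumes "sch H"
  shows "\<exists>C. \<forall>i \<xi>. (1 + norm \<xi>) ^ k * norm (fourier (H i) \<xi>) \<le> C"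
  using assms
proof (induction k arbitrary: H)
  case 0
  obtain C where "\<And>i x. 1 * norm (fourier (H i) x) \<le> C"
    using fam_bound[OF fam_fourier[OF sch_rapid[OF 0] sch_measurable[OF 0]], of "\<lambda>_ _. 1", OF insertI1] by metis
  then show ?case by (intro exI[of _ C]) simp
next
  case (Suc k)
  obtain C where C: "\<And>i \<xi>. (1 + norm \<xi>) ^ k * norm (fourier (H i) \<xi>) \<le> C" using Suc by blast
  have "\<exists>D. \<forall>i \<xi>. (1 + norm \<xi>) ^ k * norm (fourier (pd b (H i)) \<xi>) \<le> D" if "b \<in> Basis" for b
    by (rule Suc.IH[OF sch_pd[OF Suc.prems that]])
  then obtain D where D: "\<And>b i \<xi>. b \<in> Basis \<Longrightarrow> (1 + norm \<xi>) ^ k * norm (fourier (pd b (H i)) \<xi>) \<le> D b" by metis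
  have "(1 + norm \<xi>) ^ Suc k * norm (fourier (H i) \<xi>) \<le> C + (\<Sum>b\<in>Basis. D b)" for i \<xi>
  proof -
    have "(1 + norm \<xi>) * norm (fourier (H i) \<xi>) \<le> norm (fourier (H i) \<xi>) + (\<Sum>b\<in>Basis. norm (fourier (pd b (H i)) \<xi>))"
    proof -
      have "(1 + norm \<xi>) * norm (fourier (H i) \<xi>) \<le> (1 + (\<Sum>b\<in>Basis. \<bar>\<xi> \<bullet> b\<bar>)) * norm (fourier (H i) \<xi>)"
        by (intro mult_right_mono jp_le_coords) auto
      also have "\<dots> = norm (fourier (H i) \<xi>) + (\<Sum>b\<in>Basis. \<bar>\<xi> \<bullet> b\<bar> * norm (fourier (H i) \<xi>))"
        by (simp add: distrib_right sum_distrib_right)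
      also have "(\<Sum>b\<in>Basis. \<bar>\<xi> \<bullet> b\<bar> * norm (fourier (H i) \<xi>)) \<le> (\<Sum>b\<in>Basis. norm (fourier (pd b (H i)) \<xi>))"
      proof (intro sum_mono)
        fix b :: 'b assume b: "b \<in> Basis"
        have "1 \<le> 2 * pi" using pi_ge_two by linarith
        then have "\<bar>\<xi> \<bullet> b\<bar> * norm (fourier (H i) \<xi>) \<le> (2 * pi) * (\<bar>\<xi> \<bullet> b\<bar> * norm (fourier (H i) \<xi>))"
          using mult_right_mono[of 1 "2 * pi" "\<bar>\<xi> \<bullet> b\<bar> * norm (fourier (H i) \<xi>)"] by simp
        then show "\<bar>\<xi> \<bullet> b\<bar> * norm (fourier (H i) \<xi>) \<le> norm (fourier (pd b (H i)) \<xi>)"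
          by (simp add: fourier_pd[OF sch_reindex[OF Suc.prems] b] norm_mult)
      qed
      finally show ?thesis by simp
    qed
    then have "(1 + norm \<xi>) ^ k * ((1 + norm \<xi>) * norm (fourier (H i) \<xi>)) \<le> (1 + norm \<xi>) ^ k * (norm (fourier (H i) \<xi>) + (\<Sum>b\<in>Basis. norm (fourier (pd b (H i)) \<xi>)))"
      by (intro mult_left_mono) auto
    also have "\<dots> \<le> C + (\<Sum>b\<in>Basis. D b)"
      unfolding distrib_left sum_distrib_left by (intro add_mono sum_mono C D)
    finally show ?thesis by (simp add: mult_ac)
  qed
  then show ?case by blast
qed

text \<open>The class of transforms of Schwartz families is closed under \<open>pd\<close>, because
  the derivative of a transform is the transform of a coordinate multiple; the decay is
  \<open>fourier_rapid\<close>.\<close>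

theorem sch_fourier:
  fixes H :: "'i \<Rightarrow> 'a::euclidean_space \<Rightarrow> complex"
  assumes "sch H"
  shows "sch (\<lambda>i. fourier (H i))"
  unfolding sch_def
proof (rule fam_coinduct[where X = "{\<lambda>i. fourier (H i) | H :: 'i \<Rightarrow> 'a \<Rightarrow> complex. sch H}"])
  fix K :: "'i \<Rightarrow> 'a \<Rightarrow> complex" and i x assume "K \<in> {\<lambda>i. fourier (H i) | H :: 'i \<Rightarrow> 'a \<Rightarrow> complex. sch H}"
  then obtain H where K: "K = (\<lambda>i. fourier (H i))" and H: "sch H" by blast
  show "K i differentiable (at x)" unfolding K
    by (rule fam_differentiable[OF fam_fourier[OF sch_rapid[OF H] sch_measurable[OF H]]])
next
  fix K :: "'i \<Rightarrow> 'a \<Rightarrow> complex" and w :: "'i \<Rightarrow> 'a \<Rightarrow> real"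
  assume "K \<in> {\<lambda>i. fourier (H i) | H :: 'i \<Rightarrow> 'a \<Rightarrow> complex. sch H}" "w \<in> range (\<lambda>k i x. (1 + norm x) ^ k)"
  then show "\<exists>C. \<forall>i x. w i x * norm (K i x) \<le> C" using fourier_rapid by auto
next
  fix K :: "'i \<Rightarrow> 'a \<Rightarrow> complex" and b :: 'a assume "K \<in> {\<lambda>i. fourier (H i) | H :: 'i \<Rightarrow> 'a \<Rightarrow> complex. sch H}" and b: "b \<in> Basis"
  then obtain H where K: "K = (\<lambda>i. fourier (H i))" and H: "sch H" by blast
  have "sch (\<lambda>i x. (\<i> * of_real (- 2 * pi)) * of_real (x \<bullet> b) * H i x)"
    using sch_cmult_const[OF sch_coord[OF H, of b], of "\<i> * of_real (- 2 * pi)"] by (simp add: mult.assoc)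
  then show "(\<lambda>i. pd b (K i)) \<in> {\<lambda>i. fourier (H i) | H :: 'i \<Rightarrow> 'a \<Rightarrow> complex. sch H}"
    unfolding K pd_fourier[OF sch_rapid[OF H] sch_measurable[OF H] b]
    by (intro CollectI exI[of _ "\<lambda>i x. (\<i> * of_real (- 2 * pi)) * of_real (x \<bullet> b) * H i x"]) simp
qed (use assms in blast)

lemma sch_affine:
  assumes H: "sch H"
    and W: "\<And>k n. \<exists>A\<ge>0. \<forall>i y. norm (F i) * \<bar>c i\<bar> ^ n * (1 + norm y) ^ k \<le> A * (1 + norm (c i *\<^sub>R y + v i)) ^ (m k)"
  shows "sch (\<lambda>i y. F i * H i (c i *\<^sub>R y + v i))"
  unfolding sch_def
proof (rule fam_affine[OF H[unfolded sch_def]])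
  fix w :: "'a \<Rightarrow> 'b \<Rightarrow> real" and n assume "w \<in> range (\<lambda>k i x. (1 + norm x) ^ k)"
  then obtain k where k: "w = (\<lambda>i x. (1 + norm x) ^ k)" by blast
  show "\<exists>w'\<in>range (\<lambda>k i x. (1 + norm x) ^ k). \<exists>C\<ge>0. \<forall>i y. norm (F i) * \<bar>c i\<bar> ^ n * w i y \<le> C * w' i (c i *\<^sub>R y + v i)"
    unfolding k using W[of n k] by (intro bexI[of _ "\<lambda>i x. (1 + norm x) ^ (m k)"]) auto
qed

lemma sch_affine_fixed:
  assumes H: "sch H" and c: "c \<noteq> 0"
  shows "sch (\<lambda>i y. H i (c *\<^sub>R y + v))"
proof -
  have "sch (\<lambda>i y. 1 * H i (c *\<^sub>R y + v))"
  proof (rule sch_affine[OF H, where m = "\<lambda>k. k"])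
    fix k n
    define D where "D = (1 + 1 / \<bar>c\<bar>) * (1 + norm v)"
    have D: "1 + norm y \<le> D * (1 + norm (c *\<^sub>R y + v))" for y
    proof -
      have "1 + norm y \<le> (1 + 1 / \<bar>c\<bar>) * (1 + norm (c *\<^sub>R y))"
        using c by (simp add: field_simps add_nonneg_nonneg)
      also have "\<dots> \<le> (1 + 1 / \<bar>c\<bar>) * ((1 + norm (c *\<^sub>R y + v)) * (1 + norm v))"
        by (intro mult_left_mono jp_triangle) auto
      finally show ?thesis by (simp add: D_def mult_ac)
    qed
    have "norm (1::complex) * \<bar>c\<bar> ^ n * (1 + norm y) ^ k \<le> \<bar>c\<bar> ^ n * D ^ k * (1 + norm (c *\<^sub>R y + v)) ^ k" for y
    proof -
      have "(1 + norm y) ^ k \<le> (D * (1 + norm (c *\<^sub>R y + v))) ^ k" by (intro power_mono D) auto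
      then show ?thesis by (simp add: power_mult_distrib mult_left_mono mult.assoc)
    qed
    moreover have "\<bar>c\<bar> ^ n * D ^ k \<ge> 0" unfolding D_def by simp
    ultimately show "\<exists>A\<ge>0. \<forall>i y. norm (1::complex) * \<bar>c\<bar> ^ n * (1 + norm y) ^ k \<le> A * (1 + norm (c *\<^sub>R y + v)) ^ k"
      by blast
  qed
  then show ?thesis by simp
qed

section \<open>Gaussian regularization and Fourier inversion\<close>

definition ift :: "('a::euclidean_space \<Rightarrow> complex) \<Rightarrow> 'a \<Rightarrow> complex" where
  "ift \<phi> x = fourier \<phi> (- x)"

lemma ift_eq: "ift \<phi> x = (LBINT \<xi>. cis (2 * pi * (x \<bullet> \<xi>)) * \<phi> \<xi>)"
  unfolding ift_def fourier_def by simp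

lemma sch_ift: "sch H \<Longrightarrow> sch (\<lambda>i. ift (H i))"
  using sch_affine_fixed[OF sch_fourier, of H "-1" 0] by (simp add: ift_def[abs_def])

lemma lborel_pair_integrable_bound:
  fixes F :: "'a::euclidean_space \<times> 'b::euclidean_space \<Rightarrow> complex"
  assumes a: "integrable lborel a" and b: "integrable lborel b" and [measurable]: "F \<in> borel_measurable (lborel \<Otimes>\<^sub>M lborel)"
    and le: "\<And>x y. norm (F (x, y)) \<le> norm (a x :: complex) * norm (b y :: complex)"
  shows "integrable (lborel \<Otimes>\<^sub>M lborel) F"
proof (rule lborel_pair.Fubini_integrable)
  have [measurable]: "a \<in> borel_measurable borel" "b \<in> borel_measurable borel"
    using a b by (auto dest: borel_measurable_integrable)
  have bx: "integrable lborel (\<lambda>y. F (x, y))" for x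
    by (rule integrable_bound[where f = "\<lambda>y. norm (a x) * norm (b y)"]) (use b le in auto)
  then show "AE x in lborel. integrable lborel (\<lambda>y. F (x, y))" by simp
  show "integrable lborel (\<lambda>x. \<integral>y. norm (F (x, y)) \<partial>lborel)"
  proof (rule integrable_bound[where f = "\<lambda>x. norm (a x) * (LBINT y. norm (b y))"])
    show "integrable lborel (\<lambda>x. norm (a x) * (LBINT y. norm (b y)))" using a by simp
    have "norm (LBINT y. norm (F (x, y))) \<le> (LBINT y. norm (a x) * norm (b y))" for x
      by (rule norm_integral_le) (use b le in auto)
    then show "AE x in lborel. norm (LBINT y. norm (F (x, y))) \<le> norm (norm (a x) * (LBINT y. norm (b y)))"
      by (auto simp: abs_mult abs_of_nonneg)
  qed simp
qed simp

lemma
  fixes f :: "'a::euclidean_space \<Rightarrow> real \<Rightarrow> complex"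
  assumes "\<And>b. b \<in> Basis \<Longrightarrow> integrable lborel (f b)"
  shows lborel_integral_prod: "(LBINT x. (\<Prod>b\<in>Basis. f b (x \<bullet> b))) = (\<Prod>b\<in>Basis. \<integral>x. f b x \<partial>lborel)" (is ?A)
    and lborel_integrable_prod: "integrable lborel (\<lambda>x. \<Prod>b\<in>Basis. f b (x \<bullet> b))" (is ?B)
proof -
  interpret product_sigma_finite "\<lambda>_::'a. lborel :: real measure" by standard
  have [measurable]: "b \<in> Basis \<Longrightarrow> f b \<in> borel_measurable borel" for b
    using assms by (auto dest: borel_measurable_integrable)
  have eq: "(\<Prod>b\<in>Basis. f b ((\<Sum>c\<in>Basis. g c *\<^sub>R c) \<bullet> b)) = (\<Prod>b\<in>Basis. f b (g b))" for g
    by (intro prod.cong refl) simp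
  show ?A
    by (subst lborel_eq) (simp add: integral_distr eq product_integral_prod assms)
  show ?B
    by (subst lborel_eq) (simp add: integrable_distr_eq eq product_integrable_prod assms)
qed

text \<open>The transform of the one-dimensional Gaussian is the characteristic function of the
  standard normal distribution, up to the normalization \<open>sqrt (2 * pi)\<close>.\<close>

lemma gaussian_1d:
  "integrable lborel (\<lambda>x. cis (t * x) * of_real (exp (- x\<^sup>2 / 2)))"
  "(LBINT x. cis (t * x) * of_real (exp (- x\<^sup>2 / 2))) = of_real (sqrt (2 * pi) * exp (- t\<^sup>2 / 2))"
proof -
  have "integrable lborel std_normal_density" by (rule integrable_normal_density) simp
  then have "integrable lborel (\<lambda>x. sqrt (2 * pi) * std_normal_density x)" by (rule integrable_mult_right)
  moreover have e: "sqrt (2 * pi) * std_normal_density x = exp (- x\<^sup>2 / 2)" for x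
    by (simp add: std_normal_density_def)
  ultimately have i1: "integrable lborel (\<lambda>x::real. exp (- x\<^sup>2 / 2))" by simp
  show "integrable lborel (\<lambda>x. cis (t * x) * of_real (exp (- x\<^sup>2 / 2)))"
    by (rule integrable_bound[OF i1]) (auto simp: norm_mult)
  have "of_real (exp (- t\<^sup>2 / 2)) = char std_normal_distribution t"
    by (simp add: char_std_normal_distribution)
  also have "\<dots> = (LBINT x. std_normal_density x *\<^sub>R iexp (t * x))"
    unfolding char_def by (subst integral_density) auto
  finally have "of_real (sqrt (2 * pi)) * of_real (exp (- t\<^sup>2 / 2)) = of_real (sqrt (2 * pi)) * (LBINT x. std_normal_density x *\<^sub>R iexp (t * x))"
    by simp
  also have "\<dots> = (LBINT x. of_real (sqrt (2 * pi)) * (std_normal_density x *\<^sub>R iexp (t * x)))"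
    by (rule integral_mult_right_zero[symmetric])
  also have "\<dots> = (LBINT x. cis (t * x) * of_real (exp (- x\<^sup>2 / 2)))"
    by (intro integral_cong refl)
      (simp only: e[symmetric] cis_conv_exp scaleR_conv_of_real of_real_mult mult_ac)
  finally show "(LBINT x. cis (t * x) * of_real (exp (- x\<^sup>2 / 2))) = of_real (sqrt (2 * pi) * exp (- t\<^sup>2 / 2))"
    by simp
qed

lemma norm_square_coords: "norm (x::'a::euclidean_space) ^ 2 = (\<Sum>b\<in>Basis. (x \<bullet> b)\<^sup>2)"
  unfolding power2_norm_eq_inner by (subst euclidean_inner) (simp add: power2_eq_square)

lemma
  fixes z :: "'a::euclidean_space"
  shows gaussian_integrable: "integrable lborel (\<lambda>\<xi>. cis (z \<bullet> \<xi>) * of_real (exp (- (norm \<xi>)\<^sup>2 / 2)))" (is ?A)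
    and gaussian_fourier: "(LBINT \<xi>. cis (z \<bullet> \<xi>) * of_real (exp (- (norm \<xi>)\<^sup>2 / 2))) =
      of_real (sqrt (2 * pi) ^ DIM('a) * exp (- (norm z)\<^sup>2 / 2))" (is ?B)
proof -
  have eq: "cis (z \<bullet> \<xi>) * of_real (exp (- (norm \<xi>)\<^sup>2 / 2)) = (\<Prod>b\<in>Basis. cis ((z \<bullet> b) * (\<xi> \<bullet> b)) * of_real (exp (- (\<xi> \<bullet> b)\<^sup>2 / 2)))" for \<xi> :: 'a
  proof -
    have "cis (z \<bullet> \<xi>) = (\<Prod>b\<in>Basis. cis ((z \<bullet> b) * (\<xi> \<bullet> b)))"
      unfolding cis_conv_exp by (subst euclidean_inner) (simp add: exp_sum[symmetric] sum_distrib_left)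
    moreover have "exp (- (norm \<xi>)\<^sup>2 / 2) = (\<Prod>b\<in>Basis. exp (- (\<xi> \<bullet> b)\<^sup>2 / 2))"
      unfolding norm_square_coords by (simp add: exp_sum[symmetric] sum_divide_distrib sum_negf)
    ultimately show ?thesis by (simp only: of_real_prod prod.distrib)
  qed
  show ?A unfolding eq by (rule lborel_integrable_prod) (rule gaussian_1d)
  have "(LBINT \<xi>. cis (z \<bullet> \<xi>) * of_real (exp (- (norm \<xi>)\<^sup>2 / 2))) = (\<Prod>b\<in>(Basis::'a set). of_real (sqrt (2 * pi) * exp (- (z \<bullet> b)\<^sup>2 / 2)))"
    unfolding eq by (subst lborel_integral_prod) (simp_all only: gaussian_1d)
  also have "\<dots> = of_real (\<Prod>b\<in>(Basis::'a set). sqrt (2 * pi) * exp (- (z \<bullet> b)\<^sup>2 / 2))"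
    by (simp only: of_real_prod)
  also have "(\<Prod>b\<in>(Basis::'a set). sqrt (2 * pi) * exp (- (z \<bullet> b)\<^sup>2 / 2)) = sqrt (2 * pi) ^ DIM('a) * exp (- (norm z)\<^sup>2 / 2)"
    unfolding norm_square_coords prod.distrib by (simp add: exp_sum[symmetric] sum_divide_distrib sum_negf)
  finally show ?B .
qed

text \<open>The inversion integral is regularized by Gaussians \<open>g n\<close> tending to 1. For
  fixed n Fubini applies and produces an average of \<phi> against a Gaussian concentrating at x.
  Both sides converge by dominated convergence.\<close>

theorem fourier_inversion:
  fixes \<phi> :: "'a::euclidean_space \<Rightarrow> complex"
  assumes \<phi>: "sch1 \<phi>"
  shows "ift (fourier \<phi>) = \<phi>"
proof
  fix x
  define e where "e = (\<lambda>n. 1 / real (Suc n))"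
  have e0: "e n > 0" for n unfolding e_def by simp
  have elim: "e \<longlonglongrightarrow> 0" unfolding e_def using LIMSEQ_Suc[OF lim_inverse_n'] by (simp add: inverse_eq_divide)
  define g where "g = (\<lambda>n (\<xi>::'a). complex_of_real (exp (- (norm (e n *\<^sub>R \<xi>))\<^sup>2 / 2)))"
  have [measurable]: "\<phi> \<in> borel_measurable borel" "fourier \<phi> \<in> borel_measurable borel"
    using sch_measurable[OF \<phi>] sch_measurable[OF sch_fourier[OF \<phi>]] by auto
  have g[measurable]: "g n \<in> borel_measurable borel" for n unfolding g_def by measurable
  let ?d = "DIM('a)"
  have gi: "integrable lborel (g n)" for n
    using integrable_lborel_affine[OF gaussian_integrable[of "0::'a"], of "e n" 0] e0[of n] unfolding g_def by simp
  have gF: "(LBINT \<xi>. cis (2 * pi * ((x - y) \<bullet> \<xi>)) * g n \<xi>)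
      = of_real ((1 / e n) ^ ?d * sqrt (2 * pi) ^ ?d * exp (- (norm ((2 * pi / e n) *\<^sub>R (x - y)))\<^sup>2 / 2))" for n y
  proof -
    have "(LBINT \<xi>. cis (2 * pi * ((x - y) \<bullet> \<xi>)) * g n \<xi>) =
      \<bar>1 / e n\<bar> ^ ?d *\<^sub>R (LBINT \<xi>. cis (2 * pi * ((x - y) \<bullet> (0 + (1 / e n) *\<^sub>R \<xi>))) * g n (0 + (1 / e n) *\<^sub>R \<xi>))"
      by (rule integral_lborel_affine) (use e0[of n] in simp)
    also have "(\<lambda>\<xi>. cis (2 * pi * ((x - y) \<bullet> (0 + (1 / e n) *\<^sub>R \<xi>))) * g n (0 + (1 / e n) *\<^sub>R \<xi>))
      = (\<lambda>\<xi>. cis (((2 * pi / e n) *\<^sub>R (x - y)) \<bullet> \<xi>) * of_real (exp (- (norm \<xi>)\<^sup>2 / 2)))"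
      using e0[of n] unfolding g_def by (simp add: fun_eq_iff)
    finally show ?thesis unfolding gaussian_fourier using e0[of n] by (simp add: scaleR_conv_of_real)
  qed
  have main: "(LBINT \<xi>. cis (2 * pi * (x \<bullet> \<xi>)) * fourier \<phi> \<xi> * g n \<xi>)
     = of_real ((sqrt (2 * pi) / (2 * pi)) ^ ?d) * (LBINT w. \<phi> (x - (e n / (2 * pi)) *\<^sub>R w) * of_real (exp (- (norm w)\<^sup>2 / 2)))" for n
  proof -
    define F where "F = (\<lambda>y \<xi>. \<phi> y * (cis (2 * pi * ((x - y) \<bullet> \<xi>)) * g n \<xi>))"
    have Fm: "case_prod F \<in> borel_measurable (lborel \<Otimes>\<^sub>M lborel)" unfolding F_def by measurable
    have Fint: "integrable (lborel \<Otimes>\<^sub>M lborel) (case_prod F)"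
      by (rule lborel_pair_integrable_bound[OF sch_integrable[OF \<phi>] gi[of n] Fm]) (simp add: F_def norm_mult)
    have "(LBINT \<xi>. cis (2 * pi * (x \<bullet> \<xi>)) * fourier \<phi> \<xi> * g n \<xi>) = (LBINT \<xi>. (LBINT y. F y \<xi>))"
    proof (intro integral_cong refl)
      fix \<xi>
      have "cis (2 * pi * (x \<bullet> \<xi>)) * fourier \<phi> \<xi> * g n \<xi> = (cis (2 * pi * (x \<bullet> \<xi>)) * g n \<xi>) * (LBINT y. cis (- 2 * pi * (\<xi> \<bullet> y)) * \<phi> y)"
        unfolding fourier_def by (simp only: mult_ac)
      also have "\<dots> = (LBINT y. (cis (2 * pi * (x \<bullet> \<xi>)) * g n \<xi>) * (cis (- 2 * pi * (\<xi> \<bullet> y)) * \<phi> y))"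
        by simp
      also have "\<dots> = (LBINT y. F y \<xi>)"
      proof (intro integral_cong refl)
        fix y
        have "2 * pi * ((x - y) \<bullet> \<xi>) = 2 * pi * (x \<bullet> \<xi>) + (- 2 * pi * (\<xi> \<bullet> y))"
          by (simp add: inner_diff_left algebra_simps inner_commute)
        then show "(cis (2 * pi * (x \<bullet> \<xi>)) * g n \<xi>) * (cis (- 2 * pi * (\<xi> \<bullet> y)) * \<phi> y) = F y \<xi>"
          unfolding F_def by (simp only: cis_mult[symmetric] mult_ac)
      qed
      finally show "cis (2 * pi * (x \<bullet> \<xi>)) * fourier \<phi> \<xi> * g n \<xi> = (LBINT y. F y \<xi>)" .
    qed
    also have "\<dots> = (LBINT y. (LBINT \<xi>. F y \<xi>))"
      by (rule lborel_pair.Fubini_integral[OF Fint])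
    also have "\<dots> = (LBINT y. \<phi> y * of_real ((1 / e n) ^ ?d * sqrt (2 * pi) ^ ?d * exp (- (norm ((2 * pi / e n) *\<^sub>R (x - y)))\<^sup>2 / 2)))"
      unfolding F_def by (simp only: integral_mult_right_zero gF)
    \<comment> \<open>This substitution makes the Gaussian independent of n and moves n into the
      argument of \<phi>; the powers of \<open>e n\<close> cancel.\<close>
    also have "\<dots> = \<bar>- (e n / (2 * pi))\<bar> ^ ?d *\<^sub>R (LBINT w. \<phi> (x + (- (e n / (2 * pi))) *\<^sub>R w) *
        of_real ((1 / e n) ^ ?d * sqrt (2 * pi) ^ ?d * exp (- (norm ((2 * pi / e n) *\<^sub>R (x - (x + (- (e n / (2 * pi))) *\<^sub>R w))))\<^sup>2 / 2)))"
      by (rule integral_lborel_affine) (use e0[of n] in simp)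
    also have "(\<lambda>w. \<phi> (x + (- (e n / (2 * pi))) *\<^sub>R w) *
        of_real ((1 / e n) ^ ?d * sqrt (2 * pi) ^ ?d * exp (- (norm ((2 * pi / e n) *\<^sub>R (x - (x + (- (e n / (2 * pi))) *\<^sub>R w))))\<^sup>2 / 2)))
      = (\<lambda>w. of_real ((1 / e n) ^ ?d * sqrt (2 * pi) ^ ?d) * (\<phi> (x - (e n / (2 * pi)) *\<^sub>R w) * of_real (exp (- (norm w)\<^sup>2 / 2))))"
      using e0[of n] by (simp add: fun_eq_iff)
    also have "\<bar>- (e n / (2 * pi))\<bar> ^ ?d *\<^sub>R (LBINT w. of_real ((1 / e n) ^ ?d * sqrt (2 * pi) ^ ?d) * (\<phi> (x - (e n / (2 * pi)) *\<^sub>R w) * of_real (exp (- (norm w)\<^sup>2 / 2))))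
      = of_real (\<bar>- (e n / (2 * pi))\<bar> ^ ?d * ((1 / e n) ^ ?d * sqrt (2 * pi) ^ ?d)) * (LBINT w. \<phi> (x - (e n / (2 * pi)) *\<^sub>R w) * of_real (exp (- (norm w)\<^sup>2 / 2)))"
      by (simp add: scaleR_conv_of_real)
    also have "\<bar>- (e n / (2 * pi))\<bar> ^ ?d * ((1 / e n) ^ ?d * sqrt (2 * pi) ^ ?d) = (sqrt (2 * pi) / (2 * pi)) ^ ?d"
      using e0[of n] by (simp add: power_mult_distrib[symmetric] del: real_sqrt_mult)
    finally show ?thesis .
  qed
  have "(\<lambda>n. \<integral>\<xi>. cis (2 * pi * (x \<bullet> \<xi>)) * fourier \<phi> \<xi> * g n \<xi> \<partial>lborel) \<longlonglongrightarrow> (LBINT \<xi>. cis (2 * pi * (x \<bullet> \<xi>)) * fourier \<phi> \<xi>)"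
  proof (rule integral_dominated_convergence[where w = "\<lambda>\<xi>. norm (fourier \<phi> \<xi>)"])
    show "integrable lborel (\<lambda>\<xi>. norm (fourier \<phi> \<xi>))" using sch_integrable[OF sch_fourier[OF \<phi>]] by simp
    show "AE \<xi> in lborel. (\<lambda>n. cis (2 * pi * (x \<bullet> \<xi>)) * fourier \<phi> \<xi> * g n \<xi>) \<longlonglongrightarrow> cis (2 * pi * (x \<bullet> \<xi>)) * fourier \<phi> \<xi>"
    proof (intro AE_I2)
      fix \<xi>
      have "(\<lambda>n. g n \<xi>) \<longlonglongrightarrow> complex_of_real (exp (- (norm (0 *\<^sub>R \<xi>))\<^sup>2 / 2))"
        unfolding g_def by (intro tendsto_intros elim) simp
      then have "(\<lambda>n. g n \<xi>) \<longlonglongrightarrow> 1" by simp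
      then have "(\<lambda>n. cis (2 * pi * (x \<bullet> \<xi>)) * fourier \<phi> \<xi> * g n \<xi>) \<longlonglongrightarrow> cis (2 * pi * (x \<bullet> \<xi>)) * fourier \<phi> \<xi> * 1"
        by (intro tendsto_mult tendsto_const)
      then show "(\<lambda>n. cis (2 * pi * (x \<bullet> \<xi>)) * fourier \<phi> \<xi> * g n \<xi>) \<longlonglongrightarrow> cis (2 * pi * (x \<bullet> \<xi>)) * fourier \<phi> \<xi>" by simp
    qed
    show "AE \<xi> in lborel. norm (cis (2 * pi * (x \<bullet> \<xi>)) * fourier \<phi> \<xi> * g n \<xi>) \<le> norm (fourier \<phi> \<xi>)" for n
      by (intro AE_I2) (simp add: g_def norm_mult mult_left_le)
  qed simp_all
  then have L1: "(\<lambda>n. \<integral>\<xi>. cis (2 * pi * (x \<bullet> \<xi>)) * fourier \<phi> \<xi> * g n \<xi> \<partial>lborel) \<longlonglongrightarrow> ift (fourier \<phi>) x"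
    by (simp add: ift_eq)
  obtain B where B: "\<And>y. norm (\<phi> y) \<le> B" using sch_bound[OF \<phi>, of 0] by auto
  have ggi: "integrable lborel (\<lambda>w::'a. exp (- (norm w)\<^sup>2 / 2))"
  proof -
    have "integrable lborel (\<lambda>w::'a. complex_of_real (exp (- (norm w)\<^sup>2 / 2)))"
      using gaussian_integrable[of "0::'a"] by simp
    then show ?thesis by (simp only: complex_of_real_integrable_eq)
  qed
  have "(\<lambda>n. \<integral>w. \<phi> (x - (e n / (2 * pi)) *\<^sub>R w) * of_real (exp (- (norm w)\<^sup>2 / 2)) \<partial>lborel) \<longlonglongrightarrow> (LBINT w. \<phi> x * of_real (exp (- (norm (w::'a))\<^sup>2 / 2)))"
  proof (rule integral_dominated_convergence[where w = "\<lambda>w. B * exp (- (norm w)\<^sup>2 / 2)"])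
    show "integrable lborel (\<lambda>w::'a. B * exp (- (norm w)\<^sup>2 / 2))" using ggi by (rule integrable_mult_right)
    show "AE w in lborel. (\<lambda>n. \<phi> (x - (e n / (2 * pi)) *\<^sub>R w) * of_real (exp (- (norm w)\<^sup>2 / 2))) \<longlonglongrightarrow> \<phi> x * of_real (exp (- (norm (w::'a))\<^sup>2 / 2))"
    proof (intro AE_I2 tendsto_mult tendsto_const)
      fix w :: 'a
      have "(\<lambda>n. x - (e n / (2 * pi)) *\<^sub>R w) \<longlonglongrightarrow> x - (0 / (2 * pi)) *\<^sub>R w"
        by (intro tendsto_intros elim) simp
      then have "(\<lambda>n. x - (e n / (2 * pi)) *\<^sub>R w) \<longlonglongrightarrow> x" by simp
      then show "(\<lambda>n. \<phi> (x - (e n / (2 * pi)) *\<^sub>R w)) \<longlonglongrightarrow> \<phi> x"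
        using continuous_on_tendsto_compose[OF sch_continuous[OF \<phi>]] by fastforce
    qed
    show "AE w in lborel. norm (\<phi> (x - (e n / (2 * pi)) *\<^sub>R w) * of_real (exp (- (norm (w::'a))\<^sup>2 / 2))) \<le> B * exp (- (norm w)\<^sup>2 / 2)" for n
      by (intro AE_I2) (simp add: norm_mult mult_right_mono B)
  qed simp_all
  then have "(\<lambda>n. of_real ((sqrt (2 * pi) / (2 * pi)) ^ ?d) * (LBINT w. \<phi> (x - (e n / (2 * pi)) *\<^sub>R w) * of_real (exp (- (norm w)\<^sup>2 / 2))))
     \<longlonglongrightarrow> of_real ((sqrt (2 * pi) / (2 * pi)) ^ ?d) * (LBINT w. \<phi> x * of_real (exp (- (norm (w::'a))\<^sup>2 / 2)))"
    by (intro tendsto_mult tendsto_const)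
  also have "(LBINT w. \<phi> x * of_real (exp (- (norm (w::'a))\<^sup>2 / 2))) = \<phi> x * of_real (sqrt (2 * pi) ^ ?d)"
    using gaussian_fourier[of "0::'a"] by simp
  also have "of_real ((sqrt (2 * pi) / (2 * pi)) ^ ?d) * (\<phi> x * of_real (sqrt (2 * pi) ^ ?d)) = \<phi> x * of_real ((sqrt (2 * pi) / (2 * pi) * sqrt (2 * pi)) ^ ?d)"
    by (simp only: power_mult_distrib of_real_mult mult_ac)
  also have "sqrt (2 * pi) / (2 * pi) * sqrt (2 * pi) = 1"
    by (simp del: real_sqrt_mult)
  finally show "ift (fourier \<phi>) x = \<phi> x"
    using LIMSEQ_unique[OF L1] unfolding main by simp
qed

section \<open>Convolution\<close>

definition cv :: "('a::euclidean_space \<Rightarrow> complex) \<Rightarrow> ('a \<Rightarrow> complex) \<Rightarrow> 'a \<Rightarrow> complex" where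
  "cv f g x = (LBINT y. f y * g (x - y))"

lemma integrable_shift:
  fixes g :: "'a::euclidean_space \<Rightarrow> complex"
  assumes "integrable lborel g"
  shows "integrable lborel (\<lambda>x. g (x - y))" "integrable lborel (\<lambda>y. g (x - y))" "integrable lborel (\<lambda>x. g (x + y))"
proof -
  show "integrable lborel (\<lambda>x. g (x - y))" using integrable_lborel_affine[OF assms, of 1 "- y"] by simp
  show "integrable lborel (\<lambda>y. g (x - y))" using integrable_lborel_affine[OF assms, of "-1" x] by simp
  show "integrable lborel (\<lambda>x. g (x + y))" using integrable_lborel_affine[OF assms, of 1 y] by (simp add: add.commute[of y])
qed

lemma integral_shift:
  fixes g :: "'a::euclidean_space \<Rightarrow> complex"
  shows "(LBINT x. g (x - y)) = (LBINT x. g x)" "(LBINT y. g (x - y)) = (LBINT x. g x)"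
  "(LBINT x. g (x + y)) = (LBINT x. g x)"
proof -
  show "(LBINT x. g (x - y)) = (LBINT x. g x)" using integral_lborel_affine[of 1 g "- y"] by simp
  show "(LBINT y. g (x - y)) = (LBINT x. g x)" using integral_lborel_affine[of "-1" g x] by simp
  show "(LBINT x. g (x + y)) = (LBINT x. g x)" using integral_lborel_affine[of 1 g y] by (simp add: add.commute[of y])
qed

lemma integrable_conv_pair:
  fixes f g :: "'a::euclidean_space \<Rightarrow> complex"
  assumes f: "integrable lborel f" and g: "integrable lborel g"
  shows "integrable (lborel \<Otimes>\<^sub>M lborel) (\<lambda>(y, x). f y * g (x - y))"
proof (rule lborel_pair.Fubini_integrable)
  have [measurable]: "f \<in> borel_measurable borel" "g \<in> borel_measurable borel"
    using f g by (auto dest: borel_measurable_integrable)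
  show "(\<lambda>(y, x). f y * g (x - y)) \<in> borel_measurable (lborel \<Otimes>\<^sub>M lborel)" by measurable
  have "(LBINT x. norm (f y * g (x - y))) = norm (f y) * (LBINT x. norm (g x))" for y
  proof -
    have "complex_of_real (LBINT x. norm (g (x - y))) = complex_of_real (LBINT x. norm (g x))"
      using integral_shift(1)[of "\<lambda>x. complex_of_real (norm (g x))" y] by simp
    then show ?thesis by (simp add: norm_mult)
  qed
  then show "integrable lborel (\<lambda>y. \<integral>x. norm ((\<lambda>(y, x). f y * g (x - y)) (y, x)) \<partial>lborel)" using f by simp
  show "AE y in lborel. integrable lborel (\<lambda>x. (\<lambda>(y, x). f y * g (x - y)) (y, x))"
    using integrable_shift(1)[OF g] by simp
qed

lemma integrable_cv:
  assumes "integrable lborel f" "integrable lborel g"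
  shows "integrable lborel (cv f g)"
  unfolding cv_def[abs_def] by (rule lborel_pair.integrable_snd) (rule integrable_conv_pair[OF assms])

lemma fourier_cv:
  assumes f: "integrable lborel f" and g: "integrable lborel g"
  shows "fourier (cv f g) \<xi> = fourier f \<xi> * fourier g \<xi>"
proof -
  let ?e = "\<lambda>x. cis (- 2 * pi * (\<xi> \<bullet> x))"
  have [measurable]: "f \<in> borel_measurable borel" "g \<in> borel_measurable borel"
    using f g by (auto dest: borel_measurable_integrable)
  have i: "integrable (lborel \<Otimes>\<^sub>M lborel) (case_prod (\<lambda>y x. ?e x * (f y * g (x - y))))"
    by (rule integrable_bound[OF integrable_conv_pair[OF f g]]) (auto simp: norm_mult)
  have "fourier (cv f g) \<xi> = (LBINT x. (LBINT y. ?e x * (f y * g (x - y))))"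
    unfolding fourier_def cv_def by simp
  also have "\<dots> = (LBINT y. (LBINT x. ?e x * (f y * g (x - y))))"
    by (rule lborel_pair.Fubini_integral[OF i])
  also have "\<dots> = (LBINT y. (?e y * f y) * fourier g \<xi>)"
  proof (intro integral_cong refl)
    fix y
    have "(LBINT x. ?e x * (f y * g (x - y))) = (LBINT x. (?e y * f y) * (?e (x - y) * g (x - y)))"
    proof (intro integral_cong refl)
      fix x
      have "- 2 * pi * (\<xi> \<bullet> x) = - 2 * pi * (\<xi> \<bullet> y) + - 2 * pi * (\<xi> \<bullet> (x - y))"
        by (simp add: inner_diff_right algebra_simps)
      then have "?e x = ?e y * ?e (x - y)" unfolding cis_mult by (rule arg_cong)
      then show "?e x * (f y * g (x - y)) = (?e y * f y) * (?e (x - y) * g (x - y))" by (simp only: mult_ac)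
    qed
    also have "\<dots> = (?e y * f y) * (LBINT x. ?e (x - y) * g (x - y))" by (rule integral_mult_right_zero)
    also have "(LBINT x. ?e (x - y) * g (x - y)) = fourier g \<xi>"
      unfolding fourier_def by (rule integral_shift(1)[of "\<lambda>x. ?e x * g x"])
    finally show "(LBINT x. ?e x * (f y * g (x - y))) = (?e y * f y) * fourier g \<xi>" .
  qed
  also have "\<dots> = fourier f \<xi> * fourier g \<xi>" by (subst integral_mult_left_zero) (simp add: fourier_def)
  finally show ?thesis .
qed

lemma cv_commute: "cv f g = cv g f"
proof
  fix x
  show "cv f g x = cv g f x"
    using integral_shift(2)[of "\<lambda>y. f y * g (x - y)" x] by (simp add: cv_def mult.commute)
qed

text \<open>The decay of f in the parameter pays, through Peetre's inequality, for the translation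
  of g and also for the division by \<open>jw\<close>. The case c = 1 is the integrand of a
  convolution, c = - 1 gives reflected translates as they occur in pairings with
  distributions.\<close>

lemma fam_translates:
  fixes f :: "'i \<Rightarrow> 'a::euclidean_space \<Rightarrow> complex"
  assumes f: "rapid f" and g: "sch g" and c: "\<bar>c\<bar> = 1"
  shows "fam ((\<lambda>w (i, x) y. w i y / jw x) ` range (\<lambda>k i x. (1 + norm x) ^ k)) (\<lambda>(i, y) x. f i y * g i (c *\<^sub>R x + (- c) *\<^sub>R y))"
proof -
  have g': "sch (\<lambda>k :: 'i \<times> 'a. g (fst k))" by (rule sch_reindex[OF g])
  have "fam ((\<lambda>w (i, x) y. w i y / jw x) ` range (\<lambda>k i x. (1 + norm x) ^ k))
    (\<lambda>k x. f (fst k) (snd k) * g (fst k) (c *\<^sub>R x + (- c) *\<^sub>R (snd k)))"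
  proof (rule fam_affine[OF g'[unfolded sch_def]])
    fix w :: "'i \<times> 'a \<Rightarrow> 'a \<Rightarrow> real" and n
    assume "w \<in> (\<lambda>w (i, x) y. w i y / jw x) ` range (\<lambda>k i x. (1 + norm x) ^ k)"
    then obtain k where w: "w = (\<lambda>(i, x) y. (1 + norm y) ^ k / jw x)" by blast
    obtain C where C: "\<And>i x. (1 + norm x) ^ (k + Suc DIM('a)) * norm (f i x) \<le> C" using f unfolding rapid_def by metis
    have "norm (f (fst i) (snd i)) * \<bar>c\<bar> ^ n * w i y \<le> max C 0 * (1 + norm (c *\<^sub>R y + (- c) *\<^sub>R snd i)) ^ k" for i y
    proof (cases i)
      case (Pair j x)
      have n1: "norm (c *\<^sub>R y + (- c) *\<^sub>R x) = norm (y - x)"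
        using c by (metis norm_scaleR mult_1 scaleR_diff_right scaleR_minus_left uminus_add_conv_diff add.commute)
      have "1 + norm y \<le> (1 + norm (y + - x)) * (1 + norm (- x))" by (rule jp_triangle)
      then have "(1 + norm y) ^ k \<le> ((1 + norm (y - x)) * (1 + norm x)) ^ k" by (intro power_mono) auto
      then have "norm (f j x) * ((1 + norm y) ^ k / jw x) \<le> norm (f j x) * (((1 + norm (y - x)) * (1 + norm x)) ^ k / jw x)"
        by (intro mult_left_mono divide_right_mono) (auto simp: less_imp_le[OF jw_pos])
      also have "\<dots> = ((1 + norm x) ^ (k + Suc DIM('a)) * norm (f j x)) * (1 + norm (y - x)) ^ k"
        by (simp add: jw_def power_mult_distrib power_add mult_ac)
      also have "\<dots> \<le> max C 0 * (1 + norm (y - x)) ^ k" using C[of x j] by (intro mult_right_mono) auto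
      finally show ?thesis using c n1 by (simp add: Pair w)
    qed
    then show "\<exists>w'\<in>range (\<lambda>k i x. (1 + norm x) ^ k). \<exists>C\<ge>0. \<forall>i y. norm (f (fst i) (snd i)) * \<bar>c\<bar> ^ n * w i y \<le> C * w' i (c *\<^sub>R y + (- c) *\<^sub>R snd i)"
      by (intro bexI[of _ "\<lambda>i x. (1 + norm x) ^ k"] exI[of _ "max C 0"]) auto
  qed
  then show ?thesis by (simp add: case_prod_beta')
qed

lemma sch_cv:
  fixes f g :: "'i \<Rightarrow> 'a::euclidean_space \<Rightarrow> complex"
  assumes f: "sch f" and g: "sch g"
  shows "sch (\<lambda>i. cv (f i) (g i))"
proof -
  have [measurable]: "f i \<in> borel_measurable borel" "g i \<in> borel_measurable borel" for i
    by (rule sch_measurable[OF f], rule sch_measurable[OF g])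
  have 0: "(\<lambda>i x. 1) \<in> range (\<lambda>k (i::'i) (x::'a). (1 + norm x) ^ k)"
    by (rule range_eqI[of _ _ 0]) simp
  have "fam (range (\<lambda>k i x. (1 + norm x) ^ k)) (\<lambda>i x. \<integral>y. (\<lambda>(i, y) x. f i y * g i (1 *\<^sub>R x + (- 1) *\<^sub>R y)) (i, y) x \<partial>lborel)"
  proof (rule fam_integral(1)[OF integrable_jw jw_pos fam_translates[OF sch_rapid[OF f] g] 0])
    show "0 \<le> w i x" if "w \<in> range (\<lambda>k (i::'i) (x::'a). (1 + norm x) ^ k)" for w i x using that by auto
    show "(\<lambda>y. (\<lambda>(i, y) x. f i y * g i (1 *\<^sub>R x + (- 1) *\<^sub>R y)) (i, y) x) \<in> borel_measurable lborel" for i x by simp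
  qed simp_all
  then show ?thesis unfolding sch_def cv_def[abs_def] by simp
qed

lemma sch1_cv: "sch1 f \<Longrightarrow> sch1 g \<Longrightarrow> sch1 (cv f g)"
  by (rule sch_cv)

lemma fourier_inject:
  assumes "sch1 \<phi>" "sch1 \<psi>" "fourier \<phi> = fourier \<psi>"
  shows "\<phi> = \<psi>"
  by (metis fourier_inversion assms)

text \<open>Identities between convolutions of Schwartz functions are checked on the Fourier side,
  where they become pointwise products.\<close>

lemma cv_eqI:
  assumes "sch1 f" "sch1 g" "sch1 h" "\<And>\<xi>. fourier f \<xi> * fourier g \<xi> = fourier h \<xi>"
  shows "cv f g = h"
proof (rule fourier_inject[OF sch1_cv[OF assms(1,2)] assms(3)])
  show "fourier (cv f g) = fourier h"
    by (rule ext) (simp only: fourier_cv[OF sch_integrable[OF assms(1)] sch_integrable[OF assms(2)]] assms(4))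
qed

lemma cv_assoc:
  assumes "sch1 f" "sch1 g" "sch1 h"
  shows "cv f (cv g h) = cv (cv f g) h"
proof (rule cv_eqI[OF assms(1) sch1_cv[OF assms(2,3)] sch1_cv[OF sch1_cv[OF assms(1,2)] assms(3)]])
  note i = sch_integrable[OF assms(1)] sch_integrable[OF assms(2)] sch_integrable[OF assms(3)]
  show "fourier f \<xi> * fourier (cv g h) \<xi> = fourier (cv (cv f g) h) \<xi>" for \<xi>
    unfolding fourier_cv[OF i(2,3)] fourier_cv[OF integrable_cv[OF i(1,2)] i(3)] fourier_cv[OF i(1,2)]
    by (rule mult.assoc[symmetric])
qed

section \<open>Symbols built from powers of the norm and the heat exponential\<close>

text \<open>The exponential belongs to the weight, not to the function: a cofactor of the heat
  symbol such as \<open>1 - fourier \<Phi>\<close> does not decay by itself and is bounded only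
  against these weights. For l = 0 they are the Schwartz weights.\<close>

definition heat_weights :: "real \<Rightarrow> ('i \<Rightarrow> real) \<Rightarrow> ('i \<Rightarrow> 'a::euclidean_space \<Rightarrow> real) set" where
  "heat_weights \<alpha> l = range (\<lambda>k i x. (1 + norm x) ^ k * exp (- l i * norm x powr \<alpha>))"

lemma heat_weights_nonneg: "w \<in> heat_weights \<alpha> l \<Longrightarrow> 0 \<le> w i x"
  unfolding heat_weights_def by auto

lemma heat_weights_coord:
  assumes "w \<in> heat_weights \<alpha> l"
  shows "\<exists>w'\<in>heat_weights \<alpha> l. \<exists>C\<ge>0. \<forall>i x. norm x * w i x \<le> C * w' i x"
proof -
  obtain k where w: "w = (\<lambda>i x. (1 + norm x) ^ k * exp (- l i * norm x powr \<alpha>))"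
    using assms unfolding heat_weights_def by blast
  have "norm x * w i x \<le> 1 * ((1 + norm x) ^ Suc k * exp (- l i * norm x powr \<alpha>))" for i x
    unfolding w by (simp add: mult_right_mono flip: mult.assoc)
  then show ?thesis
    by (intro bexI[of _ "\<lambda>i x. (1 + norm x) ^ Suc k * exp (- l i * norm x powr \<alpha>)"] exI[of _ 1])
      (auto simp: heat_weights_def intro!: rangeI[of "\<lambda>k i x. (1 + norm x) ^ k * exp (- l i * norm x powr \<alpha>)" "Suc k" for k, simplified])
qed

lemma sch_imp_heat_fam:
  assumes "sch g" "\<And>i. 0 \<le> l i"
  shows "fam (heat_weights \<alpha> l) g"
  using assms(1) unfolding sch_def
proof (rule fam_weaken)
  fix w :: "'a \<Rightarrow> 'b \<Rightarrow> real" assume "w \<in> heat_weights \<alpha> l"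
  then obtain k where w: "w = (\<lambda>i x. (1 + norm x) ^ k * exp (- l i * norm x powr \<alpha>))"
    unfolding heat_weights_def by blast
  have "w i x \<le> 1 * (1 + norm x) ^ k" for i x
    unfolding w using assms(2) by (simp add: mult_left_le)
  then show "\<exists>w'\<in>range (\<lambda>k i x. (1 + norm x) ^ k). \<exists>C\<ge>0. \<forall>i x. w i x \<le> C * w' i x"
    by (intro bexI[of _ "\<lambda>i x. (1 + norm x) ^ k"] exI[of _ 1]) auto
qed

text \<open>Differentiation lowers the exponent of the norm, so negative powers occur; away from the
  origin they are bounded.\<close>

lemma powr_bound_away:
  assumes "\<delta> > 0"
  obtains C m where "C \<ge> 0" "\<And>x::'a::real_normed_vector. norm x \<ge> \<delta> \<Longrightarrow> norm x powr \<beta> \<le> C * (1 + norm x) ^ (m::nat)"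
proof -
  define m where "m = nat \<lceil>\<bar>\<beta>\<bar>\<rceil>"
  have m: "\<beta> \<le> real m" unfolding m_def by linarith
  have "norm x powr \<beta> \<le> (1 + \<delta> powr \<beta>) * (1 + norm x) ^ m" if x: "norm x \<ge> \<delta>" for x :: 'a
  proof (cases "\<beta> \<ge> 0")
    case True
    have "norm x powr \<beta> \<le> (1 + norm x) powr \<beta>" using True by (intro powr_mono2) auto
    also have "\<dots> \<le> (1 + norm x) powr (real m)" using m by (intro powr_mono) auto
    also have "\<dots> = (1 + norm x) ^ m" by (rule powr_realpow) (simp add: add_pos_nonneg)
    also have "\<dots> \<le> (1 + \<delta> powr \<beta>) * (1 + norm x) ^ m" by (simp add: distrib_right)
    finally show ?thesis .
  next
    case False
    have "norm x powr \<beta> \<le> \<delta> powr \<beta>" using False assms x by (intro powr_mono2') auto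
    also have "\<dots> \<le> (1 + \<delta> powr \<beta>) * 1" by simp
    also have "\<dots> \<le> (1 + \<delta> powr \<beta>) * (1 + norm x) ^ m" by (intro mult_left_mono one_le_power) auto
    finally show ?thesis .
  qed
  then show thesis by (intro that[of "1 + \<delta> powr \<beta>" m]) auto
qed

lemma has_derivative_norm_powr:
  fixes x :: "'a::euclidean_space"
  assumes "x \<noteq> 0"
  shows "((\<lambda>x. norm x powr \<beta>) has_derivative (\<lambda>h. \<beta> * norm x powr (\<beta> - 2) * (x \<bullet> h))) (at x)"
proof -
  have 1: "(norm has_derivative (\<lambda>h. (x \<bullet> h) / norm x)) (at x)"
    using has_derivative_norm[OF assms] by (simp add: sgn_div_norm divide_inverse mult.commute inner_commute)
  have 2: "((\<lambda>r. r powr \<beta>) has_derivative (\<lambda>h. \<beta> * norm x powr (\<beta> - 1) * h)) (at (norm x))"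
    using has_real_derivative_powr[of "norm x" \<beta>] assms by (simp add: has_field_derivative_def)
  have "norm x powr (\<beta> - 1) = norm x powr (\<beta> - 2) * norm x powr 1"
    unfolding powr_add[symmetric] by simp
  then have e: "norm x powr (\<beta> - 1) = norm x powr (\<beta> - 2) * norm x" using assms by simp
  have "((\<lambda>x. norm x powr \<beta>) has_derivative (\<lambda>h. \<beta> * norm x powr (\<beta> - 1) * ((x \<bullet> h) / norm x))) (at x)"
    by (rule has_derivative_compose[OF 1 2])
  then show ?thesis unfolding e using assms by (simp add: mult.assoc)
qed

text \<open>The exponent \<beta> is a parameter because a derivative replaces it by \<beta> - 2 and
  \<beta> + \<alpha> - 2, times a coordinate. This makes the family closed under
  differentiation.\<close>

definition radial :: "real \<Rightarrow> real \<Rightarrow> real \<Rightarrow> 'a::euclidean_space \<Rightarrow> complex" where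
  "radial \<alpha> l \<beta> x = of_real (norm x powr \<beta> * exp (- l * norm x powr \<alpha>))"

lemma has_derivative_radial:
  fixes x :: "'a::euclidean_space"
  assumes "x \<noteq> 0"
  shows "(radial \<alpha> l \<beta> has_derivative (\<lambda>h. of_real (x \<bullet> h) * (of_real \<beta> * radial \<alpha> l (\<beta> - 2) x - of_real (l * \<alpha>) * radial \<alpha> l (\<beta> + \<alpha> - 2) x))) (at x)"
proof -
  have e: "((\<lambda>x. exp (- l * norm x powr \<alpha>)) has_derivative
      (\<lambda>h. exp (- l * norm x powr \<alpha>) * (- l * (\<alpha> * norm x powr (\<alpha> - 2) * (x \<bullet> h))))) (at x)"
    by (rule has_derivative_compose[OF has_derivative_mult_right[OF has_derivative_norm_powr[OF assms]] DERIV_exp[unfolded has_field_derivative_def]])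
  have p: "norm x powr (\<beta> + \<alpha> - 2) = norm x powr \<beta> * norm x powr (\<alpha> - 2)"
    unfolding powr_add[symmetric] by (simp add: add_diff_eq)
  show ?thesis
    unfolding radial_def p
    by (rule has_derivative_eq_rhs[OF has_derivative_of_real[OF has_derivative_mult[OF has_derivative_norm_powr[OF assms] e]]])
       (simp add: fun_eq_iff algebra_simps)
qed

lemma has_derivative_0_near_0:
  fixes f :: "'a::euclidean_space \<Rightarrow> complex"
  assumes "norm x < \<delta>" "\<And>y. norm y < \<delta> \<Longrightarrow> f y = 0"
  shows "(f has_derivative (\<lambda>h. 0)) (at x)"
  by (rule has_derivative_transform_within_open[of "\<lambda>_. 0" _ x UNIV "ball 0 \<delta>"]) (use assms in auto)

lemma pd_0_near_0:
  assumes "norm x < \<delta>" "\<And>y. norm y < \<delta> \<Longrightarrow> f y = 0"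
  shows "pd b f x = 0"
  using pd_eqI[OF has_derivative_0_near_0[OF assms]] .

text \<open>Near the origin, where the radial factor is not smooth, the product is identically 0,
  since g vanishes on a ball; elsewhere the product rule applies.\<close>

lemma
  fixes g :: "'a::euclidean_space \<Rightarrow> complex"
  assumes g: "g differentiable (at x)" and \<delta>: "\<delta> > 0" and z: "\<And>y. norm y < \<delta> \<Longrightarrow> g y = 0"
  shows differentiable_mult_radial: "(\<lambda>x. g x * radial \<alpha> l \<beta> x) differentiable (at x)"
    and pd_mult_radial: "pd b (\<lambda>x. g x * radial \<alpha> l \<beta> x) x =
      pd b g x * radial \<alpha> l \<beta> x + (of_real \<beta> * (of_real (x \<bullet> b) * g x)) * radial \<alpha> l (\<beta> - 2) x
      + (of_real (- l * \<alpha>) * (of_real (x \<bullet> b) * g x)) * radial \<alpha> l (\<beta> + \<alpha> - 2) x"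
proof -
  have "(\<lambda>x. g x * radial \<alpha> l \<beta> x) differentiable (at x) \<and> pd b (\<lambda>x. g x * radial \<alpha> l \<beta> x) x =
      pd b g x * radial \<alpha> l \<beta> x + (of_real \<beta> * (of_real (x \<bullet> b) * g x)) * radial \<alpha> l (\<beta> - 2) x
      + (of_real (- l * \<alpha>) * (of_real (x \<bullet> b) * g x)) * radial \<alpha> l (\<beta> + \<alpha> - 2) x"
  proof (cases "norm x < \<delta>")
    case True
    have *: "((\<lambda>x. g x * radial \<alpha> l \<beta> x) has_derivative (\<lambda>h. 0)) (at x)"
      by (rule has_derivative_0_near_0[OF True]) (simp add: z)
    show ?thesis using differentiableI[OF *] pd_eqI[OF *] z[OF True] pd_0_near_0[OF True z] by simp
  next
    case False
    then have "x \<noteq> 0" using \<delta> by auto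
    then have r: "(radial \<alpha> l \<beta> has_derivative (\<lambda>h. of_real (x \<bullet> h) * (of_real \<beta> * radial \<alpha> l (\<beta> - 2) x - of_real (l * \<alpha>) * radial \<alpha> l (\<beta> + \<alpha> - 2) x))) (at x)"
      by (rule has_derivative_radial)
    show ?thesis
      by (intro conjI differentiable_mult g differentiableI[OF r])
        (simp add: pd_mult[OF g differentiableI[OF r]] pd_eqI[OF r] algebra_simps)
  qed
  then show "(\<lambda>x. g x * radial \<alpha> l \<beta> x) differentiable (at x)"
    and "pd b (\<lambda>x. g x * radial \<alpha> l \<beta> x) x =
      pd b g x * radial \<alpha> l \<beta> x + (of_real \<beta> * (of_real (x \<bullet> b) * g x)) * radial \<alpha> l (\<beta> - 2) x
      + (of_real (- l * \<alpha>) * (of_real (x \<bullet> b) * g x)) * radial \<alpha> l (\<beta> + \<alpha> - 2) x" by auto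
qed

inductive_set radial_products :: "real \<Rightarrow> ('i \<Rightarrow> real) \<Rightarrow> real \<Rightarrow> ('i \<Rightarrow> 'a::euclidean_space \<Rightarrow> complex) set"
  for \<alpha> :: real and l :: "'i \<Rightarrow> real" and \<delta> :: real where
  prod: "fam (heat_weights \<alpha> l) g \<Longrightarrow> (\<And>i x. norm x < \<delta> \<Longrightarrow> g i x = 0) \<Longrightarrow>
    (\<lambda>i x. g i x * radial \<alpha> (l i) \<beta> x) \<in> radial_products \<alpha> l \<delta>"
| add: "H \<in> radial_products \<alpha> l \<delta> \<Longrightarrow> G \<in> radial_products \<alpha> l \<delta> \<Longrightarrow> (\<lambda>i x. H i x + G i x) \<in> radial_products \<alpha> l \<delta>"

lemma radial_products_differentiable:
  assumes "\<delta> > 0"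
  shows "K \<in> radial_products \<alpha> l \<delta> \<Longrightarrow> K i differentiable (at x)"
proof (induction rule: radial_products.induct)
  case (prod g \<beta>)
  show ?case by (rule differentiable_mult_radial[OF fam_differentiable[OF prod(1)] assms prod(2)])
next
  case (add H G)
  show ?case by (rule differentiable_add[OF add(3,4)])
qed

text \<open>\<open>radial_products\<close> is closed under \<open>pd\<close>: the derivative falls
  on g, or yields a coordinate and a shifted exponent. The second kind also brings a factor l i, and
  l i \<le> 1 keeps the bounds uniform in i.\<close>

lemma sch_mult_radial:
  fixes g :: "'i \<Rightarrow> 'a::euclidean_space \<Rightarrow> complex"
  assumes g: "fam (heat_weights \<alpha> l) g" and \<delta>: "\<delta> > 0" and z: "\<And>i x. norm x < \<delta> \<Longrightarrow> g i x = 0"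
    and l: "\<And>i. 0 \<le> l i" "\<And>i. l i \<le> 1"
  shows "sch (\<lambda>i x. g i x * radial \<alpha> (l i) \<beta> x)"
  unfolding sch_def
proof (rule fam_coinduct[where X = "radial_products \<alpha> l \<delta>"])
  show "(\<lambda>i x. g i x * radial \<alpha> (l i) \<beta> x) \<in> radial_products \<alpha> l \<delta>"
    using g z by (rule radial_products.prod)
next
  fix K :: "'i \<Rightarrow> 'a \<Rightarrow> complex" and i x assume "K \<in> radial_products \<alpha> l \<delta>"
  then show "K i differentiable (at x)" by (rule radial_products_differentiable[OF \<delta>])
next
  fix K :: "'i \<Rightarrow> 'a \<Rightarrow> complex" and w :: "'i \<Rightarrow> 'a \<Rightarrow> real"
  assume "K \<in> radial_products \<alpha> l \<delta>" and "w \<in> range (\<lambda>k i x. (1 + norm x) ^ k)"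
  then obtain k where w: "w = (\<lambda>i x. (1 + norm x) ^ k)" by blast
  from \<open>K \<in> radial_products \<alpha> l \<delta>\<close> show "\<exists>C. \<forall>i x. w i x * norm (K i x) \<le> C"
  proof induction
    case (prod g \<beta>)
    obtain C m where C: "C \<ge> 0" "\<And>x::'a. norm x \<ge> \<delta> \<Longrightarrow> norm x powr \<beta> \<le> C * (1 + norm x) ^ m"
      using powr_bound_away[OF \<delta>] by metis
    have "(\<lambda>i x. (1 + norm x) ^ (k + m) * exp (- l i * norm x powr \<alpha>)) \<in> heat_weights \<alpha> l"
      unfolding heat_weights_def by (rule rangeI)
    then obtain D where D: "D \<ge> 0" "\<And>i x. (1 + norm x) ^ (k + m) * exp (- l i * norm x powr \<alpha>) * norm (g i x) \<le> D"
      by (rule fam_bound[OF prod(1)]) blast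
    have "w i x * norm (g i x * radial \<alpha> (l i) \<beta> x) \<le> C * D" for i x
    proof (cases "norm x < \<delta>")
      case True
      then show ?thesis using prod(2) C D by simp
    next
      case False
      have "w i x * norm (g i x * radial \<alpha> (l i) \<beta> x) = norm x powr \<beta> * ((1 + norm x) ^ k * exp (- l i * norm x powr \<alpha>) * norm (g i x))"
        by (simp add: w radial_def norm_mult)
      also have "\<dots> \<le> (C * (1 + norm x) ^ m) * ((1 + norm x) ^ k * exp (- l i * norm x powr \<alpha>) * norm (g i x))"
        using False by (intro mult_right_mono C(2)) auto
      also have "\<dots> = C * ((1 + norm x) ^ (k + m) * exp (- l i * norm x powr \<alpha>) * norm (g i x))"
        by (simp add: power_add)
      also have "\<dots> \<le> C * D" by (intro mult_left_mono D C)
      finally show ?thesis .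
    qed
    then show ?case by blast
  next
    case (add H G)
    obtain C where C: "\<And>i x. w i x * norm (H i x) \<le> C" using add by blast
    obtain D where D: "\<And>i x. w i x * norm (G i x) \<le> D" using add by blast
    have "w i x * norm (H i x + G i x) \<le> C + D" for i x
    proof -
      have "w i x * norm (H i x + G i x) \<le> w i x * (norm (H i x) + norm (G i x))"
        unfolding w by (intro mult_left_mono norm_triangle_ineq) auto
      also have "\<dots> \<le> C + D" using C[of i x] D[of i x] by (simp add: distrib_left)
      finally show ?thesis .
    qed
    then show ?case by blast
  qed
next
  fix K :: "'i \<Rightarrow> 'a \<Rightarrow> complex" and b :: 'a assume "K \<in> radial_products \<alpha> l \<delta>" and b: "b \<in> Basis"
  from this(1) show "(\<lambda>i. pd b (K i)) \<in> radial_products \<alpha> l \<delta>"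
  proof induction
    case (prod g \<beta>)
    have eq: "(\<lambda>i. pd b (\<lambda>x. g i x * radial \<alpha> (l i) \<beta> x)) = (\<lambda>i x. pd b (g i) x * radial \<alpha> (l i) \<beta> x + (of_real \<beta> * (of_real (x \<bullet> b) * g i x)) * radial \<alpha> (l i) (\<beta> - 2) x
      + (of_real (- l i * \<alpha>) * (of_real (x \<bullet> b) * g i x)) * radial \<alpha> (l i) (\<beta> + \<alpha> - 2) x)"
      by (intro ext) (rule pd_mult_radial[OF fam_differentiable[OF prod(1)] \<delta> prod(2)])
    have c: "fam (heat_weights \<alpha> l) (\<lambda>i x. of_real (x \<bullet> b) * g i x)"
      by (rule fam_coord[OF prod(1)], erule heat_weights_nonneg, erule heat_weights_coord)
    show ?case unfolding eq
    proof (intro radial_products.add radial_products.prod)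
      show "fam (heat_weights \<alpha> l) (\<lambda>i. pd b (g i))" by (rule fam_pd[OF prod(1) b])
      show "fam (heat_weights \<alpha> l) (\<lambda>i x. of_real \<beta> * (of_real (x \<bullet> b) * g i x))"
        by (rule fam_cmult[OF c, of _ "\<bar>\<beta>\<bar>"]) (auto intro: heat_weights_nonneg)
      show "fam (heat_weights \<alpha> l) (\<lambda>i x. of_real (- l i * \<alpha>) * (of_real (x \<bullet> b) * g i x))"
        by (rule fam_cmult[OF c, of _ "\<bar>\<alpha>\<bar>"]) (use l in \<open>auto intro: heat_weights_nonneg simp: norm_mult mult_left_le_one_le\<close>)
      show "pd b (g i) x = 0" if "norm x < \<delta>" for i x by (rule pd_0_near_0[OF that prod(2)])
    qed (use prod(2) in auto)
  next
    case (add H G)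
    have "(\<lambda>i. pd b (\<lambda>x. H i x + G i x)) = (\<lambda>i x. pd b (H i) x + pd b (G i) x)"
      by (simp add: fun_eq_iff pd_add radial_products_differentiable[OF \<delta> add(1)] radial_products_differentiable[OF \<delta> add(2)])
    then show ?case using radial_products.add[OF add(3,4)] by simp
  qed
qed

lemma sch_mult_norm_powr:
  assumes "sch g" "\<delta> > 0" "\<And>i x. norm x < \<delta> \<Longrightarrow> g i x = 0"
  shows "sch (\<lambda>i x. g i x * of_real (norm x powr \<beta>))"
  using sch_mult_radial[OF sch_imp_heat_fam[OF assms(1), of "\<lambda>_. 0" 1] assms(2,3), of \<beta>] by (simp add: radial_def)

lemma one_minus_exp_le: "0 \<le> x \<Longrightarrow> 1 - exp (- x) \<le> (x::real)"
  using exp_ge_add_one_self[of "- x"] by simp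

text \<open>Division by \<open>l i\<close> is harmless: \<open>(1 - exp (- l * v)) / l\<close> is bounded by \<open>v\<close>, and its derivative no longer
  contains \<open>1 / l\<close>.\<close>

lemma sch_mult_one_minus_exp:
  fixes g :: "'i \<Rightarrow> 'a::euclidean_space \<Rightarrow> complex"
  assumes g: "sch g" and \<delta>: "\<delta> > 0" and z: "\<And>i x. norm x < \<delta> \<Longrightarrow> g i x = 0"
    and l: "\<And>i. 0 < l i" "\<And>i. l i \<le> 1"
  shows "sch (\<lambda>i x. g i x * of_real ((1 - exp (- l i * norm x powr \<alpha>)) / l i))"
proof -
  define E where "E = (\<lambda>i (x::'a). complex_of_real ((1 - exp (- l i * norm x powr \<alpha>)) / l i))"
  \<comment> \<open>A derivative of E is free of \<open>1 / l i\<close>; the terms it produces go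
    into a plain Schwartz remainder H, and only g E needs the bound by
    \<open>norm x powr \<alpha>\<close>.\<close>
  define X where "X = {\<lambda>i x. g i x * E i x + H i x | g H :: 'i \<Rightarrow> 'a \<Rightarrow> complex. sch g \<and> (\<forall>i x. norm x < \<delta> \<longrightarrow> g i x = 0) \<and> sch H}"
  have gE: "g i x * E i x = of_real (1 / l i) * (g i x - g i x * radial \<alpha> (l i) 0 x)"
    if "\<And>x. norm x < \<delta> \<Longrightarrow> g i x = 0" for g :: "'i \<Rightarrow> 'a \<Rightarrow> complex" and i x
  proof (cases "x = 0")
    case True
    then have "g i x = 0" using that \<delta> by simp
    then show ?thesis by simp
  next
    case False
    then have "radial \<alpha> (l i) 0 x = of_real (exp (- l i * norm x powr \<alpha>))" by (simp add: radial_def)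
    then show ?thesis by (simp add: E_def diff_divide_distrib algebra_simps)
  qed
  have dpE: "(\<lambda>x. g i x * E i x) differentiable (at x) \<and>
      pd b (\<lambda>x. g i x * E i x) x = pd b (g i) x * E i x + of_real \<alpha> * (of_real (x \<bullet> b) * g i x * radial \<alpha> (l i) (\<alpha> - 2) x)"
    if g: "sch g" and z: "\<And>x. norm x < \<delta> \<Longrightarrow> g i x = 0" for g :: "'i \<Rightarrow> 'a \<Rightarrow> complex" and i x b
  proof -
    note gd = sch_differentiable[OF g]
    have r: "(\<lambda>x. g i x * radial \<alpha> (l i) 0 x) differentiable (at x)" by (rule differentiable_mult_radial[OF gd \<delta> z])
    have e: "(\<lambda>x. g i x * E i x) = (\<lambda>x. of_real (1 / l i) * (g i x + (-1) * (g i x * radial \<alpha> (l i) 0 x)))"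
      using gE[of g i, OF z] by (simp add: fun_eq_iff)
    have "pd b (\<lambda>x. g i x * E i x) x = of_real (1 / l i) * (pd b (g i) x + (-1) * pd b (\<lambda>x. g i x * radial \<alpha> (l i) 0 x) x)"
      unfolding e using gd[of i x] differentiable_mult[OF differentiable_const r, of "-1"]
      by (simp only: pd_cmult pd_add differentiable_add r)
    also have "\<dots> = of_real (1 / l i) * (pd b (g i) x - pd b (g i) x * radial \<alpha> (l i) 0 x) + of_real \<alpha> * (of_real (x \<bullet> b) * g i x * radial \<alpha> (l i) (\<alpha> - 2) x)"
      using pd_mult_radial[OF gd[of i x] \<delta> z, of b \<alpha> "l i" 0] l(1)[of i] by (simp add: field_simps)
    also have "of_real (1 / l i) * (pd b (g i) x - pd b (g i) x * radial \<alpha> (l i) 0 x) = pd b (g i) x * E i x"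
      by (rule gE[of "\<lambda>i. pd b (g i)", symmetric]) (rule pd_0_near_0[OF _ z])
    finally have "pd b (\<lambda>x. g i x * E i x) x = pd b (g i) x * E i x + of_real \<alpha> * (of_real (x \<bullet> b) * g i x * radial \<alpha> (l i) (\<alpha> - 2) x)" .
    moreover have "(\<lambda>x. g i x * E i x) differentiable (at x)"
      unfolding e by (intro differentiable_mult differentiable_add differentiable_const gd r)
    ultimately show ?thesis by blast
  qed
  have "sch (\<lambda>i x. g i x * E i x)"
    unfolding sch_def
  proof (rule fam_coinduct[where X = X])
    show "(\<lambda>i x. g i x * E i x) \<in> X"
      unfolding X_def using g z sch_cmult_const[OF g, of 0] by (intro CollectI exI[of _ g] exI[of _ "\<lambda>i x. 0"]) simp
  next
    fix K i x assume "K \<in> X"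
    then obtain g H where K: "K = (\<lambda>i x. g i x * E i x + H i x)" and *: "sch g" "\<And>i x. norm x < \<delta> \<Longrightarrow> g i x = 0" "sch H"
      unfolding X_def by blast
    show "K i differentiable (at x)" unfolding K
      by (rule differentiable_add[OF conjunct1[OF dpE[OF *(1,2)]] sch_differentiable[OF *(3)]])
  next
    fix K and w :: "'i \<Rightarrow> 'a \<Rightarrow> real" assume "K \<in> X" and "w \<in> range (\<lambda>k i x. (1 + norm x) ^ k)"
    then obtain g H k where K: "K = (\<lambda>i x. g i x * E i x + H i x)" and *: "sch g" "\<And>i x. norm x < \<delta> \<Longrightarrow> g i x = 0" "sch H"
      and w: "w = (\<lambda>i x. (1 + norm x) ^ k)"
      unfolding X_def by blast
    obtain C m where C: "C \<ge> 0" "\<And>x::'a. norm x \<ge> \<delta> \<Longrightarrow> norm x powr \<alpha> \<le> C * (1 + norm x) ^ m"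
      using powr_bound_away[OF \<delta>] by metis
    obtain D where D: "D \<ge> 0" "\<And>i x. (1 + norm x) ^ (k + m) * norm (g i x) \<le> D" using sch_bound[OF *(1)] by metis
    obtain F where F: "\<And>i x. (1 + norm x) ^ k * norm (H i x) \<le> F" using sch_bound[OF *(3)] by metis
    have gb: "(1 + norm x) ^ k * norm (g i x * E i x) \<le> C * D" for i x
    proof (cases "norm x < \<delta>")
      case True
      then show ?thesis using *(2) C D by simp
    next
      case False
      have "0 \<le> 1 - exp (- l i * norm x powr \<alpha>)" using l(1)[of i] by simp
      moreover have "(1 - exp (- l i * norm x powr \<alpha>)) / l i \<le> norm x powr \<alpha>"
        using one_minus_exp_le[of "l i * norm x powr \<alpha>"] l(1)[of i] by (simp add: divide_le_eq mult.commute)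
      ultimately have "norm (E i x) \<le> norm x powr \<alpha>" using l(1)[of i] unfolding E_def by (simp add: norm_of_real del: of_real_divide)
      also have "\<dots> \<le> C * (1 + norm x) ^ m" using C(2) False by simp
      finally have "norm (g i x * E i x) \<le> norm (g i x) * (C * (1 + norm x) ^ m)"
        by (simp add: norm_mult mult_left_mono)
      then have "(1 + norm x) ^ k * norm (g i x * E i x) \<le> (1 + norm x) ^ k * (norm (g i x) * (C * (1 + norm x) ^ m))"
        by (intro mult_left_mono) auto
      also have "\<dots> = C * ((1 + norm x) ^ (k + m) * norm (g i x))" by (simp add: power_add)
      also have "\<dots> \<le> C * D" by (intro mult_left_mono C D)
      finally show ?thesis .
    qed
    have "w i x * norm (K i x) \<le> C * D + F" for i x
    proof -
      have "w i x * norm (K i x) \<le> (1 + norm x) ^ k * (norm (g i x * E i x) + norm (H i x))"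
        unfolding w K by (intro mult_left_mono norm_triangle_ineq) auto
      also have "\<dots> \<le> C * D + F" unfolding distrib_left by (intro add_mono gb F)
      finally show ?thesis .
    qed
    then show "\<exists>C. \<forall>i x. w i x * norm (K i x) \<le> C" by blast
  next
    fix K and b :: 'a assume "K \<in> X" and b: "b \<in> Basis"
    then obtain g H where K: "K = (\<lambda>i x. g i x * E i x + H i x)" and *: "sch g" "\<And>i x. norm x < \<delta> \<Longrightarrow> g i x = 0" "sch H"
      unfolding X_def by blast
    have s: "sch (\<lambda>i x. of_real \<alpha> * (of_real (x \<bullet> b) * g i x * radial \<alpha> (l i) (\<alpha> - 2) x) + pd b (H i) x)"
    proof (intro sch_add sch_cmult_const sch_mult_radial[OF sch_imp_heat_fam \<delta>] sch_coord * sch_pd b)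
      show "of_real (x \<bullet> b) * g i x = 0" if "norm x < \<delta>" for i x using *(2)[OF that] by simp
    qed (use l in \<open>auto intro: less_imp_le\<close>)
    have "(\<lambda>i. pd b (K i)) = (\<lambda>i x. pd b (g i) x * E i x + (of_real \<alpha> * (of_real (x \<bullet> b) * g i x * radial \<alpha> (l i) (\<alpha> - 2) x) + pd b (H i) x))"
      using dpE[OF *(1,2)] by (simp add: K fun_eq_iff pd_add sch_differentiable[OF *(3)])
    moreover have "\<forall>i x. norm x < \<delta> \<longrightarrow> pd b (g i) x = 0" by (intro allI impI pd_0_near_0[OF _ *(2)])
    ultimately show "(\<lambda>i. pd b (K i)) \<in> X"
      unfolding X_def using s sch_pd[OF *(1) b]
      by (intro CollectI exI[of _ "\<lambda>i. pd b (g i)"] exI[of _ "\<lambda>i x. of_real \<alpha> * (of_real (x \<bullet> b) * g i x * radial \<alpha> (l i) (\<alpha> - 2) x) + pd b (H i) x"] conjI)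
  qed
  then show ?thesis by (simp add: E_def)
qed

section \<open>Dilations and the gain from cancellation\<close>

definition dil :: "real \<Rightarrow> ('a::euclidean_space \<Rightarrow> complex) \<Rightarrow> 'a \<Rightarrow> complex" where
  "dil \<rho> g x = of_real (\<rho> ^ DIM('a)) * g (\<rho> *\<^sub>R x)"

lemma integral_dil:
  assumes "\<rho> > 0"
  shows "(LBINT y. dil \<rho> g y * F y) = (LBINT v. g v * F (v /\<^sub>R \<rho>))"
proof -
  have "(LBINT y. dil \<rho> g y * F y) = \<bar>1 / \<rho>\<bar> ^ DIM('a) *\<^sub>R (LBINT v. dil \<rho> g (0 + (1 / \<rho>) *\<^sub>R v) * F (0 + (1 / \<rho>) *\<^sub>R v))"
    by (rule integral_lborel_affine) (use assms in simp)
  also have "\<dots> = (LBINT v. \<bar>1 / \<rho>\<bar> ^ DIM('a) *\<^sub>R (dil \<rho> g (0 + (1 / \<rho>) *\<^sub>R v) * F (0 + (1 / \<rho>) *\<^sub>R v)))"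
    by simp
  also have "(\<lambda>v. \<bar>1 / \<rho>\<bar> ^ DIM('a) *\<^sub>R (dil \<rho> g (0 + (1 / \<rho>) *\<^sub>R v) * F (0 + (1 / \<rho>) *\<^sub>R v))) = (\<lambda>v. g v * F (v /\<^sub>R \<rho>))"
    using assms by (simp add: fun_eq_iff dil_def scaleR_conv_of_real power_divide inverse_eq_divide)
  finally show ?thesis .
qed

lemma integrable_dil:
  assumes "integrable lborel g" "\<rho> > 0"
  shows "integrable lborel (dil \<rho> g)"
  unfolding dil_def[abs_def] using integrable_lborel_affine[OF assms(1), of \<rho> 0] assms(2) by simp

lemma integral_norm_dil:
  assumes "\<rho> > 0"
  shows "(LBINT y. norm (dil \<rho> g y)) = (LBINT v. norm (g v))"
proof -
  have "complex_of_real (LBINT y. norm (dil \<rho> g y)) = (LBINT y. dil \<rho> (\<lambda>v. of_real (norm (g v))) y * 1)"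
    unfolding integral_complex_of_real[symmetric] using assms
    by (intro integral_cong refl) (simp add: dil_def norm_mult norm_power)
  also have "\<dots> = complex_of_real (LBINT v. norm (g v))"
    unfolding integral_dil[OF assms] by simp
  finally show ?thesis by (simp only: of_real_eq_iff)
qed

lemma fourier_dil:
  assumes "\<rho> > 0"
  shows "fourier (dil \<rho> g) \<xi> = fourier g (\<xi> /\<^sub>R \<rho>)"
  using integral_dil[OF assms, of g "\<lambda>x. cis (- 2 * pi * (\<xi> \<bullet> x))"] unfolding fourier_def
  by (simp add: mult.commute)

lemma sch1_dil: "sch1 g \<Longrightarrow> \<rho> > 0 \<Longrightarrow> sch1 (dil \<rho> g)"
  unfolding dil_def[abs_def] using sch_cmult_const[OF sch_affine_fixed[of "\<lambda>_::unit. g" \<rho> 0]] by simp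

text \<open>Up to an outer dilation only the ratio of the two scales matters. For the heat kernel
  this merges the time \<tau> and the frequency \<open>2 ^ j\<close> into the single parameter
  \<open>2 ^ j * \<tau> powr (1 / \<alpha>)\<close>.\<close>

lemma cv_dil_dil:
  assumes "\<rho> > 0" "\<sigma> > 0"
  shows "cv (dil \<rho> f) (dil \<sigma> g) z = dil \<sigma> (cv (dil (\<rho> / \<sigma>) f) g) z"
proof -
  have "cv (dil \<rho> f) (dil \<sigma> g) z = (LBINT v. f v * dil \<sigma> g (z - v /\<^sub>R \<rho>))"
    unfolding cv_def integral_dil[OF assms(1)] ..
  also have "\<dots> = (LBINT v. of_real (\<sigma> ^ DIM('a)) * (f v * g (\<sigma> *\<^sub>R z - v /\<^sub>R (\<rho> / \<sigma>))))"
    by (simp add: dil_def scaleR_diff_right mult_ac divide_inverse)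
  also have "\<dots> = dil \<sigma> (cv (dil (\<rho> / \<sigma>) f) g) z"
    using assms by (simp add: dil_def[of \<sigma>] cv_def integral_dil)
  finally show ?thesis .
qed

lemma pd_dil:
  assumes "\<And>x. g differentiable (at x)"
  shows "pd b (dil \<rho> g) x = of_real \<rho> * dil \<rho> (pd b g) x"
proof -
  have "pd b (dil \<rho> g) x = of_real (\<rho> ^ DIM('a)) * pd b (\<lambda>x. g (\<rho> *\<^sub>R x + 0)) x"
    unfolding dil_def[abs_def] using pd_cmult[OF differentiable_affine_comp[OF assms, of \<rho> 0]] by simp
  then show ?thesis by (simp only: pd_affine[OF assms]) (simp add: dil_def)
qed

text \<open>A transform vanishing near 0 means that all moments of g vanish. The transform h is part
  of the definition because \<open>annular_decomp\<close> divides it by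
  \<open>norm \<xi> ^ 2\<close>.\<close>

definition annular :: "('a::euclidean_space \<Rightarrow> complex) \<Rightarrow> bool" where
  "annular g \<longleftrightarrow> (\<exists>h \<delta>. sch1 h \<and> 0 < \<delta> \<and> (\<forall>\<xi>. norm \<xi> < \<delta> \<longrightarrow> h \<xi> = 0) \<and> g = ift h)"

lemma annular_sch1: "annular g \<Longrightarrow> sch1 g"
  unfolding annular_def using sch_ift by fastforce

lemma annularI:
  assumes "sch1 g" "0 < \<delta>" "\<And>\<xi>. norm \<xi> < \<delta> \<Longrightarrow> fourier g \<xi> = 0"
  shows "annular g"
  unfolding annular_def using assms sch_fourier[OF assms(1)] fourier_inversion[OF assms(1)] by metis

lemma pd_ift:
  assumes h: "sch1 h" and b: "b \<in> Basis"
  shows "pd b (ift h) = ift (\<lambda>\<xi>. \<i> * of_real (2 * pi) * of_real (\<xi> \<bullet> b) * h \<xi>)"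
proof
  fix x
  have "pd b (ift h) x = - pd b (fourier h) (- x)"
    unfolding ift_def[abs_def] using pd_affine[OF sch_differentiable[OF sch_fourier[OF h]], of b "-1" 0 x] by simp
  also have "\<dots> = - fourier (\<lambda>\<xi>. (\<i> * of_real (- 2 * pi)) * of_real (\<xi> \<bullet> b) * h \<xi>) (- x)"
    unfolding pd_fourier[OF sch_rapid[OF h] sch_measurable[OF h] b] ..
  also have "\<dots> = fourier (\<lambda>\<xi>. \<i> * of_real (2 * pi) * of_real (\<xi> \<bullet> b) * h \<xi>) (- x)"
    unfolding fourier_def integral_minus[symmetric] by (intro integral_cong refl) simp
  finally show "pd b (ift h) x = ift (\<lambda>\<xi>. \<i> * of_real (2 * pi) * of_real (\<xi> \<bullet> b) * h \<xi>) x"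
    unfolding ift_def .
qed

lemma ift_add:
  assumes "integrable lborel f" "integrable lborel g"
  shows "ift (\<lambda>\<xi>. f \<xi> + g \<xi>) x = ift f x + ift g x"
proof -
  have "integrable lborel (\<lambda>\<xi>. cis (2 * pi * (x \<bullet> \<xi>)) * h \<xi>)" if "integrable lborel h" for h :: "'a \<Rightarrow> complex"
    by (rule integrable_bound[OF that])
      (use borel_measurable_integrable[OF that] in \<open>auto simp: norm_mult\<close>)
  then show ?thesis using assms by (simp add: ift_eq distrib_left)
qed

lemma ift_cmult: "ift (\<lambda>\<xi>. c * f \<xi>) x = c * ift f x"
  unfolding ift_eq by (subst integral_mult_right_zero[symmetric]) (simp only: mult.left_commute)

lemma ift_sum:
  assumes "finite J" "\<And>j. j \<in> J \<Longrightarrow> integrable lborel (f j)"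
  shows "ift (\<lambda>\<xi>. \<Sum>j\<in>J. f j \<xi>) x = (\<Sum>j\<in>J. ift (f j) x)"
  using assms
proof (induction J rule: finite_induct)
  case empty
  show ?case by (simp add: ift_eq)
next
  case (insert j J)
  have "integrable lborel (\<lambda>\<xi>. \<Sum>j\<in>J. f j \<xi>)" using insert by (intro Bochner_Integration.integrable_sum) auto
  then show ?case using insert by (simp add: ift_add)
qed

text \<open>On the Fourier side, h is the sum over b of \<open>2 \<pi> \<i> \<xi>\<^sub>b\<close>
  times \<open>\<xi>\<^sub>b h / (2 \<pi> \<i> \<bar>\<xi>\<bar>\<^sup>2)\<close>; the quotients are
  Schwartz functions because h vanishes near the origin. They vanish there too, so the step can be
  iterated.\<close>

lemma annular_decomp:
  fixes g :: "'a::euclidean_space \<Rightarrow> complex"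
  assumes "annular g"
  obtains G where "\<And>b. b \<in> Basis \<Longrightarrow> annular (G b)" "g = (\<lambda>x. \<Sum>b\<in>Basis. pd b (G b) x)"
proof -
  obtain h \<delta> where h: "sch1 h" "0 < \<delta>" "\<And>\<xi>. norm \<xi> < \<delta> \<Longrightarrow> h \<xi> = 0" "g = ift h"
    using assms unfolding annular_def by blast
  define k where "k = (\<lambda>b \<xi>. 1 / (\<i> * of_real (2 * pi)) * (of_real (\<xi> \<bullet> b) * (h \<xi> * of_real (norm \<xi> powr (-2)))))"
  have k: "sch1 (k b)" for b
    unfolding k_def by (intro sch_cmult_const sch_coord sch_mult_norm_powr[OF h(1,2)] h(3))
  have 0: "annular (ift (k b))" for b
    unfolding annular_def using h(2,3) k[of b] by (intro exI[of _ "k b"] exI[of _ \<delta>]) (simp add: k_def)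
  have "g x = (\<Sum>b\<in>Basis. pd b (ift (k b)) x)" for x
  proof -
    have "(\<Sum>b\<in>Basis. pd b (ift (k b)) x) = (\<Sum>b\<in>Basis. ift (\<lambda>\<xi>. \<i> * of_real (2 * pi) * of_real (\<xi> \<bullet> b) * k b \<xi>) x)"
      by (intro sum.cong refl) (simp only: pd_ift[OF k])
    also have "\<dots> = ift (\<lambda>\<xi>. \<Sum>b\<in>Basis. \<i> * of_real (2 * pi) * of_real (\<xi> \<bullet> b) * k b \<xi>) x"
    proof (rule ift_sum[symmetric])
      fix b :: 'a
      have "sch1 (\<lambda>\<xi>. \<i> * of_real (2 * pi) * (of_real (\<xi> \<bullet> b) * k b \<xi>))" by (intro sch_cmult_const sch_coord k)
      from sch_integrable[OF this] show "integrable lborel (\<lambda>\<xi>. \<i> * of_real (2 * pi) * of_real (\<xi> \<bullet> b) * k b \<xi>)"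
        by (simp only: mult.assoc)
    qed simp
    also have "(\<lambda>\<xi>. \<Sum>b\<in>Basis. \<i> * of_real (2 * pi) * of_real (\<xi> \<bullet> b) * k b \<xi>) = h"
    proof
      fix \<xi>
      have "(\<Sum>b\<in>Basis. \<i> * of_real (2 * pi) * of_real (\<xi> \<bullet> b) * k b \<xi>) = (\<Sum>b\<in>Basis. of_real ((\<xi> \<bullet> b)\<^sup>2) * (h \<xi> * of_real (norm \<xi> powr (-2))))"
        by (intro sum.cong refl) (simp add: k_def power2_eq_square field_simps)
      also have "\<dots> = of_real ((norm \<xi>)\<^sup>2 * norm \<xi> powr (-2)) * h \<xi>"
        unfolding norm_square_coords by (simp add: sum_distrib_right[symmetric])
      also have "\<dots> = h \<xi>"
      proof (cases "\<xi> = 0")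
        case True
        then show ?thesis using h(2) h(3)[of 0] by simp
      next
        case False
        then have "(norm \<xi>)\<^sup>2 * norm \<xi> powr (-2) = 1"
          by (simp add: powr_minus powr_numeral)
        then show ?thesis by simp
      qed
      finally show "(\<Sum>b\<in>Basis. \<i> * of_real (2 * pi) * of_real (\<xi> \<bullet> b) * k b \<xi>) = h \<xi>" .
    qed
    finally show ?thesis using h(4) by simp
  qed
  then show thesis using 0 by (intro that[of "\<lambda>b. ift (k b)"]) auto
qed

lemma fam_reflect:
  assumes "fam {\<lambda>_ _. 1} (\<lambda>_::unit. \<theta>)"
  shows "fam {\<lambda>_ _. 1} (\<lambda>_::unit. \<lambda>y. \<theta> (z - y))"
proof -
  have "fam {\<lambda>_ _. 1} (\<lambda>(_::unit) y. 1 * \<theta> ((-1) *\<^sub>R y + z))"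
    by (rule fam_affine[OF assms]) (auto intro!: exI[of _ 1])
  then show ?thesis by simp
qed

text \<open>Integration by parts inside the convolution. Only boundedness of \<theta> and its
  derivatives is assumed, so that the heat kernel may take its place.\<close>

lemma cv_pd:
  assumes f: "sch1 f" and \<theta>: "fam {\<lambda>_ _. 1} (\<lambda>_::unit. \<theta>)" and b: "b \<in> Basis"
  shows "cv (pd b f) \<theta> z = cv f (pd b \<theta>) z"
proof -
  have r: "fam {\<lambda>_ _. 1} (\<lambda>_::unit. \<lambda>y. \<theta> (z - y))" "fam {\<lambda>_ _. 1} (\<lambda>_::unit. \<lambda>y. pd b \<theta> (z - y))"
    using fam_reflect[OF \<theta>] fam_reflect[OF fam_pd[OF \<theta> b]] by auto
  have s: "sch1 (\<lambda>y. f y * \<theta> (z - y))" by (rule sch_mult[OF f r(1)])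
  have p: "pd b (\<lambda>y. \<theta> (z - y)) y = - pd b \<theta> (z - y)" for y
    using pd_affine[OF fam_differentiable[OF \<theta>], of b "-1" z y] by simp
  have "0 = (LBINT y. pd b (\<lambda>y. f y * \<theta> (z - y)) y)" by (rule integral_pd_zero[OF s b, symmetric])
  also have "\<dots> = (LBINT y. pd b f y * \<theta> (z - y) - f y * pd b \<theta> (z - y))"
    by (simp add: pd_mult[OF sch_differentiable[OF f] fam_differentiable[OF r(1)]] p)
  also have "\<dots> = cv (pd b f) \<theta> z - cv f (pd b \<theta>) z"
    unfolding cv_def
    using sch_integrable[OF sch_mult[OF sch_pd[OF f b] r(1)]] sch_integrable[OF sch_mult[OF f r(2)]] by simp
  finally show ?thesis by simp
qed

lemma sch_powr_integrable:
  fixes g :: "'a::euclidean_space \<Rightarrow> complex"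
  assumes g: "sch1 g"
  shows "integrable lborel (\<lambda>v. g v * of_real ((1 + norm v) powr a))"
proof -
  define m where "m = nat \<lceil>\<bar>a\<bar>\<rceil>"
  have [measurable]: "g \<in> borel_measurable borel" using sch_measurable[OF g] by simp
  obtain C where C: "\<And>x. (1 + norm x) ^ (m + Suc DIM('a)) * norm (g x) \<le> C" using sch_bound[OF g] by metis
  show ?thesis
  proof (rule integrable_bound[where f = "\<lambda>x. C * jw x"])
    show "integrable lborel (\<lambda>x::'a. C * jw x)" by (intro integrable_mult_right integrable_jw)
    show "AE v in lborel. norm (g v * of_real ((1 + norm v) powr a)) \<le> norm (C * jw v)"
    proof (intro AE_I2)
      fix v :: 'a
      have "(1 + norm v) powr a \<le> (1 + norm v) powr (real m)" unfolding m_def by (intro powr_mono) (linarith, simp)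
      also have "\<dots> = (1 + norm v) ^ m" by (rule powr_realpow) (simp add: add_pos_nonneg)
      finally have "norm (g v * of_real ((1 + norm v) powr a)) \<le> (1 + norm v) ^ m * norm (g v)"
        by (simp add: norm_mult mult.commute[of "norm (g v)"] mult_right_mono)
      moreover have "(1 + norm v) ^ Suc DIM('a) * ((1 + norm v) ^ m * norm (g v)) \<le> C"
        using C[of v] by (simp add: power_add mult_ac)
      ultimately show "norm (g v * of_real ((1 + norm v) powr a)) \<le> norm (C * jw v)"
        using bounded_by_jw by (metis abs_ge_self order_trans real_norm_def)
    qed
  qed measurable
qed

text \<open>Peetre's inequality transfers the decay of \<theta> to z at the cost of
  \<open>(1 + norm y) powr a\<close> on the kernel. For \<rho> \<ge> 1 this is at most
  \<open>(1 + norm (\<rho> *\<^sub>R y)) powr a\<close>, which rescales to an integral of g alone;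
  hence C is independent of \<rho>.\<close>

lemma cv_bound:
  fixes g :: "'a::euclidean_space \<Rightarrow> complex"
  assumes g: "sch1 g" and a: "a \<ge> 0"
  obtains C where "C \<ge> 0" "\<And>\<rho> \<theta> B z. \<rho> \<ge> 1 \<Longrightarrow> (\<And>x. (1 + norm x) powr a * norm (\<theta> x) \<le> B) \<Longrightarrow>
      norm (cv (dil \<rho> g) \<theta> z) \<le> C * B * (1 + norm z) powr (- a)"
proof
  define G where "G = (\<lambda>v. g v * of_real ((1 + norm v) powr a))"
  have Gi: "integrable lborel G" unfolding G_def by (rule sch_powr_integrable[OF g])
  let ?C = "\<integral>v. norm (G v) \<partial>lborel"
  show "0 \<le> ?C" by simp
  fix \<rho> :: real and \<theta> :: "'a \<Rightarrow> complex" and B z assume \<rho>: "\<rho> \<ge> 1" and B: "\<And>x. (1 + norm x) powr a * norm (\<theta> x) \<le> B"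
  have "norm (dil \<rho> g y * \<theta> (z - y)) \<le> norm (dil \<rho> G y) * (B * (1 + norm z) powr (- a))" for y
  proof -
    have z: "(1 + norm z) powr a \<le> (1 + norm (z - y)) powr a * (1 + norm y) powr a"
      using powr_mono2[OF a _ jp_triangle[of z "- y"]] by (simp add: powr_mult)
    have "norm (\<theta> (z - y)) * (1 + norm z) powr a \<le> norm (\<theta> (z - y)) * ((1 + norm (z - y)) powr a * (1 + norm y) powr a)"
      by (intro mult_left_mono z) auto
    also have "\<dots> = ((1 + norm (z - y)) powr a * norm (\<theta> (z - y))) * (1 + norm y) powr a" by simp
    also have "\<dots> \<le> B * (1 + norm y) powr a" by (intro mult_right_mono B) auto
    finally have 1: "norm (\<theta> (z - y)) * (1 + norm z) powr a \<le> B * (1 + norm y) powr a" .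
    have zp: "(1 + norm z) powr a > 0" using norm_ge_zero[of z] by (simp add: add_nonneg_eq_0_iff)
    have 2: "norm (\<theta> (z - y)) \<le> B * (1 + norm y) powr a * (1 + norm z) powr (- a)"
      using 1 zp by (simp add: powr_minus divide_inverse[symmetric] pos_le_divide_eq)
    have B0: "B \<ge> 0" using B[of 0] by (metis mult_nonneg_nonneg norm_ge_zero order_trans powr_ge_zero)
    have "norm y \<le> norm (\<rho> *\<^sub>R y)" using \<rho> mult_right_mono[of 1 \<rho> "norm y"] by simp
    then have 3: "(1 + norm y) powr a \<le> (1 + norm (\<rho> *\<^sub>R y)) powr a" using a by (intro powr_mono2) auto
    have "norm (dil \<rho> g y * \<theta> (z - y)) \<le> norm (dil \<rho> g y) * (B * (1 + norm (\<rho> *\<^sub>R y)) powr a * (1 + norm z) powr (- a))"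
      unfolding norm_mult using 3 B0 by (intro mult_left_mono order_trans[OF 2] mult_right_mono) auto
    also have "\<dots> = norm (dil \<rho> G y) * (B * (1 + norm z) powr (- a))"
      by (simp add: dil_def G_def norm_mult)
    finally show ?thesis .
  qed
  then have "norm (cv (dil \<rho> g) \<theta> z) \<le> (LBINT y. norm (dil \<rho> G y) * (B * (1 + norm z) powr (- a)))"
    unfolding cv_def using \<rho> Gi by (intro norm_integral_le) (auto intro!: integrable_dil)
  also have "\<dots> = ?C * B * (1 + norm z) powr (- a)"
    using \<rho> by (simp add: integral_norm_dil)
  finally show "norm (cv (dil \<rho> g) \<theta> z) \<le> ?C * B * (1 + norm z) powr (- a)" .
qed

text \<open>The cancellation of \<open>g\<close> is used in the form \<open>g = \<Sum>\<^sub>b \<partial>\<^sub>b G\<^sub>b\<close>: integrating by parts, each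
  derivative that is moved to \<open>\<theta>\<close> gains a factor \<open>1 / \<rho>\<close>.\<close>

lemma annular_cv_bound:
  fixes g :: "'a::euclidean_space \<Rightarrow> complex"
  assumes g: "annular g" and a: "a \<ge> 0"
  shows "\<exists>C\<ge>0. \<forall>\<rho> \<theta> B z. \<rho> \<ge> 1 \<longrightarrow> fam {\<lambda>_ _. 1} (\<lambda>_::unit. \<theta>) \<longrightarrow>
     (\<forall>bs x. set bs \<subseteq> Basis \<longrightarrow> length bs = N \<longrightarrow> (1 + norm x) powr a * norm (iter_deriv bs \<theta> x) \<le> B) \<longrightarrow>
      norm (cv (dil \<rho> g) \<theta> z) \<le> C * B / \<rho> ^ N * (1 + norm z) powr (- a)"
  using g
proof (induction N arbitrary: g)
  case 0
  obtain C where C: "C \<ge> 0" "\<And>\<rho> \<theta> B z. \<rho> \<ge> 1 \<Longrightarrow> (\<And>x. (1 + norm x) powr a * norm (\<theta> x) \<le> B) \<Longrightarrow>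
      norm (cv (dil \<rho> g) \<theta> z) \<le> C * B * (1 + norm z) powr (- a)"
    using cv_bound[OF annular_sch1[OF 0] a] by blast
  show ?case
  proof (intro exI[of _ C] conjI allI impI C(1))
    fix \<rho> :: real and \<theta> :: "'a \<Rightarrow> complex" and B z
    assume "\<rho> \<ge> 1" and *: "\<forall>bs x. set bs \<subseteq> Basis \<longrightarrow> length bs = 0 \<longrightarrow> (1 + norm x) powr a * norm (iter_deriv bs \<theta> x) \<le> B"
    have "(1 + norm x) powr a * norm (\<theta> x) \<le> B" for x using *[rule_format, of "[]" x] by simp
    from C(2)[OF \<open>\<rho> \<ge> 1\<close> this] show "norm (cv (dil \<rho> g) \<theta> z) \<le> C * B / \<rho> ^ 0 * (1 + norm z) powr (- a)" by simp
  qed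
next
  case (Suc N)
  obtain G where G: "\<And>b. b \<in> Basis \<Longrightarrow> annular (G b)" "g = (\<lambda>x. \<Sum>b\<in>Basis. pd b (G b) x)"
    using annular_decomp[OF Suc.prems] by metis
  have "\<forall>b\<in>Basis. \<exists>C\<ge>0. \<forall>\<rho> \<theta> B z. \<rho> \<ge> 1 \<longrightarrow> fam {\<lambda>_ _. 1} (\<lambda>_::unit. \<theta>) \<longrightarrow>
     (\<forall>bs x. set bs \<subseteq> Basis \<longrightarrow> length bs = N \<longrightarrow> (1 + norm x) powr a * norm (iter_deriv bs \<theta> x) \<le> B) \<longrightarrow>
      norm (cv (dil \<rho> (G b)) \<theta> z) \<le> C * B / \<rho> ^ N * (1 + norm z) powr (- a)"
    using Suc.IH[OF G(1)] by blast
  then obtain C where C: "\<And>b. b \<in> Basis \<Longrightarrow> C b \<ge> 0" "\<And>b \<rho> \<theta> B z. b \<in> Basis \<Longrightarrow> \<rho> \<ge> 1 \<Longrightarrow> fam {\<lambda>_ _. 1} (\<lambda>_::unit. \<theta>) \<Longrightarrow>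
     (\<And>bs x. set bs \<subseteq> Basis \<Longrightarrow> length bs = N \<Longrightarrow> (1 + norm x) powr a * norm (iter_deriv bs \<theta> x) \<le> B) \<Longrightarrow>
      norm (cv (dil \<rho> (G b)) \<theta> z) \<le> C b * B / \<rho> ^ N * (1 + norm z) powr (- a)"
    unfolding bchoice_iff by blast
  show ?case
  proof (intro exI[of _ "\<Sum>b\<in>Basis. C b"] conjI allI impI)
    show "0 \<le> (\<Sum>b\<in>Basis. C b)" by (intro sum_nonneg C)
    fix \<rho> :: real and \<theta> :: "'a \<Rightarrow> complex" and B z
    assume \<rho>: "\<rho> \<ge> 1" and \<theta>: "fam {\<lambda>_ _. 1} (\<lambda>_::unit. \<theta>)"
      and B: "\<forall>bs x. set bs \<subseteq> Basis \<longrightarrow> length bs = Suc N \<longrightarrow> (1 + norm x) powr a * norm (iter_deriv bs \<theta> x) \<le> B"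
    have G1: "sch1 (G b)" if "b \<in> Basis" for b by (rule annular_sch1[OF G(1)[OF that]])
    have i: "integrable lborel (\<lambda>y. dil \<rho> (pd b (G b)) y * \<theta> (z - y))" if "b \<in> Basis" for b
      using sch_integrable[OF sch_mult[OF sch1_dil[OF sch_pd[OF G1[OF that] that], of \<rho>] fam_reflect[OF \<theta>]]] \<rho> by simp
    have "cv (dil \<rho> g) \<theta> z = (\<Sum>b\<in>Basis. cv (dil \<rho> (pd b (G b))) \<theta> z)"
      unfolding cv_def G(2) using i
      by (subst Bochner_Integration.integral_sum[symmetric]) (auto simp: dil_def sum_distrib_left sum_distrib_right)
    also have "\<dots> = (\<Sum>b\<in>Basis. of_real (1 / \<rho>) * cv (dil \<rho> (G b)) (pd b \<theta>) z)"
    proof (intro sum.cong refl)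
      fix b :: 'a assume b: "b \<in> Basis"
      have "cv (dil \<rho> (G b)) (pd b \<theta>) z = cv (pd b (dil \<rho> (G b))) \<theta> z"
        using sch1_dil[OF G1[OF b], of \<rho>] \<rho> by (intro cv_pd[symmetric] \<theta> b) auto
      also have "\<dots> = of_real \<rho> * cv (dil \<rho> (pd b (G b))) \<theta> z"
        unfolding cv_def by (simp add: pd_dil[OF sch_differentiable[OF G1[OF b]]] mult.assoc)
      finally show "cv (dil \<rho> (pd b (G b))) \<theta> z = of_real (1 / \<rho>) * cv (dil \<rho> (G b)) (pd b \<theta>) z"
        using \<rho> by simp
    qed
    finally have "norm (cv (dil \<rho> g) \<theta> z) \<le> (\<Sum>b\<in>Basis. norm (of_real (1 / \<rho>) * cv (dil \<rho> (G b)) (pd b \<theta>) z))"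
      by (simp only: norm_sum)
    also have "\<dots> \<le> (\<Sum>b\<in>Basis. 1 / \<rho> * (C b * B / \<rho> ^ N * (1 + norm z) powr (- a)))"
    proof (intro sum_mono)
      fix b :: 'a assume b: "b \<in> Basis"
      have "norm (cv (dil \<rho> (G b)) (pd b \<theta>) z) \<le> C b * B / \<rho> ^ N * (1 + norm z) powr (- a)"
      proof (rule C(2)[OF b \<rho> fam_pd[OF \<theta> b]])
        fix bs x assume "set (bs::'a list) \<subseteq> Basis" "length bs = N"
        then show "(1 + norm x) powr a * norm (iter_deriv bs (pd b \<theta>) x) \<le> B"
          using B[rule_format, of "bs @ [b]" x] b by (simp add: iter_deriv_snoc)
      qed
      then have "1 / \<rho> * norm (cv (dil \<rho> (G b)) (pd b \<theta>) z) \<le> 1 / \<rho> * (C b * B / \<rho> ^ N * (1 + norm z) powr (- a))"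
        using \<rho> by (intro mult_left_mono) auto
      then show "norm (of_real (1 / \<rho>) * cv (dil \<rho> (G b)) (pd b \<theta>) z) \<le> 1 / \<rho> * (C b * B / \<rho> ^ N * (1 + norm z) powr (- a))"
        using \<rho> by (simp add: norm_mult norm_divide)
    qed
    also have "\<dots> = (\<Sum>b\<in>Basis. C b) * B / \<rho> ^ Suc N * (1 + norm z) powr (- a)"
      unfolding sum_distrib_right sum_divide_distrib by (intro sum.cong refl) simp
    finally show "norm (cv (dil \<rho> g) \<theta> z) \<le> (\<Sum>b\<in>Basis. C b) * B / \<rho> ^ Suc N * (1 + norm z) powr (- a)" .
  qed
qed

section \<open>The Littlewood--Paley kernels\<close>

text \<open>For j > 0 the differences telescope: the kernels up to J add up to
  \<open>dil (2 ^ J) \<Phi>\<close>.\<close>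

definition lp_kernel :: "('a::euclidean_space \<Rightarrow> complex) \<Rightarrow> nat \<Rightarrow> 'a \<Rightarrow> complex" where
  "lp_kernel \<Phi> j = (if j = 0 then \<Phi> else (\<lambda>x. dil (2 ^ j) \<Phi> x - dil (2 ^ (j - 1)) \<Phi> x))"

text \<open>Its transform is 1 for 1/2 < |\<xi>| \<le> 2, and 0 both for |\<xi>| \<le> 1/4 and for
  |\<xi>| > 4. The first of these zero sets makes it annular.\<close>

definition lp_mother :: "('a::euclidean_space \<Rightarrow> complex) \<Rightarrow> 'a \<Rightarrow> complex" where
  "lp_mother \<Phi> = (\<lambda>x. dil 2 \<Phi> x - dil (1 / 4) \<Phi> x)"

text \<open>The Fourier transform of \<open>lp_fat \<Phi> j\<close> equals \<open>1\<close> on the support of that of \<open>lp_kernel \<Phi> j\<close>.\<close>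

definition lp_fat :: "('a::euclidean_space \<Rightarrow> complex) \<Rightarrow> nat \<Rightarrow> 'a \<Rightarrow> complex" where
  "lp_fat \<Phi> j = (if j = 0 then dil 2 \<Phi> else dil (2 ^ j) (lp_mother \<Phi>))"

lemma fourier_diff:
  assumes "integrable lborel f" "integrable lborel g"
  shows "fourier (\<lambda>x. f x - g x) \<xi> = fourier f \<xi> - fourier g \<xi>"
proof -
  have "integrable lborel (\<lambda>x. cis (- 2 * pi * (\<xi> \<bullet> x)) * h x)" if "integrable lborel h" for h :: "'a \<Rightarrow> complex"
    by (rule integrable_bound[OF that])
      (use borel_measurable_integrable[OF that] in \<open>auto simp: norm_mult\<close>)
  from this[OF assms(1)] this[OF assms(2)] show ?thesis by (simp add: fourier_def right_diff_distrib)
qed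

context
  fixes \<Phi> :: "'a::euclidean_space \<Rightarrow> complex"
  assumes \<Phi>: "lp_function \<Phi>"
begin

lemma lp_sch1: "sch1 \<Phi>" using \<Phi> unfolding lp_function_def schwartz_sch1 by blast

lemma lp_one: "norm \<xi> \<le> 1 \<Longrightarrow> fourier \<Phi> \<xi> = 1" using \<Phi> unfolding lp_function_def by blast

lemma lp_zero: "norm \<xi> > 2 \<Longrightarrow> fourier \<Phi> \<xi> = 0" using \<Phi> unfolding lp_function_def by blast

lemma lp_even: "\<Phi> (- x) = \<Phi> x" using \<Phi> unfolding lp_function_def by (metis norm_minus_cancel)

lemma lp_kernel_sch1: "sch1 (lp_kernel \<Phi> j)"
  unfolding lp_kernel_def using lp_sch1 by (auto intro!: sch_diff sch1_dil)

lemma lp_mother_sch1: "sch1 (lp_mother \<Phi>)"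
  unfolding lp_mother_def using lp_sch1 by (auto intro!: sch_diff sch1_dil)

lemma lp_fat_sch1: "sch1 (lp_fat \<Phi> j)"
  unfolding lp_fat_def using lp_sch1 lp_mother_sch1 by (auto intro!: sch1_dil)

lemma fourier_lp_kernel:
  "fourier (lp_kernel \<Phi> j) \<xi> = (if j = 0 then fourier \<Phi> \<xi> else fourier \<Phi> (\<xi> /\<^sub>R 2 ^ j) - fourier \<Phi> (\<xi> /\<^sub>R 2 ^ (j - 1)))"
  unfolding lp_kernel_def
  using fourier_diff[OF integrable_dil[OF sch_integrable[OF lp_sch1], of "2 ^ j"] integrable_dil[OF sch_integrable[OF lp_sch1], of "2 ^ (j - 1)"]]
  by (simp add: fourier_dil)

lemma fourier_lp_mother: "fourier (lp_mother \<Phi>) \<xi> = fourier \<Phi> (\<xi> /\<^sub>R 2) - fourier \<Phi> (4 *\<^sub>R \<xi>)"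
  unfolding lp_mother_def
  using fourier_diff[OF integrable_dil[OF sch_integrable[OF lp_sch1], of 2] integrable_dil[OF sch_integrable[OF lp_sch1], of "1 / 4"]]
  by (simp add: fourier_dil)

lemma fourier_lp_fat:
  "fourier (lp_fat \<Phi> j) \<xi> = (if j = 0 then fourier \<Phi> (\<xi> /\<^sub>R 2) else fourier \<Phi> (\<xi> /\<^sub>R 2 ^ j /\<^sub>R 2) - fourier \<Phi> (4 *\<^sub>R (\<xi> /\<^sub>R 2 ^ j)))"
  unfolding lp_fat_def by (simp add: fourier_dil fourier_lp_mother)

lemma annular_lp_mother: "annular (lp_mother \<Phi>)"
  by (rule annularI[OF lp_mother_sch1, of "1 / 4"]) (simp_all add: fourier_lp_mother lp_one)

lemma lp_kernel_even: "lp_kernel \<Phi> j (- x) = lp_kernel \<Phi> j x"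
  unfolding lp_kernel_def dil_def by (simp add: lp_even)

lemma lp_fat_even: "lp_fat \<Phi> j (- x) = lp_fat \<Phi> j x"
  unfolding lp_fat_def lp_mother_def dil_def by (simp add: lp_even)

lemma norm_scale_pow: "norm (\<xi> /\<^sub>R 2 ^ n) = norm (\<xi>::'a) / 2 ^ n"
  by (simp add: divide_inverse mult.commute)

lemma norm_halve: "norm (\<xi> /\<^sub>R 2) = norm (\<xi>::'a) / 2"
  by simp

lemma norm_four: "norm (4 *\<^sub>R \<xi>) = 4 * norm (\<xi>::'a)"
  by simp

text \<open>For j > 0 and \<eta> = \<xi> / 2^j, the transform of the kernel can be nonzero only for
  1/2 < |\<eta>| \<le> 2, where that of \<open>lp_fat\<close> is 1. For j = 0 the same holds with
  |\<xi>| \<le> 2.\<close>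

lemma lp_kernel_fat: "cv (lp_kernel \<Phi> j) (lp_fat \<Phi> j) = lp_kernel \<Phi> j"
proof (rule cv_eqI[OF lp_kernel_sch1 lp_fat_sch1 lp_kernel_sch1])
  fix \<xi> :: 'a
  show "fourier (lp_kernel \<Phi> j) \<xi> * fourier (lp_fat \<Phi> j) \<xi> = fourier (lp_kernel \<Phi> j) \<xi>"
  proof (cases "j = 0")
    case True
    show ?thesis
    proof (cases "norm \<xi> > 2")
      case True
      then show ?thesis using \<open>j = 0\<close> by (simp add: fourier_lp_kernel lp_zero)
    next
      case False
      then have "fourier \<Phi> (\<xi> /\<^sub>R 2) = 1" by (intro lp_one) simp
      then show ?thesis using \<open>j = 0\<close> by (simp add: fourier_lp_fat)
    qed
  next
    case False
    define \<eta> where "\<eta> = \<xi> /\<^sub>R 2 ^ j"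
    have e: "\<xi> /\<^sub>R 2 ^ (j - 1) = 2 *\<^sub>R \<eta>"
    proof -
      obtain k where k: "j = Suc k" using False by (cases j) auto
      have "2 * inverse (2 ^ Suc k) = inverse ((2::real) ^ k)" by simp
      then show ?thesis unfolding \<eta>_def k scaleR_scaleR by simp
    qed
    have K: "fourier (lp_kernel \<Phi> j) \<xi> = fourier \<Phi> \<eta> - fourier \<Phi> (2 *\<^sub>R \<eta>)"
      using False unfolding fourier_lp_kernel e \<eta>_def[symmetric] by simp
    have F: "fourier (lp_fat \<Phi> j) \<xi> = fourier \<Phi> (\<eta> /\<^sub>R 2) - fourier \<Phi> (4 *\<^sub>R \<eta>)"
      using False unfolding fourier_lp_fat \<eta>_def[symmetric] by simp
    consider "norm \<eta> > 2" | "norm \<eta> \<le> 2" "norm \<eta> > 1 / 2" | "norm \<eta> \<le> 1 / 2" by linarith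
    then show ?thesis unfolding K F by cases (simp_all add: lp_zero lp_one)
  qed
qed

text \<open>Disjoint frequency supports. The kernel lives in |\<xi>| \<le> 2 2^i and, for i > 0,
  outside |\<xi>| \<le> 2^(i-1); the fat one in |\<xi>| \<le> 4 2^j and, for j > 0, outside |\<xi>|
  \<le> 2^j / 4. Four dyadic steps, a factor 16, separate them.\<close>

lemma lp_kernel_fat_far:
  assumes "i + 3 < j \<or> j + 3 < i"
  shows "cv (lp_kernel \<Phi> i) (lp_fat \<Phi> j) = (\<lambda>_. 0)"
proof (rule cv_eqI[OF lp_kernel_sch1 lp_fat_sch1])
  show "sch1 (\<lambda>_::'a. 0)" using sch_cmult_const[OF lp_sch1, of 0] by simp
  fix \<xi> :: 'a
  have "fourier (lp_kernel \<Phi> i) \<xi> * fourier (lp_fat \<Phi> j) \<xi> = 0"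
    using assms
  proof
    assume ij: "i + 3 < j"
    then have j: "j = i + 4 + (j - i - 4)" by simp
    have le: "16 * 2 ^ i \<le> (2::real) ^ j"
    proof -
      have "(2::real) ^ (i + 4) \<le> 2 ^ j" using ij by (intro power_increasing) auto
      then show ?thesis by (simp add: power_add)
    qed
    show ?thesis
    proof (cases "norm \<xi> > 2 * 2 ^ i")
      case True
      have "(1::real) \<le> 2 ^ i" "(2::real) ^ (i - 1) \<le> 2 ^ i" by (auto intro: power_increasing)
      then have "norm \<xi> > 2" "norm \<xi> > 2 * 2 ^ i" "norm \<xi> > 2 * 2 ^ (i - 1)" using True by linarith+
      then have "norm \<xi> > 2" "norm (\<xi> /\<^sub>R 2 ^ i) > 2" "norm (\<xi> /\<^sub>R 2 ^ (i - 1)) > 2"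
        unfolding norm_scale_pow by (simp_all only: pos_less_divide_eq zero_less_power zero_less_numeral)
      then have "fourier (lp_kernel \<Phi> i) \<xi> = 0" by (simp only: fourier_lp_kernel lp_zero) simp
      then show ?thesis by simp
    next
      case False
      have "norm \<xi> * 8 \<le> 2 ^ j" using False le by linarith
      then have n: "norm (\<xi> /\<^sub>R 2 ^ j) \<le> 1 / 8"
        unfolding norm_scale_pow by (simp add: pos_divide_le_eq)
      have "norm (\<xi> /\<^sub>R 2 ^ j /\<^sub>R 2) \<le> 1" "norm (4 *\<^sub>R (\<xi> /\<^sub>R 2 ^ j)) \<le> 1"
        using n unfolding norm_halve norm_four by - linarith+
      then have "fourier (lp_fat \<Phi> j) \<xi> = 0" using ij by (simp only: fourier_lp_fat lp_one) simp
      then show ?thesis by simp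
    qed
  next
    assume ij: "j + 3 < i"
    have le: "16 * 2 ^ j \<le> (2::real) ^ i"
    proof -
      have "(2::real) ^ (j + 4) \<le> 2 ^ i" using ij by (intro power_increasing) auto
      then show ?thesis by (simp add: power_add)
    qed
    show ?thesis
    proof (cases "norm \<xi> > 4 * 2 ^ j")
      case True
      have "norm (\<xi> /\<^sub>R 2 ^ j) > 4"
        using True unfolding norm_scale_pow by (simp only: pos_less_divide_eq zero_less_power zero_less_numeral)
      then have n: "norm (\<xi> /\<^sub>R 2 ^ j /\<^sub>R 2) > 2" "norm (4 *\<^sub>R (\<xi> /\<^sub>R 2 ^ j)) > 2"
        unfolding norm_halve norm_four by - linarith+
      have "fourier (lp_fat \<Phi> j) \<xi> = 0"
        using lp_zero[OF n(1)] lp_zero[OF n(2)] by (cases "j = 0") (simp_all add: fourier_lp_fat)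
      then show ?thesis by simp
    next
      case False
      obtain k where k: "i = Suc k" using ij by (cases i) auto
      have "(2::real) ^ i = 2 * 2 ^ (i - 1)" unfolding k by simp
      then have "norm \<xi> \<le> 2 ^ i" "norm \<xi> \<le> 2 ^ (i - 1)" using False le norm_ge_zero[of \<xi>] by linarith+
      then have "norm (\<xi> /\<^sub>R 2 ^ i) \<le> 1" "norm (\<xi> /\<^sub>R 2 ^ (i - 1)) \<le> 1"
        unfolding norm_scale_pow by simp_all
      then have "fourier (lp_kernel \<Phi> i) \<xi> = 0" using ij by (simp only: fourier_lp_kernel lp_one) simp
      then show ?thesis by simp
    qed
  qed
  then show "fourier (lp_kernel \<Phi> i) \<xi> * fourier (lp_fat \<Phi> j) \<xi> = fourier (\<lambda>_. 0) \<xi>"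
    by (simp add: fourier_def[of "\<lambda>_. 0"])
qed

lemma fourier_modulated: "fourier (\<lambda>\<xi>. cis (2 * pi * (x \<bullet> \<xi>)) * h \<xi>) y = ift h (x - y)"
proof -
  have "cis (- 2 * pi * (y \<bullet> \<xi>)) * (cis (2 * pi * (x \<bullet> \<xi>)) * h \<xi>) = cis (2 * pi * ((x - y) \<bullet> \<xi>)) * h \<xi>" for \<xi>
    unfolding mult.assoc[symmetric] cis_mult by (simp add: inner_diff_left right_diff_distrib)
  then show ?thesis unfolding ift_eq fourier_def by (simp only:)
qed

text \<open>By inversion the modulated symbol is the transform of a translated reflected kernel, so
  the operator is a convolution of u with \<open>lp_kernel\<close>; from here on everything takes
  place in space.\<close>

lemma lp_S0_eq: "lp_S0 \<Phi> u x = u (\<lambda>y. lp_kernel \<Phi> 0 (x - y))"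
  unfolding lp_S0_def dist_fourier_def fourier_modulated[abs_def] fourier_inversion[OF lp_sch1]
  by (simp add: lp_kernel_def)

lemma lp_Delta_eq: "lp_Delta \<Phi> (int (Suc n)) u x = u (\<lambda>y. lp_kernel \<Phi> (Suc n) (x - y))"
proof -
  have "psi_hat \<Phi> ((2 powi (- int (Suc n))) *\<^sub>R \<xi>) = fourier (lp_kernel \<Phi> (Suc n)) \<xi>" for \<xi>
  proof -
    have a: "(2::real) powi (- int (Suc n)) = inverse (2 ^ Suc n)" by (simp only: power_int_minus power_int_of_nat)
    have b: "2 *\<^sub>R (inverse (2 ^ Suc n) *\<^sub>R \<xi>) = \<xi> /\<^sub>R 2 ^ n"
    proof -
      have "2 * inverse (2 ^ Suc n) = inverse ((2::real) ^ n)" by simp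
      then show ?thesis unfolding scaleR_scaleR by simp
    qed
    show ?thesis unfolding psi_hat_def fourier_lp_kernel a b by simp
  qed
  then have "(\<lambda>\<xi>. cis (2 * pi * (x \<bullet> \<xi>)) * psi_hat \<Phi> ((2 powi (- int (Suc n))) *\<^sub>R \<xi>)) = (\<lambda>\<xi>. cis (2 * pi * (x \<bullet> \<xi>)) * fourier (lp_kernel \<Phi> (Suc n)) \<xi>)"
    by simp
  then show ?thesis
    unfolding lp_Delta_def dist_fourier_def
    by (simp only: fourier_modulated[abs_def] fourier_inversion[OF lp_kernel_sch1])
qed

section \<open>Decay of the heat kernel\<close>

text \<open>Outside the unit ball a single term \<open>y ^ m / m!\<close> of the exponential series
  with \<alpha> m \<ge> k beats the polynomial; inside it the polynomial is at most
  \<open>2 ^ k\<close>.\<close>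

lemma heat_exp_bound:
  assumes "\<alpha> > 0"
  shows "\<exists>C\<ge>0. \<forall>x::'b::real_normed_vector. (1 + norm x) ^ k * exp (- (norm x powr \<alpha>)) \<le> C"
proof -
  define m where "m = nat \<lceil>real k / \<alpha>\<rceil>"
  have m: "real k \<le> \<alpha> * real m"
  proof -
    have "real k / \<alpha> \<le> real m" unfolding m_def by linarith
    then show ?thesis using assms by (simp add: divide_le_eq mult.commute)
  qed
  have "(1 + norm x) ^ k * exp (- (norm x powr \<alpha>)) \<le> 2 ^ k * fact m" for x :: 'b
  proof (cases "norm x \<le> 1")
    case True
    have "(1 + norm x) ^ k * exp (- (norm x powr \<alpha>)) \<le> 2 ^ k * 1" using True by (intro mult_mono power_mono) auto
    also have "\<dots> \<le> 2 ^ k * fact m" by (intro mult_left_mono) auto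
    finally show ?thesis .
  next
    case False
    let ?y = "norm x powr \<alpha>"
    have "(1 + norm x) ^ k \<le> (2 * norm x) ^ k" using False by (intro power_mono) auto
    also have "\<dots> = 2 ^ k * norm x powr (real k)" using False by (simp add: power_mult_distrib powr_realpow del: zero_less_norm_iff)
    also have "\<dots> \<le> 2 ^ k * norm x powr (\<alpha> * real m)" using False m by (intro mult_left_mono powr_mono) auto
    also have "norm x powr (\<alpha> * real m) = ?y ^ m"
      unfolding powr_powr[symmetric] using False by (intro powr_realpow) auto
    also have "?y ^ m \<le> fact m * exp ?y"
    proof -
      have "(\<lambda>n. ?y ^ n /\<^sub>R fact n) sums exp ?y" by (rule exp_converges)
      then have "(\<Sum>n\<in>{m}. ?y ^ n /\<^sub>R fact n) \<le> exp ?y"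
        unfolding sums_iff by (metis (no_types, lifting) sum_le_suminf finite.emptyI finite_insert divide_nonneg_nonneg
            fact_ge_zero powr_ge_zero zero_le_power scaleR_nonneg_nonneg inverse_nonnegative_iff_nonnegative)
      then show ?thesis by (simp add: field_simps)
    qed
    finally have "(1 + norm x) ^ k \<le> 2 ^ k * (fact m * exp ?y)" by simp
    then have "(1 + norm x) ^ k * exp (- ?y) \<le> 2 ^ k * (fact m * exp ?y) * exp (- ?y)" by (intro mult_right_mono) auto
    also have "\<dots> = 2 ^ k * fact m" by (simp add: exp_minus)
    finally show ?thesis .
  qed
  then show ?thesis by (intro exI[of _ "2 ^ k * fact m"]) auto
qed

lemma heat_symbol_measurable[measurable]:
  "(\<lambda>\<xi>::'b::euclidean_space. complex_of_real (exp (- t * norm \<xi> powr \<alpha>))) \<in> borel_measurable borel"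
  by measurable

lemma heat_symbol_integrable:
  assumes "\<alpha> > 0"
  shows "integrable lborel (\<lambda>\<xi>::'a. complex_of_real (exp (- (norm \<xi> powr \<alpha>))))"
proof -
  obtain C where C: "\<And>x::'a. (1 + norm x) ^ Suc DIM('a) * exp (- (norm x powr \<alpha>)) \<le> C"
    using heat_exp_bound[OF assms] by metis
  show ?thesis
  proof (rule integrable_bound[where f = "\<lambda>x. C * jw x"])
    show "integrable lborel (\<lambda>x::'a. C * jw x)" by (intro integrable_mult_right integrable_jw)
    show "AE x in lborel. norm (complex_of_real (exp (- (norm (x::'a) powr \<alpha>)))) \<le> norm (C * jw x)"
      using bounded_by_jw[OF C] by (intro AE_I2) (simp add: order_trans[OF _ abs_ge_self])
  qed measurable
qed

text \<open>The factor \<open>1 - fourier \<Phi>\<close> vanishes on the unit ball and so removes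
  the singularity of the symbol at 0. It is bounded with all derivatives, which is enough against
  \<open>heat_weights\<close> because the exponential there decays.\<close>

lemma heat_high_sch:
  assumes \<alpha>: "\<alpha> > 0"
  shows "sch1 (\<lambda>\<xi>. (1 - fourier \<Phi> \<xi>) * of_real (exp (- (norm \<xi> powr \<alpha>))))"
proof -
  have c: "fam {\<lambda>_ _. 1} (\<lambda>_::unit. \<lambda>_::'a. 1)"
    using fam_cis[of 0 "0::'a"] by simp
  have f1: "fam {\<lambda>_ _. 1} (\<lambda>(_::unit) \<xi>. 1 + (-1) * fourier \<Phi> \<xi>)"
    by (intro fam_add[OF c] sch_imp_fam1 sch_cmult_const sch_fourier lp_sch1)
  have "fam (heat_weights \<alpha> (\<lambda>_. 1)) (\<lambda>(_::unit) \<xi>. 1 + (-1) * fourier \<Phi> \<xi>)"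
  proof (rule fam_weaken[OF f1])
    fix w :: "unit \<Rightarrow> 'a \<Rightarrow> real" assume "w \<in> heat_weights \<alpha> (\<lambda>_. 1)"
    then obtain k where w: "w = (\<lambda>i x. (1 + norm x) ^ k * exp (- 1 * norm x powr \<alpha>))" unfolding heat_weights_def by blast
    obtain C where "C \<ge> 0" "\<And>x::'a. (1 + norm x) ^ k * exp (- (norm x powr \<alpha>)) \<le> C"
      using heat_exp_bound[OF \<alpha>] by metis
    then show "\<exists>w'\<in>{\<lambda>_ _. 1}. \<exists>C\<ge>0. \<forall>i x. w i x \<le> C * w' i x" unfolding w by auto
  qed
  then have "sch (\<lambda>(i::unit) \<xi>. (1 + (-1) * fourier \<Phi> \<xi>) * radial \<alpha> 1 0 \<xi>)"
    by (rule sch_mult_radial[of \<alpha> "\<lambda>_. 1" _ 1]) (auto simp: lp_one)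
  moreover have "(1 + (-1) * fourier \<Phi> \<xi>) * radial \<alpha> 1 0 \<xi> = (1 - fourier \<Phi> \<xi>) * of_real (exp (- (norm \<xi> powr \<alpha>)))" for \<xi>
    by (cases "\<xi> = 0") (auto simp: lp_one radial_def)
  ultimately show ?thesis by (simp only:)
qed

lemma ift_scale:
  assumes "c > 0"
  shows "ift (\<lambda>\<xi>. h (c *\<^sub>R \<xi>)) y = of_real ((1 / c) ^ DIM('a)) * ift h (y /\<^sub>R c :: 'a)"
proof -
  have "ift (\<lambda>\<xi>. h (c *\<^sub>R \<xi>)) y = (LBINT \<xi>. of_real ((1 / c) ^ DIM('a)) * (dil c h \<xi> * cis (2 * pi * (y \<bullet> \<xi>))))"
    unfolding ift_eq using assms
    by (intro integral_cong refl) (simp add: dil_def power_divide)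
  also have "\<dots> = of_real ((1 / c) ^ DIM('a)) * (LBINT v. h v * cis (2 * pi * (y \<bullet> (v /\<^sub>R c))))"
    by (subst integral_mult_right_zero) (simp only: integral_dil[OF assms])
  finally show ?thesis unfolding ift_eq by (simp add: mult.commute)
qed

text \<open>Since the symbol is not smooth at the origin, the low frequencies are decomposed dyadically. After
  rescaling, the piece at scale \<open>2\<^sup>-\<^sup>l\<close> is \<open>2\<^sup>-\<^sup>l\<^sup>\<alpha>\<close> times a member of a bounded family of Schwartz functions.\<close>

lemma heat_low_fam:
  assumes \<alpha>: "\<alpha> > 0" and a: "a = DIM('a) + \<alpha> / 2"
  shows "fam {\<lambda>_ x. (1 + norm x) powr a} (\<lambda>_::unit. ift (\<lambda>\<xi>::'a. fourier \<Phi> \<xi> * (of_real (exp (- (norm \<xi> powr \<alpha>))) - 1)))"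
proof -
  define P where "P = fourier \<Phi>"
  define l where "l = (\<lambda>n::nat. 2 powr (- real n * \<alpha>))"
  define m where "m = (\<lambda>\<xi>::'a. complex_of_real (exp (- (norm \<xi> powr \<alpha>))))"
  define g where "g = (\<lambda>\<xi>. P \<xi> - P (2 *\<^sub>R \<xi>))"
  \<comment> \<open>The piece at scale n, rescaled to the annulus of g, up to sign and divided by
    its size l n. That these quotients form a Schwartz family is
    \<open>sch_mult_one_minus_exp\<close>.\<close>
  define N where "N = (\<lambda>(n::nat) (\<eta>::'a). g \<eta> * of_real ((1 - exp (- l n * norm \<eta> powr \<alpha>)) / l n))"
  have Ps: "sch1 P" unfolding P_def by (rule sch_fourier[OF lp_sch1])
  have gs: "sch1 g" unfolding g_def using sch_diff[OF Ps sch_affine_fixed[OF Ps, of 2 0]] by simp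
  have g0: "g \<eta> = 0" if "norm \<eta> < 1 / 2" for \<eta>
    unfolding g_def P_def using that by (simp add: lp_one)
  have l: "0 < l n" "l n \<le> 1" for n
    unfolding l_def using \<alpha> powr_mono[of "- real n * \<alpha>" 0 2] by auto
  have Ns: "sch N" unfolding N_def
    by (rule sch_mult_one_minus_exp[OF sch_const[OF gs], of "1 / 2"]) (use g0 l in auto)
  have iNs: "sch (\<lambda>n. ift (N n))" by (rule sch_ift[OF Ns])
  define G where "G = (\<lambda>(k::unit \<times> nat) (y::'a). of_real (- l (snd k) * (1 / 2 ^ snd k) ^ DIM('a)) * ift (N (snd k)) ((1 / 2 ^ snd k) *\<^sub>R y + 0))"
  \<comment> \<open>Half of the factor \<open>l n = 2 powr (- n * \<alpha>)\<close> is kept as the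
    summable majorant v n; the other half pays for the part \<alpha> / 2 of the weight exponent a,
    the part \<open>DIM('a)\<close> being paid by the dilation.\<close>
  define v where "v = (\<lambda>n::nat. 2 powr (- real n * (\<alpha> / 2)))"
  have v_eq: "v n = (2 powr (- (\<alpha> / 2))) ^ n" for n unfolding v_def by (simp add: powr_power mult.commute)
  have r1: "2 powr (- (\<alpha> / 2)) < 1" using \<alpha> powr_less_mono[of "- (\<alpha> / 2)" 0 2] by simp
  have vs: "summable v" unfolding v_eq[abs_def] using r1 by (intro summable_geometric) simp
  have vi: "integrable (count_space UNIV) v"
    unfolding integrable_count_space_nat_iff using vs by (simp add: v_def)
  let ?W = "{\<lambda>(_::unit) (x::'a). (1 + norm x) powr a}"
  have famG: "fam ((\<lambda>w (i, x) y. w i y / v x) ` ?W) G"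
    unfolding G_def
  proof (rule fam_affine[OF sch_reindex[OF iNs, of snd, unfolded sch_def]])
    fix w :: "unit \<times> nat \<Rightarrow> 'a \<Rightarrow> real" and q assume "w \<in> (\<lambda>w (i, x) y. w i y / v x) ` ?W"
    then have w: "w = (\<lambda>(i, n) y. (1 + norm y) powr a / v n)" by auto
    define M where "M = nat \<lceil>a\<rceil>"
    have a0: "a \<ge> 0" unfolding a using \<alpha> by simp
    have "norm (complex_of_real (- l (snd k) * (1 / 2 ^ snd k) ^ DIM('a))) * \<bar>1 / 2 ^ snd k\<bar> ^ q * w k y
        \<le> 1 * (1 + norm ((1 / 2 ^ snd k) *\<^sub>R y + 0)) ^ M" for k y
    proof -
      define n where "n = snd k"
      define c where "c = (1 / 2 ^ n :: real)"
      have c: "0 < c" "c \<le> 1" unfolding c_def by auto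
      have c_eq: "c = 2 powr (- real n)" unfolding c_def by (simp add: powr_minus powr_realpow divide_inverse)
      have "1 + norm y \<le> (1 / c) * (1 + norm (c *\<^sub>R y))" using c by (simp add: field_simps)
      then have "(1 + norm y) powr a \<le> ((1 / c) * (1 + norm (c *\<^sub>R y))) powr a" using a0 by (intro powr_mono2) auto
      also have "\<dots> = (1 / c) powr a * (1 + norm (c *\<^sub>R y)) powr a" using c by (subst powr_mult) auto
      also have "(1 / c) powr a = 2 powr (real n * a)" unfolding c_eq by (simp add: powr_divide powr_powr powr_minus_divide[symmetric])
      finally have 1: "(1 + norm y) powr a \<le> 2 powr (real n * a) * (1 + norm (c *\<^sub>R y)) powr a" .
      have 2: "c ^ DIM('a) = 2 powr (- real n * DIM('a))" unfolding c_eq by (simp add: powr_power mult.commute)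
      have 3: "l n * c ^ DIM('a) * (2 powr (real n * a) / v n) = 1"
        unfolding 2 l_def v_def a by (simp add: powr_add[symmetric] powr_diff[symmetric] field_simps)
      have "norm (complex_of_real (- l n * c ^ DIM('a))) * \<bar>c\<bar> ^ q * w k y = l n * c ^ DIM('a) * c ^ q * ((1 + norm y) powr a / v n)"
        using l(1)[of n] c by (simp add: w case_prod_beta n_def norm_mult norm_power)
      also have "\<dots> \<le> l n * c ^ DIM('a) * 1 * ((2 powr (real n * a) * (1 + norm (c *\<^sub>R y)) powr a) / v n)"
        using c l(1)[of n] 1 by (intro mult_mono mult_left_mono divide_right_mono power_le_one) (auto simp: v_def)
      also have "\<dots> = (l n * c ^ DIM('a) * (2 powr (real n * a) / v n)) * (1 + norm (c *\<^sub>R y)) powr a" by simp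
      also have "\<dots> = (1 + norm (c *\<^sub>R y)) powr a" unfolding 3 by simp
      also have "\<dots> \<le> (1 + norm (c *\<^sub>R y)) powr (real M)" unfolding M_def by (intro powr_mono) (linarith, simp)
      also have "\<dots> = (1 + norm (c *\<^sub>R y)) ^ M" by (rule powr_realpow) (simp add: add_pos_nonneg)
      finally show ?thesis unfolding n_def[symmetric] c_def[symmetric] by simp
    qed
    then show "\<exists>w'\<in>range (\<lambda>k i x. (1 + norm x) ^ k). \<exists>C\<ge>0. \<forall>i y. norm (complex_of_real (- l (snd i) * (1 / 2 ^ snd i) ^ DIM('a))) * \<bar>1 / 2 ^ snd i\<bar> ^ q * w i y
        \<le> C * w' i ((1 / 2 ^ snd i) *\<^sub>R y + 0)"
      by (intro bexI[of _ "\<lambda>i x. (1 + norm x) ^ M"] exI[of _ 1] conjI allI) (auto intro: rangeI)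
  qed
  have F: "fam ?W (\<lambda>i y. \<integral>n. G (i, n) y \<partial>count_space UNIV)" and Gi: "integrable (count_space UNIV) (\<lambda>n. G (i, n) y)" for i y
  proof -
    have a0: "a \<ge> 0" unfolding a using \<alpha> by simp
    have 1: "1 \<le> (1 + norm y) powr a" for y :: 'a using a0 by (intro ge_one_powr_ge_zero) auto
    note * = fam_integral[OF vi _ famG, of "\<lambda>_ x. (1 + norm x) powr a"]
    show "fam ?W (\<lambda>i y. \<integral>n. G (i, n) y \<partial>count_space UNIV)" by (rule *(1)) (auto simp: v_def 1)
    show "integrable (count_space UNIV) (\<lambda>n. G (i, n) y)" by (rule *(2)) (auto simp: v_def 1)
  qed
  have piece: "G ((), n) y = ift (\<lambda>\<xi>. - of_real (l n) * N n (2 ^ n *\<^sub>R \<xi>)) y" for n y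
    using ift_scale[of "2 ^ n" "N n" y] unfolding G_def ift_cmult by (simp add: inverse_eq_divide)
  have piece_val: "- of_real (l n) * N n (2 ^ n *\<^sub>R \<xi>) = (P (2 ^ n *\<^sub>R \<xi>) - P (2 ^ Suc n *\<^sub>R \<xi>)) * (m \<xi> - 1)" for n \<xi>
  proof -
    have "norm (2 ^ n *\<^sub>R \<xi>) powr \<alpha> = 2 powr (real n * \<alpha>) * norm \<xi> powr \<alpha>"
      by (simp add: powr_mult powr_powr[symmetric] powr_realpow)
    then have e: "l n * norm (2 ^ n *\<^sub>R \<xi>) powr \<alpha> = norm \<xi> powr \<alpha>"
      unfolding l_def by (simp add: powr_minus)
    have "- of_real (l n) * N n (2 ^ n *\<^sub>R \<xi>) = - (g (2 ^ n *\<^sub>R \<xi>) * of_real (l n * ((1 - exp (- (l n * norm (2 ^ n *\<^sub>R \<xi>) powr \<alpha>))) / l n)))"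
      unfolding N_def by (simp add: mult_ac)
    also have "\<dots> = - (g (2 ^ n *\<^sub>R \<xi>) * (1 - m \<xi>))" unfolding e using l(1)[of n] by (simp add: m_def)
    finally show ?thesis unfolding g_def by (simp add: algebra_simps)
  qed
  \<comment> \<open>The cutoffs telescope to P for \<xi> \<noteq> 0, since P vanishes at large
    arguments. At \<xi> = 0 all differences are 0, and so is the factor
    \<open>m \<xi> - 1\<close>.\<close>
  have sums: "(\<lambda>n. - of_real (l n) * N n (2 ^ n *\<^sub>R \<xi>)) sums (P \<xi> * (m \<xi> - 1))" for \<xi>
  proof (cases "\<xi> = 0")
    case True
    then show ?thesis unfolding piece_val by (simp add: m_def)
  next
    case False
    have "eventually (\<lambda>n. P (2 ^ n *\<^sub>R \<xi>) = 0) sequentially"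
    proof -
      obtain n0 where n0: "2 / norm \<xi> < 2 ^ n0" using real_arch_pow[of 2 "2 / norm \<xi>"] by auto
      show ?thesis
        using eventually_ge_at_top[of n0]
      proof eventually_elim
        case (elim n)
        then have "(2::real) ^ n0 \<le> 2 ^ n" by (intro power_increasing) auto
        then have "2 / norm \<xi> < 2 ^ n" using n0 by linarith
        then have "norm (2 ^ n *\<^sub>R \<xi>) > 2" using False by (simp add: divide_less_eq)
        then show ?case unfolding P_def by (rule lp_zero)
      qed
    qed
    then have "(\<lambda>n. P (2 ^ n *\<^sub>R \<xi>)) \<longlonglongrightarrow> 0" by (rule tendsto_eventually)
    then have "(\<lambda>n. P (2 ^ n *\<^sub>R \<xi>) - P (2 ^ Suc n *\<^sub>R \<xi>)) sums (P (2 ^ 0 *\<^sub>R \<xi>) - 0)" by (rule telescope_sums')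
    then show ?thesis unfolding piece_val using sums_mult2 by fastforce
  qed
  have "ift (\<lambda>\<xi>. P \<xi> * (m \<xi> - 1)) y = (\<integral>n. G ((), n) y \<partial>count_space UNIV)" for y
  proof -
    define B where "B = (\<lambda>n \<xi>. cis (2 * pi * (y \<bullet> \<xi>)) * (- of_real (l n) * N n (2 ^ n *\<^sub>R \<xi>)))"
    obtain C where C: "\<And>n x. (1 + norm x) ^ Suc DIM('a) * norm (N n x) \<le> C" using sch_bound[OF Ns] by metis
    have NC: "norm (N n x) \<le> C * jw x" for n x by (rule bounded_by_jw[OF C])
    have Ni: "integrable lborel (N n)" for n by (rule sch_integrable[OF Ns])
    have [measurable]: "N n \<in> borel_measurable borel" for n by (rule sch_measurable[OF Ns])
    have sc: "integrable lborel (\<lambda>\<xi>. - of_real (l n) * N n (2 ^ n *\<^sub>R \<xi>))" for n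
      using integrable_lborel_affine[OF Ni, of "2 ^ n" n 0] by simp
    have Bi: "integrable lborel (B n)" for n
      by (rule integrable_bound[OF sc[of n]]) (auto simp: B_def norm_mult)
    have nB: "(LBINT \<xi>. norm (B n \<xi>)) \<le> C * (LBINT x. jw (x::'a)) * v n" for n
    proof -
      have "(LBINT \<xi>. norm (B n \<xi>)) = (LBINT \<xi>. l n * (1 / 2 ^ n) ^ DIM('a) * norm (dil (2 ^ n) (N n) \<xi>))"
        using l(1)[of n] by (intro integral_cong refl)
          (simp add: B_def norm_mult dil_def norm_power power_divide)
      also have "\<dots> = l n * (1 / 2 ^ n) ^ DIM('a) * (LBINT \<xi>. norm (N n \<xi>))"
        by (simp add: integral_norm_dil)
      also have "\<dots> \<le> l n * (1 / 2 ^ n) ^ DIM('a) * (LBINT x. C * jw (x::'a))"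
      proof (rule mult_left_mono)
        show "(LBINT \<xi>. norm (N n \<xi>)) \<le> (LBINT x. C * jw (x::'a))"
          by (rule Bochner_Integration.integral_mono) (use NC Ni[of n] in \<open>auto intro!: integrable_mult_right integrable_jw\<close>)
      qed (use l(1)[of n] in simp)
      also have "\<dots> \<le> v n * 1 * (LBINT x. C * jw (x::'a))"
      proof -
        have "0 \<le> (LBINT x. C * jw (x::'a))"
          using NC norm_ge_zero order_trans by (intro Bochner_Integration.integral_nonneg) blast
        moreover have "l n \<le> v n" unfolding l_def v_def using \<alpha> by (intro powr_mono) auto
        ultimately show ?thesis using l(1)[of n] by (intro mult_right_mono mult_mono power_le_one) (auto simp: v_def)
      qed
      finally show ?thesis by (simp add: mult_ac)
    qed
    have "ift (\<lambda>\<xi>. P \<xi> * (m \<xi> - 1)) y = (LBINT \<xi>. (\<Sum>n. B n \<xi>))"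
      unfolding ift_eq B_def
    proof (intro integral_cong refl)
      fix \<xi>
      show "cis (2 * pi * (y \<bullet> \<xi>)) * (P \<xi> * (m \<xi> - 1)) = (\<Sum>n. cis (2 * pi * (y \<bullet> \<xi>)) * (- of_real (l n) * N n (2 ^ n *\<^sub>R \<xi>)))"
        by (rule sums_unique[OF sums_mult[OF sums]])
    qed
    also have "\<dots> = (\<Sum>n. \<integral>\<xi>. B n \<xi> \<partial>lborel)"
    proof (rule integral_suminf)
      show "integrable lborel (B n)" for n by (rule Bi)
      show "summable (\<lambda>n. \<integral>\<xi>. norm (B n \<xi>) \<partial>lborel)"
        by (rule summable_comparison_test'[where g = "\<lambda>n. C * (LBINT x. jw (x::'a)) * v n" and N = 0])
          (use nB vs in \<open>auto intro: summable_mult\<close>)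
      show "AE \<xi> in lborel. summable (\<lambda>n. norm (B n \<xi>))"
      proof (intro AE_I2)
        fix \<xi> :: 'a
        have "norm (B n \<xi>) \<le> (C * (1::real)) * v n" for n
        proof -
          have "l n \<le> v n" unfolding l_def v_def using \<alpha> by (intro powr_mono) auto
          moreover have "norm (N n (2 ^ n *\<^sub>R \<xi>)) \<le> C"
          proof -
            have "1 * norm (N n (2 ^ n *\<^sub>R \<xi>)) \<le> (1 + norm (2 ^ n *\<^sub>R \<xi>)) ^ Suc DIM('a) * norm (N n (2 ^ n *\<^sub>R \<xi>))"
              by (intro mult_right_mono one_le_power) auto
            then show ?thesis using C[of "2 ^ n *\<^sub>R \<xi>" n] by linarith
          qed
          ultimately have "l n * norm (N n (2 ^ n *\<^sub>R \<xi>)) \<le> v n * C" using l(1)[of n] by (intro mult_mono) (auto simp: v_def)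
          then show ?thesis using l(1)[of n] by (simp add: B_def norm_mult mult_ac)
        qed
        then have "norm (norm (B n \<xi>)) \<le> (C * 1) * v n" for n by simp
        then show "summable (\<lambda>n. norm (B n \<xi>))"
          by (rule summable_comparison_test'[OF summable_mult[OF vs]])
      qed
    qed
    also have "\<dots> = (\<Sum>n. G ((), n) y)" unfolding piece B_def ift_eq ..
    also have "\<dots> = (\<integral>n. G ((), n) y \<partial>count_space UNIV)"
      by (rule integral_count_space_nat[OF Gi, symmetric])
    finally show ?thesis .
  qed
  then have "(\<lambda>_::unit. ift (\<lambda>\<xi>. P \<xi> * (m \<xi> - 1))) = (\<lambda>i y. \<integral>n. G (i, n) y \<partial>count_space UNIV)"
    by (simp add: fun_eq_iff)
  then show ?thesis using F unfolding P_def m_def by simp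
qed

text \<open>The symbol m is split as \<open>P + (1 - P) * m + P * (m - 1)\<close>: a Schwartz
  function, the high frequencies, and the low frequencies with the singularity at the origin. Only
  the last part limits the decay.\<close>

theorem heat_kernel_fam:
  assumes \<alpha>: "\<alpha> > 0" and a: "a = DIM('a) + \<alpha> / 2"
  shows "fam {\<lambda>_ x. (1 + norm x) powr a} (\<lambda>_::unit. heat_kernel \<alpha> 1 :: 'a \<Rightarrow> complex)"
proof -
  let ?m = "\<lambda>\<xi>::'a. complex_of_real (exp (- (norm \<xi> powr \<alpha>)))"
  let ?P = "fourier \<Phi>"
  have sw: "fam {\<lambda>_ x. (1 + norm x) powr a} (\<lambda>_::unit. h)" if "sch1 h" for h :: "'a \<Rightarrow> complex"
  proof (rule fam_weaken[OF that[unfolded sch_def]])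
    fix w :: "unit \<Rightarrow> 'a \<Rightarrow> real" assume "w \<in> {\<lambda>_ x. (1 + norm x) powr a}"
    then have w: "w = (\<lambda>_ x. (1 + norm x) powr a)" by simp
    have "(1 + norm x) powr a \<le> 1 * (1 + norm x) ^ (nat \<lceil>a\<rceil>)" for x :: 'a
    proof -
      have "(1 + norm x) powr a \<le> (1 + norm x) powr (real (nat \<lceil>a\<rceil>))" by (intro powr_mono) (linarith, simp)
      also have "\<dots> = (1 + norm x) ^ (nat \<lceil>a\<rceil>)" by (rule powr_realpow) (simp add: add_pos_nonneg)
      finally show ?thesis by simp
    qed
    then show "\<exists>w'\<in>range (\<lambda>k i x. (1 + norm x) ^ k). \<exists>C\<ge>0. \<forall>i x. w i x \<le> C * w' i x"
      unfolding w by (intro bexI[of _ "\<lambda>i x. (1 + norm x) ^ (nat \<lceil>a\<rceil>)"] exI[of _ 1]) auto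
  qed
  have Ps: "sch1 ?P" by (rule sch_fourier[OF lp_sch1])
  have mi: "integrable lborel ?m" by (rule heat_symbol_integrable[OF \<alpha>])
  have Pi: "integrable lborel ?P" by (rule sch_integrable[OF Ps])
  have hi: "integrable lborel (\<lambda>\<xi>. (1 - ?P \<xi>) * ?m \<xi>)" by (rule sch_integrable[OF heat_high_sch[OF \<alpha>]])
  have "integrable lborel (\<lambda>\<xi>. ?m \<xi> - ?P \<xi> - (1 - ?P \<xi>) * ?m \<xi>)"
    using mi Pi hi by (intro Bochner_Integration.integrable_diff)
  then have li: "integrable lborel (\<lambda>\<xi>. ?P \<xi> * (?m \<xi> - 1))" by (simp add: algebra_simps)
  have dec: "heat_kernel \<alpha> 1 x = (ift ?P x + ift (\<lambda>\<xi>. (1 - ?P \<xi>) * ?m \<xi>) x) + ift (\<lambda>\<xi>. ?P \<xi> * (?m \<xi> - 1)) x" for x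
  proof -
    have "heat_kernel \<alpha> 1 x = ift (\<lambda>\<xi>. (?P \<xi> + (1 - ?P \<xi>) * ?m \<xi>) + ?P \<xi> * (?m \<xi> - 1)) x"
      unfolding heat_kernel_def ift_eq by (intro integral_cong refl) (simp add: algebra_simps)
    then show ?thesis using Pi hi li by (simp add: ift_add)
  qed
  have "fam {\<lambda>_ x. (1 + norm x) powr a} (\<lambda>(_::unit) x. (ift ?P x + ift (\<lambda>\<xi>. (1 - ?P \<xi>) * ?m \<xi>) x) + ift (\<lambda>\<xi>. ?P \<xi> * (?m \<xi> - 1)) x)"
    by (intro fam_add sw heat_low_fam[OF \<alpha> a] sch_ift[OF Ps] sch_ift[OF heat_high_sch[OF \<alpha>]])
  then show ?thesis unfolding dec[abs_def, symmetric] dec[symmetric] by simp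
qed

end

section \<open>Tempered distributions\<close>

lemma tempered_linear:
  assumes "tempered u" "sch1 \<phi>" "sch1 \<psi>"
  shows "u (\<lambda>x. a * \<phi> x + b * \<psi> x) = a * u \<phi> + b * u \<psi>"
  using assms schwartz_sch1 unfolding tempered_def by blast

lemma tempered_cmult: "tempered u \<Longrightarrow> sch1 \<phi> \<Longrightarrow> u (\<lambda>x. a * \<phi> x) = a * u \<phi>"
  using tempered_linear[of u \<phi> \<phi> a 0] by simp

lemma tempered_add: "tempered u \<Longrightarrow> sch1 \<phi> \<Longrightarrow> sch1 \<psi> \<Longrightarrow> u (\<lambda>x. \<phi> x + \<psi> x) = u \<phi> + u \<psi>"
  using tempered_linear[of u \<phi> \<psi> 1 1] by simp

lemma tempered_diff: "tempered u \<Longrightarrow> sch1 \<phi> \<Longrightarrow> sch1 \<psi> \<Longrightarrow> u (\<lambda>x. \<phi> x - \<psi> x) = u \<phi> - u \<psi>"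
  using tempered_linear[of u \<phi> \<psi> 1 "-1"] by simp

lemma sch1_zero: "sch1 (\<lambda>_::'a::euclidean_space. 0)"
  unfolding sch_def by (rule fam_0)

lemma tempered_sum:
  assumes u: "tempered u" and "finite J" "\<And>j. j \<in> J \<Longrightarrow> sch1 (\<phi> j)"
  shows "u (\<lambda>x. \<Sum>j\<in>J. \<phi> j x) = (\<Sum>j\<in>J. u (\<phi> j))"
  using assms(2,3)
proof (induction J rule: finite_induct)
  case empty
  then show ?case using tempered_cmult[OF u sch1_zero, of 0] by simp
next
  case (insert j J)
  have "sch1 (\<lambda>x. \<Sum>j\<in>J. \<phi> j x)" using insert by (intro sch_sum) auto
  then show ?case using insert by (simp add: tempered_add[OF u])
qed

lemma schwartz_seminorm_le:
  "(\<And>x. norm x ^ k * norm (iter_deriv bs \<phi> x) \<le> C) \<Longrightarrow> schwartz_seminorm k bs \<phi> \<le> C"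
  unfolding schwartz_seminorm_def by (intro cSUP_least) auto

lemma schwartz_seminorm_ge:
  assumes "sch1 \<phi>" "set bs \<subseteq> Basis"
  shows "norm x ^ k * norm (iter_deriv bs \<phi> x) \<le> schwartz_seminorm k bs \<phi>"
proof -
  obtain C where C: "\<And>x. (1 + norm x) ^ k * norm (iter_deriv bs \<phi> x) \<le> C"
    using sch_bound_deriv[OF assms] by metis
  have "norm x ^ k * norm (iter_deriv bs \<phi> x) \<le> C" for x
    by (rule order_trans[OF _ C[of x]]) (intro mult_right_mono power_mono, auto)
  then show ?thesis unfolding schwartz_seminorm_def by (intro cSUP_upper bdd_aboveI2) auto
qed

text \<open>The finitely many seminorms in the continuity estimate are bounded along a Schwartz
  family. All limits exchanged with u below are obtained by applying this to a suitable family of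
  scaled errors.\<close>

lemma tempered_bounded:
  fixes H :: "'i \<Rightarrow> 'a::euclidean_space \<Rightarrow> complex"
  assumes u: "tempered u" and H: "sch H"
  obtains C where "C \<ge> 0" "\<And>i. norm (u (H i)) \<le> C"
proof -
  let ?L = "\<lambda>N::nat. {bs :: 'a list. set bs \<subseteq> Basis \<and> length bs \<le> N}"
  obtain D N where D: "\<And>\<phi>. sch1 \<phi> \<Longrightarrow> norm (u \<phi>) \<le> D * (\<Sum>k\<le>N. \<Sum>bs\<in>?L N. schwartz_seminorm k bs \<phi>)"
    using u schwartz_sch1 unfolding tempered_def by blast
  have ex: "\<exists>C\<ge>0. \<forall>i. schwartz_seminorm k bs (H i) \<le> C" if bs: "set bs \<subseteq> Basis" for k bs
  proof -
    obtain C where C: "C \<ge> 0" "\<And>i x. (1 + norm x) ^ k * norm (iter_deriv bs (H i) x) \<le> C"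
      using sch_bound_deriv[OF H bs] by metis
    have "norm x ^ k * norm (iter_deriv bs (H i) x) \<le> C" for i x
      by (rule order_trans[OF _ C(2)[of x i]]) (intro mult_right_mono power_mono, auto)
    then show ?thesis using C(1) schwartz_seminorm_le by metis
  qed
  have ex': "\<exists>C. \<forall>i. set bs \<subseteq> Basis \<longrightarrow> C \<ge> 0 \<and> schwartz_seminorm k bs (H i) \<le> C" for k and bs :: "'a list"
  proof (cases "set bs \<subseteq> Basis")
    case True
    then show ?thesis using ex[OF True, of k] by blast
  qed simp
  define C where "C = (\<lambda>k bs. SOME C. \<forall>i. set bs \<subseteq> Basis \<longrightarrow> C \<ge> 0 \<and> schwartz_seminorm k bs (H i) \<le> C)"
  have C: "C k bs \<ge> 0 \<and> schwartz_seminorm k bs (H i) \<le> C k bs" if "set bs \<subseteq> Basis" for k bs i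
    using someI_ex[OF ex', of bs k] that unfolding C_def by blast
  have sn0: "0 \<le> schwartz_seminorm k bs (H i)" if "set bs \<subseteq> Basis" for k bs i
    using schwartz_seminorm_ge[OF sch_reindex[OF H, of "\<lambda>_. i"] that, of 0 k]
    by (metis mult_nonneg_nonneg norm_ge_zero order_trans zero_le_power)
  have "norm (u (H i)) \<le> \<bar>D\<bar> * (\<Sum>k\<le>N. \<Sum>bs\<in>?L N. C k bs)" for i
  proof -
    have "norm (u (H i)) \<le> D * (\<Sum>k\<le>N. \<Sum>bs\<in>?L N. schwartz_seminorm k bs (H i))"
      by (rule D[OF sch_reindex[OF H]])
    also have "\<dots> \<le> \<bar>D\<bar> * (\<Sum>k\<le>N. \<Sum>bs\<in>?L N. schwartz_seminorm k bs (H i))"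
      using sn0 by (intro mult_right_mono sum_nonneg) auto
    also have "\<dots> \<le> \<bar>D\<bar> * (\<Sum>k\<le>N. \<Sum>bs\<in>?L N. C k bs)"
      using C by (intro mult_left_mono sum_mono) auto
    finally show ?thesis .
  qed
  moreover have "0 \<le> \<bar>D\<bar> * (\<Sum>k\<le>N. \<Sum>bs\<in>?L N. C k bs)"
    using C by (intro mult_nonneg_nonneg sum_nonneg) auto
  ultimately show thesis using that by blast
qed

lemma rapid_divide_jw:
  fixes f :: "'i \<Rightarrow> 'a::euclidean_space \<Rightarrow> complex"
  assumes "rapid f"
  shows "rapid (\<lambda>i x. f i x / of_real (jw x))"
  unfolding rapid_def
proof
  fix k
  obtain C where C: "\<And>i x. (1 + norm x) ^ (k + Suc DIM('a)) * norm (f i x) \<le> C" using assms unfolding rapid_def by metis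
  have "(1 + norm x) ^ k * norm (f i x / of_real (jw x)) \<le> C" for i x
    using C[of x i] less_imp_le[OF jw_pos[of x]] unfolding norm_divide norm_of_real
    by (simp add: jw_def power_add mult_ac abs_of_nonneg)
  then show "\<exists>C. \<forall>i x. (1 + norm x) ^ k * norm (f i x / of_real (jw x)) \<le> C" by blast
qed

lemma sch_translates:
  fixes f :: "'i \<Rightarrow> 'a::euclidean_space \<Rightarrow> complex"
  assumes f: "rapid f" and g: "sch g" and c: "\<bar>c\<bar> = 1"
  shows "sch (\<lambda>(i, y) x. f i y * g i (c *\<^sub>R x + (- c) *\<^sub>R y))"
  unfolding sch_def
proof (rule fam_weaken[OF fam_translates[OF assms]])
  fix w :: "'i \<times> 'a \<Rightarrow> 'a \<Rightarrow> real" assume "w \<in> range (\<lambda>k i x. (1 + norm x) ^ k)"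
  then obtain k where w: "w = (\<lambda>i x. (1 + norm x) ^ k)" by blast
  have j: "jw x \<le> 1" for x :: 'a unfolding jw_def by (simp add: divide_le_eq add_pos_nonneg one_le_power del: power_Suc)
  have "(1 + norm y) ^ k \<le> (1 + norm y) ^ k / jw x" for x y :: 'a
    using jw_pos[of x] j[of x] by (simp add: le_divide_eq mult_left_le)
  then have "w i x \<le> 1 * (case i of (i, x) \<Rightarrow> \<lambda>y. (1 + norm y) ^ k / jw x) x" for i x
    unfolding w by (cases i) simp
  then show "\<exists>w'\<in>(\<lambda>w (i, x) y. w i y / jw x) ` range (\<lambda>k i x. (1 + norm x) ^ k). \<exists>C\<ge>0. \<forall>i x. w i x \<le> C * w' i x"
    by (intro bexI[of _ "\<lambda>(i, x) y. (1 + norm y) ^ k / jw x"] exI[of _ 1] conjI allI) (auto simp: image_iff)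
qed

text \<open>Uniform boundedness of difference quotients is the form of differentiability that
  \<open>tempered_bounded\<close> can use. The cut at |h| \<le> 1 keeps weights comparable, and h =
  0 is harmless because \<open>1 / 0 = 0\<close>.\<close>

lemma sch_difference_quotients:
  fixes g :: "'i \<Rightarrow> 'a::euclidean_space \<Rightarrow> complex"
  assumes "sch g"
  shows "sch (\<lambda>(i, h) y. of_real (if norm h \<le> 1 then 1 / norm h else 0) * (g i (y + h) - g i y))"
  unfolding sch_def
proof (rule fam_coinduct[where X = "{\<lambda>(i, h) y. of_real (if norm h \<le> 1 then 1 / norm h else 0) * (g i (y + h) - g i y) | g :: 'i \<Rightarrow> 'a \<Rightarrow> complex. sch g}"])
  fix K :: "'i \<times> 'a \<Rightarrow> 'a \<Rightarrow> complex" and k x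
  assume "K \<in> {\<lambda>(i, h) y. of_real (if norm h \<le> 1 then 1 / norm h else 0) * (g i (y + h) - g i y) | g :: 'i \<Rightarrow> 'a \<Rightarrow> complex. sch g}"
  then obtain g where K: "K = (\<lambda>(i, h) y. of_real (if norm h \<le> 1 then 1 / norm h else 0) * (g i (y + h) - g i y))" and g: "sch g" by blast
  have "(\<lambda>y. g i (1 *\<^sub>R y + h)) differentiable (at x)" for i h
    by (intro differentiable_affine_comp sch_differentiable[OF g])
  then show "K k differentiable (at x)"
    unfolding K case_prod_beta
    by (intro differentiable_mult differentiable_const differentiable_diff sch_differentiable[OF g]) simp
next
  fix K :: "'i \<times> 'a \<Rightarrow> 'a \<Rightarrow> complex" and w :: "'i \<times> 'a \<Rightarrow> 'a \<Rightarrow> real"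
  assume "K \<in> {\<lambda>(i, h) y. of_real (if norm h \<le> 1 then 1 / norm h else 0) * (g i (y + h) - g i y) | g :: 'i \<Rightarrow> 'a \<Rightarrow> complex. sch g}"
    and "w \<in> range (\<lambda>k i x. (1 + norm x) ^ k)"
  then obtain g k where K: "K = (\<lambda>(i, h) y. of_real (if norm h \<le> 1 then 1 / norm h else 0) * (g i (y + h) - g i y))" and g: "sch g"
    and w: "w = (\<lambda>i x. (1 + norm x) ^ k)" by blast
  obtain C where C: "C \<ge> 0" "\<And>i x h. norm h \<le> 1 \<Longrightarrow> (1 + norm x) ^ k * norm (g i (x + h) - g i x) \<le> C * norm h"
    using sch_lipschitz[OF g] by metis
  have "w p y * norm (K p y) \<le> C" for p y
  proof (cases p)
    case (Pair i h)
    show ?thesis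
    proof (cases "norm h \<le> 1 \<and> h \<noteq> 0")
      case True
      then show ?thesis using C(2)[of h y i] by (simp add: Pair K w norm_mult norm_divide divide_le_eq mult.assoc)
    next
      case False
      then show ?thesis using C(1) by (auto simp: Pair K)
    qed
  qed
  then show "\<exists>C. \<forall>i x. w i x * norm (K i x) \<le> C" by blast
next
  fix K :: "'i \<times> 'a \<Rightarrow> 'a \<Rightarrow> complex" and b :: 'a
  assume "K \<in> {\<lambda>(i, h) y. of_real (if norm h \<le> 1 then 1 / norm h else 0) * (g i (y + h) - g i y) | g :: 'i \<Rightarrow> 'a \<Rightarrow> complex. sch g}"
    and b: "b \<in> Basis"
  then obtain g where K: "K = (\<lambda>(i, h) y. of_real (if norm h \<le> 1 then 1 / norm h else 0) * (g i (y + h) - g i y))" and g: "sch g" by blast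
  have d: "(\<lambda>y. g i (y + h)) differentiable (at x)" "pd b (\<lambda>y. g i (y + h)) x = pd b (g i) (x + h)" for i h x
    using differentiable_affine_comp[of "g i" 1 x h] pd_affine[of "g i" 1 x h b] sch_differentiable[OF g] by auto
  have d2: "pd b (\<lambda>y. g i (y + h) - g i y) x = pd b (g i) (x + h) - pd b (g i) x" for i h x
  proof -
    note gd = sch_differentiable[OF g, of i x]
    have "pd b (\<lambda>y. g i (y + h) + (-1) * g i y) x = pd b (\<lambda>y. g i (y + h)) x + pd b (\<lambda>y. (-1) * g i y) x"
      by (rule pd_add[OF d(1) differentiable_mult[OF differentiable_const gd]])
    then show ?thesis using pd_cmult[OF gd, of b "-1"] d(2)[of i h x] by simp
  qed
  have "(\<lambda>p. pd b (K p)) = (\<lambda>(i, h) y. of_real (if norm h \<le> 1 then 1 / norm h else 0) * (pd b (g i) (y + h) - pd b (g i) y))"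
    unfolding K by (intro ext) (simp add: case_prod_beta pd_cmult d(1) d2 differentiable_diff sch_differentiable[OF g])
  then show "(\<lambda>p. pd b (K p)) \<in> {\<lambda>(i, h) y. of_real (if norm h \<le> 1 then 1 / norm h else 0) * (g i (y + h) - g i y) | g :: 'i \<Rightarrow> 'a \<Rightarrow> complex. sch g}"
    using sch_pd[OF g b] by (intro CollectI exI[of _ "\<lambda>i. pd b (g i)"]) simp
qed (use assms in blast)

lemma sch1_reflect: "sch1 g \<Longrightarrow> sch1 (\<lambda>y. g (x - y))"
  using sch_affine_fixed[of "\<lambda>_::unit. g" "-1" x] by simp

text \<open>Applying u to the bounded family of difference quotients yields a local Lipschitz
  bound.\<close>

lemma continuous_tempered_translates:
  fixes g :: "'a::euclidean_space \<Rightarrow> complex"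
  assumes u: "tempered u" and g: "sch1 g"
  shows "continuous_on UNIV (\<lambda>x. u (\<lambda>y. g (x - y)))"
proof -
  have "isCont (\<lambda>x. u (\<lambda>y. g (x - y))) x" for x
  proof -
    let ?g = "\<lambda>y. g (x - y)"
    have gx: "sch1 ?g" by (rule sch1_reflect[OF g])
    have "sch (\<lambda>p y. of_real (if norm p \<le> 1 then 1 / norm p else 0) * (?g (y - p) - ?g y))"
      using sch_reindex[OF sch_difference_quotients[OF gx], of "\<lambda>p. ((), - p)"]
      by (simp only: prod.case norm_minus_cancel add_uminus_conv_diff)
    then obtain C where C: "C \<ge> 0" "\<And>h. norm (u (\<lambda>y. of_real (if norm h \<le> 1 then 1 / norm h else 0) * (?g (y - h) - ?g y))) \<le> C"
      by (rule tempered_bounded[OF u], blast)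
    have lip: "norm (u (\<lambda>y. g (x + h - y)) - u ?g) \<le> C * norm h" if h: "norm h \<le> 1" for h
    proof (cases "h = 0")
      case False
      have e: "(\<lambda>y. ?g (y - h)) = (\<lambda>y. g (x + h - y))" by (simp add: algebra_simps)
      have s: "sch1 (\<lambda>y. g (x + h - y))" by (rule sch1_reflect[OF g])
      have "u (\<lambda>y. of_real (1 / norm h) * (g (x + h - y) - ?g y)) = of_real (1 / norm h) * (u (\<lambda>y. g (x + h - y)) - u ?g)"
        by (simp only: tempered_cmult[OF u sch_diff[OF s gx]] tempered_diff[OF u s gx])
      then have "1 / norm h * norm (u (\<lambda>y. g (x + h - y)) - u ?g) \<le> C"
        using C(2)[of h] h unfolding fun_cong[OF e] by (simp add: norm_mult norm_divide)
      then show ?thesis using False by (simp add: divide_le_eq mult.commute)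
    qed simp
    show ?thesis
      unfolding isCont_iff
    proof (rule LIM_zero_cancel, rule Lim_null_comparison)
      show "\<forall>\<^sub>F h in at 0. norm (u (\<lambda>y. g (x + h - y)) - u ?g) \<le> C * norm h"
        unfolding eventually_at using lip by (intro exI[of _ 1]) (auto simp: dist_norm less_imp_le)
      have "((\<lambda>h::'a. C * norm h) \<longlongrightarrow> C * 0) (at 0)"
        by (intro tendsto_mult tendsto_const tendsto_norm_zero tendsto_ident_at)
      then show "((\<lambda>h::'a. C * norm h) \<longlongrightarrow> 0) (at 0)" by simp
    qed
  qed
  then show ?thesis by (simp add: continuous_at_imp_continuous_on)
qed

text \<open>Rounding to a grid turns integrals of test functions into finite sums, which commute with a
  tempered distribution.\<close>

definition grid_round :: "nat \<Rightarrow> 'a::euclidean_space \<Rightarrow> 'a" where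
  "grid_round n x = (\<Sum>b\<in>Basis. (of_int \<lfloor>real (DIM('a) * Suc n) * (x \<bullet> b)\<rfloor> / real (DIM('a) * Suc n)) *\<^sub>R b)"

lemma grid_round_dist: "norm (grid_round n x - x) \<le> 1 / real (Suc n)"
proof -
  \<comment> \<open>The factor \<open>DIM('a)\<close> in the mesh compensates for the l1 norm, which
    adds up one error of size 1 / m per coordinate.\<close>
  define m where "m = real (DIM('a) * Suc n)"
  have m: "m > 0" unfolding m_def by (simp only: of_nat_0_less_iff nat_0_less_mult_iff DIM_positive zero_less_Suc simp_thms)
  have g: "grid_round n x = (\<Sum>b\<in>Basis. (of_int \<lfloor>m * (x \<bullet> b)\<rfloor> / m) *\<^sub>R b)" unfolding grid_round_def m_def ..
  have "norm (grid_round n x - x) \<le> (\<Sum>b\<in>Basis. \<bar>(grid_round n x - x) \<bullet> b\<bar>)" by (rule norm_le_l1)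
  also have "\<dots> \<le> (\<Sum>b\<in>(Basis::'a set). 1 / m)"
  proof (rule sum_mono)
    fix b :: 'a assume b: "b \<in> Basis"
    have e: "(grid_round n x - x) \<bullet> b = (of_int \<lfloor>m * (x \<bullet> b)\<rfloor> - m * (x \<bullet> b)) / m"
      using b m by (simp add: g inner_diff_left diff_divide_distrib)
    have "\<bar>of_int \<lfloor>m * (x \<bullet> b)\<rfloor> - m * (x \<bullet> b)\<bar> \<le> 1" by linarith
    then show "\<bar>(grid_round n x - x) \<bullet> b\<bar> \<le> 1 / m"
      unfolding e abs_divide using m by (simp add: divide_right_mono)
  qed
  also have "\<dots> = 1 / real (Suc n)" unfolding m_def of_nat_mult by simp
  finally show ?thesis .
qed

lemma grid_round_measurable[measurable]: "grid_round n \<in> borel_measurable borel"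
  unfolding grid_round_def[abs_def] by measurable

text \<open>The restriction to the ball of radius n makes the nodes finite in number; the missing
  tail is charged to \<open>grid_error\<close>.\<close>

definition grid_nodes :: "nat \<Rightarrow> 'a::euclidean_space set" where
  "grid_nodes n = {v \<in> range (grid_round n). norm v \<le> real n}"

lemma finite_grid_nodes: "finite (grid_nodes n :: 'a::euclidean_space set)"
proof -
  define m where "m = real (DIM('a) * Suc n)"
  have m: "m > 0" unfolding m_def by (simp only: of_nat_0_less_iff nat_0_less_mult_iff DIM_positive zero_less_Suc simp_thms)
  have g: "grid_round n x = (\<Sum>b\<in>Basis. (of_int \<lfloor>m * (x \<bullet> b)\<rfloor> / m) *\<^sub>R b)" for x :: 'a unfolding grid_round_def m_def ..
  define N where "N = \<lceil>m * real n\<rceil>"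
  define A where "A = PiE (Basis :: 'a set) (\<lambda>_. {- N..N})"
  have "finite A" unfolding A_def by (intro finite_PiE) auto
  moreover have "grid_nodes n \<subseteq> (\<lambda>f. \<Sum>b\<in>Basis. (of_int (f b) / m) *\<^sub>R b) ` A"
  proof
    fix v :: 'a assume "v \<in> grid_nodes n"
    then obtain x where v: "v = grid_round n x" and le: "norm v \<le> real n" unfolding grid_nodes_def by blast
    define f where "f = restrict (\<lambda>b. \<lfloor>m * (x \<bullet> b)\<rfloor>) Basis"
    have "f \<in> A" unfolding A_def
    proof (rule PiE_I)
      fix b :: 'a assume b: "b \<in> Basis"
      have "v \<bullet> b = of_int \<lfloor>m * (x \<bullet> b)\<rfloor> / m" using b by (simp add: v g)
      moreover have "\<bar>v \<bullet> b\<bar> \<le> real n" using Basis_le_norm[OF b, of v] le by linarith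
      ultimately have "\<bar>of_int \<lfloor>m * (x \<bullet> b)\<rfloor>\<bar> \<le> m * real n" using m by (simp add: abs_divide divide_le_eq mult.commute)
      then show "f b \<in> {- N..N}" using b unfolding f_def N_def by simp linarith
    qed (simp add: f_def)
    moreover have "v = (\<Sum>b\<in>Basis. (of_int (f b) / m) *\<^sub>R b)"
      unfolding v g by (intro sum.cong) (auto simp: f_def)
    ultimately show "v \<in> (\<lambda>f. \<Sum>b\<in>Basis. (of_int (f b) / m) *\<^sub>R b) ` A" by blast
  qed
  ultimately show ?thesis using finite_surj by blast
qed

lemma integral_grid:
  fixes q :: "'a::euclidean_space \<Rightarrow> complex"
  shows "(LBINT x. (if norm (grid_round n x) \<le> real n then q (grid_round n x) else 0))
     = (\<Sum>v\<in>grid_nodes n. of_real (measure lborel (grid_round n -` {v})) * q v)"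
proof -
  have m: "grid_round n -` {v} \<in> sets lborel" for v :: 'a
    using measurable_sets[OF grid_round_measurable, of "{v}" n] by simp
  have fin: "emeasure lborel (grid_round n -` {v}) < \<infinity>" for v :: 'a
  proof -
    have "grid_round n -` {v} \<subseteq> cball v 1"
    proof
      fix x assume "x \<in> grid_round n -` {v}"
      then have "norm (v - x) \<le> 1 / real (Suc n)" using grid_round_dist[of n x] by auto
      also have "\<dots> \<le> 1" by simp
      finally show "x \<in> cball v 1" by (simp add: dist_norm)
    qed
    then have "emeasure lborel (grid_round n -` {v}) \<le> emeasure lborel (cball v 1)" by (intro emeasure_mono) auto
    also have "\<dots> < \<infinity>" by (rule emeasure_lborel_cball_finite)
    finally show ?thesis .
  qed
  have e: "(if norm (grid_round n x) \<le> real n then q (grid_round n x) else 0) = (\<Sum>v\<in>grid_nodes n. indicator (grid_round n -` {v}) x *\<^sub>R q v)" for x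
  proof -
    have "(\<Sum>v\<in>grid_nodes n. indicator (grid_round n -` {v}) x *\<^sub>R q v) = (\<Sum>v\<in>grid_nodes n. if v = grid_round n x then q v else 0)"
      by (intro sum.cong) (auto simp: indicator_def)
    also have "\<dots> = (if grid_round n x \<in> grid_nodes n then q (grid_round n x) else 0)"
      by (rule sum.delta[OF finite_grid_nodes])
    finally show ?thesis by (simp add: grid_nodes_def)
  qed
  have i: "integrable lborel (\<lambda>x. indicator (grid_round n -` {v}) x *\<^sub>R q v)" for v
    using m[of v] fin[of v] by (intro integrable_scaleR_left) (auto intro!: integrable_real_indicator)
  have "(LBINT x. (if norm (grid_round n x) \<le> real n then q (grid_round n x) else 0))
     = (\<Sum>v\<in>grid_nodes n. \<integral>x. indicator (grid_round n -` {v}) x *\<^sub>R q v \<partial>lborel)"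
    unfolding e by (rule Bochner_Integration.integral_sum) (rule i)
  also have "\<dots> = (\<Sum>v\<in>grid_nodes n. of_real (measure lborel (grid_round n -` {v})) * q v)"
    by (intro sum.cong refl) (simp add: scaleR_conv_of_real)
  finally show ?thesis .
qed

lemma grid_round_eq_add: "\<exists>h. norm h \<le> 1 / real (Suc n) \<and> norm h \<le> 1 \<and> grid_round n x = x + h"
proof -
  have 1: "norm (grid_round n x - x) \<le> 1 / real (Suc n)" by (rule grid_round_dist)
  have 2: "1 / real (Suc n) \<le> 1" by simp
  show ?thesis using 1 order_trans[OF 1 2] by (intro exI[of _ "grid_round n x - x"]) auto
qed

lemma grid_round_LIMSEQ: "(\<lambda>n. grid_round n x) \<longlonglongrightarrow> x"
proof -
  have "(\<lambda>n. 1 / real (Suc n)) \<longlonglongrightarrow> 0" using LIMSEQ_Suc[OF lim_inverse_n'] by (simp add: inverse_eq_divide)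
  moreover have "\<forall>\<^sub>F n in sequentially. norm (grid_round n x - x) \<le> 1 / real (Suc n)"
    by (intro always_eventually allI grid_round_dist)
  ultimately have "(\<lambda>n. grid_round n x - x) \<longlonglongrightarrow> 0" by (rule Lim_null_comparison[rotated])
  then show ?thesis by (rule LIM_zero_cancel)
qed

text \<open>Integrand minus its grid approximation, magnified by n + 1. That this family is bounded,
  uniformly in n and with an integrable majorant in x, means that the Riemann sums converge at rate
  \<open>1 / (n + 1)\<close> in every Schwartz seminorm.\<close>

definition grid_error :: "('a::euclidean_space \<Rightarrow> complex) \<Rightarrow> ('a \<Rightarrow> complex) \<Rightarrow> nat \<times> 'a \<Rightarrow> 'a \<Rightarrow> complex" where
  "grid_error \<phi> g = (\<lambda>(n, x) y. of_nat (Suc n) * (\<phi> x * g (x - y) -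
     (if norm (grid_round n x) \<le> real n then \<phi> (grid_round n x) * g (grid_round n x - y) else 0)))"

text \<open>Two regimes. If the node lies in the ball, Lipschitz bounds for both factors give
  \<open>norm h \<le> 1 / (n + 1)\<close>. If it lies outside, n + 1 is at most
  \<open>2 * (1 + norm x)\<close>, and one more power of the decay of \<phi> absorbs it.\<close>

lemma grid_error_bound:
  fixes \<phi> g :: "'a::euclidean_space \<Rightarrow> complex"
  assumes \<phi>: "sch1 \<phi>" and g: "sch1 g"
  shows "\<exists>C. \<forall>p y. (1 + norm y) ^ k / jw (snd p) * norm (grid_error \<phi> g p y) \<le> C"
proof -
  define M where "M = k + Suc DIM('a)"
  obtain A where A: "A \<ge> 0" "\<And>x. (1 + norm x) ^ Suc M * norm (\<phi> x) \<le> A" using sch_bound[OF \<phi>] by metis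
  obtain B where B: "B \<ge> 0" "\<And>x. (1 + norm x) ^ k * norm (g x) \<le> B" using sch_bound[OF g] by metis
  obtain C where C: "C \<ge> 0" "\<And>x h. norm h \<le> 1 \<Longrightarrow> (1 + norm x) ^ M * norm (\<phi> (x + h) - \<phi> x) \<le> C * norm h"
    using sch_lipschitz[OF \<phi>] by metis
  obtain D where D: "D \<ge> 0" "\<And>x h. norm h \<le> 1 \<Longrightarrow> (1 + norm x) ^ k * norm (g (x + h) - g x) \<le> D * norm h"
    using sch_lipschitz[OF g] by metis
  have A': "(1 + norm x) ^ M * norm (\<phi> x) \<le> A" for x
  proof -
    have "(1 + norm x) ^ M * norm (\<phi> x) \<le> (1 + norm x) ^ Suc M * norm (\<phi> x)"
      by (intro mult_right_mono power_increasing) auto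
    then show ?thesis using A(2)[of x] by linarith
  qed
  define E where "E = C * B + 2 ^ M * A * D + 2 * A * B"
  have E1: "C * B + 2 ^ M * A * D \<le> E" "2 * A * B \<le> E" unfolding E_def using A(1) B(1) C(1) D(1) by auto
  have main: "(1 + norm x) ^ M * (1 + norm (x - y)) ^ k * norm (grid_error \<phi> g (n, x) y) \<le> E" for n x y
  proof -
    obtain h where h: "norm h \<le> 1 / real (Suc n)" "norm h \<le> 1" "grid_round n x = x + h" using grid_round_eq_add by metis
    have hn: "real (Suc n) * norm h \<le> 1" using h(1) by (simp add: field_simps)
    show ?thesis
    proof (cases "norm (x + h) \<le> real n")
      case True
      let ?w = "(1 + norm x) ^ M" and ?z = "(1 + norm (x - y)) ^ k"
      have jp: "?w \<le> 2 ^ M * (1 + norm (x + h)) ^ M"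
      proof -
        have "1 + norm x \<le> (1 + norm (x + h)) * (1 + norm h)" by (rule jp_triangle)
        also have "\<dots> \<le> (1 + norm (x + h)) * 2" using h(2) by (intro mult_left_mono) auto
        finally have "?w \<le> ((1 + norm (x + h)) * 2) ^ M" by (intro power_mono) auto
        then show ?thesis by (simp only: power_mult_distrib mult.commute)
      qed
      have 1: "?w * norm (\<phi> (x + h)) \<le> 2 ^ M * A"
      proof -
        have "?w * norm (\<phi> (x + h)) \<le> (2 ^ M * (1 + norm (x + h)) ^ M) * norm (\<phi> (x + h))" by (intro mult_right_mono jp) auto
        also have "\<dots> \<le> 2 ^ M * A" using A'[of "x + h"] by (simp add: mult.assoc)
        finally show ?thesis .
      qed
      have e: "\<phi> x * g (x - y) - \<phi> (x + h) * g (x + h - y) = - ((\<phi> (x + h) - \<phi> x) * g (x - y)) - \<phi> (x + h) * (g ((x - y) + h) - g (x - y))"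
        by (simp add: algebra_simps)
      have "norm (\<phi> x * g (x - y) - \<phi> (x + h) * g (x + h - y)) \<le> norm (\<phi> (x + h) - \<phi> x) * norm (g (x - y)) + norm (\<phi> (x + h)) * norm (g ((x - y) + h) - g (x - y))"
        unfolding e by (rule order_trans[OF norm_triangle_ineq4]) (simp add: norm_mult)
      then have "?w * ?z * norm (\<phi> x * g (x - y) - \<phi> (x + h) * g (x + h - y)) \<le> ?w * ?z * (norm (\<phi> (x + h) - \<phi> x) * norm (g (x - y)) + norm (\<phi> (x + h)) * norm (g ((x - y) + h) - g (x - y)))"
        by (intro mult_left_mono) auto
      also have "\<dots> = (?w * norm (\<phi> (x + h) - \<phi> x)) * (?z * norm (g (x - y))) + (?w * norm (\<phi> (x + h))) * (?z * norm (g ((x - y) + h) - g (x - y)))"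
        by (simp add: algebra_simps)
      also have "\<dots> \<le> (C * norm h) * B + (2 ^ M * A) * (D * norm h)"
        by (intro add_mono mult_mono C D B 1 h mult_nonneg_nonneg) (use A(1) B(1) C(1) D(1) in auto)
      also have "\<dots> = (C * B + 2 ^ M * A * D) * norm h" by (simp add: algebra_simps)
      finally have "real (Suc n) * (?w * ?z * norm (\<phi> x * g (x - y) - \<phi> (x + h) * g (x + h - y))) \<le> real (Suc n) * ((C * B + 2 ^ M * A * D) * norm h)"
        by (intro mult_left_mono) auto
      also have "\<dots> = (C * B + 2 ^ M * A * D) * (real (Suc n) * norm h)" by simp
      also have "\<dots> \<le> (C * B + 2 ^ M * A * D) * 1" using A(1) B(1) C(1) D(1) by (intro mult_left_mono hn) auto
      also have "\<dots> \<le> E" using E1 by simp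
      finally show ?thesis using True unfolding grid_error_def by (simp add: h(3) norm_mult mult_ac del: of_nat_Suc)
    next
      case False
      have "real n < norm (x + h)" using False by simp
      also have "norm (x + h) \<le> norm x + norm h" by (rule norm_triangle_ineq)
      also have "\<dots> \<le> norm x + 1" using h(2) by simp
      finally have "real n < norm x + 1" .
      then have "real (Suc n) \<le> norm x + 2" by simp
      also have "norm x + 2 \<le> 2 * (1 + norm x)" by simp
      finally have n: "real (Suc n) \<le> 2 * (1 + norm x)" .
      have "(1 + norm x) ^ M * (1 + norm (x - y)) ^ k * norm (grid_error \<phi> g (n, x) y)
          = real (Suc n) * ((1 + norm x) ^ M * norm (\<phi> x)) * ((1 + norm (x - y)) ^ k * norm (g (x - y)))"
        using False unfolding grid_error_def by (simp add: h(3) norm_mult del: of_nat_Suc)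
      also have "\<dots> \<le> (2 * (1 + norm x)) * ((1 + norm x) ^ M * norm (\<phi> x)) * B"
        by (intro mult_mono n B mult_nonneg_nonneg) auto
      also have "\<dots> = 2 * ((1 + norm x) ^ Suc M * norm (\<phi> x)) * B" by simp
      also have "\<dots> \<le> 2 * A * B" using B(1) by (intro mult_right_mono mult_left_mono A) auto
      also have "\<dots> \<le> E" using E1 by simp
      finally show ?thesis .
    qed
  qed
  have "(1 + norm y) ^ k / jw (snd p) * norm (grid_error \<phi> g p y) \<le> E" for p y
  proof (cases p)
    case (Pair n x)
    have "1 + norm (- y) \<le> (1 + norm (- y + x)) * (1 + norm x)" by (rule jp_triangle)
    then have "(1 + norm y) ^ k \<le> ((1 + norm (x - y)) * (1 + norm x)) ^ k" by (intro power_mono) auto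
    then have "(1 + norm y) ^ k / jw x * norm (grid_error \<phi> g (n, x) y) \<le> ((1 + norm (x - y)) * (1 + norm x)) ^ k / jw x * norm (grid_error \<phi> g (n, x) y)"
      by (intro mult_right_mono divide_right_mono) (auto simp: less_imp_le[OF jw_pos])
    also have "\<dots> = (1 + norm x) ^ M * (1 + norm (x - y)) ^ k * norm (grid_error \<phi> g (n, x) y)"
      unfolding M_def by (simp add: jw_def power_mult_distrib power_add)
    also have "\<dots> \<le> E" by (rule main)
    finally show ?thesis by (simp add: Pair)
  qed
  then show ?thesis by blast
qed

lemma pd_reflect:
  assumes "sch1 g"
  shows "pd b (\<lambda>y. g (x - y)) y = - pd b g (x - y)" "(\<lambda>y. g (x - y)) differentiable (at y)"
  using pd_affine[of g "-1" y x b] differentiable_affine_comp[of g "-1" y x] sch_differentiable[OF assms] by auto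

text \<open>Derivatives in y fall on g alone, up to sign, so grid errors with fixed \<phi> and
  arbitrary g form a closed class.\<close>

lemma grid_error_fam:
  fixes \<phi> g :: "'a::euclidean_space \<Rightarrow> complex"
  assumes \<phi>: "sch1 \<phi>" and g: "sch1 g"
  shows "fam ((\<lambda>w (i, x) y. w i y / jw x) ` range (\<lambda>k (i::nat) x. (1 + norm x) ^ k)) (grid_error \<phi> g)"
proof (rule fam_coinduct[where X = "{grid_error \<phi> g | g. sch1 g}"])
  have d: "(\<lambda>y. a * g (x - y) - (if c then b * g (z - y) else 0)) differentiable (at y)" if "sch1 g" for g :: "'a \<Rightarrow> complex" and a b c x z y
    by (cases c) (simp_all add: differentiable_diff differentiable_mult pd_reflect[OF that])
  have p: "pd e (\<lambda>y. a * g (x - y) - (if c then b * g (z - y) else 0)) y = a * (- pd e g (x - y)) - (if c then b * (- pd e g (z - y)) else 0)"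
    if "sch1 g" for g :: "'a \<Rightarrow> complex" and a b c x z y e
  proof -
    note r = pd_reflect[OF that]
    have "pd e (\<lambda>y. a * g (x - y) + (if c then - b else 0) * g (z - y)) y = a * (- pd e g (x - y)) + (if c then - b else 0) * (- pd e g (z - y))"
      by (subst pd_add) (simp_all only: differentiable_mult differentiable_const r pd_cmult)
    moreover have "(\<lambda>y. a * g (x - y) + (if c then - b else 0) * g (z - y)) = (\<lambda>y. a * g (x - y) - (if c then b * g (z - y) else 0))"
      by (cases c) auto
    ultimately show ?thesis by (cases c) auto
  qed
  {
    fix K :: "nat \<times> 'a \<Rightarrow> 'a \<Rightarrow> complex" and i x assume "K \<in> {grid_error \<phi> g | g. sch1 g}"
    then obtain g where K: "K = grid_error \<phi> g" and g: "sch1 g" by blast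
    show "K i differentiable (at x)"
      unfolding K grid_error_def case_prod_beta by (intro differentiable_mult differentiable_const d g)
  next
    fix K :: "nat \<times> 'a \<Rightarrow> 'a \<Rightarrow> complex" and w :: "nat \<times> 'a \<Rightarrow> 'a \<Rightarrow> real"
    assume "K \<in> {grid_error \<phi> g | g. sch1 g}" and "w \<in> (\<lambda>w (i, x) y. w i y / jw x) ` range (\<lambda>k i x. (1 + norm x) ^ k)"
    then obtain g k where K: "K = grid_error \<phi> g" "sch1 g" and w: "w = (\<lambda>(i, x) y. (1 + norm y) ^ k / jw x)" by blast
    show "\<exists>C. \<forall>i x. w i x * norm (K i x) \<le> C"
      using grid_error_bound[OF \<phi> K(2), of k] unfolding K(1) w by (simp add: case_prod_beta)
  next
    fix K :: "nat \<times> 'a \<Rightarrow> 'a \<Rightarrow> complex" and b :: 'a assume "K \<in> {grid_error \<phi> g | g. sch1 g}" and b: "b \<in> Basis"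
    then obtain g where K: "K = grid_error \<phi> g" "sch1 g" by blast
    have "pd b (K q) y = grid_error \<phi> (\<lambda>y. - 1 * pd b g y) q y" for q y
    proof (cases q)
      case (Pair n x)
      show ?thesis unfolding K(1) grid_error_def Pair prod.case
        by (subst pd_cmult[OF d[OF K(2)]]) (simp only: p[OF K(2)] mult_minus1)
    qed
    then have "(\<lambda>i. pd b (K i)) = grid_error \<phi> (\<lambda>y. - 1 * pd b g y)" by (intro ext)
    then show "(\<lambda>i. pd b (K i)) \<in> {grid_error \<phi> g | g. sch1 g}"
      using sch_cmult_const[OF sch_pd[OF K(2) b], of "-1"] by blast
  }
qed (use g in blast)

lemma one_in_sch_weights: "(\<lambda>_ _. 1) \<in> range (\<lambda>k (i::'i) (x::'a::real_normed_vector). (1 + norm x) ^ k)"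
  by (rule range_eqI[of _ _ 0]) simp

text \<open>The distribution commutes with the Riemann sums by linearity. The sums converge in the
  Schwartz topology, so u of them converges; and after u has been moved inside they converge by
  dominated convergence, because u of the translates is continuous.\<close>

theorem tempered_convolution:
  fixes \<phi> g :: "'a::euclidean_space \<Rightarrow> complex"
  assumes u: "tempered u" and \<phi>: "sch1 \<phi>" and g: "sch1 g"
  shows "integrable lborel (\<lambda>x. \<phi> x * u (\<lambda>y. g (x - y)))"
    and "u (\<lambda>y. \<integral>x. \<phi> x * g (x - y) \<partial>lborel) = (LBINT x. \<phi> x * u (\<lambda>y. g (x - y)))"
proof -
  define G where "G = (\<lambda>x. u (\<lambda>y. g (x - y)))"
  have gr: "sch1 (\<lambda>y. g (x - y))" for x by (rule sch1_reflect[OF g])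
  have Gc: "continuous_on UNIV G" unfolding G_def by (rule continuous_tempered_translates[OF u g])
  have \<phi>c: "continuous_on UNIV \<phi>" by (rule sch_continuous[OF \<phi>])
  have [measurable]: "G \<in> borel_measurable borel" "\<phi> \<in> borel_measurable borel" "g \<in> borel_measurable borel"
    using Gc \<phi>c sch_continuous[OF g] by (auto intro: borel_measurable_continuous_onI)
  \<comment> \<open>Even divided by \<open>jw x\<close>, the translates multiplied by \<phi> x form
    a Schwartz family; u is bounded on it, which provides the integrable majorant.\<close>
  obtain C where C: "C \<ge> 0" "\<And>x. norm (\<phi> x * G x) \<le> C * jw x"
  proof -
    have "sch (\<lambda>p y. (\<lambda>(i::unit, x) y. \<phi> x / of_real (jw x) * g ((-1) *\<^sub>R y + (- (-1)) *\<^sub>R x)) ((), p) y)"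
      by (rule sch_reindex[OF sch_translates[OF rapid_divide_jw[OF sch_rapid[OF \<phi>]] g]]) simp
    then have "sch (\<lambda>x y. \<phi> x / of_real (jw x) * g (x - y))" by simp
    then obtain C where C: "C \<ge> 0" "\<And>x. norm (u (\<lambda>y. \<phi> x / of_real (jw x) * g (x - y))) \<le> C"
      by (rule tempered_bounded[OF u], blast)
    have "norm (\<phi> x * G x) \<le> C * jw x" for x
      using C(2)[of x] jw_pos[of x] unfolding tempered_cmult[OF u gr]
      by (simp add: norm_mult norm_divide divide_le_eq G_def)
    then show thesis using that C(1) by blast
  qed
  have "integrable lborel (\<lambda>x. \<phi> x * G x)"
  proof (rule integrable_bound[where f = "\<lambda>x. C * jw x"])
    show "integrable lborel (\<lambda>x::'a. C * jw x)" by (intro integrable_mult_right integrable_jw)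
    show "AE x in lborel. norm (\<phi> x * G x) \<le> norm (C * jw x)"
      using C(2) by (intro AE_I2) (metis abs_ge_self order_trans real_norm_def)
  qed measurable
  then show "integrable lborel (\<lambda>x. \<phi> x * u (\<lambda>y. g (x - y)))" unfolding G_def .
  define T where "T = (\<lambda>y. \<integral>x. \<phi> x * g (x - y) \<partial>lborel)"
  define Tn where "Tn = (\<lambda>n y. \<Sum>v\<in>grid_nodes n. of_real (measure lborel (grid_round n -` {v})) * \<phi> v * g (v - y))"
  have Ts: "sch1 T"
  proof -
    have "T = cv \<phi> (\<lambda>z. g (- z))" unfolding T_def cv_def by simp
    then show ?thesis using sch1_cv[OF \<phi> sch1_reflect[OF g, of 0]] by simp
  qed
  have Tns: "sch1 (Tn n)" for n unfolding Tn_def by (intro sch_sum finite_grid_nodes sch_cmult_const gr)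
  have ge_m: "(\<lambda>x. grid_error \<phi> g (n, x) y) \<in> borel_measurable lborel" for n y
    unfolding grid_error_def prod.case by measurable
  have "fam (range (\<lambda>k (i::nat) x. (1 + norm x) ^ k)) (\<lambda>n y. \<integral>x. grid_error \<phi> g (n, x) y \<partial>lborel)"
    by (rule fam_integral(1)[OF integrable_jw jw_pos grid_error_fam[OF \<phi> g] one_in_sch_weights _ _ ge_m]) auto
  then have H: "sch (\<lambda>n y. \<integral>x. grid_error \<phi> g (n, x) y \<partial>lborel)" unfolding sch_def .
  have Hi: "integrable lborel (\<lambda>x. grid_error \<phi> g (n, x) y)" for n y
    by (rule fam_integral(2)[OF integrable_jw jw_pos grid_error_fam[OF \<phi> g] one_in_sch_weights _ _ ge_m]) auto
  have H_eq: "(LBINT x. grid_error \<phi> g (n, x) y) = of_nat (Suc n) * (T y - Tn n y)" for n y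
  proof -
    have 1: "integrable lborel (\<lambda>x. \<phi> x * g (x - y))"
      using sch_integrable[OF sch_mult[OF \<phi> sch_imp_fam1[OF sch_affine_fixed[OF g, of 1 "- y"]]]] by simp
    let ?q = "\<lambda>x. if norm (grid_round n x) \<le> real n then \<phi> (grid_round n x) * g (grid_round n x - y) else 0"
    have "integrable lborel (\<lambda>x. \<phi> x * g (x - y) - (1 / of_nat (Suc n)) * grid_error \<phi> g (n, x) y)"
      using 1 Hi by (intro Bochner_Integration.integrable_diff integrable_mult_right)
    moreover have "(\<lambda>x. \<phi> x * g (x - y) - (1 / of_nat (Suc n)) * grid_error \<phi> g (n, x) y) = ?q"
      unfolding grid_error_def by (simp add: fun_eq_iff del: of_nat_Suc)
    ultimately have 2: "integrable lborel ?q" by simp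
    have "(LBINT x. grid_error \<phi> g (n, x) y) = of_nat (Suc n) * ((LBINT x. \<phi> x * g (x - y)) - (LBINT x. ?q x))"
      unfolding grid_error_def prod.case by (simp only: integral_mult_right_zero Bochner_Integration.integral_diff[OF 1 2])
    also have "(LBINT x. ?q x) = Tn n y"
      unfolding Tn_def using integral_grid[of n "\<lambda>v. \<phi> v * g (v - y)"] by (simp add: mult.assoc)
    finally show ?thesis unfolding T_def .
  qed
  obtain B where B: "B \<ge> 0" "\<And>n. norm (u (\<lambda>y. of_nat (Suc n) * (T y - Tn n y))) \<le> B"
    using H unfolding H_eq by (rule tempered_bounded[OF u], blast)
  have "norm (u (Tn n) - u T) \<le> B * (1 / real (Suc n))" for n
  proof -
    have "real (Suc n) * norm (u T - u (Tn n)) \<le> B"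
      using B(2)[of n] unfolding tempered_cmult[OF u sch_diff[OF Ts Tns]] tempered_diff[OF u Ts Tns] norm_mult norm_of_nat .
    then show ?thesis by (simp add: field_simps norm_minus_commute)
  qed
  moreover have "(\<lambda>n. B * (1 / real (Suc n))) \<longlonglongrightarrow> B * 0"
    using LIMSEQ_Suc[OF lim_inverse_n'] by (intro tendsto_mult tendsto_const) (simp add: inverse_eq_divide)
  ultimately have "(\<lambda>n. u (Tn n) - u T) \<longlonglongrightarrow> 0"
    by (intro Lim_null_comparison[of "\<lambda>n. u (Tn n) - u T" "\<lambda>n. B * (1 / real (Suc n))"]) auto
  then have L1: "(\<lambda>n. u (Tn n)) \<longlonglongrightarrow> u T" by (rule LIM_zero_cancel)
  have uTn: "u (Tn n) = (LBINT x. (if norm (grid_round n x) \<le> real n then \<phi> (grid_round n x) * G (grid_round n x) else 0))" for n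
  proof -
    have "u (Tn n) = (\<Sum>v\<in>grid_nodes n. u (\<lambda>y. of_real (measure lborel (grid_round n -` {v})) * \<phi> v * g (v - y)))"
      unfolding Tn_def by (intro tempered_sum[OF u] finite_grid_nodes sch_cmult_const gr)
    also have "\<dots> = (\<Sum>v\<in>grid_nodes n. of_real (measure lborel (grid_round n -` {v})) * (\<phi> v * G v))"
      unfolding tempered_cmult[OF u gr] G_def by (simp add: mult.assoc)
    finally show ?thesis unfolding integral_grid[of n "\<lambda>v. \<phi> v * G v"] .
  qed
  have "(\<lambda>n. \<integral>x. (if norm (grid_round n x) \<le> real n then \<phi> (grid_round n x) * G (grid_round n x) else 0) \<partial>lborel) \<longlonglongrightarrow> (LBINT x. \<phi> x * G x)"
  proof (rule integral_dominated_convergence[where w = "\<lambda>x. (2 ^ Suc DIM('a) * C) * jw x"])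
    show "integrable lborel (\<lambda>x::'a. (2 ^ Suc DIM('a) * C) * jw x)" by (intro integrable_mult_right integrable_jw)
    show "AE x in lborel. (\<lambda>n. if norm (grid_round n x) \<le> real n then \<phi> (grid_round n x) * G (grid_round n x) else 0) \<longlonglongrightarrow> \<phi> x * G x"
    proof (intro AE_I2)
      fix x
      have c: "(\<lambda>n. \<phi> (grid_round n x) * G (grid_round n x)) \<longlonglongrightarrow> \<phi> x * G x"
        by (intro tendsto_mult continuous_on_tendsto_compose[OF \<phi>c grid_round_LIMSEQ] continuous_on_tendsto_compose[OF Gc grid_round_LIMSEQ]) auto
      have "\<forall>\<^sub>F n in sequentially. \<phi> (grid_round n x) * G (grid_round n x) = (if norm (grid_round n x) \<le> real n then \<phi> (grid_round n x) * G (grid_round n x) else 0)"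
        using eventually_ge_at_top[of "nat \<lceil>norm x + 1\<rceil>"]
      proof eventually_elim
        case (elim n)
        obtain h where h: "norm h \<le> 1" "grid_round n x = x + h" using grid_round_eq_add by metis
        have "norm (x + h) \<le> norm x + norm h" by (rule norm_triangle_ineq)
        also have "\<dots> \<le> real n" using h(1) elim by linarith
        finally show ?case using h by simp
      qed
      then show "(\<lambda>n. if norm (grid_round n x) \<le> real n then \<phi> (grid_round n x) * G (grid_round n x) else 0) \<longlonglongrightarrow> \<phi> x * G x"
        by (rule Lim_transform_eventually[OF c])
    qed
    show "AE x in lborel. norm (if norm (grid_round n x) \<le> real n then \<phi> (grid_round n x) * G (grid_round n x) else 0) \<le> (2 ^ Suc DIM('a) * C) * jw x" for n
    proof (intro AE_I2)
      fix x :: 'a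
      obtain h where h: "norm h \<le> 1" "grid_round n x = x + h" using grid_round_eq_add by metis
      have "1 + norm x \<le> (1 + norm (x + h)) * (1 + norm h)" by (rule jp_triangle)
      also have "\<dots> \<le> (1 + norm (x + h)) * 2" using h(1) by (intro mult_left_mono) auto
      finally have "(1 + norm x) ^ Suc DIM('a) \<le> ((1 + norm (x + h)) * 2) ^ Suc DIM('a)" by (intro power_mono) auto
      then have "(1 + norm x) ^ Suc DIM('a) * jw (x + h) \<le> ((1 + norm (x + h)) * 2) ^ Suc DIM('a) * jw (x + h)"
        by (intro mult_right_mono) (auto simp: less_imp_le[OF jw_pos])
      also have "\<dots> = 2 ^ Suc DIM('a)"
      proof -
        have "1 + norm (x + h) > 0" by (simp add: add_pos_nonneg)
        then show ?thesis unfolding power_mult_distrib jw_def by (simp del: power_Suc)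
      qed
      finally have "jw (x + h) \<le> 2 ^ Suc DIM('a) * jw x" by (rule bounded_by_jw)
      then have "C * jw (x + h) \<le> (2 ^ Suc DIM('a) * C) * jw x" using C(1) by (simp add: mult_left_mono mult_ac)
      then have "norm (\<phi> (x + h) * G (x + h)) \<le> (2 ^ Suc DIM('a) * C) * jw x" using C(2)[of "x + h"] by linarith
      moreover have "0 \<le> (2 ^ Suc DIM('a) * C) * jw x" using C(1) less_imp_le[OF jw_pos[of x]] by simp
      ultimately show "norm (if norm (grid_round n x) \<le> real n then \<phi> (grid_round n x) * G (grid_round n x) else 0) \<le> (2 ^ Suc DIM('a) * C) * jw x"
        unfolding h(2) by (cases "norm (x + h) \<le> real n") (simp_all only: if_True if_False norm_zero)
    qed
  qed measurable
  then have "(\<lambda>n. u (Tn n)) \<longlonglongrightarrow> (LBINT x. \<phi> x * G x)" unfolding uTn .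
  then have "u T = (LBINT x. \<phi> x * G x)" by (rule LIMSEQ_unique[OF L1])
  then show "u (\<lambda>y. \<integral>x. \<phi> x * g (x - y) \<partial>lborel) = (LBINT x. \<phi> x * u (\<lambda>y. g (x - y)))"
    unfolding T_def G_def .
qed

section \<open>Littlewood--Paley decomposition of a tempered distribution\<close>

text \<open>When E has integral 1, the integral over v is \<open>2 ^ J\<close> times the error of
  the approximate identity at scale J; boundedness of the family thus gives convergence at rate
  \<open>(1 / 2) ^ J\<close>.\<close>

definition dil_error :: "('a::euclidean_space \<Rightarrow> complex) \<Rightarrow> ('a \<Rightarrow> complex) \<Rightarrow> nat \<times> 'a \<Rightarrow> 'a \<Rightarrow> complex" where
  "dil_error E \<theta> = (\<lambda>(J, v) y. (E v * 2 ^ J) * (\<theta> (y - v /\<^sub>R 2 ^ J) - \<theta> y))"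

text \<open>If the shift v / 2^J has length at most 1, the Lipschitz bound cancels
  \<open>2 ^ J\<close>; otherwise \<open>2 ^ J\<close> is at most \<open>1 + norm v\<close>, which
  the decay of E absorbs.\<close>

lemma dil_error_bound:
  fixes E \<theta> :: "'a::euclidean_space \<Rightarrow> complex"
  assumes E: "sch1 E" and \<theta>: "sch1 \<theta>"
  shows "\<exists>C. \<forall>p y. (1 + norm y) ^ k / jw (snd p) * norm (dil_error E \<theta> p y) \<le> C"
proof -
  obtain A where A: "A \<ge> 0" "\<And>x. (1 + norm x) ^ (Suc DIM('a) + Suc k) * norm (E x) \<le> A" using sch_bound[OF E] by metis
  obtain B where B: "B \<ge> 0" "\<And>x. (1 + norm x) ^ k * norm (\<theta> x) \<le> B" using sch_bound[OF \<theta>] by metis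
  obtain C where C: "C \<ge> 0" "\<And>x h. norm h \<le> 1 \<Longrightarrow> (1 + norm x) ^ k * norm (\<theta> (x + h) - \<theta> x) \<le> C * norm h"
    using sch_lipschitz[OF \<theta>] by metis
  have "(1 + norm y) ^ k / jw (snd p) * norm (dil_error E \<theta> p y) \<le> A * (C + 2 * B)" for p y
  proof (cases p)
    case (Pair J v)
    define h where "h = - (v /\<^sub>R 2 ^ J)"
    have nh: "norm h = norm v / 2 ^ J" unfolding h_def by (simp add: divide_inverse mult.commute)
    have hv: "norm h \<le> norm v"
      unfolding nh by (simp add: divide_le_eq mult_le_cancel_left1 one_le_power)
    have key: "(1 + norm y) ^ k * (2 ^ J * norm (\<theta> (y + h) - \<theta> y)) \<le> (C + 2 * B) * (1 + norm v) ^ Suc k"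
    proof (cases "norm h \<le> 1")
      case True
      have "(1 + norm y) ^ k * (2 ^ J * norm (\<theta> (y + h) - \<theta> y)) = 2 ^ J * ((1 + norm y) ^ k * norm (\<theta> (y + h) - \<theta> y))" by simp
      also have "\<dots> \<le> 2 ^ J * (C * norm h)" by (intro mult_left_mono C True) auto
      also have "\<dots> = C * norm v" by (simp add: nh)
      also have "\<dots> \<le> (C + 2 * B) * (1 + norm v)" using B(1) C(1) by (intro mult_mono) auto
      also have "\<dots> \<le> (C + 2 * B) * (1 + norm v) ^ Suc k"
        using B(1) C(1) power_increasing[of 1 "Suc k" "1 + norm v"] by (intro mult_left_mono) auto
      finally show ?thesis .
    next
      case False
      then have J: "2 ^ J \<le> 1 + norm v" unfolding nh by (simp add: field_simps)
      have 1: "(1 + norm y) ^ k * norm (\<theta> (y + h)) \<le> (1 + norm v) ^ k * B"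
      proof -
        have "1 + norm y \<le> (1 + norm (y + h)) * (1 + norm h)" by (rule jp_triangle)
        also have "\<dots> \<le> (1 + norm (y + h)) * (1 + norm v)" using hv by (intro mult_left_mono) auto
        finally have "(1 + norm y) ^ k \<le> ((1 + norm (y + h)) * (1 + norm v)) ^ k" by (intro power_mono) auto
        then have "(1 + norm y) ^ k * norm (\<theta> (y + h)) \<le> ((1 + norm (y + h)) * (1 + norm v)) ^ k * norm (\<theta> (y + h))"
          by (intro mult_right_mono) auto
        also have "\<dots> = (1 + norm v) ^ k * ((1 + norm (y + h)) ^ k * norm (\<theta> (y + h)))" by (simp add: power_mult_distrib)
        also have "\<dots> \<le> (1 + norm v) ^ k * B" by (intro mult_left_mono B) auto
        finally show ?thesis .
      qed
      have 2: "(1 + norm y) ^ k * norm (\<theta> y) \<le> (1 + norm v) ^ k * B"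
      proof -
        have "1 * B \<le> (1 + norm v) ^ k * B" using B(1) by (intro mult_right_mono one_le_power) auto
        then show ?thesis using B(2)[of y] by linarith
      qed
      have "(1 + norm y) ^ k * (2 ^ J * norm (\<theta> (y + h) - \<theta> y)) \<le> (1 + norm y) ^ k * ((1 + norm v) * (norm (\<theta> (y + h)) + norm (\<theta> y)))"
        by (intro mult_left_mono mult_mono J norm_triangle_ineq4) auto
      also have "\<dots> = (1 + norm v) * ((1 + norm y) ^ k * norm (\<theta> (y + h)) + (1 + norm y) ^ k * norm (\<theta> y))" by (simp add: algebra_simps)
      also have "\<dots> \<le> (1 + norm v) * ((1 + norm v) ^ k * B + (1 + norm v) ^ k * B)" by (intro mult_left_mono add_mono 1 2) auto
      also have "\<dots> = (2 * B) * (1 + norm v) ^ Suc k" by simp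
      also have "\<dots> \<le> (C + 2 * B) * (1 + norm v) ^ Suc k" using C(1) by (intro mult_right_mono) auto
      finally show ?thesis .
    qed
    have "(1 + norm y) ^ k / jw v * norm (dil_error E \<theta> (J, v) y) = ((1 + norm v) ^ Suc DIM('a) * norm (E v)) * ((1 + norm y) ^ k * (2 ^ J * norm (\<theta> (y + h) - \<theta> y)))"
      unfolding dil_error_def h_def by (simp add: jw_def norm_mult norm_power)
    also have "\<dots> \<le> ((1 + norm v) ^ Suc DIM('a) * norm (E v)) * ((C + 2 * B) * (1 + norm v) ^ Suc k)"
      by (intro mult_left_mono key) auto
    also have "\<dots> = ((1 + norm v) ^ (Suc DIM('a) + Suc k) * norm (E v)) * (C + 2 * B)"
      unfolding power_add by simp
    also have "\<dots> \<le> A * (C + 2 * B)" using B(1) C(1) by (intro mult_right_mono A) auto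
    finally show ?thesis by (simp add: Pair)
  qed
  then show ?thesis by blast
qed

lemma dil_error_fam:
  fixes E \<theta> :: "'a::euclidean_space \<Rightarrow> complex"
  assumes E: "sch1 E" and \<theta>: "sch1 \<theta>"
  shows "fam ((\<lambda>w (i, x) y. w i y / jw x) ` range (\<lambda>k (i::nat) x. (1 + norm x) ^ k)) (dil_error E \<theta>)"
proof (rule fam_coinduct[where X = "{dil_error E \<theta> | \<theta>. sch1 \<theta>}"])
  have d: "(\<lambda>y. \<theta> (y - v) - \<theta> y) differentiable (at y)" and p: "pd b (\<lambda>y. \<theta> (y - v) - \<theta> y) y = pd b \<theta> (y - v) - pd b \<theta> y"
    if t: "sch1 \<theta>" for \<theta> :: "'a \<Rightarrow> complex" and v y b
  proof -
    have 1: "(\<lambda>y. \<theta> (y - v)) differentiable (at y)" "pd b (\<lambda>y. \<theta> (y - v)) y = pd b \<theta> (y - v)"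
      using differentiable_affine_comp[of \<theta> 1 y "- v"] pd_affine[of \<theta> 1 y "- v" b] sch_differentiable[OF t] by auto
    show "(\<lambda>y. \<theta> (y - v) - \<theta> y) differentiable (at y)" by (intro differentiable_diff 1 sch_differentiable[OF t])
    note td = sch_differentiable[OF t, of y]
    have "pd b (\<lambda>y. \<theta> (y - v) + (-1) * \<theta> y) y = pd b (\<lambda>y. \<theta> (y - v)) y + pd b (\<lambda>y. (-1) * \<theta> y) y"
      by (rule pd_add[OF 1(1) differentiable_mult[OF differentiable_const td]])
    then show "pd b (\<lambda>y. \<theta> (y - v) - \<theta> y) y = pd b \<theta> (y - v) - pd b \<theta> y"
      using pd_cmult[OF td, of b "-1"] 1(2) by simp
  qed
  {
    fix K :: "nat \<times> 'a \<Rightarrow> 'a \<Rightarrow> complex" and i x assume "K \<in> {dil_error E \<theta> | \<theta>. sch1 \<theta>}"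
    then obtain \<theta> where K: "K = dil_error E \<theta>" and t: "sch1 \<theta>" by blast
    show "K i differentiable (at x)"
      unfolding K dil_error_def case_prod_beta by (intro differentiable_mult[OF differentiable_const] d t)
  next
    fix K :: "nat \<times> 'a \<Rightarrow> 'a \<Rightarrow> complex" and w :: "nat \<times> 'a \<Rightarrow> 'a \<Rightarrow> real"
    assume "K \<in> {dil_error E \<theta> | \<theta>. sch1 \<theta>}" and "w \<in> (\<lambda>w (i, x) y. w i y / jw x) ` range (\<lambda>k i x. (1 + norm x) ^ k)"
    then obtain \<theta> k where K: "K = dil_error E \<theta>" "sch1 \<theta>" and w: "w = (\<lambda>(i, x) y. (1 + norm y) ^ k / jw x)" by blast
    show "\<exists>C. \<forall>i x. w i x * norm (K i x) \<le> C"
      using dil_error_bound[OF E K(2), of k] unfolding K(1) w by (simp add: case_prod_beta)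
  next
    fix K :: "nat \<times> 'a \<Rightarrow> 'a \<Rightarrow> complex" and b :: 'a assume "K \<in> {dil_error E \<theta> | \<theta>. sch1 \<theta>}" and b: "b \<in> Basis"
    then obtain \<theta> where K: "K = dil_error E \<theta>" and t: "sch1 \<theta>" by blast
    have "(\<lambda>i. pd b (K i)) = dil_error E (pd b \<theta>)"
      unfolding K dil_error_def case_prod_beta by (intro ext) (simp only: pd_cmult[OF d[OF t]] p[OF t])
    then show "(\<lambda>i. pd b (K i)) \<in> {dil_error E \<theta> | \<theta>. sch1 \<theta>}"
      using sch_pd[OF t b] by blast
  }
qed (use \<theta> in blast)

lemma tempered_approximate_identity:
  fixes E \<theta> :: "'a::euclidean_space \<Rightarrow> complex"
  assumes u: "tempered u" and E: "sch1 E" and \<theta>: "sch1 \<theta>" and one: "(LBINT x. E x) = 1"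
  shows "(\<lambda>J. u (cv (dil (2 ^ J) E) \<theta>)) \<longlonglongrightarrow> u \<theta>"
proof -
  have [measurable]: "E \<in> borel_measurable borel" "\<theta> \<in> borel_measurable borel"
    using sch_continuous[OF E] sch_continuous[OF \<theta>] by (auto intro: borel_measurable_continuous_onI)
  have m: "(\<lambda>v. dil_error E \<theta> (J, v) y) \<in> borel_measurable lborel" for J y
    unfolding dil_error_def prod.case by measurable
  have "fam (range (\<lambda>k (i::nat) x. (1 + norm x) ^ k)) (\<lambda>J y. \<integral>v. dil_error E \<theta> (J, v) y \<partial>lborel)"
    by (rule fam_integral(1)[OF integrable_jw jw_pos dil_error_fam[OF E \<theta>] one_in_sch_weights _ _ m]) auto
  then have H: "sch (\<lambda>J y. \<integral>v. dil_error E \<theta> (J, v) y \<partial>lborel)" unfolding sch_def .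
  have cs: "sch1 (cv (dil (2 ^ J) E) \<theta>)" for J by (rule sch1_cv[OF sch1_dil[OF E] \<theta>]) simp
  have eq: "(LBINT v. dil_error E \<theta> (J, v) y) = 2 ^ J * (cv (dil (2 ^ J) E) \<theta> y - \<theta> y)" for J y
  proof -
    have 1: "cv (dil (2 ^ J) E) \<theta> y = (LBINT v. E v * \<theta> (y - v /\<^sub>R 2 ^ J))"
      unfolding cv_def by (rule integral_dil) simp
    have i2: "integrable lborel (\<lambda>v. E v * \<theta> y)" using sch_integrable[OF E] by simp
    have "fam {\<lambda>_ _. 1} (\<lambda>_::unit. \<lambda>v. \<theta> (y - v /\<^sub>R 2 ^ J))"
      using sch_imp_fam1[OF sch_affine_fixed[OF \<theta>, of "- (1 / 2 ^ J)" y]] by (simp add: inverse_eq_divide)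
    from sch_integrable[OF sch_mult[OF E this]] have i1: "integrable lborel (\<lambda>v. E v * \<theta> (y - v /\<^sub>R 2 ^ J))" .
    have "(LBINT v. dil_error E \<theta> (J, v) y) = (LBINT v. 2 ^ J * (E v * \<theta> (y - v /\<^sub>R 2 ^ J) - E v * \<theta> y))"
      unfolding dil_error_def by (intro integral_cong refl) (simp add: algebra_simps)
    also have "\<dots> = 2 ^ J * ((LBINT v. E v * \<theta> (y - v /\<^sub>R 2 ^ J)) - (LBINT v. E v * \<theta> y))"
      by (simp only: integral_mult_right_zero Bochner_Integration.integral_diff[OF i1 i2])
    finally show ?thesis using one by (simp add: 1)
  qed
  obtain B where B: "B \<ge> 0" "\<And>J. norm (u (\<lambda>y. 2 ^ J * (cv (dil (2 ^ J) E) \<theta> y - \<theta> y))) \<le> B"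
    using H unfolding eq by (rule tempered_bounded[OF u], blast)
  have "norm (u (cv (dil (2 ^ J) E) \<theta>) - u \<theta>) \<le> B * (1 / 2) ^ J" for J
    using B(2)[of J] unfolding tempered_cmult[OF u sch_diff[OF cs \<theta>]] tempered_diff[OF u cs \<theta>]
    by (simp add: norm_mult norm_power power_divide le_divide_eq mult.commute)
  moreover have "(\<lambda>J. B * (1 / 2) ^ J) \<longlonglongrightarrow> B * 0"
    by (intro tendsto_mult tendsto_const LIMSEQ_realpow_zero) auto
  ultimately have "(\<lambda>J. u (cv (dil (2 ^ J) E) \<theta>) - u \<theta>) \<longlonglongrightarrow> 0"
    by (intro Lim_null_comparison[of "\<lambda>J. u (cv (dil (2 ^ J) E) \<theta>) - u \<theta>" "\<lambda>J. B * (1 / 2) ^ J"]) auto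
  then show ?thesis by (rule LIM_zero_cancel)
qed

text \<open>The partial sums of the kernels are an approximate identity, since the integral of
  \<Phi> is \<open>fourier \<Phi> 0 = 1\<close>. Inserting the fat kernel splits each term: u enters
  through its dyadic piece only, while the test function is convolved with a kernel that has
  cancellation for j > 0.\<close>

theorem tempered_lp_sums:
  fixes \<Phi> \<theta> :: "'a::euclidean_space \<Rightarrow> complex"
  assumes \<Phi>: "lp_function \<Phi>" and u: "tempered u" and \<theta>: "sch1 \<theta>"
  shows "(\<lambda>j. \<integral>x. cv (lp_fat \<Phi> j) \<theta> x * u (\<lambda>y. lp_kernel \<Phi> j (x - y)) \<partial>lborel) sums u \<theta>"
    and "integrable lborel (\<lambda>x. cv (lp_fat \<Phi> j) \<theta> x * u (\<lambda>y. lp_kernel \<Phi> j (x - y)))"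
proof -
  note ks = lp_kernel_sch1[OF \<Phi>] and fs = lp_fat_sch1[OF \<Phi>]
  have cs: "sch1 (cv (lp_fat \<Phi> j) \<theta>)" for j by (rule sch1_cv[OF fs \<theta>])
  show "integrable lborel (\<lambda>x. cv (lp_fat \<Phi> j) \<theta> x * u (\<lambda>y. lp_kernel \<Phi> j (x - y)))"
    by (rule tempered_convolution(1)[OF u cs ks])
  have term_eq: "u (cv (lp_kernel \<Phi> j) \<theta>) = (LBINT x. cv (lp_fat \<Phi> j) \<theta> x * u (\<lambda>y. lp_kernel \<Phi> j (x - y)))" for j
  proof -
    have "cv (lp_kernel \<Phi> j) \<theta> = cv (lp_kernel \<Phi> j) (cv (lp_fat \<Phi> j) \<theta>)"
      unfolding cv_assoc[OF ks fs \<theta>] lp_kernel_fat[OF \<Phi>] ..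
    also have "\<dots> = cv (cv (lp_fat \<Phi> j) \<theta>) (lp_kernel \<Phi> j)" by (rule cv_commute)
    also have "\<dots> = (\<lambda>y. \<integral>x. cv (lp_fat \<Phi> j) \<theta> x * lp_kernel \<Phi> j (x - y) \<partial>lborel)"
    proof
      fix y
      have "lp_kernel \<Phi> j (y - x) = lp_kernel \<Phi> j (x - y)" for x using lp_kernel_even[OF \<Phi>, of j "x - y"] by simp
      then show "cv (cv (lp_fat \<Phi> j) \<theta>) (lp_kernel \<Phi> j) y = (LBINT x. cv (lp_fat \<Phi> j) \<theta> x * lp_kernel \<Phi> j (x - y))"
        unfolding cv_def[of "cv (lp_fat \<Phi> j) \<theta>"] by simp
    qed
    finally show ?thesis using tempered_convolution(2)[OF u cs ks] by simp
  qed
  have part: "(\<Sum>j\<le>J. u (cv (lp_kernel \<Phi> j) \<theta>)) = u (cv (dil (2 ^ J) \<Phi>) \<theta>)" for J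
  proof (induction J)
    case 0
    have "dil 1 \<Phi> = \<Phi>" by (simp add: dil_def fun_eq_iff)
    then show ?case by (simp add: lp_kernel_def)
  next
    case (Suc J)
    have s: "sch1 (dil (2 ^ J) \<Phi>)" for J by (rule sch1_dil[OF lp_sch1[OF \<Phi>]]) simp
    have i: "integrable lborel (\<lambda>y. f y * \<theta> (x - y))" if "sch1 f" for f x
      by (rule sch_integrable[OF sch_mult[OF that sch_imp_fam1[OF sch1_reflect[OF \<theta>]]]])
    have e: "cv (dil (2 ^ Suc J) \<Phi>) \<theta> = (\<lambda>x. cv (dil (2 ^ J) \<Phi>) \<theta> x + cv (lp_kernel \<Phi> (Suc J)) \<theta> x)"
      unfolding cv_def Bochner_Integration.integral_add[OF i[OF s] i[OF ks], symmetric]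
      by (simp add: lp_kernel_def algebra_simps)
    show ?case unfolding sum.atMost_Suc Suc.IH e by (rule tempered_add[OF u sch1_cv[OF s \<theta>] sch1_cv[OF ks \<theta>], symmetric])
  qed
  have "(LBINT x. \<Phi> x) = 1" using lp_one[OF \<Phi>, of 0] by (simp add: fourier_def)
  from tempered_approximate_identity[OF u lp_sch1[OF \<Phi>] \<theta> this]
  show "(\<lambda>j. \<integral>x. cv (lp_fat \<Phi> j) \<theta> x * u (\<lambda>y. lp_kernel \<Phi> j (x - y)) \<partial>lborel) sums u \<theta>"
    unfolding part[symmetric] sums_def_le term_eq .
qed

section \<open>Real powers and a Jensen inequality on the extended half-line\<close>

lemma ennpow_ennreal: "0 \<le> r \<Longrightarrow> ennpow (ennreal r) a = ennreal (r powr a)"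
  by (simp add: ennpow_def)

lemma ennpow_top [simp]: "ennpow top a = top"
  by (simp add: ennpow_def)

lemma ennpow_zero [simp]: "ennpow 0 a = 0"
  by (simp add: ennpow_def)

lemma ennpow_mono: "x \<le> y \<Longrightarrow> 0 \<le> a \<Longrightarrow> ennpow x a \<le> ennpow y a"
  by (cases x; cases y) (auto simp: ennpow_ennreal powr_mono2 top_unique)

lemma ennpow_ennpow: "ennpow (ennpow x a) b = ennpow x (a * b)"
  by (cases x) (auto simp: ennpow_ennreal powr_powr)

lemma ennpow_one [simp]: "ennpow x 1 = x"
  by (cases x) (auto simp: ennpow_ennreal)

lemma ennpow_inverse: "a \<noteq> 0 \<Longrightarrow> ennpow (ennpow x a) (1 / a) = x" "a \<noteq> 0 \<Longrightarrow> ennpow (ennpow x (1 / a)) a = x"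
  by (simp_all add: ennpow_ennpow)

lemma ennpow_mult: "0 < a \<Longrightarrow> ennpow (x * y) a = ennpow x a * ennpow y a"
proof (cases x; cases y)
  fix r s assume "x = ennreal r" "y = ennreal s" "0 \<le> r" "0 \<le> s"
  then show ?thesis by (simp add: ennpow_ennreal powr_mult flip: ennreal_mult)
next
  fix r assume *: "0 < a" "x = ennreal r" "0 \<le> r" "y = top"
  show ?thesis using * by (cases "r = 0") (auto simp: ennpow_ennreal ennreal_mult_top)
next
  fix r assume *: "0 < a" "y = ennreal r" "0 \<le> r" "x = top"
  show ?thesis using * by (cases "r = 0") (auto simp: ennpow_ennreal ennreal_top_mult)
qed auto

lemma ennpow_measurable [measurable (raw)]:
  assumes [measurable]: "f \<in> borel_measurable M"
  shows "(\<lambda>x. ennpow (f x) a) \<in> borel_measurable M"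
  unfolding ennpow_def by measurable

lemma ennpow_add_le:
  assumes "0 < a"
  shows "ennpow (x + y) a \<le> ennreal (2 powr a) * (ennpow x a + ennpow y a)"
proof -
  have "ennpow (x + y) a \<le> ennpow (ennreal 2 * max x y) a"
  proof (rule ennpow_mono)
    have "x + y \<le> max x y + max x y" by (intro add_mono) auto
    then show "x + y \<le> ennreal 2 * max x y" by (simp add: mult_2)
  qed (use assms in simp)
  also have "\<dots> = ennreal (2 powr a) * ennpow (max x y) a"
    using assms by (simp only: ennpow_mult ennpow_ennreal[of 2] zero_le_numeral)
  also have "ennpow (max x y) a \<le> ennpow x a + ennpow y a"
    by (cases "x \<le> y") (auto simp: max_def)
  finally show ?thesis by (simp add: mult_left_mono)
qed

lemma le_ennpowI: "0 < a \<Longrightarrow> ennpow x a \<le> ennpow y a \<Longrightarrow> x \<le> y"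
  using ennpow_mono[of "ennpow x a" "ennpow y a" "1 / a"] by (simp add: ennpow_inverse)

text \<open>Either x \<le> c, or x is at most \<open>x * (x / c) powr (p - 1)\<close>. Integrated
  and optimized in c, this crude form of Young's inequality gives Jensen's inequality up to a
  constant.\<close>

lemma young_crude:
  assumes p: "1 \<le> p" and c: "0 < c"
  shows "x \<le> ennreal c + ennreal (c powr (1 - p)) * ennpow x p"
proof (cases x)
  case (real r)
  have "r \<le> c + c powr (1 - p) * r powr p"
  proof (cases "r \<le> c")
    case True
    then show ?thesis by (simp add: add_increasing2)
  next
    case False
    then have r: "0 < r" "c < r" using c by auto
    have "1 \<le> (r / c) powr (p - 1)" using r c p by (intro ge_one_powr_ge_zero) auto
    then have "r \<le> r * (r / c) powr (p - 1)" using r(1) by simp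
    also have "\<dots> = c powr (1 - p) * r powr p"
      using r c by (simp add: powr_divide powr_diff powr_minus field_simps)
    finally show ?thesis using c by linarith
  qed
  then have "ennreal r \<le> ennreal (c + c powr (1 - p) * r powr p)" by (rule ennreal_leI)
  also have "\<dots> = ennreal c + ennreal (c powr (1 - p)) * ennpow (ennreal r) p"
    using real c by (simp add: ennpow_ennreal ennreal_mult)
  finally show ?thesis using real by simp
next
  case top
  then show ?thesis using c by (simp add: ennreal_mult_top)
qed

text \<open>Each threshold c gives a bound; its two terms balance for
  \<open>c = (b / A) powr (1 / p)\<close>. Compared with the sharp inequality a factor
  \<open>2 powr p\<close> is lost. The same statement is used with decaying weights, with the
  kernels of Schur's test, and with counting measures for finite and infinite sums.\<close>

lemma jensen_ennpow:
  assumes p: "1 \<le> p" and A: "0 < A" and w: "(\<integral>\<^sup>+x. w x \<partial>M) \<le> ennreal A"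
    and [measurable]: "w \<in> borel_measurable M" "f \<in> borel_measurable M"
  shows "ennpow (\<integral>\<^sup>+x. w x * f x \<partial>M) p \<le> ennreal (2 powr p * A powr (p - 1)) * (\<integral>\<^sup>+x. w x * ennpow (f x) p \<partial>M)"
proof -
  define B where "B = (\<integral>\<^sup>+x. w x * ennpow (f x) p \<partial>M)"
  have young: "(\<integral>\<^sup>+x. w x * f x \<partial>M) \<le> ennreal (c * A) + ennreal (c powr (1 - p)) * B" if c: "0 < c" for c
  proof -
    have "(\<integral>\<^sup>+x. w x * f x \<partial>M) \<le> (\<integral>\<^sup>+x. ennreal c * w x + ennreal (c powr (1 - p)) * (w x * ennpow (f x) p) \<partial>M)"
    proof (rule nn_integral_mono)
      fix x
      have "w x * f x \<le> w x * (ennreal c + ennreal (c powr (1 - p)) * ennpow (f x) p)"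
        by (intro mult_left_mono young_crude p c) auto
      then show "w x * f x \<le> ennreal c * w x + ennreal (c powr (1 - p)) * (w x * ennpow (f x) p)"
        by (simp add: distrib_left mult_ac)
    qed
    also have "\<dots> = ennreal c * (\<integral>\<^sup>+x. w x \<partial>M) + ennreal (c powr (1 - p)) * B"
      unfolding B_def by (simp add: nn_integral_add nn_integral_cmult)
    also have "\<dots> \<le> ennreal c * ennreal A + ennreal (c powr (1 - p)) * B"
      by (intro add_mono mult_left_mono w) auto
    finally show ?thesis using c A by (simp add: ennreal_mult)
  qed
  have "ennpow (\<integral>\<^sup>+x. w x * f x \<partial>M) p \<le> ennreal (2 powr p * A powr (p - 1)) * B"
  proof (cases B)
    case top
    show ?thesis unfolding top using A by (auto simp: ennreal_mult_top)
  next
    case (real b)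
    show ?thesis
    proof (cases "b = 0")
      case True
      \<comment> \<open>For b = 0 the balanced value of c would be 0, so arbitrarily small c are
        used instead.\<close>
      have "(\<integral>\<^sup>+x. w x * f x \<partial>M) \<le> 0"
      proof (rule ennreal_le_epsilon)
        fix e :: real assume e: "0 < e"
        have "(\<integral>\<^sup>+x. w x * f x \<partial>M) \<le> ennreal (e / A * A)"
          using young[of "e / A"] e A real True by simp
        then show "(\<integral>\<^sup>+x. w x * f x \<partial>M) \<le> 0 + ennreal e" using A by simp
      qed
      then show ?thesis by simp
    next
      case False
      then have b: "0 < b" using real by simp
      define c where "c = (b / A) powr (1 / p)"
      have c: "0 < c" unfolding c_def using b A by simp
      have "c powr (1 - p) * b = c * A"
      proof -
        have "c powr p = b / A" unfolding c_def using b A p by (simp add: powr_powr)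
        then show ?thesis using c A b by (simp add: powr_diff field_simps)
      qed
      then have "(\<integral>\<^sup>+x. w x * f x \<partial>M) \<le> ennreal (2 * c * A)"
        using young[OF c] c A real b by (simp add: mult_ac ennreal_mult'[symmetric] ennreal_plus[symmetric] del: ennreal_plus)
      then have "ennpow (\<integral>\<^sup>+x. w x * f x \<partial>M) p \<le> ennpow (ennreal (2 * c * A)) p"
        using p by (intro ennpow_mono) auto
      also have "\<dots> = ennreal (2 powr p * A powr (p - 1) * b)"
      proof -
        have "(2 * c * A) powr p = 2 powr p * (c powr p) * A powr p" using c A by (simp add: powr_mult)
        also have "c powr p = b / A" unfolding c_def using b A p by (simp add: powr_powr)
        also have "2 powr p * (b / A) * A powr p = 2 powr p * A powr (p - 1) * b" using A by (simp add: powr_diff)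
        finally show ?thesis using c A by (simp add: ennpow_ennreal)
      qed
      finally show ?thesis using real A by (simp add: ennreal_mult)
    qed
  qed
  then show ?thesis unfolding B_def .
qed

lemma Lp_norm_ennpow: "p \<noteq> 0 \<Longrightarrow> ennpow (Lp_norm p f M) p = (\<integral>\<^sup>+x. ennpow (f x) p \<partial>M)"
  by (simp add: Lp_norm_def ennpow_inverse)

text \<open>\<open>jensen_ennpow\<close> with the decaying weight, which is integrable and at most
  1, so that the weighted integral on the right can be replaced by the plain one. The constant does
  not depend on the centre c by translation invariance.\<close>

lemma jp_weight_Lp:
  fixes a p :: real
  assumes a: "a > real DIM('a::euclidean_space)" and p: "1 \<le> p"
  obtains C where "C > 0" "\<And>(f :: 'a \<Rightarrow> complex) M c. f \<in> borel_measurable borel \<Longrightarrow> 0 \<le> M \<Longrightarrow>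
     (\<integral>\<^sup>+x. ennreal (norm (f x) powr p) \<partial>lborel) \<le> ennreal (M powr p) \<Longrightarrow>
     (\<integral>\<^sup>+x. ennreal ((1 + norm (x - c)) powr (- a) * norm (f x)) \<partial>lborel) \<le> ennreal (C * M)"
proof
  define A where "A = (LBINT x. (1 + norm (x::'a)) powr (- a)) + 1"
  have A0: "0 < A" unfolding A_def by (simp add: add_nonneg_pos)
  define C where "C = (2 powr p * A powr (p - 1)) powr (1 / p)"
  show C0: "C > 0" unfolding C_def using A0 by simp
  fix f :: "'a \<Rightarrow> complex" and M c
  assume [measurable]: "f \<in> borel_measurable borel" and M: "0 \<le> M"
    and f: "(\<integral>\<^sup>+x. ennreal (norm (f x) powr p) \<partial>lborel) \<le> ennreal (M powr p)"
  define w where "w = (\<lambda>x::'a. ennreal ((1 + norm (x - c)) powr (- a)))"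
  have [measurable]: "w \<in> borel_measurable lborel" unfolding w_def by measurable
  have wA: "(\<integral>\<^sup>+x. w x \<partial>lborel) \<le> ennreal A"
  proof -
    have "(\<integral>\<^sup>+x. w x \<partial>lborel) = (\<integral>\<^sup>+x. ennreal ((1 + norm (x::'a)) powr (- a)) \<partial>lborel)"
      unfolding w_def by (subst nn_integral_lborel_affine[of _ 1 c]) simp_all
    also have "\<dots> = ennreal (LBINT x. (1 + norm (x::'a)) powr (- a))"
      using integrable_jp[OF a] by (intro nn_integral_eq_integral) auto
    also have "\<dots> \<le> ennreal A" unfolding A_def by (intro ennreal_leI) simp
    finally show ?thesis .
  qed
  have w1: "w x \<le> 1" for x
  proof -
    have "(1 + norm (x - c)) powr (- a) \<le> (1 + norm (x - c)) powr 0" using a by (intro powr_mono) auto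
    also have "\<dots> = 1" using norm_ge_zero[of "x - c"] by (simp add: add_nonneg_eq_0_iff)
    finally show ?thesis unfolding w_def by (simp add: ennreal_le_1)
  qed
  have "ennpow (\<integral>\<^sup>+x. w x * ennreal (norm (f x)) \<partial>lborel) p \<le> ennreal (2 powr p * A powr (p - 1)) * (\<integral>\<^sup>+x. w x * ennpow (ennreal (norm (f x))) p \<partial>lborel)"
    by (rule jensen_ennpow[OF p A0 wA]) measurable
  also have "(\<integral>\<^sup>+x. w x * ennpow (ennreal (norm (f x))) p \<partial>lborel) \<le> (\<integral>\<^sup>+x. 1 * ennreal (norm (f x) powr p) \<partial>lborel)"
    by (intro nn_integral_mono mult_mono w1) (auto simp: ennpow_ennreal)
  also have "\<dots> \<le> ennreal (M powr p)" using f by simp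
  finally have "ennpow (\<integral>\<^sup>+x. w x * ennreal (norm (f x)) \<partial>lborel) p \<le> ennreal (2 powr p * A powr (p - 1)) * ennreal (M powr p)"
    by (simp add: mult_left_mono)
  also have "\<dots> = ennpow (ennreal (C * M)) p"
  proof -
    have "C powr p = 2 powr p * A powr (p - 1)" unfolding C_def using p A0 by (simp add: powr_powr)
    then have "(C * M) powr p = 2 powr p * A powr (p - 1) * M powr p" using M C0 by (simp add: powr_mult)
    then show ?thesis using M C0 by (simp add: ennpow_ennreal ennreal_mult'[symmetric])
  qed
  finally have "(\<integral>\<^sup>+x. w x * ennreal (norm (f x)) \<partial>lborel) \<le> ennreal (C * M)"
    by (rule le_ennpowI[rotated]) (use p in simp)
  then show "(\<integral>\<^sup>+x. ennreal ((1 + norm (x - c)) powr (- a) * norm (f x)) \<partial>lborel) \<le> ennreal (C * M)"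
    unfolding w_def by (simp add: ennreal_mult''[symmetric])
qed

section \<open>Heat kernels and their frequency-localized pieces\<close>

locale heat_lp =
  fixes \<Phi> :: "'a::euclidean_space \<Rightarrow> complex" and \<alpha> :: real
  assumes lp: "lp_function \<Phi>" and \<alpha>_pos: "0 < \<alpha>" and \<alpha>_le: "\<alpha> \<le> 2"
begin

text \<open>Any exponent strictly between \<open>DIM('a)\<close> and \<open>DIM('a) + \<alpha>\<close> would do.\<close>

definition decay :: real where "decay = real DIM('a) + \<alpha> / 2"

lemma decay_gt: "decay > real DIM('a)" unfolding decay_def using \<alpha>_pos by simp

lemma decay_nonneg: "decay \<ge> 0" using decay_gt by simp

abbreviation K :: "real \<Rightarrow> 'a \<Rightarrow> complex" where "K \<equiv> heat_kernel \<alpha>"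

definition k :: "nat \<Rightarrow> real \<Rightarrow> 'a \<Rightarrow> complex" where "k j \<tau> = cv (lp_fat \<Phi> j) (K \<tau>)"

lemma heat_kernel_scale:
  assumes \<tau>: "0 < \<tau>"
  shows "K \<tau> = dil (\<tau> powr (- 1 / \<alpha>)) (K 1)"
proof
  fix x
  define c where "c = \<tau> powr (- 1 / \<alpha>)"
  have c: "0 < c" unfolding c_def using \<tau> by simp
  have e: "- \<tau> * norm (0 + c *\<^sub>R \<xi>) powr \<alpha> = - 1 * norm \<xi> powr \<alpha>" for \<xi> :: 'a
  proof -
    have "norm (0 + c *\<^sub>R \<xi>) powr \<alpha> = c powr \<alpha> * norm \<xi> powr \<alpha>" using c by (simp add: powr_mult)
    also have "c powr \<alpha> = \<tau> powr (- 1)" unfolding c_def using \<alpha>_pos by (simp add: powr_powr)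
    finally show ?thesis using \<tau> by (simp add: powr_minus)
  qed
  have "K \<tau> x = \<bar>c\<bar> ^ DIM('a) *\<^sub>R (LBINT \<xi>. cis (2 * pi * (x \<bullet> (0 + c *\<^sub>R \<xi>))) * of_real (exp (- \<tau> * norm (0 + c *\<^sub>R \<xi>) powr \<alpha>)))"
    unfolding heat_kernel_def by (rule integral_lborel_affine) (use c in simp)
  also have "\<dots> = of_real (c ^ DIM('a)) * (LBINT \<xi>. cis (2 * pi * ((c *\<^sub>R x) \<bullet> \<xi>)) * of_real (exp (- 1 * norm \<xi> powr \<alpha>)))"
    unfolding e using c by (simp add: scaleR_conv_of_real)
  finally show "K \<tau> x = dil (\<tau> powr (- 1 / \<alpha>)) (K 1) x" unfolding dil_def heat_kernel_def c_def .
qed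

text \<open>Obtained by rescaling K 1, so the constants depend on \<tau>. Bounds uniform in \<tau>
  will come from the \<open>L\<^sup>1\<close> norm, which the rescaling preserves.\<close>

lemma heat_kernel_smooth:
  assumes \<tau>: "0 < \<tau>"
  shows "fam {\<lambda>_ x. (1 + norm x) powr decay} (\<lambda>_::unit. K \<tau>)"
proof -
  let ?c = "\<tau> powr (- 1 / \<alpha>)"
  have c: "0 < ?c" using \<tau> by simp
  have "fam {\<lambda>_ x. (1 + norm x) powr decay} (\<lambda>(_::unit) y. of_real (?c ^ DIM('a)) * K 1 (?c *\<^sub>R y + 0))"
  proof (rule fam_affine[OF heat_kernel_fam[OF lp \<alpha>_pos decay_def]])
    fix w :: "unit \<Rightarrow> 'a \<Rightarrow> real" and n assume "w \<in> {\<lambda>_ x. (1 + norm x) powr decay}"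
    then have w: "w = (\<lambda>_ x. (1 + norm x) powr decay)" by simp
    define D where "D = norm (complex_of_real (?c ^ DIM('a))) * \<bar>?c\<bar> ^ n"
    have "D * (1 + norm y) powr decay \<le> (D * (1 + 1 / ?c) powr decay) * (1 + norm (?c *\<^sub>R y + 0)) powr decay" for y :: 'a
    proof -
      have "1 + norm y \<le> (1 + 1 / ?c) * (1 + ?c * norm y)" using c by (simp add: field_simps add_nonneg_nonneg)
      then have "(1 + norm y) powr decay \<le> ((1 + 1 / ?c) * (1 + ?c * norm y)) powr decay"
        using decay_nonneg by (intro powr_mono2) auto
      also have "\<dots> = (1 + 1 / ?c) powr decay * (1 + ?c * norm y) powr decay"
        using c by (subst powr_mult) auto
      finally have "D * (1 + norm y) powr decay \<le> D * ((1 + 1 / ?c) powr decay * (1 + ?c * norm y) powr decay)"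
        unfolding D_def by (intro mult_left_mono) auto
      then show ?thesis using c by simp
    qed
    moreover have "0 \<le> D * (1 + 1 / ?c) powr decay" unfolding D_def by simp
    ultimately show "\<exists>w'\<in>{\<lambda>_ x. (1 + norm x) powr decay}. \<exists>C\<ge>0. \<forall>i y. norm (complex_of_real (?c ^ DIM('a))) * \<bar>?c\<bar> ^ n * w i y \<le> C * w' i (?c *\<^sub>R y + 0)"
      unfolding w D_def by (intro bexI[of _ "\<lambda>_ x. (1 + norm x) powr decay"] exI[of _ "D * (1 + 1 / ?c) powr decay", unfolded D_def] conjI allI) simp_all
  qed
  then show ?thesis unfolding heat_kernel_scale[OF \<tau>] dil_def[abs_def] by simp
qed

lemma one_le_jp_powr: "1 \<le> (1 + norm (x::'a)) powr decay"
  using decay_nonneg by (intro ge_one_powr_ge_zero) auto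

lemma fam_decay_imp_fam1: "fam {\<lambda>_ x. (1 + norm x) powr decay} (H :: 'i \<Rightarrow> 'a \<Rightarrow> complex) \<Longrightarrow> fam {\<lambda>_ _. 1} H"
  by (rule fam_weaken) (auto intro!: exI[of _ 1] one_le_jp_powr)

lemmas heat_kernel_fam1 = fam_decay_imp_fam1[OF heat_kernel_smooth]

lemma heat_kernel_measurable_pair [measurable]:
  "(\<lambda>(\<tau>, x). K \<tau> x) \<in> borel_measurable (borel \<Otimes>\<^sub>M (borel :: 'a measure))"
  unfolding heat_kernel_def by measurable

lemma heat_kernel_measurable [measurable]: "K \<tau> \<in> borel_measurable borel"
  unfolding heat_kernel_def[abs_def] by measurable

lemma heat_kernel_1_bound:
  obtains C where "C \<ge> 0" "\<And>x. norm (K 1 x) \<le> C * (1 + norm x) powr (- decay)"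
proof -
  obtain C where C: "C \<ge> 0" "\<And>x. (1 + norm x) powr decay * norm (K 1 x) \<le> C"
    using fam_bound[OF heat_kernel_smooth[of 1], of "\<lambda>_ x. (1 + norm x) powr decay"] by auto
  have "norm (K 1 x) \<le> C * (1 + norm x) powr (- decay)" for x
  proof -
    have "(1 + norm x) powr decay > 0" using norm_ge_zero[of x] by (simp add: add_nonneg_eq_0_iff)
    then show ?thesis using C(2)[of x] by (simp add: powr_minus divide_inverse[symmetric] pos_le_divide_eq mult.commute)
  qed
  then show thesis using that C(1) by blast
qed

lemma integrable_decay: "integrable lborel (\<lambda>x::'a. (1 + norm x) powr (- decay))"
  by (rule integrable_jp[OF decay_gt])

lemma heat_kernel_1_integrable: "integrable lborel (K 1)"
proof -
  obtain C where C: "C \<ge> 0" "\<And>x. norm (K 1 x) \<le> C * (1 + norm x) powr (- decay)" using heat_kernel_1_bound by blast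
  show ?thesis
    by (rule integrable_bound[OF integrable_mult_right[OF integrable_decay, of C]])
      (use C in \<open>auto simp: abs_mult\<close>)
qed

lemma heat_kernel_integrable: "0 < \<tau> \<Longrightarrow> integrable lborel (K \<tau>)"
  unfolding heat_kernel_scale by (intro integrable_dil heat_kernel_1_integrable) simp

definition \<kappa> :: real where "\<kappa> = (LBINT x. norm (K 1 x))"

lemma \<kappa>_nonneg: "0 \<le> \<kappa>" unfolding \<kappa>_def by simp

lemma integral_norm_heat_kernel: "0 < \<tau> \<Longrightarrow> (LBINT x. norm (K \<tau> x)) = \<kappa>"
  unfolding \<kappa>_def heat_kernel_scale by (intro integral_norm_dil) simp

text \<open>The symbol is real and even, so conjugation amounts to the substitution of - \<xi> for
  \<xi>. It is needed because the result has to be a real distribution.\<close>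

lemma heat_kernel_real: "K \<tau> x \<in> \<real>"
proof -
  have "cnj (K \<tau> x) = (LBINT \<xi>. cis (- 2 * pi * (x \<bullet> \<xi>)) * of_real (exp (- \<tau> * norm \<xi> powr \<alpha>)))"
    unfolding heat_kernel_def by (subst Bochner_Integration.integral_cnj[symmetric]) (simp add: cis_cnj)
  also have "\<dots> = K \<tau> x"
    using integral_lborel_affine[of "-1" "\<lambda>\<xi>. cis (- 2 * pi * (x \<bullet> \<xi>)) * of_real (exp (- \<tau> * norm \<xi> powr \<alpha>))" 0]
    unfolding heat_kernel_def by simp
  finally show ?thesis by (simp add: Reals_cnj_iff)
qed

text \<open>For j > 0 cancellation turns derivatives of order N into the factor
  \<open>2 ^ (j * N)\<close>. For j = 0 there is no cancellation, that factor is 1, and order 0 is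
  used. This is why the hypothesis mentions both orders.\<close>

lemma fat_bound:
  obtains C where "C \<ge> 0" "\<And>j (\<theta> :: 'a \<Rightarrow> complex) B z. fam {\<lambda>_ _. 1} (\<lambda>_::unit. \<theta>) \<Longrightarrow>
     (\<And>bs x. set bs \<subseteq> Basis \<Longrightarrow> length bs = 0 \<or> length bs = N \<Longrightarrow> (1 + norm x) powr decay * norm (iter_deriv bs \<theta> x) \<le> B) \<Longrightarrow>
     norm (cv (lp_fat \<Phi> j) \<theta> z) \<le> C * B / 2 ^ (j * N) * (1 + norm z) powr (- decay)"
proof -
  obtain C0 where C0: "C0 \<ge> 0" "\<And>\<rho> \<theta> B z. \<rho> \<ge> 1 \<Longrightarrow> (\<And>x. (1 + norm x) powr decay * norm (\<theta> x) \<le> B) \<Longrightarrow>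
      norm (cv (dil \<rho> \<Phi>) \<theta> z) \<le> C0 * B * (1 + norm z) powr (- decay)"
    using cv_bound[OF lp_sch1[OF lp] decay_nonneg] by blast
  obtain C1 where C1: "C1 \<ge> 0" "\<And>\<rho> \<theta> B z. \<rho> \<ge> 1 \<Longrightarrow> fam {\<lambda>_ _. 1} (\<lambda>_::unit. \<theta>) \<Longrightarrow>
     (\<And>bs x. set bs \<subseteq> Basis \<Longrightarrow> length bs = N \<Longrightarrow> (1 + norm x) powr decay * norm (iter_deriv bs \<theta> x) \<le> B) \<Longrightarrow>
      norm (cv (dil \<rho> (lp_mother \<Phi>)) \<theta> z) \<le> C1 * B / \<rho> ^ N * (1 + norm z) powr (- decay)"
    using annular_cv_bound[OF annular_lp_mother[OF lp] decay_nonneg, of N] by blast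
  show thesis
  proof (rule that[of "C0 + C1"])
    show "0 \<le> C0 + C1" using C0(1) C1(1) by simp
    fix j and \<theta> :: "'a \<Rightarrow> complex" and B z
    assume \<theta>: "fam {\<lambda>_ _. 1} (\<lambda>_::unit. \<theta>)"
      and B: "\<And>bs x. set bs \<subseteq> Basis \<Longrightarrow> length bs = 0 \<or> length bs = N \<Longrightarrow> (1 + norm x) powr decay * norm (iter_deriv bs \<theta> x) \<le> B"
    have B0: "(1 + norm x) powr decay * norm (\<theta> x) \<le> B" for x using B[of "[]" x] by simp
    have Bn: "0 \<le> B" using B0[of 0] by (metis mult_nonneg_nonneg norm_ge_zero order_trans powr_ge_zero)
    show "norm (cv (lp_fat \<Phi> j) \<theta> z) \<le> (C0 + C1) * B / 2 ^ (j * N) * (1 + norm z) powr (- decay)"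
    proof (cases "j = 0")
      case True
      have "norm (cv (dil 2 \<Phi>) \<theta> z) \<le> C0 * B * (1 + norm z) powr (- decay)" by (rule C0(2)[OF _ B0]) simp
      also have "\<dots> \<le> (C0 + C1) * B * (1 + norm z) powr (- decay)" using C1(1) Bn by (intro mult_right_mono) auto
      finally show ?thesis using True by (simp add: lp_fat_def)
    next
      case False
      have "norm (cv (dil (2 ^ j) (lp_mother \<Phi>)) \<theta> z) \<le> C1 * B / (2 ^ j) ^ N * (1 + norm z) powr (- decay)"
        by (rule C1(2)[OF _ \<theta> B]) auto
      also have "\<dots> \<le> (C0 + C1) * B / (2 ^ j) ^ N * (1 + norm z) powr (- decay)"
        using C0(1) Bn by (intro mult_right_mono divide_right_mono) auto
      finally show ?thesis using False by (simp add: lp_fat_def power_mult)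
    qed
  qed
qed

end

section \<open>Young's inequality and associativity beyond Schwartz functions\<close>

lemma norm_integral_le_nn: "ennreal (norm (\<integral>x. f x \<partial>M)) \<le> (\<integral>\<^sup>+x. ennreal (norm (f x)) \<partial>M)"
  for f :: "'x \<Rightarrow> 'b::{banach,second_countable_topology}"
  by (cases "integrable M f") (auto simp: integral_norm_bound_ennreal not_integrable_integral_eq)

lemma cv_measurable [measurable]:
  assumes [measurable]: "f \<in> borel_measurable borel" "g \<in> borel_measurable borel"
  shows "cv f g \<in> borel_measurable borel"
  unfolding cv_def[abs_def] by measurable

lemma nn_integral_shift:
  fixes f :: "'a::euclidean_space \<Rightarrow> ennreal"
  assumes "f \<in> borel_measurable borel"
  shows "(\<integral>\<^sup>+x. f (x - y) \<partial>lborel) = (\<integral>\<^sup>+x. f x \<partial>lborel)" "(\<integral>\<^sup>+y. f (x - y) \<partial>lborel) = (\<integral>\<^sup>+x. f x \<partial>lborel)"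
  using nn_integral_lborel_affine[OF assms, of 1 "- y"] nn_integral_lborel_affine[OF assms, of "-1" x] by simp_all

lemma nn_integral_norm_cv:
  fixes f g :: "'a::euclidean_space \<Rightarrow> complex"
  assumes [measurable]: "f \<in> borel_measurable borel" "g \<in> borel_measurable borel"
  shows "(\<integral>\<^sup>+x. ennreal (norm (cv f g x)) \<partial>lborel)
    \<le> (\<integral>\<^sup>+x. ennreal (norm (f x)) \<partial>lborel) * (\<integral>\<^sup>+x. ennreal (norm (g x)) \<partial>lborel)"
proof -
  have "(\<integral>\<^sup>+x. ennreal (norm (cv f g x)) \<partial>lborel) \<le> (\<integral>\<^sup>+x. \<integral>\<^sup>+y. ennreal (norm (f y)) * ennreal (norm (g (x - y))) \<partial>lborel \<partial>lborel)"
    unfolding cv_def by (intro nn_integral_mono order_trans[OF norm_integral_le_nn]) (simp add: norm_mult ennreal_mult)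
  also have "\<dots> = (\<integral>\<^sup>+y. \<integral>\<^sup>+x. ennreal (norm (f y)) * ennreal (norm (g (x - y))) \<partial>lborel \<partial>lborel)"
    by (rule lborel_pair.Fubini') measurable
  also have "\<dots> = (\<integral>\<^sup>+y. ennreal (norm (f y)) * (\<integral>\<^sup>+x. ennreal (norm (g x)) \<partial>lborel) \<partial>lborel)"
    by (simp add: nn_integral_cmult nn_integral_shift(1)[of "\<lambda>x. ennreal (norm (g x))"])
  also have "\<dots> = (\<integral>\<^sup>+x. ennreal (norm (f x)) \<partial>lborel) * (\<integral>\<^sup>+x. ennreal (norm (g x)) \<partial>lborel)"
    by (rule nn_integral_multc) measurable
  finally show ?thesis .
qed

text \<open>The heat kernel is outside the scope of \<open>cv_assoc\<close>, whose proof goes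
  through Schwartz functions on the Fourier side; for bounded h Fubini applies directly.\<close>

lemma cv_assoc_bounded:
  fixes f g h :: "'a::euclidean_space \<Rightarrow> complex"
  assumes f: "integrable lborel f" and g: "integrable lborel g"
    and [measurable]: "h \<in> borel_measurable borel" and B: "\<And>x. norm (h x) \<le> B"
  shows "cv f (cv g h) = cv (cv f g) h"
proof
  fix x
  have [measurable]: "f \<in> borel_measurable borel" "g \<in> borel_measurable borel" using f g by (auto dest: borel_measurable_integrable)
  have "cv f (cv g h) x = (LBINT y. \<integral>v. f y * g (v - y) * h (x - v) \<partial>lborel)"
    unfolding cv_def
  proof (intro integral_cong refl)
    fix y
    have "(LBINT v. f y * g (v - y) * h (x - v)) = (LBINT v. f y * g v * h (x - y - v))"
      using integral_shift(1)[of "\<lambda>v. f y * g v * h (x - y - v)" y] by (simp add: algebra_simps)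
    then show "f y * (LBINT v. g v * h (x - y - v)) = (LBINT v. f y * g (v - y) * h (x - v))"
      by (simp only: mult.assoc integral_mult_right_zero)
  qed
  also have "\<dots> = (LBINT v. \<integral>y. f y * g (v - y) * h (x - v) \<partial>lborel)"
  proof (rule lborel_pair.Fubini_integral)
    have 1: "integrable (lborel \<Otimes>\<^sub>M lborel) (\<lambda>z. B *\<^sub>R (f (snd z) * g (fst z - snd z)))"
      using lborel_pair.integrable_product_swap[OF integrable_conv_pair[OF f g]]
      by (intro integrable_scaleR_right) (simp add: case_prod_unfold)
    have 2: "(\<lambda>z. f (snd z) * g (fst z - snd z) * h (x - fst z)) \<in> borel_measurable (lborel \<Otimes>\<^sub>M lborel)" by measurable
    have "norm (f y * g (v - y)) * norm (h (x - v)) \<le> \<bar>B\<bar> * norm (f y * g (v - y))" for v y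
      unfolding mult.commute[of "\<bar>B\<bar>"] using B[of "x - v"] by (intro mult_left_mono) auto
    then have 3: "norm (f (snd z) * g (fst z - snd z) * h (x - fst z)) \<le> norm (B *\<^sub>R (f (snd z) * g (fst z - snd z)))" for z
      by (simp only: norm_mult norm_scaleR)
    show "integrable (lborel \<Otimes>\<^sub>M lborel) (\<lambda>(v, y). f y * g (v - y) * h (x - v))"
      unfolding case_prod_beta by (rule integrable_bound[OF 1 2]) (intro AE_I2 3)
  qed
  also have "\<dots> = cv (cv f g) h x" unfolding cv_def by simp
  finally show "cv f (cv g h) x = cv (cv f g) h x" .
qed

context heat_lp
begin

lemma heat_kernel_even: "K \<tau> (- x) = K \<tau> x"
  using integral_lborel_affine[of "-1" "\<lambda>\<xi>. cis (2 * pi * (x \<bullet> \<xi>)) * of_real (exp (- \<tau> * norm \<xi> powr \<alpha>))" 0]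
  unfolding heat_kernel_def by simp

lemma heat_kernel_bound:
  assumes "0 < \<tau>"
  obtains C where "C \<ge> 0" "\<And>x. norm (K \<tau> x) \<le> C"
proof -
  obtain C where "C \<ge> 0" "\<And>x. 1 * norm (K \<tau> x) \<le> C"
    using fam_bound[OF heat_kernel_fam1[OF assms], of "\<lambda>_ _. 1"] by auto
  then show thesis using that by simp
qed

lemmas fat_sch1 = lp_fat_sch1[OF lp]
lemmas kernel_sch1 = lp_kernel_sch1[OF lp]

lemma fat_measurable [measurable]: "lp_fat \<Phi> j \<in> borel_measurable borel" by (rule sch_measurable[OF fat_sch1])
lemma kernel_measurable [measurable]: "lp_kernel \<Phi> j \<in> borel_measurable borel" by (rule sch_measurable[OF kernel_sch1])
lemma fat_integrable: "integrable lborel (lp_fat \<Phi> j)" by (rule sch_integrable[OF fat_sch1])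

lemma cv_even:
  assumes "\<And>x. f (- x) = f x" "\<And>x. g (- x) = g x"
  shows "cv f g (- x) = cv f g (x :: 'b::euclidean_space)"
proof -
  have "cv f g (- x) = (LBINT y. f y * g (x + y))"
    unfolding cv_def by (intro integral_cong refl) (metis assms(2) minus_add_distrib minus_diff_eq diff_minus_eq_add add.commute)
  also have "\<dots> = cv f g x"
    using integral_lborel_affine[of "-1" "\<lambda>y. f y * g (x + y)" 0] unfolding cv_def by (simp add: assms(1))
  finally show ?thesis .
qed

lemma k_even: "k j \<tau> (- x) = k j \<tau> x"
  unfolding k_def by (rule cv_even) (rule lp_fat_even[OF lp], rule heat_kernel_even)

lemma k_measurable_pair [measurable]: "(\<lambda>(\<tau>, x). k j \<tau> x) \<in> borel_measurable (borel \<Otimes>\<^sub>M (borel :: 'a measure))"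
  unfolding k_def cv_def by measurable

lemma k_measurable [measurable]: "k j \<tau> \<in> borel_measurable borel"
  unfolding k_def by (rule cv_measurable[OF fat_measurable heat_kernel_measurable])

lemma fam_bound_uniform:
  assumes H: "fam {\<lambda>_ x. (1 + norm x) powr decay} (H :: 'i \<Rightarrow> 'a \<Rightarrow> complex)"
  obtains B where "B \<ge> 0" "\<And>i bs x. set bs \<subseteq> Basis \<Longrightarrow> length bs = 0 \<or> length bs = N \<Longrightarrow>
    (1 + norm x) powr decay * norm (iter_deriv bs (H i) x) \<le> B"
proof -
  let ?S = "{bs::'a list. set bs \<subseteq> Basis \<and> length bs \<le> N}"
  have fin: "finite ?S" by (rule finite_lists_length_le) simp
  have "\<exists>C\<ge>0. \<forall>i x. (1 + norm x) powr decay * norm (iter_deriv bs (H i) x) \<le> C" if "bs \<in> ?S" for bs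
  proof -
    obtain C where "C \<ge> 0" "\<And>i x. (1 + norm x) powr decay * norm (iter_deriv bs (H i) x) \<le> C"
      using fam_bound_deriv[OF H, of bs "\<lambda>_ x. (1 + norm x) powr decay"] \<open>bs \<in> ?S\<close> by auto
    then show ?thesis by (intro exI[of _ C]) simp
  qed
  then obtain C where C: "\<And>bs. bs \<in> ?S \<Longrightarrow> C bs \<ge> 0 \<and> (\<forall>i x. (1 + norm x) powr decay * norm (iter_deriv bs (H i) x) \<le> C bs)"
    by metis
  show thesis
  proof (rule that[of "sum C ?S"])
    show "0 \<le> sum C ?S" using C by (intro sum_nonneg) auto
    fix i bs and x :: 'a assume "set bs \<subseteq> (Basis :: 'a set)" "length bs = 0 \<or> length bs = N"
    then have bs: "bs \<in> ?S" by auto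
    have "(1 + norm x) powr decay * norm (iter_deriv bs (H i) x) \<le> C bs" using C[OF bs] by blast
    also have "\<dots> \<le> sum C ?S" using C by (intro member_le_sum bs fin) auto
    finally show "(1 + norm x) powr decay * norm (iter_deriv bs (H i) x) \<le> sum C ?S" .
  qed
qed

text \<open>For fixed \<tau> the decay in j is as fast as desired, with a constant depending on
  \<tau>. This secures convergence of the dyadic sums for every s; the rate in \<tau> is the subject
  of \<open>k_L1\<close>.\<close>

lemma k_bound:
  assumes "0 < \<tau>"
  obtains C where "C \<ge> 0" "\<And>j z. norm (k j \<tau> z) \<le> C / 2 ^ (j * N) * (1 + norm z) powr (- decay)"
proof -
  obtain C where C: "C \<ge> 0" "\<And>j \<theta> B z. fam {\<lambda>_ _. 1} (\<lambda>_::unit. \<theta>) \<Longrightarrow>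
     (\<And>bs x. set bs \<subseteq> Basis \<Longrightarrow> length bs = 0 \<or> length bs = N \<Longrightarrow> (1 + norm x) powr decay * norm (iter_deriv bs \<theta> x) \<le> B) \<Longrightarrow>
     norm (cv (lp_fat \<Phi> j) \<theta> z) \<le> C * B / 2 ^ (j * N) * (1 + norm z) powr (- decay)"
    using fat_bound[of N] by blast
  obtain B where B: "B \<ge> 0" "\<And>(i::unit) bs x. set bs \<subseteq> Basis \<Longrightarrow> length bs = 0 \<or> length bs = N \<Longrightarrow> (1 + norm x) powr decay * norm (iter_deriv bs (K \<tau>) x) \<le> B"
    using fam_bound_uniform[OF heat_kernel_smooth[OF assms], of N] by blast
  show thesis
  proof (rule that[of "C * B"])
    show "0 \<le> C * B" using C(1) B(1) by simp
    show "norm (k j \<tau> z) \<le> C * B / 2 ^ (j * N) * (1 + norm z) powr (- decay)" for j z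
      unfolding k_def by (rule C(2)[OF heat_kernel_fam1[OF assms] B(2)])
  qed
qed

text \<open>N exceeds |s| by at least 1, so the growth \<open>2 powr (- j * s)\<close> of the pieces
  is beaten with a factor \<open>2 ^ j\<close> to spare, and the sum over j is geometric.\<close>

lemma powr_2_le:
  assumes "\<bar>s\<bar> + 1 \<le> real N" "0 \<le> X * C * M"
  shows "X / 2 ^ (j * N) * (C * (M * 2 powr (- (real j * s)))) \<le> X * C * M * (1 / 2) ^ j"
proof -
  have "(2::real) powr (- (real j * s)) / 2 ^ (j * N) = 2 powr (- (real j * s) - real (j * N))"
    unfolding powr_diff powr_realpow[OF zero_less_numeral] ..
  also have "\<dots> \<le> 2 powr (- real j)"
  proof (intro powr_mono)
    have "real j * 1 \<le> real j * (real N + s)" using assms by (intro mult_left_mono) auto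
    then show "- (real j * s) - real (j * N) \<le> - real j" by (simp add: algebra_simps)
  qed simp
  also have "\<dots> = (1 / 2) ^ j" by (simp only: powr_minus powr_realpow[OF zero_less_numeral] power_one_over inverse_eq_divide)
  finally have "X * C * M * (2 powr (- (real j * s)) / 2 ^ (j * N)) \<le> X * C * M * (1 / 2) ^ j"
    by (intro mult_left_mono assms(2))
  then show ?thesis by (simp add: mult_ac)
qed

end

section \<open>Distributions with dyadic pieces bounded in the Lebesgue norm\<close>

locale heat_lp_sp = heat_lp \<Phi> \<alpha> for \<Phi> :: "'a::euclidean_space \<Rightarrow> complex" and \<alpha> +
  fixes p s :: real
  assumes p: "1 \<le> p"
begin

definition lpc :: "'a dist \<Rightarrow> nat \<Rightarrow> 'a \<Rightarrow> complex" where
  "lpc u j x = u (\<lambda>y. lp_kernel \<Phi> j (x - y))"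

text \<open>Of the Triebel--Lizorkin norm, only the bound on each dyadic piece matters for the input.\<close>

definition bdd :: "'a dist \<Rightarrow> real \<Rightarrow> bool" where
  "bdd u M \<longleftrightarrow> tempered u \<and> 0 \<le> M \<and> (\<forall>j. (\<integral>\<^sup>+x. ennreal (norm (lpc u j x) powr p) \<partial>lborel)
     \<le> ennreal ((M * 2 powr (- (real j * s))) powr p))"

definition N :: nat where "N = nat \<lceil>\<bar>s\<bar> + 1\<rceil>"

lemma N_ge: "\<bar>s\<bar> + 1 \<le> real N" unfolding N_def by linarith

lemma bdd_tempered: "bdd u M \<Longrightarrow> tempered u" and bdd_nonneg: "bdd u M \<Longrightarrow> 0 \<le> M"
  unfolding bdd_def by auto

lemma lpc_continuous: "tempered u \<Longrightarrow> continuous_on UNIV (lpc u j)"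
  unfolding lpc_def[abs_def] by (rule continuous_tempered_translates[OF _ kernel_sch1])

lemma lpc_measurable: "tempered u \<Longrightarrow> lpc u j \<in> borel_measurable borel"
  by (rule borel_measurable_continuous_onI[OF lpc_continuous])

text \<open>That such a constant exists is part of the proof of \<open>\<omega>_pos\<close> and \<open>\<omega>_bound\<close>.\<close>

definition \<omega> :: real where "\<omega> = (SOME C. C > 0 \<and> (\<forall>u M j c. bdd u M \<longrightarrow>
     (\<integral>\<^sup>+x. ennreal ((1 + norm (x - c)) powr (- decay) * norm (lpc u j x)) \<partial>lborel) \<le> ennreal (C * (M * 2 powr (- (real j * s))))))"

lemma
  shows \<omega>_pos: "\<omega> > 0"
    and \<omega>_bound: "bdd u M \<Longrightarrow> (\<integral>\<^sup>+x. ennreal ((1 + norm (x - c)) powr (- decay) * norm (lpc u j x)) \<partial>lborel) \<le> ennreal (\<omega> * (M * 2 powr (- (real j * s))))"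
proof -
  obtain C where C: "C > 0" "\<And>(f :: 'a \<Rightarrow> complex) M c. f \<in> borel_measurable borel \<Longrightarrow> 0 \<le> M \<Longrightarrow>
     (\<integral>\<^sup>+x. ennreal (norm (f x) powr p) \<partial>lborel) \<le> ennreal (M powr p) \<Longrightarrow>
     (\<integral>\<^sup>+x. ennreal ((1 + norm (x - c)) powr (- decay) * norm (f x)) \<partial>lborel) \<le> ennreal (C * M)"
    using jp_weight_Lp[OF decay_gt p] by blast
  have "C > 0 \<and> (\<forall>u M j c. bdd u M \<longrightarrow>
     (\<integral>\<^sup>+x. ennreal ((1 + norm (x - c)) powr (- decay) * norm (lpc u j x)) \<partial>lborel) \<le> ennreal (C * (M * 2 powr (- (real j * s)))))"
  proof (intro conjI allI impI C(1))
    fix u M j c assume b: "bdd u M"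
    show "(\<integral>\<^sup>+x. ennreal ((1 + norm (x - c)) powr (- decay) * norm (lpc u j x)) \<partial>lborel) \<le> ennreal (C * (M * 2 powr (- (real j * s))))"
    proof (rule C(2))
      show "lpc u j \<in> borel_measurable borel" by (rule lpc_measurable[OF bdd_tempered[OF b]])
      show "0 \<le> M * 2 powr (- (real j * s))" using bdd_nonneg[OF b] by simp
      show "(\<integral>\<^sup>+x. ennreal (norm (lpc u j x) powr p) \<partial>lborel) \<le> ennreal ((M * 2 powr (- (real j * s))) powr p)"
        using b unfolding bdd_def by blast
    qed
  qed
  then have *: "\<omega> > 0 \<and> (\<forall>u M j c. bdd u M \<longrightarrow>
     (\<integral>\<^sup>+x. ennreal ((1 + norm (x - c)) powr (- decay) * norm (lpc u j x)) \<partial>lborel) \<le> ennreal (\<omega> * (M * 2 powr (- (real j * s)))))"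
    unfolding \<omega>_def by (rule someI)
  show "\<omega> > 0" using * by (rule conjunct1)
  show "(\<integral>\<^sup>+x. ennreal ((1 + norm (x - c)) powr (- decay) * norm (lpc u j x)) \<partial>lborel) \<le> ennreal (\<omega> * (M * 2 powr (- (real j * s))))"
    if "bdd u M" using * that by simp
qed

text \<open>The common estimate for the terms of all dyadic sums. The centre c is free, so that
  translates of one test function share the bound.\<close>

lemma weighted_nn:
  assumes u: "bdd u M" and X: "0 \<le> X" and h: "\<And>z. norm (h z) \<le> X / 2 ^ (j * N) * (1 + norm (z - c)) powr (- decay)"
  shows "(\<integral>\<^sup>+z. ennreal (norm (h z * lpc u j z)) \<partial>lborel) \<le> ennreal (X * \<omega> * M * (1 / 2) ^ j)"
proof -
  have [measurable]: "lpc u j \<in> borel_measurable borel" by (rule lpc_measurable[OF bdd_tempered[OF u]])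
  have "(\<integral>\<^sup>+z. ennreal (norm (h z * lpc u j z)) \<partial>lborel)
      \<le> (\<integral>\<^sup>+z. ennreal (X / 2 ^ (j * N)) * ennreal ((1 + norm (z - c)) powr (- decay) * norm (lpc u j z)) \<partial>lborel)"
  proof (intro nn_integral_mono)
    fix z
    have "norm (h z * lpc u j z) \<le> (X / 2 ^ (j * N)) * ((1 + norm (z - c)) powr (- decay) * norm (lpc u j z))"
      unfolding norm_mult mult.assoc[symmetric] by (intro mult_right_mono h) simp
    then show "ennreal (norm (h z * lpc u j z)) \<le> ennreal (X / 2 ^ (j * N)) * ennreal ((1 + norm (z - c)) powr (- decay) * norm (lpc u j z))"
      using X by (subst ennreal_mult[symmetric]) (auto intro!: ennreal_leI)
  qed
  also have "\<dots> = ennreal (X / 2 ^ (j * N)) * (\<integral>\<^sup>+z. ennreal ((1 + norm (z - c)) powr (- decay) * norm (lpc u j z)) \<partial>lborel)"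
    by (rule nn_integral_cmult) measurable
  also have "\<dots> \<le> ennreal (X / 2 ^ (j * N)) * ennreal (\<omega> * (M * 2 powr (- (real j * s))))"
    by (intro mult_left_mono \<omega>_bound[OF u]) simp
  also have "\<dots> = ennreal (X / 2 ^ (j * N) * (\<omega> * (M * 2 powr (- (real j * s)))))"
    using X by (intro ennreal_mult'[symmetric]) simp
  also have "\<dots> \<le> ennreal (X * \<omega> * M * (1 / 2) ^ j)"
    using X \<omega>_pos bdd_nonneg[OF u] by (intro ennreal_leI powr_2_le N_ge) simp
  finally show ?thesis .
qed

lemma weighted:
  assumes u: "bdd u M" and X: "0 \<le> X" and h: "\<And>z. norm (h z) \<le> X / 2 ^ (j * N) * (1 + norm (z - c)) powr (- decay)"
  shows "norm (LBINT z. h z * lpc u j z) \<le> X * \<omega> * M * (1 / 2) ^ j"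
    and "h \<in> borel_measurable borel \<Longrightarrow> integrable lborel (\<lambda>z. h z * lpc u j z)"
proof -
  note nn = weighted_nn[OF u X h]
  have "ennreal (norm (LBINT z. h z * lpc u j z)) \<le> ennreal (X * \<omega> * M * (1 / 2) ^ j)"
    by (rule order_trans[OF norm_integral_le_nn nn])
  then show "norm (LBINT z. h z * lpc u j z) \<le> X * \<omega> * M * (1 / 2) ^ j"
    using X \<omega>_pos bdd_nonneg[OF u] by (subst (asm) ennreal_le_iff) auto
  show "integrable lborel (\<lambda>z. h z * lpc u j z)" if [measurable]: "h \<in> borel_measurable borel"
  proof (rule integrableI_bounded)
    have [measurable]: "lpc u j \<in> borel_measurable borel" by (rule lpc_measurable[OF bdd_tempered[OF u]])
    show "(\<lambda>z. h z * lpc u j z) \<in> borel_measurable lborel" by measurable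
    show "(\<integral>\<^sup>+z. ennreal (norm (h z * lpc u j z)) \<partial>lborel) < \<infinity>"
      by (rule le_less_trans[OF nn]) simp
  qed
qed

section \<open>The convolution with the heat kernel as a limit of truncations\<close>

text \<open>The index is the truncation radius. Dilating the cutoff by a radius of at least 1 does
  not increase its derivatives; \<open>max 1 R\<close> extends this to all real indices without
  affecting the limit.\<close>

lemma truncated_kernel_fam:
  assumes \<tau>: "0 < \<tau>"
  shows "fam {\<lambda>_ y. (1 + norm y) powr decay} (\<lambda>R y. K \<tau> (x - y) * fourier \<Phi> (y /\<^sub>R max 1 R))"
proof (rule fam_mult)
  have "fam ((\<lambda>w j. w ()) ` {\<lambda>_ y. (1 + norm y) powr decay}) (\<lambda>_::real. K \<tau>)"
    by (rule fam_reindex[OF heat_kernel_smooth[OF \<tau>]])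
  then have K: "fam {\<lambda>_ y. (1 + norm y) powr decay} (\<lambda>_::real. K \<tau>)" by simp
  have "fam {\<lambda>_ y. (1 + norm y) powr decay} (\<lambda>(R::real) y. 1 * K \<tau> ((- 1) *\<^sub>R y + x))"
  proof (rule fam_affine[OF K])
    fix w :: "real \<Rightarrow> 'a \<Rightarrow> real" and n assume "w \<in> {\<lambda>_ y. (1 + norm y) powr decay}"
    then have w: "w = (\<lambda>_ y. (1 + norm y) powr decay)" by simp
    have "(1 + norm y) powr decay \<le> (1 + norm x) powr decay * (1 + norm ((- 1) *\<^sub>R y + x)) powr decay" for y :: 'a
    proof -
      have "1 + norm y \<le> (1 + norm (y + - x)) * (1 + norm (- x))" by (rule jp_triangle)
      then have "1 + norm y \<le> (1 + norm x) * (1 + norm ((- 1) *\<^sub>R y + x))"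
        by (simp add: norm_minus_commute mult.commute)
      then have "(1 + norm y) powr decay \<le> ((1 + norm x) * (1 + norm ((- 1) *\<^sub>R y + x))) powr decay"
        using decay_nonneg by (intro powr_mono2) auto
      then show ?thesis by (subst (asm) powr_mult) auto
    qed
    then show "\<exists>w'\<in>{\<lambda>_ y. (1 + norm y) powr decay}. \<exists>C\<ge>0. \<forall>(i::real) y. norm (1::complex) * \<bar>- 1\<bar> ^ n * w i y \<le> C * w' i ((- 1) *\<^sub>R y + x)"
      unfolding w by (intro bexI[of _ "\<lambda>_ y. (1 + norm y) powr decay"] exI[of _ "(1 + norm x) powr decay"]) simp_all
  qed
  then show "fam {\<lambda>_ y. (1 + norm y) powr decay} (\<lambda>(R::real) y. K \<tau> (x - y))" by simp
  have "fam ((\<lambda>w j. w ()) ` {\<lambda>_ y. 1}) (\<lambda>_::real. fourier \<Phi>)"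
    by (rule fam_reindex[OF sch_imp_fam1[OF sch_fourier[OF lp_sch1[OF lp]]]])
  then have F: "fam {\<lambda>_ y. 1} (\<lambda>_::real. fourier \<Phi>)" by simp
  have "fam {\<lambda>_ y. 1} (\<lambda>(R::real) y. 1 * fourier \<Phi> ((1 / max 1 R) *\<^sub>R y + 0))"
  proof (rule fam_affine[OF F])
    fix w :: "real \<Rightarrow> 'a \<Rightarrow> real" and n assume "w \<in> {\<lambda>_ y. 1}"
    then have w: "w = (\<lambda>_ y. 1)" by simp
    have "\<bar>1 / max 1 i\<bar> ^ n \<le> 1" for i :: real by (intro power_le_one) auto
    then show "\<exists>w'\<in>{\<lambda>_ y. 1}. \<exists>C\<ge>0. \<forall>i y. norm (1::complex) * \<bar>1 / max 1 i\<bar> ^ n * w i y \<le> C * w' i ((1 / max 1 i) *\<^sub>R y + 0)"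
      unfolding w by (intro bexI[of _ "\<lambda>_ y. 1"] exI[of _ 1]) simp_all
  qed
  then show "fam {\<lambda>_ _. 1} (\<lambda>(R::real) y. fourier \<Phi> (y /\<^sub>R max 1 R))" by (simp add: divide_inverse)
qed auto

lemma truncated_kernel_sch1:
  assumes \<tau>: "0 < \<tau>" and R: "0 < R"
  shows "sch1 (\<lambda>y. K \<tau> (x - y) * fourier \<Phi> (y /\<^sub>R R))"
proof -
  have "sch1 (\<lambda>y. fourier \<Phi> (inverse R *\<^sub>R y + 0))"
    by (rule sch_affine_fixed[OF sch_fourier[OF lp_sch1[OF lp]]]) (use R in simp)
  then have "sch1 (\<lambda>y. fourier \<Phi> (y /\<^sub>R R) * K \<tau> (x - y))"
    by (intro sch_mult fam_reflect heat_kernel_fam1[OF \<tau>]) simp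
  then show ?thesis by (simp add: mult.commute)
qed

lemma k_term:
  assumes "0 < \<tau>"
  obtains C where "C \<ge> 0"
    "\<And>u M j x. bdd u M \<Longrightarrow> (\<integral>\<^sup>+z. ennreal (norm (k j \<tau> (x - z) * lpc u j z)) \<partial>lborel) \<le> ennreal (C * M * (1 / 2) ^ j)"
    "\<And>u M j x. bdd u M \<Longrightarrow> norm (LBINT z. k j \<tau> (x - z) * lpc u j z) \<le> C * M * (1 / 2) ^ j"
    "\<And>u M j x. bdd u M \<Longrightarrow> integrable lborel (\<lambda>z. k j \<tau> (x - z) * lpc u j z)"
proof -
  obtain C where C: "C \<ge> 0" "\<And>j z. norm (k j \<tau> z) \<le> C / 2 ^ (j * N) * (1 + norm z) powr (- decay)"
    using k_bound[OF assms, of N] by blast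
  have h: "norm (k j \<tau> (x - z)) \<le> C / 2 ^ (j * N) * (1 + norm (z - x)) powr (- decay)" for j x z
    using C(2)[of j "x - z"] by (simp add: norm_minus_commute)
  have m: "(\<lambda>z. k j \<tau> (x - z)) \<in> borel_measurable borel" for j x by measurable
  show thesis
  proof (rule that[of "C * \<omega>"])
    show "0 \<le> C * \<omega>" using C(1) \<omega>_pos by simp
    show "(\<integral>\<^sup>+z. ennreal (norm (k j \<tau> (x - z) * lpc u j z)) \<partial>lborel) \<le> ennreal (C * \<omega> * M * (1 / 2) ^ j)" if "bdd u M" for u M j x
      by (rule weighted_nn[OF that C(1) h])
    show "norm (LBINT z. k j \<tau> (x - z) * lpc u j z) \<le> C * \<omega> * M * (1 / 2) ^ j" if "bdd u M" for u M j x
      by (rule weighted(1)[OF that C(1) h])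
    show "integrable lborel (\<lambda>z. k j \<tau> (x - z) * lpc u j z)" if "bdd u M" for u M j x
      by (rule weighted(2)[OF that C(1) h m])
  qed
qed

lemma cv_fat_reflected_kernel: "cv (lp_fat \<Phi> j) (\<lambda>y. K \<tau> (x - y)) z = k j \<tau> (x - z)"
proof -
  have "cv (lp_fat \<Phi> j) (\<lambda>y. K \<tau> (x - y)) z = (LBINT y. lp_fat \<Phi> j y * K \<tau> (x - z + y))"
    unfolding cv_def by (simp add: algebra_simps)
  also have "\<dots> = k j \<tau> (x - z)"
    using integral_lborel_affine[of "-1" "\<lambda>y. lp_fat \<Phi> j y * K \<tau> (x - z + y)" 0]
    unfolding k_def cv_def by (simp add: lp_fat_even[OF lp])
  finally show ?thesis .
qed

text \<open>For each R the truncated kernel is a Schwartz function, so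
  \<open>tempered_lp_sums\<close> applies. The terms have a geometric majorant independent of R,
  hence Tannery's theorem reduces the limit to single terms. There dominated convergence is used
  twice: inside the convolution with the fat kernel and in the integral against the piece of
  u.\<close>

lemma trunc_conv_tendsto:
  assumes u: "bdd u M" and \<tau>: "0 < \<tau>"
  shows "(trunc_conv \<Phi> (K \<tau>) u x \<longlongrightarrow> (\<Sum>j. \<integral>z. k j \<tau> (x - z) * lpc u j z \<partial>lborel)) at_top"
proof -
  define \<theta> where "\<theta> = (\<lambda>R y. K \<tau> (x - y) * fourier \<Phi> (y /\<^sub>R max 1 R))"
  note ut = bdd_tempered[OF u]
  have \<theta>s: "sch1 (\<theta> R)" for R unfolding \<theta>_def by (rule truncated_kernel_sch1[OF \<tau>]) simp
  have \<theta>f: "fam {\<lambda>_ y. (1 + norm y) powr decay} \<theta>" unfolding \<theta>_def by (rule truncated_kernel_fam[OF \<tau>])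
  obtain B where B: "B \<ge> 0" "\<And>R bs y. set bs \<subseteq> Basis \<Longrightarrow> length bs = 0 \<or> length bs = N \<Longrightarrow>
    (1 + norm y) powr decay * norm (iter_deriv bs (\<theta> R) y) \<le> B"
    using fam_bound_uniform[OF \<theta>f, of N] by blast
  have \<theta>B: "norm (\<theta> R y) \<le> B" for R y
  proof -
    have "1 * norm (\<theta> R y) \<le> (1 + norm y) powr decay * norm (\<theta> R y)" by (intro mult_right_mono one_le_jp_powr) simp
    also have "\<dots> \<le> B" using B(2)[of "[]"] by simp
    finally show ?thesis by simp
  qed
  obtain C where C: "C \<ge> 0" "\<And>j \<theta> B z. fam {\<lambda>_ _. 1} (\<lambda>_::unit. \<theta>) \<Longrightarrow>
     (\<And>bs x. set bs \<subseteq> Basis \<Longrightarrow> length bs = 0 \<or> length bs = N \<Longrightarrow> (1 + norm x) powr decay * norm (iter_deriv bs \<theta> x) \<le> B) \<Longrightarrow>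
     norm (cv (lp_fat \<Phi> j) \<theta> z) \<le> C * B / 2 ^ (j * N) * (1 + norm z) powr (- decay)"
    using fat_bound[of N] by blast
  have cB: "norm (cv (lp_fat \<Phi> j) (\<theta> R) z) \<le> C * B / 2 ^ (j * N) * (1 + norm (z - 0)) powr (- decay)" for j R z
    using C(2)[OF sch_imp_fam1[OF \<theta>s] B(2)] by simp
  have CB: "0 \<le> C * B" using C(1) B(1) by simp
  have \<theta>m[measurable]: "\<theta> R \<in> borel_measurable borel" for R by (rule sch_measurable[OF \<theta>s])
  have [measurable]: "lpc u j \<in> borel_measurable borel" for j by (rule lpc_measurable[OF ut])
  have ev: "eventually (\<lambda>R::real. R \<ge> B') at_top" for B' by (rule eventually_ge_at_top)
  have \<theta>lim: "((\<lambda>R. \<theta> R y) \<longlongrightarrow> K \<tau> (x - y)) at_top" for y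
  proof (rule tendsto_eventually)
    show "\<forall>\<^sub>F R in at_top. \<theta> R y = K \<tau> (x - y)"
      using ev[of "1 + norm y"]
    proof eventually_elim
      case (elim R)
      then have R: "1 \<le> R" "norm y \<le> R" using norm_ge_zero[of y] by linarith+
      then have "norm (y /\<^sub>R max 1 R) \<le> 1" by (simp add: divide_simps max_def)
      then show ?case unfolding \<theta>_def using lp_one[OF lp] by simp
    qed
  qed
  have cvlim: "((\<lambda>R. cv (lp_fat \<Phi> j) (\<theta> R) z) \<longlongrightarrow> k j \<tau> (x - z)) at_top" for j z
    unfolding cv_fat_reflected_kernel[symmetric] cv_def
  proof (rule integral_dominated_convergence_at_top[where w = "\<lambda>y. norm (lp_fat \<Phi> j y) * B"])
    show "integrable lborel (\<lambda>y. norm (lp_fat \<Phi> j y) * B)" using fat_integrable by simp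
    show "\<forall>\<^sub>F R in at_top. AE y in lborel. norm (lp_fat \<Phi> j y * \<theta> R (z - y)) \<le> norm (lp_fat \<Phi> j y) * B"
      unfolding norm_mult by (intro always_eventually allI AE_I2 mult_left_mono \<theta>B) simp
    show "AE y in lborel. ((\<lambda>R. lp_fat \<Phi> j y * \<theta> R (z - y)) \<longlongrightarrow> lp_fat \<Phi> j y * K \<tau> (x - (z - y))) at_top"
      by (intro AE_I2 tendsto_mult_left \<theta>lim)
  qed measurable
  define t where "t = (\<lambda>j R. \<integral>z. cv (lp_fat \<Phi> j) (\<theta> R) z * lpc u j z \<partial>lborel)"
  have tlim: "(t j \<longlongrightarrow> (LBINT z. k j \<tau> (x - z) * lpc u j z)) at_top" for j
    unfolding t_def
  proof (rule integral_dominated_convergence_at_top[where w = "\<lambda>z. norm (of_real (C * B / 2 ^ (j * N) * (1 + norm (z - 0)) powr (- decay)) * lpc u j z)"])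
    have "integrable lborel (\<lambda>z. of_real (C * B / 2 ^ (j * N) * (1 + norm (z - 0)) powr (- decay)) * lpc u j z)"
    proof (rule weighted(2)[OF u CB])
      show "norm (complex_of_real (C * B / 2 ^ (j * N) * (1 + norm (z - 0)) powr (- decay))) \<le> C * B / 2 ^ (j * N) * (1 + norm (z - 0)) powr (- decay)" for z
        unfolding norm_of_real by (rule eq_refl[OF abs_of_nonneg]) (intro mult_nonneg_nonneg divide_nonneg_nonneg CB zero_le_power powr_ge_zero zero_le_numeral)
    qed measurable
    then show "integrable lborel (\<lambda>z. norm (of_real (C * B / 2 ^ (j * N) * (1 + norm (z - 0)) powr (- decay)) * lpc u j z))"
      by (rule integrable_norm)
    show "\<forall>\<^sub>F R in at_top. AE z in lborel. norm (cv (lp_fat \<Phi> j) (\<theta> R) z * lpc u j z)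
      \<le> norm (of_real (C * B / 2 ^ (j * N) * (1 + norm (z - 0)) powr (- decay)) * lpc u j z)"
    proof (intro always_eventually allI AE_I2)
      fix R z
      show "norm (cv (lp_fat \<Phi> j) (\<theta> R) z * lpc u j z) \<le> norm (of_real (C * B / 2 ^ (j * N) * (1 + norm (z - 0)) powr (- decay)) * lpc u j z)"
        unfolding norm_mult norm_of_real by (rule mult_right_mono[OF order_trans[OF cB abs_ge_self] norm_ge_zero])
    qed
    show "AE z in lborel. ((\<lambda>R. cv (lp_fat \<Phi> j) (\<theta> R) z * lpc u j z) \<longlongrightarrow> k j \<tau> (x - z) * lpc u j z) at_top"
      by (intro AE_I2 tendsto_mult_right cvlim)
  qed measurable
  have tB: "norm (t j R) \<le> (C * B) * \<omega> * M * (1 / 2) ^ j" for j R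
    unfolding t_def by (rule weighted(1)[OF u CB cB])
  have "((\<lambda>R. \<Sum>j. t j R) \<longlongrightarrow> (\<Sum>j. \<integral>z. k j \<tau> (x - z) * lpc u j z \<partial>lborel)) at_top"
  proof -
    have 1: "summable (\<lambda>j. (C * B) * \<omega> * M * (1 / 2) ^ j)" by (intro summable_mult summable_geometric) simp
    have 2: "\<forall>\<^sub>F (j, R) in at_top \<times>\<^sub>F at_top. norm (t j R) \<le> (C * B) * \<omega> * M * (1 / 2) ^ j"
      by (intro always_eventually) (simp only: case_prod_beta tB simp_thms)
    show ?thesis
      by (rule tannerys_theorem[OF tlim 2 1 trivial_limit_at_top_linorder, THEN conjunct2, THEN conjunct2])
  qed
  then show ?thesis
  proof (rule Lim_transform_eventually)
    show "\<forall>\<^sub>F R in at_top. (\<Sum>j. t j R) = trunc_conv \<Phi> (K \<tau>) u x R"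
      using ev[of 1]
    proof eventually_elim
      case (elim R)
      have "(\<lambda>j. t j R) sums u (\<theta> R)"
        unfolding t_def lpc_def by (rule tempered_lp_sums(1)[OF lp ut \<theta>s])
      then show ?case using elim unfolding trunc_conv_def \<theta>_def by (simp add: sums_iff max_def)
    qed
  qed
qed

lemma conv_dist_eq:
  assumes "bdd u M" "0 < \<tau>"
  shows "conv_dist \<Phi> (K \<tau>) u x = (\<Sum>j. \<integral>z. k j \<tau> (x - z) * lpc u j z \<partial>lborel)"
  unfolding conv_dist_def by (rule tendsto_Lim[OF _ trunc_conv_tendsto[OF assms]]) simp

text \<open>Truncated pairings at positive radii are real because kernel and cutoff are, and the
  real line is closed in the complex plane.\<close>

lemma conv_dist_real:
  assumes "bdd u M" "0 < \<tau>" "real_dist u"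
  shows "conv_dist \<Phi> (K \<tau>) u x \<in> \<real>"
proof -
  have "(trunc_conv \<Phi> (K \<tau>) u x \<longlongrightarrow> conv_dist \<Phi> (K \<tau>) u x) at_top"
    unfolding conv_dist_eq[OF assms(1,2)] by (rule trunc_conv_tendsto[OF assms(1,2)])
  then have 1: "?thesis" if "\<forall>\<^sub>F R in at_top. trunc_conv \<Phi> (K \<tau>) u x R \<in> \<real>"
    using that by (intro Lim_in_closed_set[OF closed_complex_Reals that trivial_limit_at_top_linorder])
  have "\<forall>\<^sub>F R in at_top. trunc_conv \<Phi> (K \<tau>) u x R \<in> \<real>"
    using eventually_gt_at_top[of 0]
  proof eventually_elim
    case (elim R)
    have "fourier \<Phi> y \<in> \<real>" for y
      using lp unfolding lp_function_def by (meson nonneg_Reals_subset_Reals subsetD)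
    then have "range (\<lambda>y. K \<tau> (x - y) * fourier \<Phi> (y /\<^sub>R R)) \<subseteq> \<real>" by (auto intro: Reals_mult heat_kernel_real)
    then show ?case
      unfolding trunc_conv_def
      by (rule assms(3)[unfolded real_dist_def, rule_format, OF schwartz_sch1[THEN iffD2, OF truncated_kernel_sch1[OF assms(2) elim]]])
  qed
  then show ?thesis by (rule 1)
qed

text \<open>Pairing \<open>K\<^sub>\<tau> * u\<close> with \<open>\<phi>\<close>, the convolution is moved to the test function. This
  makes the bound uniform in \<open>\<tau>\<close>.\<close>

definition pairing :: "'a dist \<Rightarrow> real \<Rightarrow> ('a \<Rightarrow> complex) \<Rightarrow> nat \<Rightarrow> complex" where
  "pairing u \<tau> \<phi> j = (LBINT z. cv (cv (lp_fat \<Phi> j) \<phi>) (K \<tau>) z * lpc u j z)"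

lemma cv_test_k:
  assumes \<tau>: "0 < \<tau>" and \<phi>: "sch1 \<phi>"
  shows "cv (cv (lp_fat \<Phi> j) \<phi>) (K \<tau>) z = (LBINT x. k j \<tau> (x - z) * \<phi> x)"
proof -
  obtain C where C: "\<And>x. norm (K \<tau> x) \<le> C" using heat_kernel_bound[OF \<tau>] by blast
  have "cv (cv (lp_fat \<Phi> j) \<phi>) (K \<tau>) z = cv (cv \<phi> (lp_fat \<Phi> j)) (K \<tau>) z" unfolding cv_commute[of \<phi>] ..
  also have "\<dots> = cv \<phi> (k j \<tau>) z"
    unfolding k_def by (subst cv_assoc_bounded[OF sch_integrable[OF \<phi>] fat_integrable heat_kernel_measurable C]) (rule refl)
  also have "\<dots> = (LBINT x. k j \<tau> (x - z) * \<phi> x)"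
    unfolding cv_def
  proof (rule integral_cong[OF refl])
    show "\<phi> x * k j \<tau> (z - x) = k j \<tau> (x - z) * \<phi> x" for x using k_even[of j \<tau> "x - z"] by simp
  qed
  finally show ?thesis .
qed

text \<open>The dyadic series of \<open>conv_dist\<close> has a geometric majorant independent of x,
  so it may be integrated term by term against \<phi>; Fubini turns each term into a
  \<open>pairing\<close>.\<close>

lemma
  assumes u: "bdd u M" and \<tau>: "0 < \<tau>" and \<phi>: "sch1 \<phi>"
  shows conv_dist_integrable: "integrable lborel (\<lambda>x. conv_dist \<Phi> (K \<tau>) u x * \<phi> x)"
    and conv_dist_pairing: "(LBINT x. conv_dist \<Phi> (K \<tau>) u x * \<phi> x) = (\<Sum>j. pairing u \<tau> \<phi> j)"
proof -
  have [measurable]: "lpc u j \<in> borel_measurable borel" for j by (rule lpc_measurable[OF bdd_tempered[OF u]])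
  have [measurable]: "\<phi> \<in> borel_measurable borel" by (rule sch_measurable[OF \<phi>])
  have i\<phi>: "integrable lborel \<phi>" by (rule sch_integrable[OF \<phi>])
  define c where "c = (\<lambda>j x. \<integral>z. k j \<tau> (x - z) * lpc u j z \<partial>lborel)"
  have [measurable]: "c j \<in> borel_measurable borel" for j unfolding c_def by measurable
  obtain C where C: "C \<ge> 0"
    "\<And>u M j x. bdd u M \<Longrightarrow> (\<integral>\<^sup>+z. ennreal (norm (k j \<tau> (x - z) * lpc u j z)) \<partial>lborel) \<le> ennreal (C * M * (1 / 2) ^ j)"
    "\<And>u M j x. bdd u M \<Longrightarrow> norm (LBINT z. k j \<tau> (x - z) * lpc u j z) \<le> C * M * (1 / 2) ^ j"
    "\<And>u M j x. bdd u M \<Longrightarrow> integrable lborel (\<lambda>z. k j \<tau> (x - z) * lpc u j z)"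
    using k_term[OF \<tau>] by blast
  have M: "0 \<le> M" by (rule bdd_nonneg[OF u])
  have cB: "norm (c j x) \<le> C * M * (1 / 2) ^ j" for j x unfolding c_def by (rule C(3)[OF u])
  have le: "norm (c j x * \<phi> x) \<le> C * M * (1 / 2) ^ j * norm (\<phi> x)" for j x
    unfolding norm_mult by (intro mult_right_mono cB) simp
  have icj: "integrable lborel (\<lambda>x. c j x * \<phi> x)" for j
  proof (rule integrable_bound[OF integrable_mult_right[OF i\<phi>, of "complex_of_real (C * M * (1 / 2) ^ j)"]])
    show "AE x in lborel. norm (c j x * \<phi> x) \<le> norm (complex_of_real (C * M * (1 / 2) ^ j) * \<phi> x)"
      using le C(1) M by (intro AE_I2) (simp add: norm_mult norm_power norm_divide abs_mult)
  qed measurable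
  have sm: "summable (\<lambda>j. C * M * (1 / 2) ^ j * y)" for y :: real
    by (intro summable_mult2 summable_mult summable_geometric) simp
  have s1: "summable (\<lambda>j. norm (c j x * \<phi> x))" for x
    by (rule summable_comparison_test'[OF sm[of "norm (\<phi> x)"]]) (simp only: real_norm_def abs_norm_cancel le)
  have s2: "summable (\<lambda>j. \<integral>x. norm (c j x * \<phi> x) \<partial>lborel)"
  proof (rule summable_comparison_test'[OF sm[of "\<integral>x. norm (\<phi> x) \<partial>lborel"]])
    fix j
    have "norm (LBINT x. norm (c j x * \<phi> x)) = (LBINT x. norm (c j x * \<phi> x))" by simp
    also have "\<dots> \<le> (LBINT x. C * M * (1 / 2) ^ j * norm (\<phi> x))"
      using le icj i\<phi> by (intro Bochner_Integration.integral_mono) auto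
    also have "\<dots> = C * M * (1 / 2) ^ j * (LBINT x. norm (\<phi> x))" by simp
    finally show "norm (LBINT x. norm (c j x * \<phi> x)) \<le> C * M * (1 / 2) ^ j * (LBINT x. norm (\<phi> x))" .
  qed
  have eq: "conv_dist \<Phi> (K \<tau>) u x * \<phi> x = (\<Sum>j. c j x * \<phi> x)" for x
  proof -
    have "summable (\<lambda>j. c j x)"
      by (rule summable_comparison_test'[OF sm[of 1]]) (simp only: mult_1_right cB)
    then show ?thesis unfolding conv_dist_eq[OF u \<tau>] c_def by (rule suminf_mult2)
  qed
  show "integrable lborel (\<lambda>x. conv_dist \<Phi> (K \<tau>) u x * \<phi> x)"
    unfolding eq by (rule integrable_suminf[OF icj AE_I2[OF s1] s2])
  have "(LBINT x. conv_dist \<Phi> (K \<tau>) u x * \<phi> x) = (\<Sum>j. \<integral>x. c j x * \<phi> x \<partial>lborel)"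
    unfolding eq by (rule integral_suminf[OF icj AE_I2[OF s1] s2])
  also have "(\<lambda>j. \<integral>x. c j x * \<phi> x \<partial>lborel) = pairing u \<tau> \<phi>"
  proof
    fix j
    have "(LBINT x. c j x * \<phi> x) = (LBINT x. \<integral>z. k j \<tau> (x - z) * lpc u j z * \<phi> x \<partial>lborel)"
      unfolding c_def by simp
    also have "\<dots> = (LBINT z. \<integral>x. k j \<tau> (x - z) * lpc u j z * \<phi> x \<partial>lborel)"
    proof (rule lborel_pair.Fubini_integral[symmetric], rule integrableI_bounded)
      show m: "(\<lambda>(x, z). k j \<tau> (x - z) * lpc u j z * \<phi> x) \<in> borel_measurable (lborel \<Otimes>\<^sub>M lborel)" by measurable
      have "(\<integral>\<^sup>+y. ennreal (norm (case y of (x, z) \<Rightarrow> k j \<tau> (x - z) * lpc u j z * \<phi> x)) \<partial>(lborel \<Otimes>\<^sub>M lborel))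
          = (\<integral>\<^sup>+x. \<integral>\<^sup>+z. ennreal (norm (\<phi> x)) * ennreal (norm (k j \<tau> (x - z) * lpc u j z)) \<partial>lborel \<partial>lborel)"
        by (subst lborel.nn_integral_fst[symmetric]) (auto simp: norm_mult ennreal_mult'' mult_ac)
      also have "\<dots> = (\<integral>\<^sup>+x. ennreal (norm (\<phi> x)) * (\<integral>\<^sup>+z. ennreal (norm (k j \<tau> (x - z) * lpc u j z)) \<partial>lborel) \<partial>lborel)"
        by (intro nn_integral_cong nn_integral_cmult) measurable
      also have "\<dots> \<le> (\<integral>\<^sup>+x. ennreal (norm (\<phi> x)) * ennreal (C * M * (1 / 2) ^ j) \<partial>lborel)"
        by (intro nn_integral_mono mult_left_mono C(2)[OF u]) simp
      also have "\<dots> = (\<integral>\<^sup>+x. ennreal (norm (\<phi> x)) \<partial>lborel) * ennreal (C * M * (1 / 2) ^ j)"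
        by (rule nn_integral_multc) measurable
      also have "\<dots> < \<infinity>"
        using i\<phi> unfolding integrable_iff_bounded by (auto simp: ennreal_mult_less_top)
      finally show "(\<integral>\<^sup>+y. ennreal (norm (case y of (x, z) \<Rightarrow> k j \<tau> (x - z) * lpc u j z * \<phi> x)) \<partial>(lborel \<Otimes>\<^sub>M lborel)) < \<infinity>" .
    qed
    also have "\<dots> = pairing u \<tau> \<phi> j"
      unfolding pairing_def cv_test_k[OF \<tau> \<phi>]
    proof (intro integral_cong refl)
      fix z
      have "(\<lambda>x. k j \<tau> (x - z) * lpc u j z * \<phi> x) = (\<lambda>x. k j \<tau> (x - z) * \<phi> x * lpc u j z)" by (simp add: mult_ac)
      then show "(LBINT x. k j \<tau> (x - z) * lpc u j z * \<phi> x) = (LBINT x. k j \<tau> (x - z) * \<phi> x) * lpc u j z" by simp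
    qed
    finally show "(LBINT x. c j x * \<phi> x) = pairing u \<tau> \<phi> j" .
  qed
  finally show "(LBINT x. conv_dist \<Phi> (K \<tau>) u x * \<phi> x) = (\<Sum>j. pairing u \<tau> \<phi> j)" .
qed

text \<open>The heat kernel enters only through its \<open>L\<^sup>1\<close> norm \<kappa>, the same
  for all \<tau> > 0: the integral over its variable w is taken last, and \<open>weighted_nn\<close>
  is applied with centre w to the shifted test function. So no singularity at \<tau> = 0
  appears.\<close>

lemma pairing_bound:
  obtains C where "C \<ge> 0" "\<And>u M \<tau> \<phi> B j. bdd u M \<Longrightarrow> 0 < \<tau> \<Longrightarrow> sch1 \<phi> \<Longrightarrow>
     (\<And>bs x. set bs \<subseteq> Basis \<Longrightarrow> length bs = 0 \<or> length bs = N \<Longrightarrow> (1 + norm x) powr decay * norm (iter_deriv bs \<phi> x) \<le> B) \<Longrightarrow>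
     norm (pairing u \<tau> \<phi> j) \<le> C * B * M * (1 / 2) ^ j"
proof -
  obtain C where C: "C \<ge> 0" "\<And>j \<theta> B z. fam {\<lambda>_ _. 1} (\<lambda>_::unit. \<theta>) \<Longrightarrow>
     (\<And>bs x. set bs \<subseteq> Basis \<Longrightarrow> length bs = 0 \<or> length bs = N \<Longrightarrow> (1 + norm x) powr decay * norm (iter_deriv bs \<theta> x) \<le> B) \<Longrightarrow>
     norm (cv (lp_fat \<Phi> j) \<theta> z) \<le> C * B / 2 ^ (j * N) * (1 + norm z) powr (- decay)"
    using fat_bound[of N] by blast
  show thesis
  proof (rule that[of "C * \<omega> * \<kappa>"])
    show "0 \<le> C * \<omega> * \<kappa>" using C(1) \<omega>_pos \<kappa>_nonneg by simp
    fix u M j and \<tau> B :: real and \<phi> :: "'a \<Rightarrow> complex"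
    assume u: "bdd u M" and \<tau>: "0 < \<tau>" and \<phi>: "sch1 \<phi>"
      and B: "\<And>bs x. set bs \<subseteq> Basis \<Longrightarrow> length bs = 0 \<or> length bs = N \<Longrightarrow> (1 + norm x) powr decay * norm (iter_deriv bs \<phi> x) \<le> B"
    have [measurable]: "lpc u j \<in> borel_measurable borel" by (rule lpc_measurable[OF bdd_tempered[OF u]])
    have [measurable]: "\<phi> \<in> borel_measurable borel" by (rule sch_measurable[OF \<phi>])
    have "0 \<le> (1 + norm (0::'a)) powr decay * norm (iter_deriv [] \<phi> 0)" by simp
    also have "\<dots> \<le> B" using B[of "[]" 0] by simp
    finally have B0: "0 \<le> B" .
    have CB: "0 \<le> C * B" using C(1) B0 by simp
    let ?X = "C * B * \<omega> * M * (1 / 2) ^ j"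
    have X: "0 \<le> ?X" using CB \<omega>_pos bdd_nonneg[OF u] by simp
    define e where "e = cv (lp_fat \<Phi> j) \<phi>"
    have [measurable]: "e \<in> borel_measurable borel" unfolding e_def by (intro cv_measurable) measurable
    have "ennreal (norm (pairing u \<tau> \<phi> j)) \<le> (\<integral>\<^sup>+z. ennreal (norm (cv e (K \<tau>) z * lpc u j z)) \<partial>lborel)"
      unfolding pairing_def e_def by (rule norm_integral_le_nn)
    also have "\<dots> \<le> (\<integral>\<^sup>+z. \<integral>\<^sup>+w. ennreal (norm (K \<tau> w)) * ennreal (norm (e (z - w) * lpc u j z)) \<partial>lborel \<partial>lborel)"
    proof (intro nn_integral_mono)
      fix z
      have "cv e (K \<tau>) z * lpc u j z = (LBINT w. K \<tau> w * e (z - w) * lpc u j z)"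
        unfolding cv_commute[of e] unfolding cv_def by simp
      then show "ennreal (norm (cv e (K \<tau>) z * lpc u j z)) \<le> (\<integral>\<^sup>+w. ennreal (norm (K \<tau> w)) * ennreal (norm (e (z - w) * lpc u j z)) \<partial>lborel)"
        using norm_integral_le_nn[of lborel "\<lambda>w. K \<tau> w * e (z - w) * lpc u j z"]
        by (simp only: norm_mult mult.assoc ennreal_mult''[OF mult_nonneg_nonneg[OF norm_ge_zero norm_ge_zero]])
    qed
    also have "\<dots> = (\<integral>\<^sup>+w. \<integral>\<^sup>+z. ennreal (norm (K \<tau> w)) * ennreal (norm (e (z - w) * lpc u j z)) \<partial>lborel \<partial>lborel)"
      by (rule lborel_pair.Fubini') measurable
    also have "\<dots> = (\<integral>\<^sup>+w. ennreal (norm (K \<tau> w)) * (\<integral>\<^sup>+z. ennreal (norm (e (z - w) * lpc u j z)) \<partial>lborel) \<partial>lborel)"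
      by (intro nn_integral_cong nn_integral_cmult) measurable
    also have "\<dots> \<le> (\<integral>\<^sup>+w. ennreal (norm (K \<tau> w)) * ennreal ?X \<partial>lborel)"
    proof (intro nn_integral_mono mult_left_mono)
      show "(\<integral>\<^sup>+z. ennreal (norm (e (z - w) * lpc u j z)) \<partial>lborel) \<le> ennreal ?X" for w
        unfolding e_def by (rule weighted_nn[OF u CB C(2)[OF sch_imp_fam1[OF \<phi>] B]])
    qed simp
    also have "\<dots> = (\<integral>\<^sup>+w. ennreal (norm (K \<tau> w)) \<partial>lborel) * ennreal ?X" by (rule nn_integral_multc) measurable
    also have "(\<integral>\<^sup>+w. ennreal (norm (K \<tau> w)) \<partial>lborel) = ennreal \<kappa>"
      unfolding integral_norm_heat_kernel[OF \<tau>, symmetric] using heat_kernel_integrable[OF \<tau>]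
      by (intro nn_integral_eq_integral) auto
    also have "ennreal \<kappa> * ennreal ?X = ennreal (C * \<omega> * \<kappa> * B * M * (1 / 2) ^ j)"
      using X \<kappa>_nonneg by (subst ennreal_mult[symmetric]) (auto simp: mult_ac)
    finally show "norm (pairing u \<tau> \<phi> j) \<le> C * \<omega> * \<kappa> * B * M * (1 / 2) ^ j"
      using X \<kappa>_nonneg C(1) \<omega>_pos B0 bdd_nonneg[OF u] by (subst (asm) ennreal_le_iff) auto
  qed
qed

text \<open>For \<open>\<rho> = 2^j \<tau>^(1/\<alpha>) \<ge> 1\<close> two derivatives of \<open>K\<^sub>1\<close> gain \<open>\<rho>^-2\<close>, more than needed;
  the power \<open>\<rho>^(-3\<alpha>/4)\<close> keeps the singularity at \<open>\<tau> = 0\<close> integrable.\<close>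

lemma k_L1:
  assumes T: "0 < T"
  obtains C where "C > 0" "\<And>j \<tau>. 0 < \<tau> \<Longrightarrow> \<tau> \<le> T \<Longrightarrow> (\<integral>\<^sup>+x. ennreal (norm (k j \<tau> x)) \<partial>lborel)
     \<le> ennreal (C * 2 powr (- (real j * (3 * \<alpha> / 4))) * \<tau> powr (- (3 / 4)))"
proof -
  define b where "b = 3 * \<alpha> / 4"
  have b: "0 \<le> b" "b \<le> 2" unfolding b_def using \<alpha>_pos \<alpha>_le by simp_all
  define A0 where "A0 = (LBINT x. norm (lp_fat \<Phi> 0 x))"
  define A where "A = (LBINT x. norm (lp_mother \<Phi> x))"
  define J where "J = (LBINT x. (1 + norm (x::'a)) powr (- decay))"
  have pos: "0 \<le> A0" "0 \<le> A" "0 \<le> J" unfolding A0_def A_def J_def by simp_all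
  note K1 = heat_kernel_integrable[of 1, simplified]
  have mi: "integrable lborel (lp_mother \<Phi>)" by (rule sch_integrable[OF lp_mother_sch1[OF lp]])
  obtain C1 where C1: "C1 \<ge> 0" "\<And>\<rho> \<theta> B z. \<rho> \<ge> 1 \<Longrightarrow> fam {\<lambda>_ _. 1} (\<lambda>_::unit. \<theta>) \<Longrightarrow>
     (\<And>bs x. set bs \<subseteq> Basis \<Longrightarrow> length bs = 2 \<Longrightarrow> (1 + norm x) powr decay * norm (iter_deriv bs \<theta> x) \<le> B) \<Longrightarrow>
      norm (cv (dil \<rho> (lp_mother \<Phi>)) \<theta> z) \<le> C1 * B / \<rho> ^ 2 * (1 + norm z) powr (- decay)"
    using annular_cv_bound[OF annular_lp_mother[OF lp] decay_nonneg, of 2] by blast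
  obtain B where B: "B \<ge> 0" "\<And>(i::unit) bs x. set bs \<subseteq> Basis \<Longrightarrow> length bs = 0 \<or> length bs = 2 \<Longrightarrow> (1 + norm x) powr decay * norm (iter_deriv bs (K 1) x) \<le> B"
    using fam_bound_uniform[OF heat_kernel_smooth[of 1], of 2] by auto
  have L1: "(\<integral>\<^sup>+x. ennreal (norm (f x)) \<partial>lborel) = ennreal (LBINT x. norm (f x))" if "integrable lborel f" for f :: "'a \<Rightarrow> complex"
    using that by (intro nn_integral_eq_integral) auto
  have young: "(LBINT x. norm (cv f g x)) \<le> (LBINT x. norm (f x)) * (LBINT x. norm (g x))"
    if f: "integrable lborel f" and g: "integrable lborel g" for f g :: "'a \<Rightarrow> complex"
  proof -
    have "ennreal (LBINT x. norm (cv f g x)) \<le> ennreal (LBINT x. norm (f x)) * ennreal (LBINT x. norm (g x))"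
      using nn_integral_norm_cv[of f g] f g
      unfolding L1[OF f] L1[OF g] L1[OF integrable_cv[OF f g]] by (auto dest: borel_measurable_integrable)
    then show ?thesis by (simp add: ennreal_mult'[symmetric] ennreal_le_iff)
  qed
  define C where "C = A0 * \<kappa> * T powr (3 / 4) + C1 * B * J + A * \<kappa> + 1"
  have C0: "0 \<le> A0 * \<kappa> * T powr (3 / 4)" "0 \<le> C1 * B * J" "0 \<le> A * \<kappa>" using pos \<kappa>_nonneg C1(1) B(1) by simp_all
  show thesis
  proof (rule that[of C])
    show "C > 0" unfolding C_def using C0 by linarith
    fix j and \<tau> :: real assume \<tau>: "0 < \<tau>" "\<tau> \<le> T"
    have ki: "integrable lborel (k j \<tau>)" unfolding k_def by (rule integrable_cv[OF fat_integrable heat_kernel_integrable[OF \<tau>(1)]])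
    have "(LBINT x. norm (k j \<tau> x)) \<le> C * 2 powr (- (real j * b)) * \<tau> powr (- (3 / 4))"
    proof (cases "j = 0")
      case True
      have "(LBINT x. norm (k j \<tau> x)) \<le> A0 * \<kappa>"
        unfolding k_def True A0_def integral_norm_heat_kernel[OF \<tau>(1), symmetric]
        by (rule young[OF fat_integrable heat_kernel_integrable[OF \<tau>(1)]])
      \<comment> \<open>At j = 0 the bound is constant in \<tau>; the singular factor common to all
        j is inserted by means of \<tau> \<le> T.\<close>
      also have "\<dots> \<le> A0 * \<kappa> * (T powr (3 / 4) * \<tau> powr (- (3 / 4)))"
      proof -
        have "\<tau> powr (3 / 4) \<le> T powr (3 / 4)" using \<tau> by (intro powr_mono2) auto
        then have "1 \<le> T powr (3 / 4) * \<tau> powr (- (3 / 4))" using \<tau> by (simp add: powr_minus field_simps)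
        then have "A0 * \<kappa> * 1 \<le> A0 * \<kappa> * (T powr (3 / 4) * \<tau> powr (- (3 / 4)))"
          using pos \<kappa>_nonneg by (intro mult_left_mono) auto
        then show ?thesis by simp
      qed
      also have "\<dots> = (A0 * \<kappa> * T powr (3 / 4)) * \<tau> powr (- (3 / 4))" by simp
      also have "\<dots> \<le> C * \<tau> powr (- (3 / 4))" unfolding C_def using C0 by (intro mult_right_mono) auto
      finally show ?thesis using True by simp
    next
      case False
      define \<sigma> where "\<sigma> = \<tau> powr (- 1 / \<alpha>)"
      \<comment> \<open>The frequency measured in units of the heat kernel at time \<tau>; it equals
        \<open>2 ^ j * \<tau> powr (1 / \<alpha>)\<close>.\<close>
      define \<rho> where "\<rho> = 2 ^ j / \<sigma>"
      have \<sigma>: "0 < \<sigma>" unfolding \<sigma>_def using \<tau> by simp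
      have \<rho>: "0 < \<rho>" unfolding \<rho>_def using \<sigma> by simp
      define G where "G = cv (dil \<rho> (lp_mother \<Phi>)) (K 1)"
      have kG: "k j \<tau> = dil \<sigma> G"
        unfolding k_def G_def \<rho>_def heat_kernel_scale[OF \<tau>(1)] \<sigma>_def[symmetric] using False \<sigma>
        by (intro ext) (simp add: lp_fat_def cv_dil_dil)
      have di: "integrable lborel (dil \<rho> (lp_mother \<Phi>))" by (rule integrable_dil[OF mi \<rho>])
      have Gi: "integrable lborel G" unfolding G_def by (rule integrable_cv[OF di K1])
      have "(LBINT x. norm (k j \<tau> x)) = (LBINT x. norm (G x))" unfolding kG by (rule integral_norm_dil[OF \<sigma>])
      also have "\<dots> \<le> (C1 * B * J + A * \<kappa>) * \<rho> powr (- b)"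
      proof (cases "1 \<le> \<rho>")
        case True
        have "(LBINT x. norm (G x)) \<le> (LBINT x. C1 * B / \<rho> ^ 2 * (1 + norm (x::'a)) powr (- decay))"
        proof (rule Bochner_Integration.integral_mono)
          show "norm (G x) \<le> C1 * B / \<rho> ^ 2 * (1 + norm x) powr (- decay)" for x
            unfolding G_def by (rule C1(2)[OF True heat_kernel_fam1 B(2)]) auto
        qed (use Gi integrable_decay in auto)
        also have "\<dots> = C1 * B * J * (1 / \<rho> ^ 2)" unfolding J_def by simp
        also have "\<dots> \<le> C1 * B * J * \<rho> powr (- b)"
        proof (rule mult_left_mono[OF _ C0(2)])
          have "1 / \<rho> ^ 2 = \<rho> powr (- 2)" by (simp only: powr_minus powr_numeral[OF less_imp_le[OF \<rho>]] inverse_eq_divide)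
          also have "\<dots> \<le> \<rho> powr (- b)" using True b by (intro powr_mono) auto
          finally show "1 / \<rho> ^ 2 \<le> \<rho> powr (- b)" .
        qed
        also have "\<dots> \<le> (C1 * B * J + A * \<kappa>) * \<rho> powr (- b)" using C0 by (intro mult_right_mono) auto
        finally show ?thesis .
      next
        case False
        \<comment> \<open>For \<rho> < 1 no cancellation is exploited: Young's inequality gives a
          constant, and \<open>\<rho> powr (- b)\<close> is at least 1.\<close>
        have "(LBINT x. norm (G x)) \<le> A * \<kappa>"
          using young[OF di K1] unfolding G_def integral_norm_dil[OF \<rho>] A_def \<kappa>_def .
        also have "\<dots> \<le> (C1 * B * J + A * \<kappa>) * 1" using C0 by simp
        also have "\<dots> \<le> (C1 * B * J + A * \<kappa>) * \<rho> powr (- b)"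
        proof (rule mult_left_mono)
          have "\<rho> powr b \<le> 1 powr b" using \<rho> False b by (intro powr_mono2) auto
          then show "1 \<le> \<rho> powr (- b)" unfolding powr_minus using \<rho> by (intro one_le_inverse) simp_all
        qed (use C0 in linarith)
        finally show ?thesis .
      qed
      also have "\<rho> powr (- b) = 2 powr (- (real j * b)) * \<tau> powr (- (3 / 4))"
      proof -
        have "\<rho> = 2 powr real j * \<tau> powr (1 / \<alpha>)"
          unfolding \<rho>_def \<sigma>_def minus_divide_left[symmetric] powr_minus powr_realpow[OF zero_less_numeral] by (simp only: divide_inverse inverse_inverse_eq)
        then have "\<rho> powr (- b) = (2 powr real j) powr (- b) * (\<tau> powr (1 / \<alpha>)) powr (- b)"
          by (simp only: powr_mult powr_ge_zero)
        also have "\<dots> = 2 powr (- (real j * b)) * \<tau> powr (1 / \<alpha> * - b)" by (simp only: powr_powr mult_minus_right)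
        also have "1 / \<alpha> * - b = - (3 / 4)" unfolding b_def using \<alpha>_pos by simp
        finally show ?thesis .
      qed
      also have "(C1 * B * J + A * \<kappa>) * (2 powr (- (real j * b)) * \<tau> powr (- (3 / 4))) \<le> C * (2 powr (- (real j * b)) * \<tau> powr (- (3 / 4)))"
        unfolding C_def using C0 by (intro mult_right_mono) auto
      finally show ?thesis by (simp add: mult.assoc)
    qed
    then show "(\<integral>\<^sup>+x. ennreal (norm (k j \<tau> x)) \<partial>lborel) \<le> ennreal (C * 2 powr (- (real j * (3 * \<alpha> / 4))) * \<tau> powr (- (3 / 4)))"
      unfolding L1[OF ki] b_def by (rule ennreal_leI)
  qed
qed

end

section \<open>The parabolic operator\<close>

text \<open>Lebesgue measure is complete. This is what permits changing f on a null set of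
  times.\<close>

lemma measurable_lebesgue_on_AE:
  fixes f g :: "real \<Rightarrow> 'b::euclidean_space"
  assumes f: "f \<in> borel_measurable (lebesgue_on {a..b})" and eq: "AE x in lebesgue_on {a..b}. f x = g x"
  shows "g \<in> borel_measurable (lebesgue_on {a..b})"
proof -
  have m: "{a..b} \<inter> space lebesgue \<in> sets lebesgue" by simp
  have eq': "AE x in lebesgue. indicator {a..b} x *\<^sub>R f x = indicator {a..b} x *\<^sub>R g x"
    using eq unfolding AE_restrict_space_iff[OF m] by eventually_elim (auto simp: indicator_def)
  show ?thesis
    using f unfolding borel_measurable_restrict_space_iff[OF m] by (rule borel_measurable_AE[OF _ eq'])
qed

text \<open>If f is not measurable then g is not either, and both Bochner integrals are 0.\<close>

lemma integral_lebesgue_on_AE: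
  fixes f g :: "real \<Rightarrow> 'b::euclidean_space"
  assumes eq: "AE x in lebesgue_on {a..b}. f x = g x"
  shows "integral\<^sup>L (lebesgue_on {a..b}) f = integral\<^sup>L (lebesgue_on {a..b}) g"
proof (cases "f \<in> borel_measurable (lebesgue_on {a..b})")
  case True
  show ?thesis by (rule integral_cong_AE[OF True measurable_lebesgue_on_AE[OF True eq] eq])
next
  case False
  have "AE x in lebesgue_on {a..b}. g x = f x" using eq by eventually_elim simp
  then have "g \<notin> borel_measurable (lebesgue_on {a..b})" using False measurable_lebesgue_on_AE by blast
  then show ?thesis using False by (metis borel_measurable_integrable not_integrable_integral_eq)
qed

context heat_lp_sp
begin

text \<open>The function is measurable in r and continuous in z, hence the limit of its values at
  the rounded points; these are finite sums of functions of r times indicators in z.\<close>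

lemma lpc_jointly_measurable:
  fixes f :: "'b \<Rightarrow> 'a dist"
  assumes f_tempered: "\<And>r. tempered (f r)" and f_measurable: "\<And>\<phi>. sch1 \<phi> \<Longrightarrow> (\<lambda>r. f r \<phi>) \<in> borel_measurable X"
  shows "(\<lambda>(r, z). lpc (f r) j z) \<in> borel_measurable (X \<Otimes>\<^sub>M lborel)"
proof (rule borel_measurable_LIMSEQ_metric)
  define F where "F = (\<lambda>n (r, z::'a). \<Sum>v\<in>grid_nodes n. (if grid_round n z = v then lpc (f r) j v else 0))"
  have [measurable]: "(\<lambda>r. lpc (f r) j v) \<in> borel_measurable X" for v
    unfolding lpc_def by (rule f_measurable[OF sch1_reflect[OF kernel_sch1]])
  show "F n \<in> borel_measurable (X \<Otimes>\<^sub>M lborel)" for n unfolding F_def by measurable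
  fix q :: "'b \<times> 'a" assume "q \<in> space (X \<Otimes>\<^sub>M lborel)"
  obtain r z where q: "q = (r, z)" by (cases q)
  have "(\<lambda>n. lpc (f r) j (grid_round n z)) \<longlonglongrightarrow> lpc (f r) j z"
    using lpc_continuous[OF f_tempered] grid_round_LIMSEQ by (rule continuous_on_tendsto_compose) auto
  then have "(\<lambda>n. F n q) \<longlonglongrightarrow> lpc (f r) j z"
  proof (rule Lim_transform_eventually)
    show "\<forall>\<^sub>F n in sequentially. lpc (f r) j (grid_round n z) = F n q"
      using eventually_ge_at_top[of "nat \<lceil>norm z + 1\<rceil>"]
    proof eventually_elim
      case (elim n)
      have "norm (grid_round n z) \<le> norm z + norm (grid_round n z - z)" using norm_triangle_ineq[of z "grid_round n z - z"] by simp
      also have "\<dots> \<le> norm z + 1" using grid_round_dist[of n z] by (intro add_left_mono order_trans[OF grid_round_dist]) simp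
      also have "\<dots> \<le> real n" using elim by linarith
      finally have "grid_round n z \<in> grid_nodes n" unfolding grid_nodes_def by simp
      then show ?case unfolding F_def q by (simp add: sum.delta' finite_grid_nodes)
    qed
  qed
  then show "(\<lambda>n. F n q) \<longlonglongrightarrow> (case q of (r, z) \<Rightarrow> lpc (f r) j z)" unfolding q by simp
qed

lemma TL_measurable:
  assumes "\<And>r. tempered (f r)" "\<And>\<phi>. sch1 \<phi> \<Longrightarrow> (\<lambda>r. f r \<phi>) \<in> borel_measurable X"
  shows "(\<lambda>r. TL_norm \<Phi> p q \<sigma> (f r)) \<in> borel_measurable X"
proof -
  have [measurable]: "(\<lambda>(r, z). f r (\<lambda>y. lp_kernel \<Phi> j (z - y))) \<in> borel_measurable (X \<Otimes>\<^sub>M lborel)" for j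
    using lpc_jointly_measurable[OF assms] unfolding lpc_def .
  show ?thesis unfolding TL_norm_def Lp_norm_def lp_S0_eq[OF lp] lp_Delta_eq[OF lp] by measurable
qed

text \<open>One term of the sum over n is at most the whole sum. Its q-th root is a single weighted
  piece, so the exponent q disappears from the bound.\<close>

lemma bdd_TL:
  assumes u: "tempered u" and TL: "TL_norm \<Phi> p q s u < top" and q: "0 < q"
  shows "bdd u (enn2real (TL_norm \<Phi> p q s u))"
  unfolding bdd_def
proof (intro conjI allI u enn2real_nonneg)
  fix j
  define m where "m = enn2real (TL_norm \<Phi> p q s u)"
  have m: "TL_norm \<Phi> p q s u = ennreal m" "0 \<le> m" unfolding m_def using TL by simp_all
  have p0: "0 < p" using p by simp
  have [measurable]: "lpc u j \<in> borel_measurable borel" by (rule lpc_measurable[OF u])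
  have le: "(\<integral>\<^sup>+x. ennpow (F x) p \<partial>lborel) \<le> ennreal (m powr p)" if "Lp_norm p F lborel \<le> ennreal m" for F
  proof -
    have "(\<integral>\<^sup>+x. ennpow (F x) p \<partial>lborel) = ennpow (Lp_norm p F lborel) p" using p0 by (simp add: Lp_norm_ennpow)
    also have "\<dots> \<le> ennpow (ennreal m) p" using that p0 by (intro ennpow_mono) auto
    finally show ?thesis using m(2) by (simp add: ennpow_ennreal)
  qed
  have term_le: "F n \<le> (\<Sum>n. F n)" for F :: "nat \<Rightarrow> ennreal" and n
    using sum_le_suminf[OF summableI, of "{n}" F] by simp
  show "(\<integral>\<^sup>+x. ennreal (norm (lpc u j x) powr p) \<partial>lborel) \<le> ennreal ((m * 2 powr (- (real j * s))) powr p)"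
  proof (cases j)
    case 0
    have "(\<integral>\<^sup>+x. ennpow (ennreal (norm (lp_S0 \<Phi> u x))) p \<partial>lborel) \<le> ennreal (m powr p)"
      by (rule le) (unfold m(1)[symmetric] TL_norm_def, rule add_increasing2[OF zero_le order_refl])
    then show ?thesis unfolding 0 lp_S0_eq[OF lp] lpc_def using m(2) by (simp add: ennpow_ennreal)
  next
    case (Suc n)
    let ?c = "\<lambda>n x. (2 powr (real (Suc n) * s) * norm (lp_Delta \<Phi> (int (Suc n)) u x)) powr q"
    have "(\<integral>\<^sup>+x. ennreal ((2 powr (real j * s) * norm (lpc u j x)) powr p) \<partial>lborel)
        \<le> (\<integral>\<^sup>+x. ennpow (ennpow (\<Sum>n. ennreal (?c n x)) (1 / q)) p \<partial>lborel)"
    proof (rule nn_integral_mono)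
      fix x
      have "ennreal ((2 powr (real j * s) * norm (lpc u j x)) powr p) = ennpow (ennpow (ennreal (?c n x)) (1 / q)) p"
        using q by (simp add: ennpow_ennpow ennpow_ennreal powr_powr lp_Delta_eq[OF lp] lpc_def Suc del: of_nat_Suc)
      also have "\<dots> \<le> ennpow (ennpow (\<Sum>n. ennreal (?c n x)) (1 / q)) p"
      proof (intro ennpow_mono)
        show "ennreal (?c n x) \<le> (\<Sum>n. ennreal (?c n x))" by (rule term_le)
      qed (use q p0 in auto)
      finally show "ennreal ((2 powr (real j * s) * norm (lpc u j x)) powr p) \<le> ennpow (ennpow (\<Sum>n. ennreal (?c n x)) (1 / q)) p" .
    qed
    also have "\<dots> \<le> ennreal (m powr p)"
      by (rule le) (unfold m(1)[symmetric] TL_norm_def, rule add_increasing[OF zero_le order_refl])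
    finally have *: "(\<integral>\<^sup>+x. ennreal ((2 powr (real j * s) * norm (lpc u j x)) powr p) \<partial>lborel) \<le> ennreal (m powr p)" .
    have "(\<integral>\<^sup>+x. ennreal (norm (lpc u j x) powr p) \<partial>lborel)
        = (\<integral>\<^sup>+x. ennreal (2 powr (- (real j * s) * p)) * ennreal ((2 powr (real j * s) * norm (lpc u j x)) powr p) \<partial>lborel)"
    proof (rule nn_integral_cong)
      fix x
      have "2 powr (- (real j * s) * p) * (2 powr (real j * s) * norm (lpc u j x)) powr p = norm (lpc u j x) powr p"
      proof -
        have 1: "2 powr (- (real j * s) * p) * 2 powr (real j * s * p) = (1::real)" unfolding powr_add[symmetric] by simp
        have 2: "(2 powr (real j * s) * norm (lpc u j x)) powr p = 2 powr (real j * s * p) * norm (lpc u j x) powr p"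
          by (simp only: powr_mult powr_powr)
        show ?thesis unfolding 2 mult.assoc[symmetric] 1 by simp
      qed
      then show "ennreal (norm (lpc u j x) powr p) = ennreal (2 powr (- (real j * s) * p)) * ennreal ((2 powr (real j * s) * norm (lpc u j x)) powr p)"
        by (simp only: ennreal_mult[OF powr_ge_zero powr_ge_zero, symmetric])
    qed
    also have "\<dots> = ennreal (2 powr (- (real j * s) * p)) * (\<integral>\<^sup>+x. ennreal ((2 powr (real j * s) * norm (lpc u j x)) powr p) \<partial>lborel)"
      by (rule nn_integral_cmult) measurable
    also have "\<dots> \<le> ennreal (2 powr (- (real j * s) * p)) * ennreal (m powr p)" by (intro mult_left_mono *) simp
    also have "\<dots> = ennreal ((m * 2 powr (- (real j * s))) powr p)"
      using m(2) by (simp add: ennreal_mult[symmetric] powr_mult powr_powr mult.commute)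
    finally show ?thesis .
  qed
qed

end

section \<open>The time integral for data that are good at every time\<close>

text \<open>The pointwise conditions are imposed at every real r. The exceptional times allowed by
  the function space are repaired before this locale is entered, and M r then plays the role of the
  norm of f r.\<close>

locale heat_data = heat_lp_sp \<Phi> \<alpha> p s for \<Phi> :: "'a::euclidean_space \<Rightarrow> complex" and \<alpha> p s +
  fixes T :: real and f :: "real \<Rightarrow> 'a dist" and M :: "real \<Rightarrow> real"
  assumes T: "0 < T"
    and f_bdd: "\<And>r. bdd (f r) (M r)"
    and f_real: "\<And>r. real_dist (f r)"
    and f_measurable: "\<And>\<phi>. sch1 \<phi> \<Longrightarrow> (\<lambda>r. f r \<phi>) \<in> borel_measurable (lebesgue_on {0..T})"
    and M_measurable [measurable]: "M \<in> borel_measurable (lebesgue_on {0..T})"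
    and M_finite: "(\<integral>\<^sup>+r. ennreal (M r powr p) \<partial>lebesgue_on {0..T}) < \<infinity>"
begin

abbreviation L :: "real measure" where "L \<equiv> lebesgue_on {0..T}"

lemma finite_L: "finite_measure L"
  using finite_measure_lebesgue_on[of "{0..T}"] by simp

sublocale L: sigma_finite_measure L
  using finite_L by (rule finite_measure.axioms(1))

sublocale LB: pair_sigma_finite L "lborel :: 'a measure" ..
sublocale LL: pair_sigma_finite L L ..

lemma id_L [measurable]: "(\<lambda>r. r) \<in> L \<rightarrow>\<^sub>M borel"
  by (intro measurable_restrict_space1 measurable_completion) simp

lemma M_nonneg: "0 \<le> M r" by (rule bdd_nonneg[OF f_bdd])

lemma M_integrable: "integrable L M"
proof (rule integrableI_bounded)
  have "(\<integral>\<^sup>+r. ennreal (norm (M r)) \<partial>L) \<le> (\<integral>\<^sup>+r. 1 + ennreal (M r powr p) \<partial>L)"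
  proof (rule nn_integral_mono)
    fix r
    have "M r \<le> 1 + M r powr p"
    proof (cases "M r \<le> 1")
      case False
      then have "M r powr 1 \<le> M r powr p" using p by (intro powr_mono) auto
      then show ?thesis using False by simp
    qed (simp add: add_increasing2)
    then have "ennreal (norm (M r)) \<le> ennreal (1 + M r powr p)" using M_nonneg[of r] by (intro ennreal_leI) simp
    then show "ennreal (norm (M r)) \<le> 1 + ennreal (M r powr p)" by simp
  qed
  also have "\<dots> = emeasure L (space L) + (\<integral>\<^sup>+r. ennreal (M r powr p) \<partial>L)" by (subst nn_integral_add) auto
  also have "\<dots> < \<infinity>" using finite_measure.emeasure_finite[OF finite_L] M_finite by (simp add: less_top)
  finally show "(\<integral>\<^sup>+r. ennreal (norm (M r)) \<partial>L) < \<infinity>" .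
qed measurable

lemma f_tempered: "tempered (f r)" by (rule bdd_tempered[OF f_bdd])

lemma lpc_joint [measurable]: "(\<lambda>(r, z). lpc (f r) j z) \<in> borel_measurable (L \<Otimes>\<^sub>M lborel)"
  by (rule lpc_jointly_measurable[OF f_tempered f_measurable])

text \<open>Extension by 0 to r \<ge> t puts all t on the same measure space L, so that joint
  measurability in t and r makes sense.\<close>

definition S :: "real \<Rightarrow> ('a \<Rightarrow> complex) \<Rightarrow> real \<Rightarrow> complex" where
  "S t \<phi> r = (if r < t then \<Sum>j. pairing (f r) (t - r) \<phi> j else 0)"

lemma S_eq:
  assumes "r < t" "sch1 \<phi>"
  shows "S t \<phi> r = (LBINT x. conv_dist \<Phi> (K (t - r)) (f r) x * \<phi> x)"
  using conv_dist_pairing[OF f_bdd, of "t - r" \<phi> r] assms by (simp add: S_def)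

definition seminorm_order :: nat where "seminorm_order = max N (nat \<lceil>decay\<rceil>)"

definition seminorms :: "('a \<Rightarrow> complex) \<Rightarrow> real" where
  "seminorms \<phi> = (\<Sum>k\<le>seminorm_order. \<Sum>bs\<in>{bs. set bs \<subseteq> Basis \<and> length bs \<le> seminorm_order}. schwartz_seminorm k bs \<phi>)"

text \<open>Expresses the weighted bounds through the seminorms in the definition of
  \<open>tempered\<close>. There one number limits both the powers and the derivatives, whence the
  maximum in \<open>seminorm_order\<close>.\<close>

lemma decay_seminorms:
  assumes \<phi>: "sch1 \<phi>" and bs: "set bs \<subseteq> Basis" "length bs = 0 \<or> length bs = N"
  shows "(1 + norm x) powr decay * norm (iter_deriv bs \<phi> x) \<le> 2 ^ nat \<lceil>decay\<rceil> * seminorms \<phi>"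
proof -
  let ?d = "nat \<lceil>decay\<rceil>" and ?S = "{bs::'a list. set bs \<subseteq> Basis \<and> length bs \<le> seminorm_order}"
  have d: "decay \<le> real ?d" "0 < ?d" "?d \<le> seminorm_order" using decay_gt unfolding seminorm_order_def by linarith+
  have nn: "0 \<le> schwartz_seminorm k cs \<phi>" if "set cs \<subseteq> Basis" for k cs
    by (rule order_trans[OF _ schwartz_seminorm_ge[OF \<phi> that, of 0]]) simp
  have "(1 + norm x) powr decay \<le> (1 + norm x) powr real ?d" using d by (intro powr_mono) auto
  also have "\<dots> = (1 + norm x) ^ ?d" by (intro powr_realpow) (simp add: add_pos_nonneg)
  also have "\<dots> \<le> 2 ^ ?d * (norm x ^ 0 + norm x ^ ?d)"
  proof (cases "norm x \<le> 1")
    case True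
    have "(1 + norm x) ^ ?d \<le> 2 ^ ?d" using True by (intro power_mono) auto
    also have "\<dots> \<le> 2 ^ ?d * (norm x ^ 0 + norm x ^ ?d)" by simp
    finally show ?thesis .
  next
    case False
    have "(1 + norm x) ^ ?d \<le> (2 * norm x) ^ ?d" using False by (intro power_mono) auto
    also have "\<dots> \<le> 2 ^ ?d * (norm x ^ 0 + norm x ^ ?d)" by (simp add: power_mult_distrib)
    finally show ?thesis .
  qed
  finally have "(1 + norm x) powr decay * norm (iter_deriv bs \<phi> x) \<le> 2 ^ ?d * (norm x ^ 0 + norm x ^ ?d) * norm (iter_deriv bs \<phi> x)"
    by (intro mult_right_mono) auto
  also have "\<dots> = 2 ^ ?d * (norm x ^ 0 * norm (iter_deriv bs \<phi> x) + norm x ^ ?d * norm (iter_deriv bs \<phi> x))"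
    by (simp only: distrib_right mult.assoc)
  also have "\<dots> \<le> 2 ^ ?d * (schwartz_seminorm 0 bs \<phi> + schwartz_seminorm ?d bs \<phi>)"
    by (intro mult_left_mono add_mono schwartz_seminorm_ge[OF \<phi> bs(1)]) simp
  also have "schwartz_seminorm 0 bs \<phi> + schwartz_seminorm ?d bs \<phi> = (\<Sum>k\<in>{0, ?d}. schwartz_seminorm k bs \<phi>)"
    using d by simp
  also have "\<dots> \<le> (\<Sum>k\<le>seminorm_order. schwartz_seminorm k bs \<phi>)"
    using d nn bs(1) by (intro sum_mono2) auto
  also have "\<dots> \<le> seminorms \<phi>"
    unfolding seminorms_def
  proof (rule sum_mono)
    have "bs \<in> ?S" using bs unfolding seminorm_order_def by auto
    then show "schwartz_seminorm k bs \<phi> \<le> (\<Sum>bs\<in>?S. schwartz_seminorm k bs \<phi>)" for k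
      using nn by (intro member_le_sum) (auto intro: finite_lists_length_le)
  qed
  finally show ?thesis by simp
qed

text \<open>\<open>pairing_bound\<close> summed over j: linear in the seminorms of \<phi> and in M
  r, and without singularity at r = t. It yields integrability in r as well as the continuity of
  \<open>T_op\<close> in \<phi>.\<close>

lemma S_seminorms:
  obtains C where "C \<ge> 0"
    "\<And>t r \<phi>. sch1 \<phi> \<Longrightarrow> summable (\<lambda>j. if r < t then pairing (f r) (t - r) \<phi> j else 0)"
    "\<And>t r \<phi>. sch1 \<phi> \<Longrightarrow> norm (S t \<phi> r) \<le> C * seminorms \<phi> * M r"
proof -
  obtain C where C: "C \<ge> 0" "\<And>u M \<tau> \<phi> B j. bdd u M \<Longrightarrow> 0 < \<tau> \<Longrightarrow> sch1 \<phi> \<Longrightarrow>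
     (\<And>bs x. set bs \<subseteq> Basis \<Longrightarrow> length bs = 0 \<or> length bs = N \<Longrightarrow> (1 + norm x) powr decay * norm (iter_deriv bs \<phi> x) \<le> B) \<Longrightarrow>
     norm (pairing u \<tau> \<phi> j) \<le> C * B * M * (1 / 2) ^ j"
    using pairing_bound by blast
  let ?d = "2 ^ nat \<lceil>decay\<rceil> :: real"
  let ?g = "\<lambda>\<phi> r (j::nat). C * (?d * seminorms \<phi>) * M r * (1 / 2) ^ j"
  let ?h = "\<lambda>t \<phi> r j. if r < t then pairing (f r) (t - r) \<phi> j else 0"
  have le: "norm (?h t \<phi> r j) \<le> ?g \<phi> r j" if "sch1 \<phi>" for t r \<phi> j
  proof (cases "r < t")
    case True
    have "norm (pairing (f r) (t - r) \<phi> j) \<le> ?g \<phi> r j"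
      by (rule C(2)[OF f_bdd _ that decay_seminorms[OF that]]) (use True in simp_all)
    then show ?thesis using True by simp
  next
    case False
    have "0 \<le> (1 + norm (0::'a)) powr decay * norm (iter_deriv [] \<phi> 0)" by simp
    also have "\<dots> \<le> ?d * seminorms \<phi>" using decay_seminorms[OF that, of "[]" 0] by simp
    finally show ?thesis using False C(1) M_nonneg by simp
  qed
  have sg: "summable (?g \<phi> r)" for \<phi> r by (intro summable_mult summable_geometric) simp
  show thesis
  proof (rule that[of "C * ?d * 2"])
    show "0 \<le> C * ?d * 2" using C(1) by simp
    show "summable (?h t \<phi> r)" if "sch1 \<phi>" for t r \<phi>
      by (rule summable_comparison_test'[OF sg le[OF that]])
    show "norm (S t \<phi> r) \<le> C * ?d * 2 * seminorms \<phi> * M r" if "sch1 \<phi>" for t r \<phi>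
    proof -
      have "S t \<phi> r = suminf (?h t \<phi> r)" unfolding S_def by simp
      also have "norm \<dots> \<le> suminf (?g \<phi> r)" by (rule norm_suminf_le[OF le[OF that] sg])
      also have "\<dots> = C * (?d * seminorms \<phi>) * M r * 2"
        by (subst suminf_mult[OF summable_geometric]) (simp_all add: suminf_geometric)
      finally show ?thesis by (simp only: mult_ac)
    qed
  qed
qed

lemma L_borel: "g \<in> X \<rightarrow>\<^sub>M L \<Longrightarrow> g \<in> borel_measurable X"
  by (rule measurable_compose[OF _ id_L])

lemma LL_less [measurable]: "Measurable.pred (L \<Otimes>\<^sub>M L) (\<lambda>q. snd q < fst q)"
proof -
  have [measurable]: "fst \<in> borel_measurable (L \<Otimes>\<^sub>M L)" "snd \<in> borel_measurable (L \<Otimes>\<^sub>M L)" by (auto intro!: L_borel)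
  show ?thesis by measurable
qed

lemma S_measurable [measurable]:
  assumes \<phi>: "sch1 \<phi>"
  shows "(\<lambda>(t, r). S t \<phi> r) \<in> borel_measurable (L \<Otimes>\<^sub>M L)"
proof (rule borel_measurable_LIMSEQ_metric)
  define h where "h = (\<lambda>j (t, r). if r < t then pairing (f r) (t - r) \<phi> j else 0)"
  have [measurable]: "\<phi> \<in> borel_measurable borel" by (rule sch_measurable[OF \<phi>])
  have hm: "h j \<in> borel_measurable (L \<Otimes>\<^sub>M L)" for j
  proof -
    define e where "e = cv (lp_fat \<Phi> j) \<phi>"
    have [measurable]: "e \<in> borel_measurable borel" unfolding e_def by (intro cv_measurable) measurable
    have 1: "(\<lambda>(\<tau>, z). cv e (K \<tau>) z) \<in> borel_measurable (borel \<Otimes>\<^sub>M lborel)" unfolding cv_def by measurable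
    have [measurable]: "(\<lambda>q. fst (fst q)) \<in> borel_measurable ((L \<Otimes>\<^sub>M L) \<Otimes>\<^sub>M lborel)" "(\<lambda>q. snd (fst q)) \<in> borel_measurable ((L \<Otimes>\<^sub>M L) \<Otimes>\<^sub>M lborel)"
      by (rule L_borel, measurable)+
    have 2: "(\<lambda>q. (fst (fst q) - snd (fst q), snd q)) \<in> (L \<Otimes>\<^sub>M L) \<Otimes>\<^sub>M lborel \<rightarrow>\<^sub>M borel \<Otimes>\<^sub>M (lborel :: 'a measure)" by measurable
    have 3: "(\<lambda>q. (snd (fst q), snd q)) \<in> (L \<Otimes>\<^sub>M L) \<Otimes>\<^sub>M lborel \<rightarrow>\<^sub>M L \<Otimes>\<^sub>M (lborel :: 'a measure)" by measurable
    have [measurable]: "(\<lambda>q. cv e (K (fst (fst q) - snd (fst q))) (snd q) * lpc (f (snd (fst q))) j (snd q)) \<in> borel_measurable ((L \<Otimes>\<^sub>M L) \<Otimes>\<^sub>M lborel)"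
      using borel_measurable_times[OF measurable_compose[OF 2 1] measurable_compose[OF 3 lpc_joint]] by simp
    have "(\<lambda>q. pairing (f (snd q)) (fst q - snd q) \<phi> j) \<in> borel_measurable (L \<Otimes>\<^sub>M L)"
      unfolding pairing_def e_def[symmetric]
      by (rule lborel.borel_measurable_lebesgue_integral) (simp add: case_prod_beta')
    then show ?thesis unfolding h_def case_prod_beta' by measurable
  qed
  show "(\<lambda>q. \<Sum>j<n. h j q) \<in> borel_measurable (L \<Otimes>\<^sub>M L)" for n by (intro borel_measurable_sum hm)
  fix q
  obtain C where C: "C \<ge> 0"
    "\<And>t r \<phi>. sch1 \<phi> \<Longrightarrow> summable (\<lambda>j. if r < t then pairing (f r) (t - r) \<phi> j else 0)"
    "\<And>t r \<phi>. sch1 \<phi> \<Longrightarrow> norm (S t \<phi> r) \<le> C * seminorms \<phi> * M r"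
    using S_seminorms by blast
  have "summable (\<lambda>j. h j q)" unfolding h_def using C(2)[OF \<phi>] by (simp add: case_prod_beta)
  moreover have "(case q of (t, r) \<Rightarrow> S t \<phi> r) = (\<Sum>j. h j q)" unfolding h_def S_def by (simp add: case_prod_beta)
  ultimately show "(\<lambda>n. \<Sum>j<n. h j q) \<longlonglongrightarrow> (case q of (t, r) \<Rightarrow> S t \<phi> r)" by (simp only: summable_LIMSEQ)
qed

lemma S_integrable:
  assumes \<phi>: "sch1 \<phi>" and t: "t \<in> {0..T}"
  shows "integrable L (S t \<phi>)"
proof -
  obtain C where C: "C \<ge> 0"
    "\<And>t r \<phi>. sch1 \<phi> \<Longrightarrow> summable (\<lambda>j. if r < t then pairing (f r) (t - r) \<phi> j else 0)"
    "\<And>t r \<phi>. sch1 \<phi> \<Longrightarrow> norm (S t \<phi> r) \<le> C * seminorms \<phi> * M r"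
    using S_seminorms by blast
  have m: "S t \<phi> \<in> borel_measurable L"
    using measurable_Pair2[OF S_measurable[OF \<phi>], of t] t by (simp add: space_restrict_space)
  show ?thesis
  proof (rule integrable_bound[OF integrable_mult_right[OF M_integrable, of "C * seminorms \<phi>"] m], intro AE_I2)
    show "norm (S t \<phi> r) \<le> norm (C * seminorms \<phi> * M r)" for r
      using C(3)[OF \<phi>, of t r] unfolding real_norm_def by linarith
  qed
qed

lemma restrict_L: "t \<in> {0..T} \<Longrightarrow> lebesgue_on {0..t} = restrict_space L {0..t}"
  by (subst restrict_restrict_space) (auto simp: Int_absorb1 Int_absorb2)

lemma AE_less:
  assumes t: "t \<in> {0..T}"
  shows "AE r in lebesgue_on {0..t}. r < t"
proof -
  have "AE r in lebesgue. r \<noteq> t" by (rule AE_completion) (rule AE_lborel_singleton)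
  then show ?thesis by (subst AE_restrict_space_iff) auto
qed

text \<open>The integrand of \<open>T_op\<close> coincides with S for r < t. At r = t it involves
  the heat kernel at time 0, about which nothing is known, but this is a null set; for r > t the
  function S is 0.\<close>

lemma
  assumes \<phi>: "sch1 \<phi>" and t: "t \<in> {0..T}"
  shows T_op_integrable: "integrable (lebesgue_on {0..t}) (\<lambda>r. \<integral>x. conv_dist \<Phi> (K (t - r)) (f r) x * \<phi> x \<partial>lborel)"
    and T_op_eq: "T_op \<Phi> \<alpha> f t \<phi> = (\<integral>r. S t \<phi> r \<partial>L)"
proof -
  have z: "indicator {0..t} r *\<^sub>R S t \<phi> r = S t \<phi> r" if "r \<in> space L" for r
    using that by (auto simp: S_def indicator_def space_restrict_space)
  have \<Omega>: "{0..t} \<inter> space L \<in> sets L" using t by (auto simp: sets_restrict_space_iff space_restrict_space Int_absorb2)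
  have i: "integrable (lebesgue_on {0..t}) (S t \<phi>)"
    unfolding restrict_L[OF t] integrable_restrict_space[OF \<Omega>]
    by (rule Bochner_Integration.integrable_cong[OF refl z, THEN iffD2, OF _ S_integrable[OF \<phi> t]])
  have eq: "AE r in lebesgue_on {0..t}. S t \<phi> r = (LBINT x. conv_dist \<Phi> (K (t - r)) (f r) x * \<phi> x)"
    using AE_less[OF t] by eventually_elim (rule S_eq[OF _ \<phi>])
  have m: "(\<lambda>r. \<integral>x. conv_dist \<Phi> (K (t - r)) (f r) x * \<phi> x \<partial>lborel) \<in> borel_measurable (lebesgue_on {0..t})"
    by (rule measurable_lebesgue_on_AE[OF borel_measurable_integrable[OF i] eq])
  show "integrable (lebesgue_on {0..t}) (\<lambda>r. \<integral>x. conv_dist \<Phi> (K (t - r)) (f r) x * \<phi> x \<partial>lborel)"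
    by (rule integrable_cong_AE_imp[OF i m eq])
  have "T_op \<Phi> \<alpha> f t \<phi> = (\<integral>r. S t \<phi> r \<partial>lebesgue_on {0..t})"
    unfolding T_op_def by (rule integral_cong_AE[OF m borel_measurable_integrable[OF i]]) (use eq in eventually_elim, simp)
  also have "\<dots> = (\<integral>r. S t \<phi> r \<partial>L)"
    unfolding restrict_L[OF t] integral_restrict_space[OF \<Omega>] by (rule integral_cong[OF refl z])
  finally show "T_op \<Phi> \<alpha> f t \<phi> = (\<integral>r. S t \<phi> r \<partial>L)" .
qed

lemma T_op_defined: "T_op_defined \<Phi> \<alpha> T f"
  unfolding T_op_defined_def
proof (intro ballI conjI)
  fix t assume t: "t \<in> {0..T}"
  show "AE r in lebesgue_on {0..t}. (\<forall>x. \<exists>l. (trunc_conv \<Phi> (K (t - r)) (f r) x \<longlongrightarrow> l) at_top) \<and>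
      (\<forall>\<phi>\<in>schwartz. integrable lborel (\<lambda>x. conv_dist \<Phi> (K (t - r)) (f r) x * \<phi> x))"
    using AE_less[OF t]
  proof eventually_elim
    case (elim r)
    then have r: "0 < t - r" by simp
    show ?case
      unfolding schwartz_sch1 Ball_def by (intro conjI allI impI exI) (rule trunc_conv_tendsto[OF f_bdd r], erule conv_dist_integrable[OF f_bdd r])
  qed
  show "integrable (lebesgue_on {0..t}) (\<lambda>r. \<integral>x. conv_dist \<Phi> (K (t - r)) (f r) x * \<phi> x \<partial>lborel)" if "\<phi> \<in> schwartz" for \<phi>
    by (rule T_op_integrable[OF _ t]) (use that in \<open>simp add: schwartz_sch1\<close>)
qed

lemma T_op_measurable:
  assumes "sch1 \<phi>"
  shows "(\<lambda>t. T_op \<Phi> \<alpha> f t \<phi>) \<in> borel_measurable L"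
proof -
  have "(\<lambda>t. \<integral>r. S t \<phi> r \<partial>L) \<in> borel_measurable L"
    by (rule L.borel_measurable_lebesgue_integral[OF S_measurable[OF assms]])
  then show ?thesis
    by (rule measurable_cong[THEN iffD1, rotated]) (simp add: T_op_eq[OF assms] space_restrict_space)
qed

lemma T_op_tempered:
  assumes t: "t \<in> {0..T}"
  shows "tempered (T_op \<Phi> \<alpha> f t)"
  unfolding tempered_def
proof (intro conjI ballI allI)
  fix \<phi> \<psi> :: "'a \<Rightarrow> complex" and a b assume "\<phi> \<in> schwartz" "\<psi> \<in> schwartz"
  then have s: "sch1 \<phi>" "sch1 \<psi>" unfolding schwartz_sch1 .
  have ab: "sch1 (\<lambda>x. a * \<phi> x + b * \<psi> x)" by (intro sch_add sch_cmult_const s)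
  have lin: "S t (\<lambda>x. a * \<phi> x + b * \<psi> x) r = a * S t \<phi> r + b * S t \<psi> r" for r
  proof (cases "r < t")
    case True
    let ?c = "\<lambda>x. conv_dist \<Phi> (K (t - r)) (f r) x"
    have i: "integrable lborel (\<lambda>x. ?c x * \<phi> x)" "integrable lborel (\<lambda>x. ?c x * \<psi> x)"
      using True by (auto intro: conv_dist_integrable[OF f_bdd] s)
    have "S t (\<lambda>x. a * \<phi> x + b * \<psi> x) r = (LBINT x. a * (?c x * \<phi> x) + b * (?c x * \<psi> x))"
      unfolding S_eq[OF True ab] by (simp add: algebra_simps)
    also have "\<dots> = a * S t \<phi> r + b * S t \<psi> r"
      unfolding S_eq[OF True s(1)] S_eq[OF True s(2)] using i by simp
    finally show ?thesis .
  qed (simp add: S_def)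
  show "T_op \<Phi> \<alpha> f t (\<lambda>x. a * \<phi> x + b * \<psi> x) = a * T_op \<Phi> \<alpha> f t \<phi> + b * T_op \<Phi> \<alpha> f t \<psi>"
    unfolding T_op_eq[OF ab t] T_op_eq[OF s(1) t] T_op_eq[OF s(2) t] lin[abs_def]
    using S_integrable[OF s(1) t] S_integrable[OF s(2) t] by simp
next
  obtain C where C: "C \<ge> 0"
    "\<And>t r \<phi>. sch1 \<phi> \<Longrightarrow> summable (\<lambda>j. if r < t then pairing (f r) (t - r) \<phi> j else 0)"
    "\<And>t r \<phi>. sch1 \<phi> \<Longrightarrow> norm (S t \<phi> r) \<le> C * seminorms \<phi> * M r"
    using S_seminorms by blast
  have "norm (T_op \<Phi> \<alpha> f t \<phi>) \<le> C * (\<integral>r. M r \<partial>L) * seminorms \<phi>" if \<phi>: "sch1 \<phi>" for \<phi>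
  proof -
    have "norm (\<integral>r. S t \<phi> r \<partial>L) \<le> (\<integral>r. C * seminorms \<phi> * M r \<partial>L)"
      by (rule norm_integral_le[OF integrable_mult_right[OF M_integrable] C(3)[OF \<phi>]])
    then show ?thesis unfolding T_op_eq[OF \<phi> t] by (simp add: mult_ac)
  qed
  note B = this
  show "\<exists>C N. \<forall>\<phi>\<in>schwartz. norm (T_op \<Phi> \<alpha> f t \<phi>)
      \<le> C * (\<Sum>k\<le>N. \<Sum>bs\<in>{bs. set bs \<subseteq> Basis \<and> length bs \<le> N}. schwartz_seminorm k bs \<phi>)"
    by (intro exI[of _ "C * (\<integral>r. M r \<partial>L)"] exI[of _ seminorm_order] ballI B[unfolded seminorms_def]) (simp only: schwartz_sch1)
qed

lemma T_op_real:
  assumes t: "t \<in> {0..T}"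
  shows "real_dist (T_op \<Phi> \<alpha> f t)"
  unfolding real_dist_def
proof (intro ballI impI)
  fix \<phi> :: "'a \<Rightarrow> complex" assume "\<phi> \<in> schwartz" and r: "range \<phi> \<subseteq> \<real>"
  then have \<phi>: "sch1 \<phi>" unfolding schwartz_sch1 by simp
  have R: "(\<integral>x. g x \<partial>X) \<in> \<real>" if "\<And>x. g x \<in> \<real>" for g :: "'b \<Rightarrow> complex" and X
  proof -
    have "(\<integral>x. g x \<partial>X) = (\<integral>x. of_real (Re (g x)) \<partial>X)" using that by (simp add: of_real_Re)
    also have "\<dots> = of_real (\<integral>x. Re (g x) \<partial>X)" by (rule integral_complex_of_real)
    finally have "(\<integral>x. g x \<partial>X) = of_real (\<integral>x. Re (g x) \<partial>X)" .
    then show ?thesis by simp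
  qed
  have "S t \<phi> r \<in> \<real>" for r
  proof (cases "r < t")
    case True
    have "\<phi> x \<in> \<real>" for x using r by auto
    then show ?thesis
      unfolding S_eq[OF True \<phi>] using True
      by (intro R Reals_mult conv_dist_real[OF f_bdd _ f_real]) auto
  qed (simp add: S_def)
  then show "T_op \<Phi> \<alpha> f t \<phi> \<in> \<real>" unfolding T_op_eq[OF \<phi> t] by (rule R)
qed

end

section \<open>Schur's test\<close>

text \<open>Jensen's inequality in y for each x, then Fubini. The first mass bound contributes
  \<open>A powr (p - 1)\<close>, the second the remaining factor A.\<close>

lemma schur_ennpow:
  assumes "pair_sigma_finite X Y" and p: "1 \<le> p" and A: "0 < A"
    and [measurable]: "(\<lambda>(x, y). w x y) \<in> borel_measurable (X \<Otimes>\<^sub>M Y)" "g \<in> borel_measurable Y"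
    and wY: "\<And>x. x \<in> space X \<Longrightarrow> (\<integral>\<^sup>+y. w x y \<partial>Y) \<le> ennreal A"
    and wX: "\<And>y. y \<in> space Y \<Longrightarrow> (\<integral>\<^sup>+x. w x y \<partial>X) \<le> ennreal A"
  shows "(\<integral>\<^sup>+x. ennpow (\<integral>\<^sup>+y. w x y * g y \<partial>Y) p \<partial>X) \<le> ennreal (2 powr p * A powr p) * (\<integral>\<^sup>+y. ennpow (g y) p \<partial>Y)"
proof -
  interpret pair_sigma_finite X Y by fact
  let ?c = "ennreal (2 powr p * A powr (p - 1))"
  have "(\<integral>\<^sup>+x. ennpow (\<integral>\<^sup>+y. w x y * g y \<partial>Y) p \<partial>X) \<le> (\<integral>\<^sup>+x. ?c * (\<integral>\<^sup>+y. w x y * ennpow (g y) p \<partial>Y) \<partial>X)"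
    by (intro nn_integral_mono jensen_ennpow[OF p A wY]) measurable
  also have "\<dots> = ?c * (\<integral>\<^sup>+x. \<integral>\<^sup>+y. w x y * ennpow (g y) p \<partial>Y \<partial>X)" by (rule nn_integral_cmult) measurable
  also have "(\<integral>\<^sup>+x. \<integral>\<^sup>+y. w x y * ennpow (g y) p \<partial>Y \<partial>X) = (\<integral>\<^sup>+y. \<integral>\<^sup>+x. w x y * ennpow (g y) p \<partial>X \<partial>Y)"
    by (rule Fubini'[symmetric]) measurable
  also have "\<dots> \<le> (\<integral>\<^sup>+y. ennreal A * ennpow (g y) p \<partial>Y)"
  proof (rule nn_integral_mono)
    fix y assume y: "y \<in> space Y"
    have "(\<integral>\<^sup>+x. w x y * ennpow (g y) p \<partial>X) = (\<integral>\<^sup>+x. w x y \<partial>X) * ennpow (g y) p"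
      using y by (intro nn_integral_multc) measurable
    also have "\<dots> \<le> ennreal A * ennpow (g y) p" by (intro mult_right_mono wX[OF y]) simp
    finally show "(\<integral>\<^sup>+x. w x y * ennpow (g y) p \<partial>X) \<le> ennreal A * ennpow (g y) p" .
  qed
  also have "\<dots> = ennreal A * (\<integral>\<^sup>+y. ennpow (g y) p \<partial>Y)" by (rule nn_integral_cmult) measurable
  also have "?c * (ennreal A * (\<integral>\<^sup>+y. ennpow (g y) p \<partial>Y)) = ennreal (2 powr p * A powr p) * (\<integral>\<^sup>+y. ennpow (g y) p \<partial>Y)"
  proof -
    have "A powr (p - 1) * A = A powr p" using A by (simp add: powr_diff)
    then have "?c * ennreal A = ennreal (2 powr p * A powr p)" using A by (simp add: ennreal_mult'[symmetric] mult.assoc)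
    then show ?thesis by (simp only: mult.assoc[symmetric])
  qed
  finally show ?thesis by (simp add: mult_left_mono)
qed

lemma ennpow_sum_le:
  assumes "finite J" "J \<noteq> {}" and p: "1 \<le> p"
  shows "ennpow (\<Sum>j\<in>J. g j) p \<le> ennreal (2 powr p * real (card J) powr (p - 1)) * (\<Sum>j\<in>J. ennpow (g j) p)"
proof -
  have c: "0 < real (card J)" using assms by (simp add: card_gt_0_iff)
  have "(\<integral>\<^sup>+j. 1 \<partial>count_space J) \<le> ennreal (real (card J))"
    using assms by (simp add: emeasure_count_space ennreal_of_nat_eq_real_of_nat)
  from jensen_ennpow[OF p c this, of g] show ?thesis
    using assms(1) by (simp add: nn_integral_count_space_finite)
qed

section \<open>The space-time kernel between dyadic pieces\<close>

context heat_data
begin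

abbreviation P :: "(real \<times> 'a) measure" where "P \<equiv> L \<Otimes>\<^sub>M lborel"

text \<open>A majorant for the kernel that sends the j-th piece of f to its contribution to the i-th
  piece of \<open>T\<^sup>\<alpha> f\<close>, zero unless the source time is earlier. Time and space
  form one variable, so Schur's test is applied once.\<close>

definition W :: "nat \<Rightarrow> nat \<Rightarrow> real \<times> 'a \<Rightarrow> real \<times> 'a \<Rightarrow> ennreal" where
  "W i j q q' = (if fst q' < fst q then ennreal (norm (cv (lp_kernel \<Phi> i) (k j (fst q - fst q')) (snd q - snd q'))) else 0)"

lemma W_measurable [measurable]: "(\<lambda>(q, q'). W i j q q') \<in> borel_measurable (P \<Otimes>\<^sub>M P)"
proof -
  have 1: "(\<lambda>(\<tau>, y). cv (lp_kernel \<Phi> i) (k j \<tau>) y) \<in> borel_measurable (borel \<Otimes>\<^sub>M borel)" unfolding cv_def by measurable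
  have [measurable]: "(\<lambda>q. fst (fst q)) \<in> borel_measurable (P \<Otimes>\<^sub>M P)" "(\<lambda>q. fst (snd q)) \<in> borel_measurable (P \<Otimes>\<^sub>M P)"
    by (rule L_borel, measurable)+
  have [measurable]: "(\<lambda>q. snd (fst q)) \<in> borel_measurable (P \<Otimes>\<^sub>M P)" "(\<lambda>q. snd (snd q)) \<in> borel_measurable (P \<Otimes>\<^sub>M P)"
    unfolding measurable_lborel2[symmetric] by measurable
  have 2: "(\<lambda>q. (fst (fst q) - fst (snd q), snd (fst q) - snd (snd q))) \<in> P \<Otimes>\<^sub>M P \<rightarrow>\<^sub>M borel \<Otimes>\<^sub>M borel" by measurable
  have [measurable]: "(\<lambda>q. cv (lp_kernel \<Phi> i) (k j (fst (fst q) - fst (snd q))) (snd (fst q) - snd (snd q))) \<in> borel_measurable (P \<Otimes>\<^sub>M P)"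
    using measurable_compose[OF 2 1] by simp
  show ?thesis unfolding W_def case_prod_beta' by measurable
qed

lemma W_measurable1 [measurable]: "q \<in> space P \<Longrightarrow> W i j q \<in> borel_measurable P"
  using measurable_Pair2[OF W_measurable, of q] by simp

sublocale PP: pair_sigma_finite P P
  by (intro pair_sigma_finite.intro LB.sigma_finite_measure_axioms)

abbreviation g :: "nat \<Rightarrow> real \<times> 'a \<Rightarrow> ennreal" where
  "g j q \<equiv> ennreal (norm (lpc (f (fst q)) j (snd q)))"

lemma g_measurable [measurable]: "g j \<in> borel_measurable P"
  using lpc_joint[of j] unfolding case_prod_beta' by measurable

definition H :: "nat \<Rightarrow> nat \<Rightarrow> real \<times> 'a \<Rightarrow> ennreal" where
  "H i j q = (\<integral>\<^sup>+q'. W i j q q' * g j q' \<partial>P)"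

lemma H_measurable [measurable]: "H i j \<in> borel_measurable P"
  unfolding H_def by measurable

definition near :: "nat \<Rightarrow> nat set" where "near i = {j. j \<le> i + 3 \<and> i \<le> j + 3}"

lemma finite_near: "finite (near i)" unfolding near_def by simp

lemma near_nonempty: "near i \<noteq> {}" unfolding near_def by auto

lemma card_near: "card (near i) \<le> 7"
proof -
  have "near i \<subseteq> {i - 3..i + 3}" unfolding near_def by auto
  then have "card (near i) \<le> card {i - 3..i + 3}" by (intro card_mono) auto
  then show ?thesis by simp
qed

text \<open>Since all kernels are even, the reflected and translated test kernel combines with
  \<open>k\<^sub>j\<^sub>,\<^sub>\<tau>\<close> to an ordinary convolution evaluated at x - z. For
  far indices its convolution with the fat kernel is already 0.\<close>

lemma pairing_kernel:
  assumes \<tau>: "0 < \<tau>"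
  shows "pairing u \<tau> (\<lambda>y. lp_kernel \<Phi> i (x - y)) j = (LBINT z. cv (lp_kernel \<Phi> i) (k j \<tau>) (x - z) * lpc u j z)"
    and "j \<notin> near i \<Longrightarrow> pairing u \<tau> (\<lambda>y. lp_kernel \<Phi> i (x - y)) j = 0"
proof -
  let ?\<phi> = "\<lambda>y. lp_kernel \<Phi> i (x - y)"
  have "cv (cv (lp_fat \<Phi> j) ?\<phi>) (K \<tau>) z = cv (lp_kernel \<Phi> i) (k j \<tau>) (x - z)" for z
  proof -
    have "cv (cv (lp_fat \<Phi> j) ?\<phi>) (K \<tau>) z = (LBINT y. k j \<tau> (y - z) * lp_kernel \<Phi> i (x - y))"
      by (rule cv_test_k[OF \<tau> sch1_reflect[OF kernel_sch1]])
    also have "\<dots> = (LBINT v. lp_kernel \<Phi> i v * k j \<tau> (x - z - v))"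
      using integral_shift(2)[of "\<lambda>v. lp_kernel \<Phi> i v * k j \<tau> (x - z - v)" x] by (simp add: algebra_simps)
    finally show ?thesis unfolding cv_def .
  qed
  then show "pairing u \<tau> ?\<phi> j = (LBINT z. cv (lp_kernel \<Phi> i) (k j \<tau>) (x - z) * lpc u j z)"
    unfolding pairing_def by simp
  assume "j \<notin> near i"
  then have far: "cv (lp_kernel \<Phi> i) (lp_fat \<Phi> j) = (\<lambda>_. 0)"
    by (intro lp_kernel_fat_far[OF lp]) (auto simp: near_def)
  have "cv (lp_fat \<Phi> j) ?\<phi> y = cv (lp_kernel \<Phi> i) (lp_fat \<Phi> j) (x - y)" for y
  proof -
    have "cv (lp_fat \<Phi> j) ?\<phi> y = (LBINT v. lp_fat \<Phi> j v * lp_kernel \<Phi> i (x - y + v))"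
      unfolding cv_def by (simp add: algebra_simps)
    also have "\<dots> = (LBINT v. lp_fat \<Phi> j v * lp_kernel \<Phi> i (x - y - v))"
      using integral_lborel_affine[of "-1" "\<lambda>v. lp_fat \<Phi> j v * lp_kernel \<Phi> i (x - y + v)" 0] by (simp add: lp_fat_even[OF lp])
    finally show ?thesis unfolding cv_commute[of "lp_kernel \<Phi> i"] unfolding cv_def .
  qed
  then have "cv (lp_fat \<Phi> j) ?\<phi> = (\<lambda>_. 0)" unfolding far by (intro ext)
  then show "pairing u \<tau> ?\<phi> j = 0" unfolding pairing_def by (simp add: cv_def)
qed

text \<open>Only the at most seven indices of \<open>near i\<close> contribute, so the series in S
  is a finite sum; the triangle inequality then leaves positive integral operators.\<close>

lemma T_op_kernel_bound:
  assumes t: "t \<in> {0..T}"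
  shows "ennreal (norm (T_op \<Phi> \<alpha> f t (\<lambda>y. lp_kernel \<Phi> i (x - y)))) \<le> (\<Sum>j\<in>near i. H i j (t, x))"
proof -
  let ?\<phi> = "\<lambda>y. lp_kernel \<Phi> i (x - y)"
  have q: "(t, x) \<in> space P" using t by (simp add: space_pair_measure space_restrict_space)
  note [measurable] = W_measurable1[OF q]
  have "ennreal (norm (T_op \<Phi> \<alpha> f t ?\<phi>)) \<le> (\<integral>\<^sup>+r. ennreal (norm (S t ?\<phi> r)) \<partial>L)"
    unfolding T_op_eq[OF sch1_reflect[OF kernel_sch1] t] by (rule norm_integral_le_nn)
  also have "\<dots> \<le> (\<integral>\<^sup>+r. (\<Sum>j\<in>near i. \<integral>\<^sup>+z. W i j (t, x) (r, z) * g j (r, z) \<partial>lborel) \<partial>L)"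
  proof (rule nn_integral_mono)
    fix r
    show "ennreal (norm (S t ?\<phi> r)) \<le> (\<Sum>j\<in>near i. \<integral>\<^sup>+z. W i j (t, x) (r, z) * g j (r, z) \<partial>lborel)"
    proof (cases "r < t")
      case True
      then have \<tau>: "0 < t - r" by simp
      have "S t ?\<phi> r = (\<Sum>j. pairing (f r) (t - r) ?\<phi> j)" unfolding S_def using True by simp
      also have "\<dots> = (\<Sum>j\<in>near i. pairing (f r) (t - r) ?\<phi> j)"
        by (rule suminf_finite[OF finite_near pairing_kernel(2)[OF \<tau>]])
      also have "ennreal (norm \<dots>) \<le> ennreal (\<Sum>j\<in>near i. norm (pairing (f r) (t - r) ?\<phi> j))"
        by (intro ennreal_leI norm_sum)
      also have "\<dots> = (\<Sum>j\<in>near i. ennreal (norm (pairing (f r) (t - r) ?\<phi> j)))" by (simp add: sum_ennreal)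
      also have "\<dots> \<le> (\<Sum>j\<in>near i. \<integral>\<^sup>+z. W i j (t, x) (r, z) * g j (r, z) \<partial>lborel)"
      proof (rule sum_mono)
        fix j
        show "ennreal (norm (pairing (f r) (t - r) ?\<phi> j)) \<le> (\<integral>\<^sup>+z. W i j (t, x) (r, z) * g j (r, z) \<partial>lborel)"
          unfolding pairing_kernel(1)[OF \<tau>] using True
          by (intro order_trans[OF norm_integral_le_nn]) (simp add: W_def norm_mult ennreal_mult'')
      qed
      finally show ?thesis .
    qed (simp add: S_def)
  qed
  also have "\<dots> = (\<Sum>j\<in>near i. \<integral>\<^sup>+r. \<integral>\<^sup>+z. W i j (t, x) (r, z) * g j (r, z) \<partial>lborel \<partial>L)"
    by (rule nn_integral_sum) measurable
  also have "\<dots> = (\<Sum>j\<in>near i. H i j (t, x))"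
    unfolding H_def by (intro sum.cong refl lborel.nn_integral_fst) measurable
  finally show ?thesis .
qed

text \<open>The integral of \<open>\<tau> powr (- (3 / 4))\<close> over [0, T], in the form given by
  the antiderivative.\<close>

definition \<rho> :: real where "\<rho> = T powr (- (3 / 4) + 1) / (- (3 / 4) + 1)"

lemma \<rho>_pos: "0 < \<rho>" unfolding \<rho>_def using T by simp

lemma nn_integral_L: "h \<in> borel_measurable borel \<Longrightarrow> (\<integral>\<^sup>+r. h r \<partial>L) = (\<integral>\<^sup>+r. h r * indicator {0..T} r \<partial>lborel)"
  by (simp add: nn_integral_restrict_space nn_integral_completion)

lemma time_mass:
  shows "t \<in> {0..T} \<Longrightarrow> (\<integral>\<^sup>+r. (if r < t then ennreal ((t - r) powr (- (3 / 4))) else 0) \<partial>L) \<le> ennreal \<rho>"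
    and "r \<in> {0..T} \<Longrightarrow> (\<integral>\<^sup>+t. (if r < t then ennreal ((t - r) powr (- (3 / 4))) else 0) \<partial>L) \<le> ennreal \<rho>"
proof -
  define h where "h = (\<lambda>\<tau>. ennreal (\<tau> powr (- (3 / 4))) * indicator {0..T} \<tau>)"
  have [measurable]: "h \<in> borel_measurable borel" unfolding h_def by measurable
  have h: "(\<integral>\<^sup>+\<tau>. h \<tau> \<partial>lborel) = ennreal \<rho>"
    unfolding h_def \<rho>_def by (rule nn_integral_has_integral_lebesgue'[OF _ has_integral_powr_from_0]) (use T in auto)
  show "(\<integral>\<^sup>+r. (if r < t then ennreal ((t - r) powr (- (3 / 4))) else 0) \<partial>L) \<le> ennreal \<rho>" if "t \<in> {0..T}"
  proof -
    have "(\<integral>\<^sup>+r. (if r < t then ennreal ((t - r) powr (- (3 / 4))) else 0) \<partial>L) \<le> (\<integral>\<^sup>+r. h (t - r) \<partial>lborel)"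
      using that by (subst nn_integral_L) (auto simp: h_def indicator_def intro!: nn_integral_mono)
    then show ?thesis by (simp add: nn_integral_shift(2)[of h] h)
  qed
  show "(\<integral>\<^sup>+t. (if r < t then ennreal ((t - r) powr (- (3 / 4))) else 0) \<partial>L) \<le> ennreal \<rho>" if "r \<in> {0..T}"
  proof -
    have "(\<integral>\<^sup>+t. (if r < t then ennreal ((t - r) powr (- (3 / 4))) else 0) \<partial>L) \<le> (\<integral>\<^sup>+t. h (t - r) \<partial>lborel)"
      using that by (subst nn_integral_L) (auto simp: h_def indicator_def intro!: nn_integral_mono)
    then show ?thesis by (simp add: nn_integral_shift(1)[of h] h)
  qed
qed

lemma kernel_L1: "(\<integral>\<^sup>+x. ennreal (norm (lp_kernel \<Phi> i x)) \<partial>lborel) \<le> ennreal (2 * (LBINT x. norm (\<Phi> x)))"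
proof -
  have L1: "(\<integral>\<^sup>+x. ennreal (norm (h x)) \<partial>lborel) = ennreal (LBINT x. norm (h x))" if "integrable lborel h" for h :: "'a \<Rightarrow> complex"
    using that by (intro nn_integral_eq_integral) auto
  have i\<Phi>: "integrable lborel \<Phi>" by (rule sch_integrable[OF lp_sch1[OF lp]])
  have d: "integrable lborel (dil (2 ^ n) \<Phi>)" for n by (intro integrable_dil i\<Phi>) simp
  have "(LBINT x. norm (lp_kernel \<Phi> i x)) \<le> 2 * (LBINT x. norm (\<Phi> x))"
  proof (cases "i = 0")
    case False
    have "(LBINT x. norm (lp_kernel \<Phi> i x)) \<le> (LBINT x. norm (dil (2 ^ i) \<Phi> x) + norm (dil (2 ^ (i - 1)) \<Phi> x))"
    proof (rule Bochner_Integration.integral_mono)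
      show "integrable lborel (\<lambda>x. norm (lp_kernel \<Phi> i x))" by (intro integrable_norm sch_integrable[OF kernel_sch1])
      show "integrable lborel (\<lambda>x. norm (dil (2 ^ i) \<Phi> x) + norm (dil (2 ^ (i - 1)) \<Phi> x))"
        by (intro Bochner_Integration.integrable_add integrable_norm d)
      show "norm (lp_kernel \<Phi> i x) \<le> norm (dil (2 ^ i) \<Phi> x) + norm (dil (2 ^ (i - 1)) \<Phi> x)" for x
        using False norm_triangle_ineq4 by (simp add: lp_kernel_def)
    qed
    also have "\<dots> = (LBINT x. norm (dil (2 ^ i) \<Phi> x)) + (LBINT x. norm (dil (2 ^ (i - 1)) \<Phi> x))"
      by (intro Bochner_Integration.integral_add integrable_norm d)
    also have "\<dots> = 2 * (LBINT x. norm (\<Phi> x))" by (simp add: integral_norm_dil)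
    finally show ?thesis .
  qed (simp add: lp_kernel_def)
  then show ?thesis unfolding L1[OF sch_integrable[OF kernel_sch1]] by (rule ennreal_leI)
qed

definition b :: real where "b = 3 * \<alpha> / 4"

definition Mp :: ennreal where "Mp = (\<integral>\<^sup>+r. ennreal (M r powr p) \<partial>L)"

definition G :: "nat \<Rightarrow> real \<times> 'a \<Rightarrow> ennreal" where "G i q = (\<Sum>j\<in>near i. H i j q)"

lemma G_measurable [measurable]: "G i \<in> borel_measurable P" unfolding G_def by measurable

text \<open>The final constant has to be chosen before f is given, whereas the estimates are proved
  in a locale that fixes f. So the constants are functions of C and of the parameters other than f
  and M, and the choice of C is a predicate.\<close>

definition L1_const :: "real \<Rightarrow> bool" where
  "L1_const C \<longleftrightarrow> 0 < C \<and> (\<forall>j \<tau>. 0 < \<tau> \<longrightarrow> \<tau> \<le> T \<longrightarrow>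
    (\<integral>\<^sup>+x. ennreal (norm (k j \<tau> x)) \<partial>lborel) \<le> ennreal (C * 2 powr (- (real j * (3 * \<alpha> / 4))) * \<tau> powr (- (3 / 4))))"

definition mass_const :: "real \<Rightarrow> real" where
  "mass_const C = (2 * (LBINT x. norm (\<Phi> x)) + 1) * C * \<rho>"

definition Lp_const :: "real \<Rightarrow> real" where
  "Lp_const C = 2 powr p * 7 powr (p - 1) * 7 * (2 powr p * mass_const C powr p * 2 powr (3 * \<bar>b + s\<bar> * p))"

context
  fixes Ck :: real
  assumes L1_const: "L1_const Ck"
begin

abbreviation D :: real where "D \<equiv> mass_const Ck"
abbreviation E :: real where "E \<equiv> Lp_const Ck"

lemma Ck: "0 < Ck"
  and kL: "0 < \<tau> \<Longrightarrow> \<tau> \<le> T \<Longrightarrow>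
    (\<integral>\<^sup>+x. ennreal (norm (k j \<tau> x)) \<partial>lborel) \<le> ennreal (Ck * 2 powr (- (real j * (3 * \<alpha> / 4))) * \<tau> powr (- (3 / 4)))"
  using L1_const unfolding L1_const_def by auto

lemma D_pos: "0 < D"
  unfolding mass_const_def using Ck \<rho>_pos by (intro mult_pos_pos add_nonneg_pos) simp_all

lemma W_space:
  assumes t: "r \<in> {0..T}" "t \<in> {0..T}"
  shows "(if r < t then \<integral>\<^sup>+y. ennreal (norm (cv (lp_kernel \<Phi> i) (k j (t - r)) y)) \<partial>lborel else 0)
    \<le> ennreal (D / \<rho> * 2 powr (- (real j * b))) * (if r < t then ennreal ((t - r) powr (- (3 / 4))) else 0)"
proof (cases "r < t")
  case True
  let ?n = "2 * (LBINT x. norm (\<Phi> x))" and ?c = "Ck * 2 powr (- (real j * (3 * \<alpha> / 4))) * (t - r) powr (- (3 / 4))"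
  have "(\<integral>\<^sup>+y. ennreal (norm (cv (lp_kernel \<Phi> i) (k j (t - r)) y)) \<partial>lborel) \<le> ennreal ?n * ennreal ?c"
    by (rule order_trans[OF nn_integral_norm_cv mult_mono[OF kernel_L1 kL]]) (use t True in auto)
  also have "\<dots> = ennreal (?n * ?c)" using Ck by (intro ennreal_mult[symmetric]) auto
  also have "\<dots> \<le> ennreal ((?n + 1) * ?c)" using Ck by (intro ennreal_leI mult_right_mono) auto
  also have "(?n + 1) * ?c = D / \<rho> * 2 powr (- (real j * b)) * (t - r) powr (- (3 / 4))"
    unfolding mass_const_def b_def using \<rho>_pos by simp
  also have "ennreal \<dots> = ennreal (D / \<rho> * 2 powr (- (real j * b))) * ennreal ((t - r) powr (- (3 / 4)))"
    using D_pos \<rho>_pos by (intro ennreal_mult) auto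
  finally show ?thesis using True by simp
qed simp

lemma D_time:
  assumes "h \<in> borel_measurable L" "(\<integral>\<^sup>+r. h r \<partial>L) \<le> ennreal \<rho>"
  shows "(\<integral>\<^sup>+r. ennreal (D / \<rho> * 2 powr (- (real j * b))) * h r \<partial>L) \<le> ennreal (D * 2 powr (- (real j * b)))"
proof -
  have "(\<integral>\<^sup>+r. ennreal (D / \<rho> * 2 powr (- (real j * b))) * h r \<partial>L) = ennreal (D / \<rho> * 2 powr (- (real j * b))) * (\<integral>\<^sup>+r. h r \<partial>L)"
    by (rule nn_integral_cmult[OF assms(1)])
  also have "\<dots> \<le> ennreal (D / \<rho> * 2 powr (- (real j * b))) * ennreal \<rho>" by (intro mult_left_mono assms(2)) simp
  also have "\<dots> = ennreal (D * 2 powr (- (real j * b)))"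
    using D_pos \<rho>_pos by (subst ennreal_mult[symmetric]) auto
  finally show ?thesis .
qed

lemma cv_kernel_measurable [measurable]: "cv (lp_kernel \<Phi> i) (k j \<tau>) \<in> borel_measurable borel"
  by (rule cv_measurable[OF kernel_measurable k_measurable])

text \<open>Integrating in space first gives the \<open>L\<^sup>1\<close> norm of a convolution, the
  same in either variable by translation invariance. What remains is the time singularity of order
  3/4, whose integral is at most \<open>\<rho>\<close>.\<close>

lemma W_mass:
  shows "q \<in> space P \<Longrightarrow> (\<integral>\<^sup>+q'. W i j q q' \<partial>P) \<le> ennreal (D * 2 powr (- (real j * b)))"
    and "q' \<in> space P \<Longrightarrow> (\<integral>\<^sup>+q. W i j q q' \<partial>P) \<le> ennreal (D * 2 powr (- (real j * b)))"
proof -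
  let ?n = "\<lambda>\<tau> y. ennreal (norm (cv (lp_kernel \<Phi> i) (k j \<tau>) y))"
  let ?h = "\<lambda>r t::real. if r < t then ennreal ((t - r) powr (- (3 / 4))) else 0"
  show "(\<integral>\<^sup>+q'. W i j q q' \<partial>P) \<le> ennreal (D * 2 powr (- (real j * b)))" if q: "q \<in> space P"
  proof -
    obtain t x where tx: "q = (t, x)" by (cases q)
    have t: "t \<in> {0..T}" using q unfolding tx by (simp add: space_pair_measure space_restrict_space)
    have [measurable]: "?h r \<in> borel_measurable L" "(\<lambda>r. ?h r t) \<in> borel_measurable L" for r by measurable
    have "(\<integral>\<^sup>+q'. W i j q q' \<partial>P) = (\<integral>\<^sup>+r. \<integral>\<^sup>+z. W i j q (r, z) \<partial>lborel \<partial>L)"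
      by (rule lborel.nn_integral_fst[symmetric]) (rule W_measurable1[OF q])
    also have "\<dots> = (\<integral>\<^sup>+r. (if r < t then \<integral>\<^sup>+y. ?n (t - r) y \<partial>lborel else 0) \<partial>L)"
      unfolding W_def tx by (intro nn_integral_cong) (simp add: nn_integral_shift(2)[of "?n _"])
    also have "\<dots> \<le> (\<integral>\<^sup>+r. ennreal (D / \<rho> * 2 powr (- (real j * b))) * ?h r t \<partial>L)"
      by (intro nn_integral_mono W_space t) (simp add: space_restrict_space)
    also have "\<dots> \<le> ennreal (D * 2 powr (- (real j * b)))" by (rule D_time[OF _ time_mass(1)[OF t]]) measurable
    finally show ?thesis .
  qed
  show "(\<integral>\<^sup>+q. W i j q q' \<partial>P) \<le> ennreal (D * 2 powr (- (real j * b)))" if q: "q' \<in> space P"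
  proof -
    obtain r z where rz: "q' = (r, z)" by (cases q')
    have r: "r \<in> {0..T}" using q unfolding rz by (simp add: space_pair_measure space_restrict_space)
    have [measurable]: "?h r \<in> borel_measurable L" by measurable
    have "(\<integral>\<^sup>+q. W i j q q' \<partial>P) = (\<integral>\<^sup>+t. \<integral>\<^sup>+x. W i j (t, x) q' \<partial>lborel \<partial>L)"
      by (rule lborel.nn_integral_fst[symmetric]) (use measurable_Pair1[OF W_measurable q] in simp)
    also have "\<dots> = (\<integral>\<^sup>+t. (if r < t then \<integral>\<^sup>+y. ?n (t - r) y \<partial>lborel else 0) \<partial>L)"
      unfolding W_def rz by (intro nn_integral_cong) (simp add: nn_integral_shift(1)[of "?n _"])
    also have "\<dots> \<le> (\<integral>\<^sup>+t. ennreal (D / \<rho> * 2 powr (- (real j * b))) * ?h r t \<partial>L)"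
      by (intro nn_integral_mono W_space r) (simp add: space_restrict_space)
    also have "\<dots> \<le> ennreal (D * 2 powr (- (real j * b)))" by (rule D_time[OF _ time_mass(2)[OF r]]) measurable
    finally show ?thesis .
  qed
qed

lemma g_Lp: "(\<integral>\<^sup>+q. ennpow (g j q) p \<partial>P) \<le> ennreal (2 powr (- (real j * s) * p)) * Mp"
proof -
  have "(\<integral>\<^sup>+q. ennpow (g j q) p \<partial>P) = (\<integral>\<^sup>+r. \<integral>\<^sup>+z. ennpow (g j (r, z)) p \<partial>lborel \<partial>L)"
    by (rule lborel.nn_integral_fst[symmetric]) measurable
  also have "\<dots> \<le> (\<integral>\<^sup>+r. ennreal (2 powr (- (real j * s) * p)) * ennreal (M r powr p) \<partial>L)"
  proof (rule nn_integral_mono)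
    fix r
    have "(\<integral>\<^sup>+z. ennpow (g j (r, z)) p \<partial>lborel) \<le> ennreal ((M r * 2 powr (- (real j * s))) powr p)"
      using f_bdd[of r] unfolding bdd_def by (simp add: ennpow_ennreal)
    also have "(M r * 2 powr (- (real j * s))) powr p = 2 powr (- (real j * s) * p) * M r powr p"
      using M_nonneg[of r] by (simp add: powr_mult powr_powr)
    finally show "(\<integral>\<^sup>+z. ennpow (g j (r, z)) p \<partial>lborel) \<le> ennreal (2 powr (- (real j * s) * p)) * ennreal (M r powr p)"
      by (simp add: ennreal_mult)
  qed
  also have "\<dots> = ennreal (2 powr (- (real j * s) * p)) * Mp" unfolding Mp_def by (rule nn_integral_cmult) measurable
  finally show ?thesis .
qed

text \<open>Schur's test produces the gain b at the index j of the source. Since i and j differ by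
  at most 3, passing to the index i costs at most
  \<open>2 powr (3 * \<bar>b + s\<bar> * p)\<close>.\<close>

lemma H_Lp:
  assumes "j \<in> near i"
  shows "(\<integral>\<^sup>+q. ennpow (H i j q) p \<partial>P) \<le> ennreal (2 powr p * D powr p * 2 powr (3 * \<bar>b + s\<bar> * p) * 2 powr (- (real i * (b + s)) * p)) * Mp"
proof -
  have "(\<integral>\<^sup>+q. ennpow (H i j q) p \<partial>P) \<le> ennreal (2 powr p * (D * 2 powr (- (real j * b))) powr p) * (\<integral>\<^sup>+q. ennpow (g j q) p \<partial>P)"
    unfolding H_def
    by (rule schur_ennpow[OF PP.pair_sigma_finite_axioms p _ W_measurable g_measurable W_mass]) (use D_pos in auto)
  also have "\<dots> \<le> ennreal (2 powr p * (D * 2 powr (- (real j * b))) powr p) * (ennreal (2 powr (- (real j * s) * p)) * Mp)"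
    by (intro mult_left_mono g_Lp) simp
  also have "\<dots> = ennreal (2 powr p * (D * 2 powr (- (real j * b))) powr p * 2 powr (- (real j * s) * p)) * Mp"
    by (simp add: ennreal_mult' mult.assoc)
  also have "\<dots> \<le> ennreal (2 powr p * D powr p * 2 powr (3 * \<bar>b + s\<bar> * p) * 2 powr (- (real i * (b + s)) * p)) * Mp"
  proof (intro mult_right_mono ennreal_leI)
    have "\<bar>real i - real j\<bar> \<le> 3" using assms unfolding near_def by auto
    then have "\<bar>real i - real j\<bar> * \<bar>b + s\<bar> \<le> 3 * \<bar>b + s\<bar>" by (intro mult_right_mono) auto
    then have "(real i - real j) * (b + s) \<le> 3 * \<bar>b + s\<bar>" by (simp only: abs_mult[symmetric] abs_le_iff)
    then have "- (real j * (b + s)) \<le> 3 * \<bar>b + s\<bar> + - (real i * (b + s))" by (simp add: algebra_simps)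
    then have "- (real j * (b + s)) * p \<le> (3 * \<bar>b + s\<bar> + - (real i * (b + s))) * p" using p by (intro mult_right_mono) auto
    then have "2 powr (- (real j * (b + s)) * p) \<le> 2 powr (3 * \<bar>b + s\<bar> * p + - (real i * (b + s)) * p)"
      unfolding distrib_right by (intro powr_mono) auto
    then have "2 powr p * D powr p * 2 powr (- (real j * (b + s)) * p) \<le> 2 powr p * D powr p * (2 powr (3 * \<bar>b + s\<bar> * p + - (real i * (b + s)) * p))"
      by (intro mult_left_mono) auto
    moreover have "(D * 2 powr (- (real j * b))) powr p * 2 powr (- (real j * s) * p) = D powr p * 2 powr (- (real j * (b + s)) * p)"
      using D_pos by (simp add: powr_mult powr_powr powr_add[symmetric] algebra_simps)
    ultimately show "2 powr p * (D * 2 powr (- (real j * b))) powr p * 2 powr (- (real j * s) * p)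
        \<le> 2 powr p * D powr p * 2 powr (3 * \<bar>b + s\<bar> * p) * 2 powr (- (real i * (b + s)) * p)"
      by (simp only: powr_add mult.assoc)
  qed simp
  finally show ?thesis .
qed

lemma G_Lp: "(\<integral>\<^sup>+q. ennpow (G i q) p \<partial>P) \<le> ennreal (E * 2 powr (- (real i * (b + s)) * p)) * Mp"
proof -
  let ?X = "2 powr p * D powr p * 2 powr (3 * \<bar>b + s\<bar> * p) * 2 powr (- (real i * (b + s)) * p)"
  have "(\<integral>\<^sup>+q. ennpow (G i q) p \<partial>P) \<le> (\<integral>\<^sup>+q. ennreal (2 powr p * real (card (near i)) powr (p - 1)) * (\<Sum>j\<in>near i. ennpow (H i j q) p) \<partial>P)"
    unfolding G_def by (intro nn_integral_mono ennpow_sum_le finite_near near_nonempty p)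
  also have "\<dots> = ennreal (2 powr p * real (card (near i)) powr (p - 1)) * (\<Sum>j\<in>near i. \<integral>\<^sup>+q. ennpow (H i j q) p \<partial>P)"
    by (simp add: nn_integral_cmult nn_integral_sum)
  also have "\<dots> \<le> ennreal (2 powr p * real (card (near i)) powr (p - 1)) * (\<Sum>j\<in>near i. ennreal ?X * Mp)"
    by (intro mult_left_mono sum_mono H_Lp) auto
  also have "\<dots> = ennreal (2 powr p * real (card (near i)) powr (p - 1) * real (card (near i)) * ?X) * Mp"
    by (simp add: ennreal_mult' ennreal_of_nat_eq_real_of_nat mult.assoc)
  also have "\<dots> \<le> ennreal (E * 2 powr (- (real i * (b + s)) * p)) * Mp"
  proof (intro mult_right_mono ennreal_leI)
    have "real (card (near i)) powr (p - 1) * real (card (near i)) \<le> 7 powr (p - 1) * 7"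
      using card_near[of i] p by (intro mult_mono powr_mono2) auto
    then have "(real (card (near i)) powr (p - 1) * real (card (near i))) * (2 powr p * ?X) \<le> (7 powr (p - 1) * 7) * (2 powr p * ?X)"
      by (intro mult_right_mono) auto
    then show "2 powr p * real (card (near i)) powr (p - 1) * real (card (near i)) * ?X \<le> E * 2 powr (- (real i * (b + s)) * p)"
      unfolding Lp_const_def by (simp only: mult_ac)
  qed simp
  finally show ?thesis .
qed

end

end

section \<open>The Triebel--Lizorkin norm of the solution\<close>

context heat_data
begin

text \<open>The norm contains a q-sum inside an integral of order p, while the pieces are controlled
  one by one in order p. Taking geometric weights \<open>w n\<close> out of the sum, Jensen's
  inequality with exponent \<open>p / q \<ge> 1\<close> replaces it by a p-sum, which commutes with
  the integral. This costs \<epsilon> derivatives, covered by the surplus.\<close>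

lemma TL_estimate:
  fixes q :: real
  assumes C: "L1_const C"
    and q: "0 < q" "q \<le> p" and p2: "2 \<le> p"
    and V: "V = 1 / (1 - 2 powr (- (\<alpha> / 8) * q))"
  shows "(\<integral>\<^sup>+t. ennpow (TL_norm \<Phi> p q (s + \<alpha> / p) (T_op \<Phi> \<alpha> f t)) p \<partial>L)
    \<le> ennreal (2 powr p * (Lp_const C + 2 powr (p / q) * V powr (p / q - 1) * V * Lp_const C)) * Mp"
proof -
  define \<sigma> where "\<sigma> = s + \<alpha> / p"
  \<comment> \<open>As \<alpha> / p \<le> \<alpha> / 2, the order \<sigma> + \<epsilon> is at most s
    + 5 \<alpha> / 8, still below s + b = s + 3 \<alpha> / 4.\<close>
  define \<epsilon> where "\<epsilon> = \<alpha> / 8"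
  define w where "w = (\<lambda>n. ennreal (2 powr (- (real (Suc n) * \<epsilon>) * q)))"
  define c where "c = (\<lambda>n. ennreal (2 powr (real (Suc n) * (\<sigma> + \<epsilon>) * p)))"
  define B where "B = ennreal (2 powr (p / q) * V powr (p / q - 1))"
  have p0: "0 < p" using p by simp
  have pq: "1 \<le> p / q" using q by simp
  have E0: "0 \<le> Lp_const C" unfolding Lp_const_def by simp
  define z where "z = (2::real) powr (- \<epsilon> * q)"
  have z: "0 < z" "z < 1" unfolding z_def \<epsilon>_def using \<alpha>_pos q by (simp_all add: powr_less_one)
  have Vz: "V = 1 / (1 - z)" unfolding V z_def \<epsilon>_def ..
  have V0: "0 < V" unfolding Vz using z by simp
  have wV: "(\<Sum>n. w n) \<le> ennreal V"
  proof -
    \<comment> \<open>The weights carry the exponent n + 1; comparison with \<open>z ^ n\<close>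
      gives the full geometric series with sum V.\<close>
    have "w n \<le> ennreal (z ^ n)" for n
    proof -
      have "z ^ n = 2 powr (- \<epsilon> * q * real n)" unfolding z_def by (simp add: powr_realpow[symmetric] powr_powr)
      moreover have "- (real (Suc n) * \<epsilon>) * q \<le> - \<epsilon> * q * real n"
        using \<alpha>_pos q unfolding \<epsilon>_def by (simp add: algebra_simps)
      ultimately show ?thesis unfolding w_def by (intro ennreal_leI) (simp only:, intro powr_mono, auto)
    qed
    then have "(\<Sum>n. w n) \<le> (\<Sum>n. ennreal (z ^ n))" by (intro suminf_le summableI)
    also have "\<dots> = ennreal V"
      unfolding Vz using z by (intro suminf_ennreal_eq geometric_sums) auto
    finally show ?thesis .
  qed
  define R where "R = (\<lambda>q'. ennpow (G 0 q') p + B * (\<Sum>n. w n * (c n * ennpow (G (Suc n) q') p)))"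
  have Gm [measurable]: "G i \<in> borel_measurable P" for i by (rule G_measurable)
  have pointwise: "ennpow (TL_norm \<Phi> p q \<sigma> (T_op \<Phi> \<alpha> f t)) p \<le> ennreal (2 powr p) * (\<integral>\<^sup>+x. R (t, x) \<partial>lborel)"
    if t: "t \<in> {0..T}" for t
  proof -
    have tL: "t \<in> space L" using t by (simp add: space_restrict_space)
    have [measurable]: "(\<lambda>x. G i (t, x)) \<in> borel_measurable lborel" for i by (rule measurable_Pair2[OF Gm tL])
    let ?u = "T_op \<Phi> \<alpha> f t"
    have Gb: "ennreal (norm (?u (\<lambda>y. lp_kernel \<Phi> i (x - y)))) \<le> G i (t, x)" for i x
      unfolding G_def by (rule T_op_kernel_bound[OF t])
    let ?C = "\<lambda>n x. ennreal ((2 powr (real (Suc n) * \<sigma>) * norm (lp_Delta \<Phi> (int (Suc n)) ?u x)) powr q)"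
    have "ennpow (TL_norm \<Phi> p q \<sigma> ?u) p \<le> ennreal (2 powr p) *
       ((\<integral>\<^sup>+x. ennpow (ennreal (norm (lp_S0 \<Phi> ?u x))) p \<partial>lborel) + (\<integral>\<^sup>+x. ennpow (ennpow (\<Sum>n. ?C n x) (1 / q)) p \<partial>lborel))"
      unfolding TL_norm_def using p0 by (intro order_trans[OF ennpow_add_le]) (simp_all add: Lp_norm_ennpow)
    also have "\<dots> \<le> ennreal (2 powr p) * ((\<integral>\<^sup>+x. ennpow (G 0 (t, x)) p \<partial>lborel)
         + (\<integral>\<^sup>+x. B * (\<Sum>n. w n * (c n * ennpow (G (Suc n) (t, x)) p)) \<partial>lborel))"
    proof (intro mult_left_mono add_mono nn_integral_mono)
      fix x
      show "ennpow (ennreal (norm (lp_S0 \<Phi> ?u x))) p \<le> ennpow (G 0 (t, x)) p"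
        unfolding lp_S0_eq[OF lp] using p0 by (intro ennpow_mono Gb) simp
      let ?F = "\<lambda>n. ennpow (ennreal (2 powr (real (Suc n) * (\<sigma> + \<epsilon>))) * G (Suc n) (t, x)) q"
      have "?C n x \<le> w n * ?F n" for n
      proof -
        have "?C n x = ennpow (ennreal (2 powr (real (Suc n) * \<sigma>)) * ennreal (norm (lp_Delta \<Phi> (int (Suc n)) ?u x))) q"
          by (simp only: ennreal_mult[OF powr_ge_zero norm_ge_zero, symmetric] ennpow_ennreal mult_nonneg_nonneg powr_ge_zero norm_ge_zero)
        also have "\<dots> \<le> ennpow (ennreal (2 powr (real (Suc n) * \<sigma>)) * G (Suc n) (t, x)) q"
          unfolding lp_Delta_eq[OF lp] using q by (intro ennpow_mono mult_left_mono Gb) auto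
        also have "ennreal (2 powr (real (Suc n) * \<sigma>)) = ennreal (2 powr (- (real (Suc n) * \<epsilon>))) * ennreal (2 powr (real (Suc n) * (\<sigma> + \<epsilon>)))"
          by (simp add: ennreal_mult[symmetric] powr_add[symmetric] distrib_left del: of_nat_Suc)
        also have "ennpow (ennreal (2 powr (- (real (Suc n) * \<epsilon>))) * ennreal (2 powr (real (Suc n) * (\<sigma> + \<epsilon>))) * G (Suc n) (t, x)) q = w n * ?F n"
          unfolding mult.assoc ennpow_mult[OF q(1), of "ennreal (2 powr (- (real (Suc n) * \<epsilon>)))"]
          unfolding w_def by (simp only: ennpow_ennreal powr_ge_zero powr_powr)
        finally show ?thesis .
      qed
      then have le: "(\<Sum>n. ?C n x) \<le> (\<Sum>n. w n * ?F n)" by (intro suminf_le summableI)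
      have "ennpow (ennpow (\<Sum>n. ?C n x) (1 / q)) p \<le> ennpow (\<Sum>n. w n * ?F n) (p / q)"
        unfolding ennpow_ennpow times_divide_eq_left mult_1_left by (rule ennpow_mono[OF le]) (use q p0 in simp)
      also have "\<dots> \<le> B * (\<Sum>n. w n * ennpow (?F n) (p / q))"
        unfolding B_def nn_integral_count_space_nat[symmetric]
        by (rule jensen_ennpow[OF pq V0]) (simp_all only: nn_integral_count_space_nat wV borel_measurable_count_space)
      also have "(\<lambda>n. ennpow (?F n) (p / q)) = (\<lambda>n. c n * ennpow (G (Suc n) (t, x)) p)"
      proof
        fix n
        have "ennpow (?F n) (p / q) = ennpow (ennreal (2 powr (real (Suc n) * (\<sigma> + \<epsilon>))) * G (Suc n) (t, x)) p"
          using q by (simp add: ennpow_ennpow)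
        also have "\<dots> = c n * ennpow (G (Suc n) (t, x)) p"
          unfolding ennpow_mult[OF p0] c_def by (simp only: ennpow_ennreal powr_ge_zero powr_powr)
        finally show "ennpow (?F n) (p / q) = c n * ennpow (G (Suc n) (t, x)) p" .
      qed
      finally show "ennpow (ennpow (\<Sum>n. ?C n x) (1 / q)) p \<le> B * (\<Sum>n. w n * (c n * ennpow (G (Suc n) (t, x)) p))" .
    qed auto
    also have "\<dots> = ennreal (2 powr p) * (\<integral>\<^sup>+x. R (t, x) \<partial>lborel)"
      unfolding R_def by (subst nn_integral_add) auto
    finally show ?thesis .
  qed
  have [measurable]: "R \<in> borel_measurable P" unfolding R_def by measurable
  have "(\<integral>\<^sup>+t. ennpow (TL_norm \<Phi> p q \<sigma> (T_op \<Phi> \<alpha> f t)) p \<partial>L) \<le> (\<integral>\<^sup>+t. ennreal (2 powr p) * (\<integral>\<^sup>+x. R (t, x) \<partial>lborel) \<partial>L)"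
    by (intro nn_integral_mono pointwise) (simp add: space_restrict_space)
  also have "\<dots> = ennreal (2 powr p) * (\<integral>\<^sup>+t. \<integral>\<^sup>+x. R (t, x) \<partial>lborel \<partial>L)" by (rule nn_integral_cmult) measurable
  also have "(\<integral>\<^sup>+t. \<integral>\<^sup>+x. R (t, x) \<partial>lborel \<partial>L) = (\<integral>\<^sup>+q'. R q' \<partial>P)" by (rule lborel.nn_integral_fst) measurable
  also have "\<dots> = (\<integral>\<^sup>+q'. ennpow (G 0 q') p \<partial>P) + B * (\<Sum>n. w n * (c n * (\<integral>\<^sup>+q'. ennpow (G (Suc n) q') p \<partial>P)))"
    unfolding R_def by (simp add: nn_integral_add nn_integral_cmult nn_integral_suminf)
  also have "\<dots> \<le> ennreal (Lp_const C) * Mp + B * (\<Sum>n. w n * (ennreal (Lp_const C) * Mp))"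
  proof (intro add_mono mult_left_mono suminf_le summableI)
    have "(\<integral>\<^sup>+q'. ennpow (G 0 q') p \<partial>P) \<le> ennreal (Lp_const C * 2 powr (- (real 0 * (b + s)) * p)) * Mp" by (rule G_Lp[OF C])
    then show "(\<integral>\<^sup>+q'. ennpow (G 0 q') p \<partial>P) \<le> ennreal (Lp_const C) * Mp" by simp
    fix n
    have "c n * (\<integral>\<^sup>+q'. ennpow (G (Suc n) q') p \<partial>P) \<le> c n * (ennreal (Lp_const C * 2 powr (- (real (Suc n) * (b + s)) * p)) * Mp)"
      by (intro mult_left_mono G_Lp[OF C]) auto
    also have "\<dots> = ennreal (Lp_const C * (2 powr (real (Suc n) * (\<sigma> + \<epsilon>) * p) * 2 powr (- (real (Suc n) * (b + s)) * p))) * Mp"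
      unfolding c_def mult.assoc[symmetric] using E0 by (simp only: ennreal_mult'[OF powr_ge_zero, symmetric] mult_ac)
    also have "\<dots> \<le> ennreal (Lp_const C) * Mp"
    proof (intro mult_right_mono ennreal_leI)
      have "\<alpha> / p \<le> \<alpha> / 2" using p2 \<alpha>_pos by (intro divide_left_mono) auto
      then have "\<sigma> + \<epsilon> - (b + s) \<le> 0" unfolding \<sigma>_def \<epsilon>_def b_def using \<alpha>_pos by linarith
      then have "real (Suc n) * p * (\<sigma> + \<epsilon> - (b + s)) \<le> 0" using p0 by (intro mult_nonneg_nonpos) auto
      then have "real (Suc n) * (\<sigma> + \<epsilon>) * p + - (real (Suc n) * (b + s)) * p \<le> 0" by (simp add: algebra_simps)
      then have "2 powr (real (Suc n) * (\<sigma> + \<epsilon>) * p + - (real (Suc n) * (b + s)) * p) \<le> (2::real) powr 0" by (intro powr_mono) auto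
      then have "2 powr (real (Suc n) * (\<sigma> + \<epsilon>) * p) * 2 powr (- (real (Suc n) * (b + s)) * p) \<le> (1::real)"
        by (simp only: powr_add powr_zero_eq_one zero_neq_numeral[symmetric] if_False)
      then show "Lp_const C * (2 powr (real (Suc n) * (\<sigma> + \<epsilon>) * p) * 2 powr (- (real (Suc n) * (b + s)) * p)) \<le> Lp_const C"
        using E0 by (rule mult_left_le)
    qed simp
    finally show "c n * (\<integral>\<^sup>+q'. ennpow (G (Suc n) q') p \<partial>P) \<le> ennreal (Lp_const C) * Mp" .
  qed auto
  also have "(\<Sum>n. w n * (ennreal (Lp_const C) * Mp)) = (\<Sum>n. w n) * (ennreal (Lp_const C) * Mp)" by (rule ennreal_suminf_multc)
  also have "\<dots> \<le> ennreal V * (ennreal (Lp_const C) * Mp)" by (intro mult_right_mono wV) simp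
  also have "ennreal (2 powr p) * (ennreal (Lp_const C) * Mp + B * (ennreal V * (ennreal (Lp_const C) * Mp)))
      = ennreal (2 powr p * (Lp_const C + 2 powr (p / q) * V powr (p / q - 1) * V * Lp_const C)) * Mp"
  proof -
    have 2: "0 \<le> 2 powr (p / q) * V powr (p / q - 1) * V * Lp_const C" using V0 E0 by simp
    have 1: "B * ennreal V * ennreal (Lp_const C) = ennreal (2 powr (p / q) * V powr (p / q - 1) * V * Lp_const C)"
      unfolding B_def using V0 E0 by (simp add: ennreal_mult[symmetric])
    have "ennreal (2 powr p) * (ennreal (Lp_const C) * Mp + B * (ennreal V * (ennreal (Lp_const C) * Mp)))
       = ennreal (2 powr p) * (ennreal (Lp_const C) + B * ennreal V * ennreal (Lp_const C)) * Mp"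
      by (simp only: distrib_left distrib_right mult.assoc)
    also have "ennreal (2 powr p) * (ennreal (Lp_const C) + B * ennreal V * ennreal (Lp_const C)) = ennreal (2 powr p * (Lp_const C + 2 powr (p / q) * V powr (p / q - 1) * V * Lp_const C))"
      unfolding 1 ennreal_plus[OF E0 2, symmetric] by (rule ennreal_mult'[OF powr_ge_zero, symmetric])
    finally show ?thesis .
  qed
  finally show ?thesis unfolding \<sigma>_def by (simp add: mult_left_mono add_left_mono)
qed

end

section \<open>Removal of exceptional times and choice of the constant\<close>

theorem theorem1p1:
  fixes \<Phi> :: "'a::euclidean_space \<Rightarrow> complex"
    and T \<alpha> p q s :: real
  assumes "lp_function \<Phi>"
    and "0 < T"
    and "0 < \<alpha>" and "\<alpha> \<le> 2"
    and "2 \<le> q" and "q \<le> p"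
  shows "\<exists>c>0. \<forall>f \<in> parabolic_TL \<Phi> T p q s.
    T_op_defined \<Phi> \<alpha> T f \<and>
    T_op \<Phi> \<alpha> f \<in> parabolic_TL \<Phi> T p q (s + \<alpha> / p) \<and>
    parabolic_norm \<Phi> T p q (s + \<alpha> / p) (T_op \<Phi> \<alpha> f) \<le> ennreal c * parabolic_norm \<Phi> T p q s f"
proof -
  interpret heat_lp_sp \<Phi> \<alpha> p s by standard (use assms in auto)
  have q: "0 < q" and p0: "0 < p" and p2: "2 \<le> p" using assms by auto
  obtain C where C: "C > 0" "\<And>j \<tau>. 0 < \<tau> \<Longrightarrow> \<tau> \<le> T \<Longrightarrow> (\<integral>\<^sup>+x. ennreal (norm (k j \<tau> x)) \<partial>lborel)
     \<le> ennreal (C * 2 powr (- (real j * (3 * \<alpha> / 4))) * \<tau> powr (- (3 / 4)))"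
    using k_L1[OF \<open>0 < T\<close>] by blast
  define V where "V = 1 / (1 - 2 powr (- (\<alpha> / 8) * q))"
  \<comment> \<open>The constant exported from the locale \<open>heat_data\<close> takes no argument
    f or M, so it can be fixed here, before f is introduced.\<close>
  define Y where "Y = heat_data.Lp_const \<Phi> \<alpha> p s T C"
  define Z where "Z = 2 powr p * (Y + 2 powr (p / q) * V powr (p / q - 1) * V * Y)"
  define c where "c = \<bar>Z\<bar> powr (1 / p) + 1"
  have main: "T_op_defined \<Phi> \<alpha> T f \<and> T_op \<Phi> \<alpha> f \<in> parabolic_TL \<Phi> T p q (s + \<alpha> / p) \<and>
    parabolic_norm \<Phi> T p q (s + \<alpha> / p) (T_op \<Phi> \<alpha> f) \<le> ennreal c * parabolic_norm \<Phi> T p q s f"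
    if f: "f \<in> parabolic_TL \<Phi> T p q s" for f
  proof -
    let ?L = "lebesgue_on {0..T}"
    have ae0: "AE r in ?L. tempered (f r) \<and> real_dist (f r)"
      and fm: "\<And>\<phi>. sch1 \<phi> \<Longrightarrow> (\<lambda>r. f r \<phi>) \<in> borel_measurable ?L"
      and fin: "parabolic_norm \<Phi> T p q s f < top"
      using f unfolding parabolic_TL_def schwartz_sch1[symmetric] by auto
    have z: "tempered (\<lambda>_. 0 :: complex)" "real_dist (\<lambda>_. 0)" "TL_norm \<Phi> p q s (\<lambda>_. 0) = 0"
      unfolding tempered_def real_dist_def TL_norm_def Lp_norm_def lp_S0_def lp_Delta_def dist_fourier_def
      by (auto intro!: exI[of _ 0])
    \<comment> \<open>Two repairs, in this order: \<open>f0\<close> removes the times at which f r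
      is not a real tempered distribution, \<open>f'\<close> those of infinite norm. Measurability
      of the norm in time is available for families tempered at every r, and it is needed to see
      that the second set is null.\<close>
    define f0 where "f0 = (\<lambda>r. if tempered (f r) \<and> real_dist (f r) then f r else (\<lambda>_. 0))"
    define f' where "f' = (\<lambda>r. if TL_norm \<Phi> p q s (f0 r) < top then f0 r else (\<lambda>_. 0))"
    have f0: "tempered (f0 r)" "real_dist (f0 r)" for r unfolding f0_def using z by auto
    have f': "tempered (f' r)" "real_dist (f' r)" "TL_norm \<Phi> p q s (f' r) < top" for r
      unfolding f'_def using z f0 by auto
    have ae1: "AE r in ?L. f r = f0 r" using ae0 by eventually_elim (simp add: f0_def)
    have f0m: "(\<lambda>r. f0 r \<phi>) \<in> borel_measurable ?L" if "sch1 \<phi>" for \<phi>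
      by (rule measurable_lebesgue_on_AE[OF fm[OF that]]) (use ae1 in eventually_elim, simp)
    note TL0 [measurable] = TL_measurable[where f = f0 and \<sigma> = s and q = q, OF f0(1) f0m]
    have pn: "ennpow (parabolic_norm \<Phi> T p q s f) p = (\<integral>\<^sup>+r. ennpow (TL_norm \<Phi> p q s (f r)) p \<partial>?L)"
      unfolding parabolic_norm_def using p0 by (simp add: Lp_norm_ennpow)
    also have "\<dots> = (\<integral>\<^sup>+r. ennpow (TL_norm \<Phi> p q s (f0 r)) p \<partial>?L)"
      by (rule nn_integral_cong_AE) (use ae1 in eventually_elim, simp)
    finally have pn0: "ennpow (parabolic_norm \<Phi> T p q s f) p = (\<integral>\<^sup>+r. ennpow (TL_norm \<Phi> p q s (f0 r)) p \<partial>?L)" .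
    have pfin: "ennpow (parabolic_norm \<Phi> T p q s f) p < top" using fin by (simp add: ennpow_def)
    have "AE r in ?L. ennpow (TL_norm \<Phi> p q s (f0 r)) p \<noteq> \<infinity>"
      by (rule nn_integral_PInf_AE) (use pfin pn0 in \<open>auto simp: less_top\<close>)
    then have ae2: "AE r in ?L. f0 r = f' r"
    proof eventually_elim
      case (elim r)
      then have "TL_norm \<Phi> p q s (f0 r) \<noteq> top" by auto
      then show ?case unfolding f'_def by (simp add: less_top)
    qed
    have ae: "AE r in ?L. f r = f' r" using ae1 ae2 by eventually_elim simp
    have f'm: "(\<lambda>r. f' r \<phi>) \<in> borel_measurable ?L" if "sch1 \<phi>" for \<phi>
      by (rule measurable_lebesgue_on_AE[OF fm[OF that]]) (use ae in eventually_elim, simp)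
    note TL' [measurable] = TL_measurable[where f = f' and \<sigma> = s and q = q, OF f'(1) f'm]
    define M where "M = (\<lambda>r. enn2real (TL_norm \<Phi> p q s (f' r)))"
    have Mpow: "ennreal (M r powr p) = ennpow (TL_norm \<Phi> p q s (f' r)) p" for r
      unfolding M_def ennpow_def using f'(3)[of r] by simp
    have Mint: "(\<integral>\<^sup>+r. ennreal (M r powr p) \<partial>?L) = ennpow (parabolic_norm \<Phi> T p q s f) p"
      unfolding Mpow pn by (rule nn_integral_cong_AE) (use ae in eventually_elim, simp)
    interpret heat_data \<Phi> \<alpha> p s T f' M
    proof
      show "bdd (f' r) (M r)" for r unfolding M_def by (rule bdd_TL[OF f'(1,3) q])
      show "M \<in> borel_measurable ?L" unfolding M_def by measurable
      show "(\<integral>\<^sup>+r. ennreal (M r powr p) \<partial>?L) < \<infinity>" unfolding Mint using pfin by simp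
    qed (use \<open>0 < T\<close> f'(2) f'm in auto)
    have L1: "L1_const C" unfolding L1_const_def using C by blast
    have aet: "AE r in lebesgue_on {0..t}. f r = f' r" if t: "t \<in> {0..T}" for t
    proof -
      have "{0..t} \<inter> space ?L \<in> sets ?L" using t by (auto simp: sets_restrict_space_iff space_restrict_space Int_absorb2)
      then show ?thesis
        unfolding restrict_L[OF t] using ae by (subst AE_restrict_space_iff) (auto elim: eventually_mono)
    qed
    let ?I = "\<lambda>f t \<phi> r. \<integral>x. conv_dist \<Phi> (K (t - r)) (f r) x * \<phi> x \<partial>lborel"
    have aeI: "AE r in lebesgue_on {0..t}. ?I f' t \<phi> r = ?I f t \<phi> r" if "t \<in> {0..T}" for t \<phi>
      using aet[OF that] by eventually_elim simp
    \<comment> \<open>The repaired times form a null set and \<open>T_op\<close> integrates over r,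
      so equality holds at every t in [0, T], not just almost everywhere.\<close>
    have T_eq: "T_op \<Phi> \<alpha> f t = T_op \<Phi> \<alpha> f' t" if "t \<in> {0..T}" for t
      unfolding T_op_def using integral_lebesgue_on_AE[OF aeI[OF that]] by (intro ext) (rule sym)
    have td: "T_op_defined \<Phi> \<alpha> T f"
      unfolding T_op_defined_def
    proof (intro ballI conjI)
      fix t assume t: "t \<in> {0..T}"
      note d = T_op_defined[unfolded T_op_defined_def, rule_format, OF t]
      show "AE r in lebesgue_on {0..t}. (\<forall>x. \<exists>l. (trunc_conv \<Phi> (K (t - r)) (f r) x \<longlongrightarrow> l) at_top) \<and>
          (\<forall>\<phi>\<in>schwartz. integrable lborel (\<lambda>x. conv_dist \<Phi> (K (t - r)) (f r) x * \<phi> x))"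
        using d[THEN conjunct1] aet[OF t] by eventually_elim simp
      fix \<phi> :: "'a \<Rightarrow> complex" assume "\<phi> \<in> schwartz"
      then have i: "integrable (lebesgue_on {0..t}) (?I f' t \<phi>)" using d by blast
      show "integrable (lebesgue_on {0..t}) (?I f t \<phi>)"
        by (rule integrable_cong_AE_imp[OF i measurable_lebesgue_on_AE[OF borel_measurable_integrable[OF i] aeI[OF t]] aeI[OF t]])
    qed
    have Y0: "0 \<le> Y" unfolding Y_def Lp_const_def by simp
    have "2 powr (- (\<alpha> / 8) * q) < (1::real)" using \<open>0 < \<alpha>\<close> q by (simp add: powr_less_one)
    then have V0: "0 < V" unfolding V_def by simp
    have Z0: "0 \<le> Z" unfolding Z_def using Y0 V0 by simp
    have norm_le: "parabolic_norm \<Phi> T p q (s + \<alpha> / p) (T_op \<Phi> \<alpha> f) \<le> ennreal c * parabolic_norm \<Phi> T p q s f"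
    proof (rule le_ennpowI[OF p0])
      have "ennpow (parabolic_norm \<Phi> T p q (s + \<alpha> / p) (T_op \<Phi> \<alpha> f)) p
          = (\<integral>\<^sup>+t. ennpow (TL_norm \<Phi> p q (s + \<alpha> / p) (T_op \<Phi> \<alpha> f' t)) p \<partial>?L)"
        unfolding parabolic_norm_def using p0
        by (simp add: Lp_norm_ennpow) (intro nn_integral_cong, simp add: T_eq space_restrict_space)
      also have "\<dots> \<le> ennreal Z * Mp"
        unfolding Z_def Y_def by (rule TL_estimate[OF L1 q \<open>q \<le> p\<close> p2 V_def])
      also have "\<dots> = ennpow (ennreal (Z powr (1 / p))) p * ennpow (parabolic_norm \<Phi> T p q s f) p"
        unfolding Mp_def Mint using Z0 p0 by (simp add: ennpow_ennreal powr_powr)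
      also have "\<dots> \<le> ennpow (ennreal c) p * ennpow (parabolic_norm \<Phi> T p q s f) p"
        unfolding c_def using Z0 p0 by (intro mult_right_mono ennpow_mono ennreal_leI) auto
      also have "\<dots> = ennpow (ennreal c * parabolic_norm \<Phi> T p q s f) p" by (rule ennpow_mult[OF p0, symmetric])
      finally show "ennpow (parabolic_norm \<Phi> T p q (s + \<alpha> / p) (T_op \<Phi> \<alpha> f)) p \<le> ennpow (ennreal c * parabolic_norm \<Phi> T p q s f) p" .
    qed
    have "T_op \<Phi> \<alpha> f \<in> parabolic_TL \<Phi> T p q (s + \<alpha> / p)"
      unfolding parabolic_TL_def
    proof (intro CollectI conjI ballI)
      show "AE t in ?L. tempered (T_op \<Phi> \<alpha> f t) \<and> real_dist (T_op \<Phi> \<alpha> f t)"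
        by (rule AE_I2) (simp add: space_restrict_space T_eq T_op_tempered T_op_real)
      show "(\<lambda>t. T_op \<Phi> \<alpha> f t \<phi>) \<in> borel_measurable ?L" if "\<phi> \<in> schwartz" for \<phi>
        by (rule measurable_cong[THEN iffD1, OF _ T_op_measurable])
          (use that in \<open>simp_all add: space_restrict_space T_eq schwartz_sch1\<close>)
      show "parabolic_norm \<Phi> T p q (s + \<alpha> / p) (T_op \<Phi> \<alpha> f) < top"
        by (rule le_less_trans[OF norm_le]) (use fin in \<open>simp add: ennreal_mult_less_top\<close>)
    qed
    then show ?thesis using td norm_le by blast
  qed
  have "c > 0" unfolding c_def by (simp add: add_nonneg_pos)
  then show ?thesis using main by blast
qed

end
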